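(* Let $(X,S)$ be a templicial object in $\mathcal{V}$ and $a,b\in S$. Then for every $n\ge0$ there is a canonical isomorphism $$\mathfrak{C}_{\mathcal{V}}[X]_n(a,b)\simeq\mathrm{colim}_{(T,\vec T)\in\mathcal{N}_f[n]}\,X_T(a,b),$$ where $\mathcal{N}_f[n]$ is the category of necklaces equipped with a flanked flag of length $n$, and the colimit is that of the contravariant functor $(T,\vec T)\mapsto X_T(a,b)$, i.e. it is taken over $\mathcal{N}_f[n]^{op}$.
   Context: Base category. Fix a complete and cocomplete, symmetric monoidal closed category $(\mathcal{V},\otimes,I)$. $F:\mathrm{Set}\to\mathcal{V}$ is the colimit-preserving functor with $F(\{*\})=I$ (unique up to natural isomorphism), applied levelwise also as $F:\mathrm{SSet}\to S\mathcal{V}$. Quivers. For a set $S$, $\mathcal{V}\mathrm{Quiv}_S$ is the category of families $Q=(Q(a,b))_{a,b\in S}$ of objects of $\mathcal{V}$. It is monoidal with $(Q\otimes_S P)(a,b)=\coprod_{c\in S}Q(a,c)\otimes P(c,b)$ and unit $I_S$, where $I_S(a,b)=I$ if $a=b$ and $I_S(a,b)=0$ (initial object) otherwise. Intervals. $\mathbf{\Delta}_f$ is the category with objects $[n]=\{0,\dots,n\}$, $n\ge 0$, and order-preserving maps $f:[m]\to[n]$ with $f(0)=0$, $f(m)=n$ as morphisms. It is monoidal with $[m]+[n]=[m+n]$, where for $f:[m]\to[m']$, $g:[n]\to[n']$ one has $(f+g)(i)=f(i)$ for $i\le m$ and $(f+g)(i)=m'+g(i-m)$ for $i\ge m$. Templicial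 objects. A templicial object in $\mathcal{V}$ is a pair $(X,S)$ with $S$ a set and $X:\mathbf{\Delta}_f^{op}\to\mathcal{V}\mathrm{Quiv}_S$ a colax monoidal functor which is strongly unital (the counit $\epsilon:X_0\to I_S$ is an isomorphism). Here $X_n=X([n])$, with comultiplications $\mu_{k,l}:X_{k+l}\to X_k\otimes_S X_l$. Necklaces. $\mathcal{N}ec$ is the category with objects pairs $(T,p)$ with $p\ge 0$ and $\{0,p\}\subseteq T\subseteq[p]$, and morphisms $(T,p)\to(U,q)$ the morphisms $f:[p]\to[q]$ of $\mathbf{\Delta}_f$ with $U\subseteq f(T)$; $(T,p)\vee(U,q)=(T\cup(p+U),p+q)$. A map is inert if $p=q$ and $f=\mathrm{id}_{[p]}$, active if $f(T)=U$; each map factors uniquely as active followed by inert. For $T=\{0=t_0<\dots<t_k=p\}$ put $X_T=X_{t_1}\otimes_S\dots\otimes_S X_{p-t_{k-1}}$ (equal to $I_S$ for $T=\{0\}$), and let $\mu_T:X_p\to X_T$ be the iterated comultiplication. $T\mapsto X_T$ extends to $X_\bullet:\mathcal{N}ec^{op}\to\mathcal{V}\mathrm{Quiv}_S$: for inert $(T,p)\to(U,p)$ with $U=\{0=u_0<\dots<u_l=p\}$ write $T=T_1\vee\dots\vee T_l$ with $T_i$ on $[u_i-u_{i-1}]$ and use $\mu_{T_1}\otimes\dots\otimes\mu_{T_l}$; for active $f$ write $f=f_1+\dots+f_k$ with $f_i:[t_i-t_{i-1}]\to[f(t_i)-f(t_{i-1})]$ and use $X(f_1)\otimes\dots\otimes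 X(f_k)$ (together with $X_0\simeq I_S$). Categorification. For a necklace $(T,p)$ let $\mathcal{P}_T=\{V\subseteq[p]\mid T\subseteq V\}$, ordered by inclusion, functorial via $V\mapsto f(V)$, and let $N$ be the classical nerve. $\mathfrak{C}_{\mathcal{V}}[X]$ is the $S\mathcal{V}$-enriched category ($S\mathcal{V}$ being simplicial objects in $\mathcal{V}$) with object set $S$ and hom-objects the weighted colimits (coends) $\mathfrak{C}_{\mathcal{V}}[X](a,b)=\int^{T\in\mathcal{N}ec}X_T(a,b)\otimes FN(\mathcal{P}_T)\in S\mathcal{V}$; $\mathfrak{C}_{\mathcal{V}}[X]_n(a,b)\in\mathcal{V}$ is its object of $n$-simplices. Flags. A flag of length $n$ on a necklace $(T,p)$ is a sequence $\vec T=(T_0\subseteq\dots\subseteq T_n)$ with $T\subseteq T_0$ and $T_n\subseteq[p]$. It is flanked if $T=T_0$ and $T_n=[p]$. $\mathcal{N}_f[n]$ denotes the category of pairs $(T,\vec T)$ with $T$ a necklace and $\vec T$ a flanked flag of length $n$ on $T$; a morphism $(T,\vec T)\to(U,\vec U)$ is a necklace map $f:T\to U$ with $f(T_i)=U_i$ for all $i\in[n]$. *)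

theory Defs
  imports "HOL-Library.FuncSet" "HOL-Library.Equipollence"
begin

section \<open>Categories, functors, limits and colimits\<close>

record ('o, 'a) cat =
  Ob :: "'o set"
  Arr :: "'a set"
  Dom :: "'a \<Rightarrow> 'o"
  Cod :: "'a \<Rightarrow> 'o"
  Idn :: "'o \<Rightarrow> 'a"
  Comp :: "'a \<Rightarrow> 'a \<Rightarrow> 'a"  (infixr "\<bullet>\<index>" 60)

definition hom :: "('o, 'a, 'z) cat_scheme \<Rightarrow> 'o \<Rightarrow> 'o \<Rightarrow> 'a set" where
  "hom C x y = {f \<in> Arr C. Dom C f = x \<and> Cod C f = y}"

locale category =
  fixes C :: "('o, 'a, 'z) cat_scheme" (structure)
  assumes Dom_Ob: "f \<in> Arr C \<Longrightarrow> Dom C f \<in> Ob C"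
    and Cod_Ob: "f \<in> Arr C \<Longrightarrow> Cod C f \<in> Ob C"
    and Idn_hom: "x \<in> Ob C \<Longrightarrow> Idn C x \<in> hom C x x"
    and Comp_hom: "f \<in> hom C x y \<Longrightarrow> g \<in> hom C y z \<Longrightarrow> g \<bullet> f \<in> hom C x z"
    and Comp_Idn_left: "f \<in> hom C x y \<Longrightarrow> Idn C y \<bullet> f = f"
    and Comp_Idn_right: "f \<in> hom C x y \<Longrightarrow> f \<bullet> Idn C x = f"
    and Comp_assoc: "f \<in> hom C w x \<Longrightarrow> g \<in> hom C x y \<Longrightarrow> h \<in> hom C y z \<Longrightarrow>
      (h \<bullet> g) \<bullet> f = h \<bullet> (g \<bullet> f)"

definition inverse_pair :: "('o, 'a, 'z) cat_scheme \<Rightarrow> 'a \<Rightarrow> 'a \<Rightarrow> bool" where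
  "inverse_pair C f g \<longleftrightarrow> f \<in> Arr C \<and> g \<in> hom C (Cod C f) (Dom C f) \<and>
     g \<bullet>\<^bsub>C\<^esub> f = Idn C (Dom C f) \<and> f \<bullet>\<^bsub>C\<^esub> g = Idn C (Cod C f)"

definition is_iso :: "('o, 'a, 'z) cat_scheme \<Rightarrow> 'a \<Rightarrow> bool" where
  "is_iso C f \<longleftrightarrow> (\<exists>g. inverse_pair C f g)"

definition inv_arr :: "('o, 'a, 'z) cat_scheme \<Rightarrow> 'a \<Rightarrow> 'a" where
  "inv_arr C f = (THE g. inverse_pair C f g)"

definition op_cat :: "('o, 'a, 'z) cat_scheme \<Rightarrow> ('o, 'a) cat" where
  "op_cat C = \<lparr>Ob = Ob C, Arr = Arr C, Dom = Cod C, Cod = Dom C, Idn = Idn C,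
     Comp = (\<lambda>g f. f \<bullet>\<^bsub>C\<^esub> g)\<rparr>"

definition prod_cat ::
  "('o, 'a, 'y) cat_scheme \<Rightarrow> ('p, 'b, 'z) cat_scheme \<Rightarrow> ('o \<times> 'p, 'a \<times> 'b) cat" where
  "prod_cat C D = \<lparr>Ob = Ob C \<times> Ob D, Arr = Arr C \<times> Arr D,
     Dom = map_prod (Dom C) (Dom D), Cod = map_prod (Cod C) (Cod D),
     Idn = map_prod (Idn C) (Idn D),
     Comp = (\<lambda>(g, g') (f, f'). (g \<bullet>\<^bsub>C\<^esub> f, g' \<bullet>\<^bsub>D\<^esub> f'))\<rparr>"

definition discrete_cat :: "'i set \<Rightarrow> ('i, 'i) cat" where
  "discrete_cat A = \<lparr>Ob = A, Arr = A, Dom = id, Cod = id, Idn = id, Comp = (\<lambda>g f. f)\<rparr>"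

text \<open>Arrows of concrete categories carry their source and target.\<close>

datatype ('o, 'm) arrow = Arrow (src: 'o) (amap: 'm) (tgt: 'o)

record ('o, 'a, 'p, 'b) ftr =
  FO :: "'o \<Rightarrow> 'p"
  FA :: "'a \<Rightarrow> 'b"

definition is_functor ::
  "('o, 'a, 'y) cat_scheme \<Rightarrow> ('p, 'b, 'z) cat_scheme \<Rightarrow> ('o, 'a, 'p, 'b, 'x) ftr_scheme \<Rightarrow> bool"
  where
  "is_functor J C F \<longleftrightarrow>
     (\<forall>x \<in> Ob J. FO F x \<in> Ob C) \<and>
     (\<forall>f \<in> Arr J. FA F f \<in> hom C (FO F (Dom J f)) (FO F (Cod J f))) \<and>
     (\<forall>x \<in> Ob J. FA F (Idn J x) = Idn C (FO F x)) \<and>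
     (\<forall>f \<in> Arr J. \<forall>g \<in> Arr J. Cod J f = Dom J g \<longrightarrow>
        FA F (g \<bullet>\<^bsub>J\<^esub> f) = FA F g \<bullet>\<^bsub>C\<^esub> FA F f)"

definition mk_functor ::
  "('o, 'a, 'y) cat_scheme \<Rightarrow> ('o \<Rightarrow> 'p) \<Rightarrow> ('a \<Rightarrow> 'b) \<Rightarrow> ('o, 'a, 'p, 'b) ftr" where
  "mk_functor J fo fa = \<lparr>FO = restrict fo (Ob J), FA = restrict fa (Arr J)\<rparr>"

definition comp_functor ::
  "('o, 'a, 'w) cat_scheme \<Rightarrow> ('p, 'b, 'q, 'c, 'y) ftr_scheme \<Rightarrow>
   ('o, 'a, 'p, 'b, 'z) ftr_scheme \<Rightarrow> ('o, 'a, 'q, 'c) ftr" where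
  "comp_functor J G F = mk_functor J (\<lambda>x. FO G (FO F x)) (\<lambda>f. FA G (FA F f))"

definition nat_trans ::
  "('o, 'a, 'y) cat_scheme \<Rightarrow> ('p, 'b, 'z) cat_scheme \<Rightarrow>
   ('o, 'a, 'p, 'b) ftr \<Rightarrow> ('o, 'a, 'p, 'b) ftr \<Rightarrow> ('o \<Rightarrow> 'b) set" where
  "nat_trans J C F G = {\<alpha> \<in> \<Pi>\<^sub>E x \<in> Ob J. hom C (FO F x) (FO G x).
     \<forall>f \<in> Arr J. \<alpha> (Cod J f) \<bullet>\<^bsub>C\<^esub> FA F f = FA G f \<bullet>\<^bsub>C\<^esub> \<alpha> (Dom J f)}"

definition functor_cat ::
  "('o, 'a, 'y) cat_scheme \<Rightarrow> ('p, 'b, 'z) cat_scheme \<Rightarrow>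
   (('o, 'a, 'p, 'b) ftr, (('o, 'a, 'p, 'b) ftr, 'o \<Rightarrow> 'b) arrow) cat" where
  "functor_cat J C =
    (let Fs = {F. is_functor J C F \<and> FO F \<in> extensional (Ob J) \<and> FA F \<in> extensional (Arr J)}
     in \<lparr>Ob = Fs,
         Arr = {Arrow F \<alpha> G | F \<alpha> G. F \<in> Fs \<and> G \<in> Fs \<and> \<alpha> \<in> nat_trans J C F G},
         Dom = src, Cod = tgt,
         Idn = (\<lambda>F. Arrow F (\<lambda>x\<in>Ob J. Idn C (FO F x)) F),
         Comp = (\<lambda>\<beta> \<alpha>. Arrow (src \<alpha>) (\<lambda>x\<in>Ob J. amap \<beta> x \<bullet>\<^bsub>C\<^esub> amap \<alpha> x) (tgt \<beta>))\<rparr>)"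

definition is_cocone ::
  "('o, 'a, 'z) cat_scheme \<Rightarrow> ('i, 'j, 'y) cat_scheme \<Rightarrow> ('i, 'j, 'o, 'a, 'x) ftr_scheme \<Rightarrow>
   'o \<Rightarrow> ('i \<Rightarrow> 'a) \<Rightarrow> bool" where
  "is_cocone C J D L \<iota> \<longleftrightarrow> L \<in> Ob C \<and> (\<forall>j \<in> Ob J. \<iota> j \<in> hom C (FO D j) L) \<and>
     (\<forall>f \<in> Arr J. \<iota> (Cod J f) \<bullet>\<^bsub>C\<^esub> FA D f = \<iota> (Dom J f))"

definition is_colimit ::
  "('o, 'a, 'z) cat_scheme \<Rightarrow> ('i, 'j, 'y) cat_scheme \<Rightarrow> ('i, 'j, 'o, 'a, 'x) ftr_scheme \<Rightarrow>
   'o \<Rightarrow> ('i \<Rightarrow> 'a) \<Rightarrow> bool" where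
  "is_colimit C J D L \<iota> \<longleftrightarrow> is_cocone C J D L \<iota> \<and>
     (\<forall>M \<kappa>. is_cocone C J D M \<kappa> \<longrightarrow> (\<exists>!h. h \<in> hom C L M \<and> (\<forall>j \<in> Ob J. h \<bullet>\<^bsub>C\<^esub> \<iota> j = \<kappa> j)))"

definition is_cone ::
  "('o, 'a, 'z) cat_scheme \<Rightarrow> ('i, 'j, 'y) cat_scheme \<Rightarrow> ('i, 'j, 'o, 'a, 'x) ftr_scheme \<Rightarrow>
   'o \<Rightarrow> ('i \<Rightarrow> 'a) \<Rightarrow> bool" where
  "is_cone C J D L \<pi> \<longleftrightarrow> L \<in> Ob C \<and> (\<forall>j \<in> Ob J. \<pi> j \<in> hom C L (FO D j)) \<and>
     (\<forall>f \<in> Arr J. FA D f \<bullet>\<^bsub>C\<^esub> \<pi> (Dom J f) = \<pi> (Cod J f))"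

definition is_limit ::
  "('o, 'a, 'z) cat_scheme \<Rightarrow> ('i, 'j, 'y) cat_scheme \<Rightarrow> ('i, 'j, 'o, 'a, 'x) ftr_scheme \<Rightarrow>
   'o \<Rightarrow> ('i \<Rightarrow> 'a) \<Rightarrow> bool" where
  "is_limit C J D L \<pi> \<longleftrightarrow> is_cone C J D L \<pi> \<and>
     (\<forall>M \<kappa>. is_cone C J D M \<kappa> \<longrightarrow> (\<exists>!h. h \<in> hom C M L \<and> (\<forall>j \<in> Ob J. \<pi> j \<bullet>\<^bsub>C\<^esub> h = \<kappa> j)))"

text \<open>
  Smallness is relative to a type \<open>'u\<close>: a category is small if its objects and arrows
  are elements of \<open>'u\<close>, and a set (of any type) is small if it injects into \<open>'u\<close>.
\<close>

definition complete_cat :: "'u itself \<Rightarrow> ('o, 'a, 'z) cat_scheme \<Rightarrow> bool" where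
  "complete_cat U C \<longleftrightarrow> (\<forall>(J :: ('u, 'u) cat) (D :: ('u, 'u, 'o, 'a) ftr).
     category J \<longrightarrow> is_functor J C D \<longrightarrow> (\<exists>L \<pi>. is_limit C J D L \<pi>))"

definition cocomplete_cat :: "'u itself \<Rightarrow> ('o, 'a, 'z) cat_scheme \<Rightarrow> bool" where
  "cocomplete_cat U C \<longleftrightarrow> (\<forall>(J :: ('u, 'u) cat) (D :: ('u, 'u, 'o, 'a) ftr).
     category J \<longrightarrow> is_functor J C D \<longrightarrow> (\<exists>L \<iota>. is_colimit C J D L \<iota>))"

definition preserves_colimits ::
  "'u itself \<Rightarrow> ('o, 'a, 'y) cat_scheme \<Rightarrow> ('p, 'b, 'z) cat_scheme \<Rightarrow>
   ('o, 'a, 'p, 'b, 'x) ftr_scheme \<Rightarrow> bool" where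
  "preserves_colimits U C C' F \<longleftrightarrow>
     (\<forall>(J :: ('u, 'u) cat) (D :: ('u, 'u, 'o, 'a) ftr) L \<iota>.
        category J \<longrightarrow> is_functor J C D \<longrightarrow> is_colimit C J D L \<iota> \<longrightarrow>
        is_colimit C' J (comp_functor J F D) (FO F L) (\<lambda>j. FA F (\<iota> j)))"

text \<open>
  Chosen universal constructions: an object with its structure maps, meaningful whenever one
  exists and then unique up to unique isomorphism.
\<close>

definition colimit ::
  "('o, 'a, 'z) cat_scheme \<Rightarrow> ('i, 'j, 'y) cat_scheme \<Rightarrow> ('i, 'j, 'o, 'a, 'x) ftr_scheme \<Rightarrow>
   'o \<times> ('i \<Rightarrow> 'a)" where
  "colimit C J D = (SOME (L, \<iota>). is_colimit C J D L \<iota>)"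

definition initial_obj :: "('o, 'a, 'z) cat_scheme \<Rightarrow> 'o" where
  "initial_obj C = (SOME z. z \<in> Ob C \<and> (\<forall>x \<in> Ob C. \<exists>!f. f \<in> hom C z x))"

definition coprod :: "('o, 'a, 'z) cat_scheme \<Rightarrow> 'i set \<Rightarrow> ('i \<Rightarrow> 'o) \<Rightarrow> 'o \<times> ('i \<Rightarrow> 'a)" where
  "coprod C A x = colimit C (discrete_cat A) (mk_functor (discrete_cat A) x (\<lambda>i. Idn C (x i)))"

definition is_cowedge ::
  "('o, 'a, 'z) cat_scheme \<Rightarrow> ('i, 'j, 'y) cat_scheme \<Rightarrow>
   ('i \<times> 'i, 'j \<times> 'j, 'o, 'a, 'x) ftr_scheme \<Rightarrow> 'o \<Rightarrow> ('i \<Rightarrow> 'a) \<Rightarrow> bool" where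
  "is_cowedge C J G E \<omega> \<longleftrightarrow> E \<in> Ob C \<and> (\<forall>j \<in> Ob J. \<omega> j \<in> hom C (FO G (j, j)) E) \<and>
     (\<forall>f \<in> Arr J. \<omega> (Dom J f) \<bullet>\<^bsub>C\<^esub> FA G (f, Idn J (Dom J f)) =
                  \<omega> (Cod J f) \<bullet>\<^bsub>C\<^esub> FA G (Idn J (Cod J f), f))"

text \<open>Here \<open>G\<close> is a functor from \<open>prod_cat (op_cat J) J\<close> to \<open>C\<close>.\<close>

definition is_coend ::
  "('o, 'a, 'z) cat_scheme \<Rightarrow> ('i, 'j, 'y) cat_scheme \<Rightarrow>
   ('i \<times> 'i, 'j \<times> 'j, 'o, 'a, 'x) ftr_scheme \<Rightarrow> 'o \<Rightarrow> ('i \<Rightarrow> 'a) \<Rightarrow> bool" where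
  "is_coend C J G E \<omega> \<longleftrightarrow> is_cowedge C J G E \<omega> \<and>
     (\<forall>M \<kappa>. is_cowedge C J G M \<kappa> \<longrightarrow> (\<exists>!h. h \<in> hom C E M \<and> (\<forall>j \<in> Ob J. h \<bullet>\<^bsub>C\<^esub> \<omega> j = \<kappa> j)))"

definition coend ::
  "('o, 'a, 'z) cat_scheme \<Rightarrow> ('i, 'j, 'y) cat_scheme \<Rightarrow>
   ('i \<times> 'i, 'j \<times> 'j, 'o, 'a, 'x) ftr_scheme \<Rightarrow> 'o \<times> ('i \<Rightarrow> 'a)" where
  "coend C J G = (SOME (E, \<omega>). is_coend C J G E \<omega>)"


section \<open>Monoidal categories and colax monoidal functors\<close>

record ('o, 'a) moncat = "('o, 'a) cat" +
  TenO :: "'o \<Rightarrow> 'o \<Rightarrow> 'o"  (infixr "\<otimes>\<index>" 70)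
  TenA :: "'a \<Rightarrow> 'a \<Rightarrow> 'a"  (infixr "\<odot>\<index>" 70)
  Unit :: "'o"  ("\<one>\<index>")
  Assoc :: "'o \<Rightarrow> 'o \<Rightarrow> 'o \<Rightarrow> 'a"
  LUn :: "'o \<Rightarrow> 'a"
  RUn :: "'o \<Rightarrow> 'a"

record ('o, 'a) smoncat = "('o, 'a) moncat" +
  Braid :: "'o \<Rightarrow> 'o \<Rightarrow> 'a"

locale monoidal_category = category V
  for V :: "('o, 'a, 'z) moncat_scheme" (structure) +
  assumes Unit_Ob: "\<one> \<in> Ob V"
    and TenO_Ob: "x \<in> Ob V \<Longrightarrow> y \<in> Ob V \<Longrightarrow> x \<otimes> y \<in> Ob V"
    and TenA_hom: "f \<in> hom V x x' \<Longrightarrow> g \<in> hom V y y' \<Longrightarrow> f \<odot> g \<in> hom V (x \<otimes> y) (x' \<otimes> y')"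
    and TenA_Idn: "x \<in> Ob V \<Longrightarrow> y \<in> Ob V \<Longrightarrow> Idn V x \<odot> Idn V y = Idn V (x \<otimes> y)"
    and TenA_Comp: "f \<in> hom V x x' \<Longrightarrow> f' \<in> hom V x' x'' \<Longrightarrow> g \<in> hom V y y' \<Longrightarrow> g' \<in> hom V y' y'' \<Longrightarrow>
      (f' \<bullet> f) \<odot> (g' \<bullet> g) = (f' \<odot> g') \<bullet> (f \<odot> g)"
    and Assoc_hom: "x \<in> Ob V \<Longrightarrow> y \<in> Ob V \<Longrightarrow> z \<in> Ob V \<Longrightarrow>
      Assoc V x y z \<in> hom V ((x \<otimes> y) \<otimes> z) (x \<otimes> (y \<otimes> z))"
    and Assoc_iso: "x \<in> Ob V \<Longrightarrow> y \<in> Ob V \<Longrightarrow> z \<in> Ob V \<Longrightarrow> is_iso V (Assoc V x y z)"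
    and Assoc_natural: "f \<in> hom V x x' \<Longrightarrow> g \<in> hom V y y' \<Longrightarrow> h \<in> hom V z z' \<Longrightarrow>
      Assoc V x' y' z' \<bullet> ((f \<odot> g) \<odot> h) = (f \<odot> (g \<odot> h)) \<bullet> Assoc V x y z"
    and LUn_hom: "x \<in> Ob V \<Longrightarrow> LUn V x \<in> hom V (\<one> \<otimes> x) x"
    and LUn_iso: "x \<in> Ob V \<Longrightarrow> is_iso V (LUn V x)"
    and LUn_natural: "f \<in> hom V x y \<Longrightarrow> LUn V y \<bullet> (Idn V \<one> \<odot> f) = f \<bullet> LUn V x"
    and RUn_hom: "x \<in> Ob V \<Longrightarrow> RUn V x \<in> hom V (x \<otimes> \<one>) x"
    and RUn_iso: "x \<in> Ob V \<Longrightarrow> is_iso V (RUn V x)"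
    and RUn_natural: "f \<in> hom V x y \<Longrightarrow> RUn V y \<bullet> (f \<odot> Idn V \<one>) = f \<bullet> RUn V x"
    and pentagon: "w \<in> Ob V \<Longrightarrow> x \<in> Ob V \<Longrightarrow> y \<in> Ob V \<Longrightarrow> z \<in> Ob V \<Longrightarrow>
      (Idn V w \<odot> Assoc V x y z) \<bullet> Assoc V w (x \<otimes> y) z \<bullet> (Assoc V w x y \<odot> Idn V z) =
      Assoc V w x (y \<otimes> z) \<bullet> Assoc V (w \<otimes> x) y z"
    and triangle: "x \<in> Ob V \<Longrightarrow> y \<in> Ob V \<Longrightarrow>
      (Idn V x \<odot> LUn V y) \<bullet> Assoc V x \<one> y = RUn V x \<odot> Idn V y"

locale symmetric_monoidal_category = monoidal_category V
  for V :: "('o, 'a, 'z) smoncat_scheme" (structure) +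
  assumes Braid_hom: "x \<in> Ob V \<Longrightarrow> y \<in> Ob V \<Longrightarrow> Braid V x y \<in> hom V (x \<otimes> y) (y \<otimes> x)"
    and Braid_natural: "f \<in> hom V x x' \<Longrightarrow> g \<in> hom V y y' \<Longrightarrow>
      Braid V x' y' \<bullet> (f \<odot> g) = (g \<odot> f) \<bullet> Braid V x y"
    and Braid_Braid: "x \<in> Ob V \<Longrightarrow> y \<in> Ob V \<Longrightarrow> Braid V y x \<bullet> Braid V x y = Idn V (x \<otimes> y)"
    and hexagon: "x \<in> Ob V \<Longrightarrow> y \<in> Ob V \<Longrightarrow> z \<in> Ob V \<Longrightarrow>
      Assoc V y z x \<bullet> Braid V x (y \<otimes> z) \<bullet> Assoc V x y z =
      (Idn V y \<odot> Braid V x z) \<bullet> Assoc V y x z \<bullet> (Braid V x y \<odot> Idn V z)"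

text \<open>Closedness: every functor \<open>- \<otimes> y\<close> has a right adjoint, given by universal arrows.\<close>

locale closed_symmetric_monoidal_category = symmetric_monoidal_category V
  for V :: "('o, 'a, 'z) smoncat_scheme" (structure) +
  assumes closed: "y \<in> Ob V \<Longrightarrow> z \<in> Ob V \<Longrightarrow>
    \<exists>H \<in> Ob V. \<exists>ev \<in> hom V (H \<otimes> y) z. \<forall>x \<in> Ob V. \<forall>f \<in> hom V (x \<otimes> y) z.
      \<exists>!g. g \<in> hom V x H \<and> ev \<bullet> (g \<odot> Idn V y) = f"

definition op_moncat :: "('o, 'a, 'z) moncat_scheme \<Rightarrow> ('o, 'a) moncat" where
  "op_moncat C = \<lparr>Ob = Ob C, Arr = Arr C, Dom = Cod C, Cod = Dom C, Idn = Idn C,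
     Comp = (\<lambda>g f. f \<bullet>\<^bsub>C\<^esub> g), TenO = TenO C, TenA = TenA C, Unit = Unit C,
     Assoc = (\<lambda>x y z. inv_arr C (Assoc C x y z)),
     LUn = (\<lambda>x. inv_arr C (LUn C x)), RUn = (\<lambda>x. inv_arr C (RUn C x))\<rparr>"

record ('o, 'a, 'p, 'b) colax = "('o, 'a, 'p, 'b) ftr" +
  Mu :: "'o \<Rightarrow> 'o \<Rightarrow> 'b"
  Eps :: "'b"

definition is_colax_monoidal ::
  "('o, 'a, 'y) moncat_scheme \<Rightarrow> ('p, 'b, 'z) moncat_scheme \<Rightarrow> ('o, 'a, 'p, 'b) colax \<Rightarrow> bool"
  where
  "is_colax_monoidal C D X \<longleftrightarrow> is_functor C D X \<and>
     (\<forall>x \<in> Ob C. \<forall>y \<in> Ob C. Mu X x y \<in> hom D (FO X (x \<otimes>\<^bsub>C\<^esub> y)) (FO X x \<otimes>\<^bsub>D\<^esub> FO X y)) \<and>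
     Eps X \<in> hom D (FO X \<one>\<^bsub>C\<^esub>) \<one>\<^bsub>D\<^esub> \<and>
     (\<forall>f \<in> Arr C. \<forall>g \<in> Arr C.
        Mu X (Cod C f) (Cod C g) \<bullet>\<^bsub>D\<^esub> FA X (f \<odot>\<^bsub>C\<^esub> g) =
        (FA X f \<odot>\<^bsub>D\<^esub> FA X g) \<bullet>\<^bsub>D\<^esub> Mu X (Dom C f) (Dom C g)) \<and>
     (\<forall>x \<in> Ob C. \<forall>y \<in> Ob C. \<forall>z \<in> Ob C.
        Assoc D (FO X x) (FO X y) (FO X z) \<bullet>\<^bsub>D\<^esub>
          (Mu X x y \<odot>\<^bsub>D\<^esub> Idn D (FO X z)) \<bullet>\<^bsub>D\<^esub> Mu X (x \<otimes>\<^bsub>C\<^esub> y) z =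
        (Idn D (FO X x) \<odot>\<^bsub>D\<^esub> Mu X y z) \<bullet>\<^bsub>D\<^esub> Mu X x (y \<otimes>\<^bsub>C\<^esub> z) \<bullet>\<^bsub>D\<^esub> FA X (Assoc C x y z)) \<and>
     (\<forall>x \<in> Ob C. LUn D (FO X x) \<bullet>\<^bsub>D\<^esub> (Eps X \<odot>\<^bsub>D\<^esub> Idn D (FO X x)) \<bullet>\<^bsub>D\<^esub> Mu X \<one>\<^bsub>C\<^esub> x =
        FA X (LUn C x)) \<and>
     (\<forall>x \<in> Ob C. RUn D (FO X x) \<bullet>\<^bsub>D\<^esub> (Idn D (FO X x) \<odot>\<^bsub>D\<^esub> Eps X) \<bullet>\<^bsub>D\<^esub> Mu X x \<one>\<^bsub>C\<^esub> =
        FA X (RUn C x))"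

text \<open>
  Iterated tensor products, associated to the right; the empty product is the unit, and a
  product of one factor is that factor.
\<close>

fun tens_list :: "('o, 'a, 'z) moncat_scheme \<Rightarrow> 'o list \<Rightarrow> 'o" where
  "tens_list D [] = \<one>\<^bsub>D\<^esub>"
| "tens_list D [x] = x"
| "tens_list D (x # y # zs) = x \<otimes>\<^bsub>D\<^esub> tens_list D (y # zs)"

fun tens_list_arr :: "('o, 'a, 'z) moncat_scheme \<Rightarrow> 'a list \<Rightarrow> 'a" where
  "tens_list_arr D [] = Idn D \<one>\<^bsub>D\<^esub>"
| "tens_list_arr D [f] = f"
| "tens_list_arr D (f # g # hs) = f \<odot>\<^bsub>D\<^esub> tens_list_arr D (g # hs)"

text \<open>The coherence isomorphism \<open>x \<otimes> tens_list D xs \<rightarrow> tens_list D (x # xs)\<close>.\<close>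

definition cons_iso :: "('o, 'a, 'z) moncat_scheme \<Rightarrow> 'o \<Rightarrow> 'o list \<Rightarrow> 'a" where
  "cons_iso D x xs = (if xs = [] then RUn D x else Idn D (x \<otimes>\<^bsub>D\<^esub> tens_list D xs))"

text \<open>The coherence isomorphism \<open>tens_list D xs \<otimes> tens_list D ys \<rightarrow> tens_list D (xs @ ys)\<close>.\<close>

fun append_iso :: "('o, 'a, 'z) moncat_scheme \<Rightarrow> 'o list \<Rightarrow> 'o list \<Rightarrow> 'a" where
  "append_iso D [] ys = LUn D (tens_list D ys)"
| "append_iso D (x # xs) ys =
     cons_iso D x (xs @ ys) \<bullet>\<^bsub>D\<^esub> (Idn D x \<odot>\<^bsub>D\<^esub> append_iso D xs ys) \<bullet>\<^bsub>D\<^esub>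
     Assoc D x (tens_list D xs) (tens_list D ys) \<bullet>\<^bsub>D\<^esub>
     (inv_arr D (cons_iso D x xs) \<odot>\<^bsub>D\<^esub> Idn D (tens_list D ys))"


section \<open>Quivers\<close>

text \<open>A \<open>V\<close>-quiver with vertex set \<open>S\<close> is an extensional function on \<open>S \<times> S\<close>.\<close>

type_synonym ('s, 'o) quiver = "'s \<times> 's \<Rightarrow> 'o"

definition quiv_ten ::
  "('o, 'a, 'z) moncat_scheme \<Rightarrow> 's set \<Rightarrow> ('s, 'o) quiver \<Rightarrow> ('s, 'o) quiver \<Rightarrow> ('s, 'o) quiver"
  where
  "quiv_ten V S Q P = (\<lambda>(a, b)\<in>S \<times> S. fst (coprod V S (\<lambda>c. Q (a, c) \<otimes>\<^bsub>V\<^esub> P (c, b))))"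

text \<open>The coprojection \<open>Q (a, c) \<otimes> P (c, b) \<rightarrow> quiv_ten V S Q P (a, b)\<close>.\<close>

definition quiv_inj ::
  "('o, 'a, 'z) moncat_scheme \<Rightarrow> 's set \<Rightarrow> ('s, 'o) quiver \<Rightarrow> ('s, 'o) quiver \<Rightarrow> 's \<Rightarrow> 's \<Rightarrow> 's \<Rightarrow> 'a"
  where
  "quiv_inj V S Q P a b c = snd (coprod V S (\<lambda>c. Q (a, c) \<otimes>\<^bsub>V\<^esub> P (c, b))) c"

definition quiv_unit :: "('o, 'a, 'z) moncat_scheme \<Rightarrow> 's set \<Rightarrow> ('s, 'o) quiver" where
  "quiv_unit V S = (\<lambda>(a, b)\<in>S \<times> S. if a = b then \<one>\<^bsub>V\<^esub> else initial_obj V)"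

text \<open>
  The coherence morphisms are characterised by their composites with coprojections; this
  determines them because, for closed \<open>V\<close>, tensoring preserves coproducts and initial objects.
\<close>

definition quiv_ten_arr ::
  "('o, 'a, 'z) moncat_scheme \<Rightarrow> 's set \<Rightarrow> (('s, 'o) quiver, ('s, 'a) quiver) arrow \<Rightarrow>
   (('s, 'o) quiver, ('s, 'a) quiver) arrow \<Rightarrow> (('s, 'o) quiver, ('s, 'a) quiver) arrow" where
  "quiv_ten_arr V S \<alpha> \<beta> =
    (let Q = src \<alpha>; Q' = tgt \<alpha>; P = src \<beta>; P' = tgt \<beta> in
     Arrow (quiv_ten V S Q P)
       (\<lambda>(a, b)\<in>S \<times> S. THE h. h \<in> hom V (quiv_ten V S Q P (a, b)) (quiv_ten V S Q' P' (a, b)) \<and>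
          (\<forall>c \<in> S. h \<bullet>\<^bsub>V\<^esub> quiv_inj V S Q P a b c =
                   quiv_inj V S Q' P' a b c \<bullet>\<^bsub>V\<^esub> (amap \<alpha> (a, c) \<odot>\<^bsub>V\<^esub> amap \<beta> (c, b))))
       (quiv_ten V S Q' P'))"

definition quiv_assoc ::
  "('o, 'a, 'z) moncat_scheme \<Rightarrow> 's set \<Rightarrow> ('s, 'o) quiver \<Rightarrow> ('s, 'o) quiver \<Rightarrow> ('s, 'o) quiver \<Rightarrow>
   (('s, 'o) quiver, ('s, 'a) quiver) arrow" where
  "quiv_assoc V S Q P R =
    (let QP = quiv_ten V S Q P; PR = quiv_ten V S P R;
         L = quiv_ten V S QP R; M = quiv_ten V S Q PR in
     Arrow L
       (\<lambda>(a, b)\<in>S \<times> S. THE h. h \<in> hom V (L (a, b)) (M (a, b)) \<and>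
          (\<forall>c \<in> S. \<forall>d \<in> S.
             h \<bullet>\<^bsub>V\<^esub> quiv_inj V S QP R a b d \<bullet>\<^bsub>V\<^esub> (quiv_inj V S Q P a d c \<odot>\<^bsub>V\<^esub> Idn V (R (d, b))) =
             quiv_inj V S Q PR a b c \<bullet>\<^bsub>V\<^esub> (Idn V (Q (a, c)) \<odot>\<^bsub>V\<^esub> quiv_inj V S P R c b d) \<bullet>\<^bsub>V\<^esub>
             Assoc V (Q (a, c)) (P (c, d)) (R (d, b))))
       M)"

definition quiv_lun ::
  "('o, 'a, 'z) moncat_scheme \<Rightarrow> 's set \<Rightarrow> ('s, 'o) quiver \<Rightarrow>
   (('s, 'o) quiver, ('s, 'a) quiver) arrow" where
  "quiv_lun V S Q =
    (let L = quiv_ten V S (quiv_unit V S) Q in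
     Arrow L
       (\<lambda>(a, b)\<in>S \<times> S. THE h. h \<in> hom V (L (a, b)) (Q (a, b)) \<and>
          h \<bullet>\<^bsub>V\<^esub> quiv_inj V S (quiv_unit V S) Q a b a = LUn V (Q (a, b)))
       Q)"

definition quiv_run ::
  "('o, 'a, 'z) moncat_scheme \<Rightarrow> 's set \<Rightarrow> ('s, 'o) quiver \<Rightarrow>
   (('s, 'o) quiver, ('s, 'a) quiver) arrow" where
  "quiv_run V S Q =
    (let L = quiv_ten V S Q (quiv_unit V S) in
     Arrow L
       (\<lambda>(a, b)\<in>S \<times> S. THE h. h \<in> hom V (L (a, b)) (Q (a, b)) \<and>
          h \<bullet>\<^bsub>V\<^esub> quiv_inj V S Q (quiv_unit V S) a b b = RUn V (Q (a, b)))
       Q)"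

definition quiv ::
  "('o, 'a, 'z) moncat_scheme \<Rightarrow> 's set \<Rightarrow>
   (('s, 'o) quiver, (('s, 'o) quiver, ('s, 'a) quiver) arrow) moncat" where
  "quiv V S =
    (let Qs = S \<times> S \<rightarrow>\<^sub>E Ob V in
     \<lparr>Ob = Qs,
      Arr = {Arrow Q \<alpha> P | Q \<alpha> P. Q \<in> Qs \<and> P \<in> Qs \<and> \<alpha> \<in> (\<Pi>\<^sub>E x \<in> S \<times> S. hom V (Q x) (P x))},
      Dom = src, Cod = tgt,
      Idn = (\<lambda>Q. Arrow Q (\<lambda>x\<in>S \<times> S. Idn V (Q x)) Q),
      Comp = (\<lambda>\<beta> \<alpha>. Arrow (src \<alpha>) (\<lambda>x\<in>S \<times> S. amap \<beta> x \<bullet>\<^bsub>V\<^esub> amap \<alpha> x) (tgt \<beta>)),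
      TenO = quiv_ten V S, TenA = quiv_ten_arr V S, Unit = quiv_unit V S,
      Assoc = quiv_assoc V S, LUn = quiv_lun V S, RUn = quiv_run V S\<rparr>)"


section \<open>Simplices, intervals and templicial objects\<close>

text \<open>The object \<open>[n] = {0, ..., n}\<close> is represented by \<open>n\<close>.\<close>

type_synonym mon_map = "(nat, nat \<Rightarrow> nat) arrow"

definition delta :: "(nat, mon_map) cat" where
  "delta = \<lparr>Ob = UNIV,
     Arr = {Arrow m f n | m f n. f \<in> {..m} \<rightarrow>\<^sub>E {..n} \<and> mono_on {..m} f},
     Dom = src, Cod = tgt, Idn = (\<lambda>n. Arrow n (\<lambda>i\<in>{..n}. i) n),
     Comp = (\<lambda>g f. Arrow (src f) (compose {..src f} (amap g) (amap f)) (tgt g))\<rparr>"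

definition delta_f :: "(nat, mon_map) moncat" where
  "delta_f = \<lparr>Ob = UNIV,
     Arr = {Arrow m f n | m f n. Arrow m f n \<in> Arr delta \<and> f 0 = 0 \<and> f m = n},
     Dom = src, Cod = tgt, Idn = Idn delta, Comp = Comp delta,
     TenO = (+),
     TenA = (\<lambda>f g. Arrow (src f + src g)
       (\<lambda>i\<in>{..src f + src g}. if i \<le> src f then amap f i else tgt f + amap g (i - src f))
       (tgt f + tgt g)),
     Unit = 0, Assoc = (\<lambda>k m n. Idn delta (k + m + n)), LUn = Idn delta, RUn = Idn delta\<rparr>"

type_synonym ('s, 'o, 'a) templicial =
  "(nat, mon_map, ('s, 'o) quiver, (('s, 'o) quiver, ('s, 'a) quiver) arrow) colax"

definition templicial_object ::
  "('o, 'a, 'z) moncat_scheme \<Rightarrow> 's set \<Rightarrow> ('s, 'o, 'a) templicial \<Rightarrow> bool" where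
  "templicial_object V S X \<longleftrightarrow>
     is_colax_monoidal (op_moncat delta_f) (quiv V S) X \<and> is_iso (quiv V S) (Eps X)"


section \<open>Necklaces\<close>

type_synonym necklace = "nat set \<times> nat"
type_synonym nec_map = "(necklace, nat \<Rightarrow> nat) arrow"

definition necklaces :: "necklace set" where
  "necklaces = {(T, p). {0, p} \<subseteq> T \<and> T \<subseteq> {..p}}"

definition nec :: "(necklace, nec_map) cat" where
  "nec = \<lparr>Ob = necklaces,
     Arr = {Arrow (T, p) f (U, q) | T p f U q. (T, p) \<in> necklaces \<and> (U, q) \<in> necklaces \<and>
       Arrow p f q \<in> Arr delta_f \<and> U \<subseteq> f ` T},
     Dom = src, Cod = tgt,
     Idn = (\<lambda>(T, p). Arrow (T, p) (\<lambda>i\<in>{..p}. i) (T, p)),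
     Comp = (\<lambda>g f. Arrow (src f) (compose {..snd (src f)} (amap g) (amap f)) (tgt g))\<rparr>"

text \<open>
  For \<open>T = {t\<^sub>0 < ... < t\<^sub>k}\<close>, \<open>consec T\<close> lists the pairs \<open>(t\<^sub>i\<^sub>-\<^sub>1, t\<^sub>i)\<close> and \<open>gaps T\<close> the
  differences \<open>t\<^sub>i - t\<^sub>i\<^sub>-\<^sub>1\<close>. The latter are invariant under translation of \<open>T\<close>.
\<close>

definition consec :: "nat set \<Rightarrow> (nat \<times> nat) list" where
  "consec T = (let ts = sorted_list_of_set T in zip ts (tl ts))"

definition gaps :: "nat set \<Rightarrow> nat list" where
  "gaps T = map (\<lambda>(s, t). t - s) (consec T)"

text \<open>
  In the rest of this section \<open>X\<close> is a strongly unital colax monoidal functor from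
  \<open>op_moncat delta_f\<close> to a monoidal category \<open>D\<close> (later \<open>quiv V S\<close>).
\<close>

definition nec_obj ::
  "('o, 'a, 'z) moncat_scheme \<Rightarrow> (nat, mon_map, 'o, 'a) colax \<Rightarrow> nat set \<Rightarrow> 'o" where
  "nec_obj D X T = tens_list D (map (FO X) (gaps T))"

text \<open>The iterated comultiplication \<open>X\<^sub>p \<rightarrow> X\<^sub>T\<close>, where \<open>gaps T\<close> is the list argument.\<close>

fun comult ::
  "('o, 'a, 'z) moncat_scheme \<Rightarrow> (nat, mon_map, 'o, 'a) colax \<Rightarrow> nat list \<Rightarrow> 'a" where
  "comult D X [] = Eps X"
| "comult D X (n # ns) =
     cons_iso D (FO X n) (map (FO X) ns) \<bullet>\<^bsub>D\<^esub> (Idn D (FO X n) \<odot>\<^bsub>D\<^esub> comult D X ns) \<bullet>\<^bsub>D\<^esub>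
     Mu X n (sum_list ns)"

text \<open>
  The tensor product of the comultiplications of several lists, with codomain rebracketed to
  the product over the concatenated list.
\<close>

fun comults ::
  "('o, 'a, 'z) moncat_scheme \<Rightarrow> (nat, mon_map, 'o, 'a) colax \<Rightarrow> nat list list \<Rightarrow> 'a" where
  "comults D X [] = Idn D \<one>\<^bsub>D\<^esub>"
| "comults D X (ns # nss) =
     append_iso D (map (FO X) ns) (map (FO X) (concat nss)) \<bullet>\<^bsub>D\<^esub>
     (comult D X ns \<odot>\<^bsub>D\<^esub> comults D X nss) \<bullet>\<^bsub>D\<^esub>
     inv_arr D (cons_iso D (FO X (sum_list ns)) (map (\<lambda>ns. FO X (sum_list ns)) nss))"

text \<open>
  \<open>X\<^sub>U \<rightarrow> X\<^sub>T\<close> for the inert map given by \<open>U \<subseteq> T\<close>: the component \<open>T\<^sub>i\<close> of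
  \<open>T = T\<^sub>1 \<or> ... \<or> T\<^sub>l\<close> is the translate of \<open>T \<inter> {u\<^sub>i\<^sub>-\<^sub>1..u\<^sub>i}\<close>.
\<close>

definition inert_arr ::
  "('o, 'a, 'z) moncat_scheme \<Rightarrow> (nat, mon_map, 'o, 'a) colax \<Rightarrow> nat set \<Rightarrow> nat set \<Rightarrow> 'a" where
  "inert_arr D X T U = comults D X (map (\<lambda>(u, v). gaps (T \<inter> {u..v})) (consec U))"

text \<open>
  The isomorphism from the product of the \<open>X\<^sub>n\<close> with \<open>n \<noteq> 0\<close> in a list to the product over the
  whole list, inserting the factors \<open>X\<^sub>0\<close> by the inverse of the counit.
\<close>

fun fill ::
  "('o, 'a, 'z) moncat_scheme \<Rightarrow> (nat, mon_map, 'o, 'a) colax \<Rightarrow> nat list \<Rightarrow> 'a" where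
  "fill D X [] = Idn D \<one>\<^bsub>D\<^esub>"
| "fill D X (n # ns) =
     (let ms = map (FO X) (filter (\<lambda>n. n \<noteq> 0) ns) in
      cons_iso D (FO X n) (map (FO X) ns) \<bullet>\<^bsub>D\<^esub>
      (if n = 0
       then (inv_arr D (Eps X) \<odot>\<^bsub>D\<^esub> fill D X ns) \<bullet>\<^bsub>D\<^esub> inv_arr D (LUn D (tens_list D ms))
       else (Idn D (FO X n) \<odot>\<^bsub>D\<^esub> fill D X ns) \<bullet>\<^bsub>D\<^esub> inv_arr D (cons_iso D (FO X n) ms)))"

text \<open>
  \<open>X\<^bsub>f(T)\<^esub> \<rightarrow> X\<^sub>T\<close> for the active map given by \<open>f\<close>. The list of all \<open>f t\<^sub>i - f t\<^sub>i\<^sub>-\<^sub>1\<close>, with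
  zeros removed, is \<open>gaps (f ` T)\<close>.
\<close>

definition active_arr ::
  "('o, 'a, 'z) moncat_scheme \<Rightarrow> (nat, mon_map, 'o, 'a) colax \<Rightarrow> nat set \<Rightarrow> (nat \<Rightarrow> nat) \<Rightarrow> 'a"
  where
  "active_arr D X T f =
     tens_list_arr D
       (map (\<lambda>(s, t). FA X (Arrow (t - s) (\<lambda>j\<in>{..t - s}. f (s + j) - f s) (f t - f s)))
         (consec T)) \<bullet>\<^bsub>D\<^esub>
     fill D X (map (\<lambda>(s, t). f t - f s) (consec T))"

text \<open>The functor \<open>X\<^sub>\<bullet> : Nec\<^sup>o\<^sup>p \<rightarrow> D\<close>.\<close>

definition nec_functor ::
  "('o, 'a, 'z) moncat_scheme \<Rightarrow> (nat, mon_map, 'o, 'a) colax \<Rightarrow>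
   (necklace, nec_map, 'o, 'a) ftr" where
  "nec_functor D X = mk_functor (op_cat nec) (\<lambda>(T, p). nec_obj D X T)
     (\<lambda>\<phi>. case \<phi> of Arrow (T, p) f (U, q) \<Rightarrow> active_arr D X T f \<bullet>\<^bsub>D\<^esub> inert_arr D X (f ` T) U)"

text \<open>The functor \<open>T \<mapsto> X\<^sub>T(a, b)\<close>.\<close>

definition nec_functor_at ::
  "('o, 'a, 'z) moncat_scheme \<Rightarrow> 's set \<Rightarrow> ('s, 'o, 'a) templicial \<Rightarrow> 's \<Rightarrow> 's \<Rightarrow>
   (necklace, nec_map, 'o, 'a) ftr" where
  "nec_functor_at V S X a b = mk_functor (op_cat nec)
     (\<lambda>T. FO (nec_functor (quiv V S) X) T (a, b))
     (\<lambda>f. amap (FA (nec_functor (quiv V S) X) f) (a, b))"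


section \<open>Sets, nerves and categorification\<close>

text \<open>The category of small sets with elements in a type \<open>'x\<close>.\<close>

definition set_cat :: "'u itself \<Rightarrow> ('x set, ('x set, 'x \<Rightarrow> 'x) arrow) cat" where
  "set_cat U = \<lparr>Ob = {A. A \<lesssim> (UNIV :: 'u set)},
     Arr = {Arrow A f B | A f B. A \<lesssim> (UNIV :: 'u set) \<and> B \<lesssim> (UNIV :: 'u set) \<and> f \<in> A \<rightarrow>\<^sub>E B},
     Dom = src, Cod = tgt, Idn = (\<lambda>A. Arrow A (\<lambda>x\<in>A. x) A),
     Comp = (\<lambda>g f. Arrow (src f) (compose (src f) (amap g) (amap f)) (tgt g))\<rparr>"

text \<open>
  The nerve of a poset: an \<open>n\<close>-simplex is a functor from \<open>[n]\<close>, that is, a monotone map.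
\<close>

definition nerve_simplices :: "'p::order set \<Rightarrow> nat \<Rightarrow> (nat \<Rightarrow> 'p) set" where
  "nerve_simplices P n = {\<sigma> \<in> {..n} \<rightarrow>\<^sub>E P. mono_on {..n} \<sigma>}"

definition nerve ::
  "'p::order set \<Rightarrow> (nat, mon_map, (nat \<Rightarrow> 'p) set, ((nat \<Rightarrow> 'p) set, (nat \<Rightarrow> 'p) \<Rightarrow> nat \<Rightarrow> 'p) arrow) ftr"
  where
  "nerve P = mk_functor (op_cat delta) (nerve_simplices P)
     (\<lambda>\<theta>. case \<theta> of Arrow m f n \<Rightarrow>
        Arrow (nerve_simplices P n) (\<lambda>\<sigma>\<in>nerve_simplices P n. compose {..m} \<sigma> f)
          (nerve_simplices P m))"

definition nerve_map ::
  "'p::order set \<Rightarrow> ('p \<Rightarrow> 'p) \<Rightarrow> 'p set \<Rightarrow>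
   ((nat, mon_map, (nat \<Rightarrow> 'p) set, ((nat \<Rightarrow> 'p) set, (nat \<Rightarrow> 'p) \<Rightarrow> nat \<Rightarrow> 'p) arrow) ftr,
    nat \<Rightarrow> ((nat \<Rightarrow> 'p) set, (nat \<Rightarrow> 'p) \<Rightarrow> nat \<Rightarrow> 'p) arrow) arrow" where
  "nerve_map P f Q = Arrow (nerve P)
     (\<lambda>n. Arrow (nerve_simplices P n) (\<lambda>\<sigma>\<in>nerve_simplices P n. \<lambda>i\<in>{..n}. f (\<sigma> i))
        (nerve_simplices Q n))
     (nerve Q)"

definition nec_poset :: "necklace \<Rightarrow> nat set set" where
  "nec_poset = (\<lambda>(T, p). {V. T \<subseteq> V \<and> V \<subseteq> {..p}})"

type_synonym simplex = "nat \<Rightarrow> nat set"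
type_synonym set_map = "(simplex set, simplex \<Rightarrow> simplex) arrow"
type_synonym ('o, 'a) simp_obj = "(nat, mon_map, 'o, 'a) ftr"
type_synonym ('o, 'a) simp_map = "(('o, 'a) simp_obj, nat \<Rightarrow> 'a) arrow"

definition simplicial :: "('o, 'a, 'z) cat_scheme \<Rightarrow> (('o, 'a) simp_obj, ('o, 'a) simp_map) cat"
  where
  "simplicial C = functor_cat (op_cat delta) C"

text \<open>The functor \<open>T \<mapsto> N(P\<^sub>T)\<close> from necklaces to simplicial sets.\<close>

definition nec_nerve ::
  "(necklace, nec_map, (simplex set, set_map) simp_obj, (simplex set, set_map) simp_map) ftr"
  where
  "nec_nerve = mk_functor nec (\<lambda>T. nerve (nec_poset T))
     (\<lambda>\<phi>. nerve_map (nec_poset (src \<phi>)) (\<lambda>V. amap \<phi> ` V) (nec_poset (tgt \<phi>)))"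

text \<open>The levelwise application of \<open>F\<close> to simplicial objects.\<close>

definition levelwise ::
  "('o, 'a, 'p, 'b) ftr \<Rightarrow>
   (('o, 'a) simp_obj, ('o, 'a) simp_map, ('p, 'b) simp_obj, ('p, 'b) simp_map) ftr" where
  "levelwise F = \<lparr>FO = comp_functor (op_cat delta) F,
     FA = (\<lambda>\<alpha>. Arrow (comp_functor (op_cat delta) F (src \<alpha>)) (\<lambda>n. FA F (amap \<alpha> n))
                 (comp_functor (op_cat delta) F (tgt \<alpha>)))\<rparr>"

text \<open>The tensoring of simplicial objects in \<open>V\<close> over \<open>V\<close>.\<close>

definition simp_ten ::
  "('o, 'a, 'z) moncat_scheme \<Rightarrow> 'o \<Rightarrow> ('o, 'a) simp_obj \<Rightarrow> ('o, 'a) simp_obj" where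
  "simp_ten V A Y = mk_functor (op_cat delta) (\<lambda>n. A \<otimes>\<^bsub>V\<^esub> FO Y n) (\<lambda>\<theta>. Idn V A \<odot>\<^bsub>V\<^esub> FA Y \<theta>)"

definition simp_ten_arr ::
  "('o, 'a, 'z) moncat_scheme \<Rightarrow> 'a \<Rightarrow> ('o, 'a) simp_map \<Rightarrow> ('o, 'a) simp_map" where
  "simp_ten_arr V u \<alpha> = Arrow (simp_ten V (Dom V u) (src \<alpha>)) (\<lambda>n. u \<odot>\<^bsub>V\<^esub> amap \<alpha> n)
     (simp_ten V (Cod V u) (tgt \<alpha>))"

text \<open>The integrand \<open>(T, U) \<mapsto> X\<^sub>T(a, b) \<otimes> FN(P\<^sub>U)\<close> and its coend.\<close>

definition cat_integrand ::
  "('o, 'a, 'z) moncat_scheme \<Rightarrow> (simplex set, set_map, 'o, 'a) ftr \<Rightarrow> 's set \<Rightarrow>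
   ('s, 'o, 'a) templicial \<Rightarrow> 's \<Rightarrow> 's \<Rightarrow>
   (necklace \<times> necklace, nec_map \<times> nec_map, ('o, 'a) simp_obj, ('o, 'a) simp_map) ftr" where
  "cat_integrand V F S X a b = mk_functor (prod_cat (op_cat nec) nec)
     (\<lambda>(T, U). simp_ten V (FO (nec_functor_at V S X a b) T) (FO (levelwise F) (FO nec_nerve U)))
     (\<lambda>(f, g). simp_ten_arr V (FA (nec_functor_at V S X a b) f)
        (FA (levelwise F) (FA nec_nerve g)))"

definition categorification_coend ::
  "('o, 'a, 'z) moncat_scheme \<Rightarrow> (simplex set, set_map, 'o, 'a) ftr \<Rightarrow> 's set \<Rightarrow>
   ('s, 'o, 'a) templicial \<Rightarrow> 's \<Rightarrow> 's \<Rightarrow> ('o, 'a) simp_obj \<times> (necklace \<Rightarrow> ('o, 'a) simp_map)" where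
  "categorification_coend V F S X a b = coend (simplicial V) nec (cat_integrand V F S X a b)"

abbreviation categorification_hom ::
  "('o, 'a, 'z) moncat_scheme \<Rightarrow> (simplex set, set_map, 'o, 'a) ftr \<Rightarrow> 's set \<Rightarrow>
   ('s, 'o, 'a) templicial \<Rightarrow> 's \<Rightarrow> 's \<Rightarrow> ('o, 'a) simp_obj" where
  "categorification_hom V F S X a b \<equiv> fst (categorification_coend V F S X a b)"


section \<open>Flags\<close>

definition is_flag :: "nat \<Rightarrow> necklace \<Rightarrow> simplex \<Rightarrow> bool" where
  "is_flag n = (\<lambda>(T, p) \<tau>. \<tau> \<in> extensional {..n} \<and> T \<subseteq> \<tau> 0 \<and> (\<forall>i<n. \<tau> i \<subseteq> \<tau> (Suc i)) \<and>
     \<tau> n \<subseteq> {..p})"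

definition is_flanked :: "nat \<Rightarrow> necklace \<Rightarrow> simplex \<Rightarrow> bool" where
  "is_flanked n = (\<lambda>(T, p) \<tau>. T = \<tau> 0 \<and> \<tau> n = {..p})"

definition flanked_flags :: "nat \<Rightarrow> (necklace \<times> simplex) set" where
  "flanked_flags n = {(T, \<tau>). T \<in> necklaces \<and> is_flag n T \<tau> \<and> is_flanked n T \<tau>}"

definition nec_flanked ::
  "nat \<Rightarrow> (necklace \<times> simplex, (necklace \<times> simplex, nat \<Rightarrow> nat) arrow) cat" where
  "nec_flanked n = \<lparr>Ob = flanked_flags n,
     Arr = {Arrow (T, \<tau>) f (U, \<upsilon>) | T \<tau> f U \<upsilon>.
       (T, \<tau>) \<in> flanked_flags n \<and> (U, \<upsilon>) \<in> flanked_flags n \<and> Arrow T f U \<in> Arr nec \<and>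
       (\<forall>i\<le>n. f ` \<tau> i = \<upsilon> i)},
     Dom = src, Cod = tgt,
     Idn = (\<lambda>(T, \<tau>). Arrow (T, \<tau>) (amap (Idn nec T)) (T, \<tau>)),
     Comp = (\<lambda>g f. Arrow (src f)
       (compose {..snd (fst (src f))} (amap g) (amap f)) (tgt g))\<rparr>"

text \<open>The diagram \<open>(T, \<tau>) \<mapsto> X\<^sub>T(a, b)\<close> on \<open>op_cat (nec_flanked n)\<close>.\<close>

definition flanked_diagram ::
  "('o, 'a, 'z) moncat_scheme \<Rightarrow> 's set \<Rightarrow> ('s, 'o, 'a) templicial \<Rightarrow> 's \<Rightarrow> 's \<Rightarrow> nat \<Rightarrow>
   (necklace \<times> simplex, (necklace \<times> simplex, nat \<Rightarrow> nat) arrow, 'o, 'a) ftr" where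
  "flanked_diagram V S X a b n = mk_functor (op_cat (nec_flanked n))
     (\<lambda>(T, \<tau>). FO (nec_functor_at V S X a b) T)
     (\<lambda>\<phi>. FA (nec_functor_at V S X a b) (Arrow (fst (src \<phi>)) (amap \<phi>) (fst (tgt \<phi>))))"

definition flanked_colimit ::
  "('o, 'a, 'z) moncat_scheme \<Rightarrow> 's set \<Rightarrow> ('s, 'o, 'a) templicial \<Rightarrow> 's \<Rightarrow> 's \<Rightarrow> nat \<Rightarrow>
   'o \<times> (necklace \<times> simplex \<Rightarrow> 'a)" where
  "flanked_colimit V S X a b n =
     colimit V (op_cat (nec_flanked n)) (flanked_diagram V S X a b n)"

text \<open>
  The composite \<open>X\<^sub>T(a, b) \<cong> X\<^sub>T(a, b) \<otimes> I \<rightarrow> X\<^sub>T(a, b) \<otimes> FN(P\<^sub>T)\<^sub>n \<rightarrow> C[X]\<^sub>n(a, b)\<close>, where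
  \<open>I = F({*}) \<rightarrow> FN(P\<^sub>T)\<^sub>n\<close> picks out the \<open>n\<close>-simplex \<open>\<tau>\<close> of \<open>N(P\<^sub>T)\<close> and the last map is the
  structure map of the coend.
\<close>

definition flag_map ::
  "('o, 'a, 'z) moncat_scheme \<Rightarrow> (simplex set, set_map, 'o, 'a) ftr \<Rightarrow> simplex \<Rightarrow> 's set \<Rightarrow>
   ('s, 'o, 'a) templicial \<Rightarrow> 's \<Rightarrow> 's \<Rightarrow> nat \<Rightarrow> necklace \<Rightarrow> simplex \<Rightarrow> 'a" where
  "flag_map V F pt S X a b n T \<tau> =
    (let A = FO (nec_functor_at V S X a b) T in
     amap (snd (categorification_coend V F S X a b) T) n \<bullet>\<^bsub>V\<^esub>
     (Idn V A \<odot>\<^bsub>V\<^esub>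
        FA F (Arrow {pt} (\<lambda>x\<in>{pt}. \<tau>) (nerve_simplices (nec_poset T) n))) \<bullet>\<^bsub>V\<^esub>
     inv_arr V (RUn V A))"

end

theory Submission
  imports Defs
begin

text \<open>
  Fix \<open>n\<close> and write \<open>A\<^sub>T = X\<^sub>T(a, b)\<close>. As \<open>F\<close> preserves colimits, \<open>A\<^sub>T \<otimes> FN(P\<^sub>T)\<^sub>n\<close> is the copower of
  \<open>A\<^sub>T\<close> by the set of flags of length \<open>n\<close> on \<open>T\<close>, so a cowedge at level \<open>n\<close> is the same as a cocone
  over the opposite of the category of all pairs \<open>(T, \<tau>)\<close>. The flanked pairs form a coreflective
  subcategory: restrict a flag to its top and take its bottom as the set of joints. Hence they
  yield the same colimit. By uniqueness the colimits for varying \<open>n\<close> form a simplicial object,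
  which is then the coend.

  That \<open>T \<mapsto> X\<^sub>T\<close> is a functor is proved in a strict monoidal category whose objects are lists of
  objects and in which \<open>X\<close> is replaced by an isomorphic functor with \<open>X\<^sub>0 = I\<close> on the nose. There a
  necklace map acts by a product over consecutive joints, and functoriality amounts to the
  behaviour of lists of consecutive joints under refinement and monotone image.
\<close>

text \<open>The definitions work with choices: tensor products of quivers are
  \<open>THE\<close>-arrows out of chosen coproducts, products of beads are bracketed to the right,
  the coend and the colimit are \<open>SOME\<close>-choices. Hence quivers must first be shown to
  form a monoidal category (closedness makes tensoring preserve coproducts, so each coherence law
  can be tested on coprojections), and a coend must be exhibited before anything is known about the
  chosen one. The real obstacle is functoriality of X_T. A necklace map may collapse beads; the
  resulting gaps of length 0 are deleted from the list, and \<open>fill\<close> puts X_0 back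
  through the inverse counit. Brackets and units are therefore treated separately: lists make the
  brackets disappear, and once X_0 is the empty list, a gap of length 0 contributes nothing to a
  concatenation. What remains is to move an inert map past an active one, which is naturality of the
  iterated comultiplication. Infinity of the type 'u ensures that the countable category of flanked
  pairs counts as small.\<close>

context category
begin

section \<open>Calculus of composites and inverses in a category\<close>

lemma Arr_Comp [simp]:
  assumes "f \<in> Arr C" "g \<in> Arr C" "Dom C g = Cod C f"
  shows "g \<bullet> f \<in> Arr C" "Dom C (g \<bullet> f) = Dom C f" "Cod C (g \<bullet> f) = Cod C g"
  using Comp_hom[of f "Dom C f" "Cod C f" g "Cod C g"] assms by (auto simp: hom_def)

lemma Arr_Idn [simp]:
  assumes "x \<in> Ob C"
  shows "Idn C x \<in> Arr C" "Dom C (Idn C x) = x" "Cod C (Idn C x) = x"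
  using Idn_hom[OF assms] by (auto simp: hom_def)

lemma Comp_assoc' [simp]:
  assumes "f \<in> Arr C" "g \<in> Arr C" "h \<in> Arr C" "Dom C g = Cod C f" "Dom C h = Cod C g"
  shows "(h \<bullet> g) \<bullet> f = h \<bullet> (g \<bullet> f)"
  using Comp_assoc[of f "Dom C f" "Cod C f" g "Cod C g" h "Cod C h"] assms by (auto simp: hom_def)

lemma Idn_Comp [simp]:
  assumes "f \<in> Arr C" "Cod C f = y"
  shows "Idn C y \<bullet> f = f"
  using Comp_Idn_left[of f "Dom C f" y] assms by (auto simp: hom_def)

lemma Comp_Idn [simp]:
  assumes "f \<in> Arr C" "Dom C f = x"
  shows "f \<bullet> Idn C x = f"
  using Comp_Idn_right[of f x "Cod C f"] assms by (auto simp: hom_def)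

lemma Ob_Dom_Cod [simp]: "f \<in> Arr C \<Longrightarrow> Dom C f \<in> Ob C" "f \<in> Arr C \<Longrightarrow> Cod C f \<in> Ob C"
  by (auto intro: Dom_Ob Cod_Ob)

lemma hom_Ob: "f \<in> hom C x y \<Longrightarrow> x \<in> Ob C" "f \<in> hom C x y \<Longrightarrow> y \<in> Ob C"
  by (auto simp: hom_def)

lemma inverse_pair_unique:
  assumes "inverse_pair C f g" "inverse_pair C f g'"
  shows "g = g'"
proof -
  have h: "f \<in> Arr C" "g \<in> Arr C" "g' \<in> Arr C" "Dom C g = Cod C f" "Cod C g = Dom C f"
    "Dom C g' = Cod C f" "Cod C g' = Dom C f"
    "g' \<bullet> f = Idn C (Dom C f)" "f \<bullet> g = Idn C (Cod C f)"
    using assms by (auto simp: inverse_pair_def hom_def)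
  have "g = (g' \<bullet> f) \<bullet> g"
    unfolding h(8) using h(1-7) by simp
  also have "\<dots> = g' \<bullet> (f \<bullet> g)" using h(1-7) by simp
  also have "\<dots> = g'" unfolding h(9) using h(1-7) by simp
  finally show ?thesis .
qed

lemma inv_arr_eqI: "inverse_pair C f g \<Longrightarrow> inv_arr C f = g"
  unfolding inv_arr_def by (rule the_equality) (auto intro: inverse_pair_unique)

lemma inverse_pair_inv_arr: "is_iso C f \<Longrightarrow> inverse_pair C f (inv_arr C f)"
  using inv_arr_eqI by (auto simp: is_iso_def)

lemma inv_arr [simp]:
  assumes "is_iso C f"
  shows "inv_arr C f \<in> Arr C" "Dom C (inv_arr C f) = Cod C f" "Cod C (inv_arr C f) = Dom C f"
    "inv_arr C f \<bullet> f = Idn C (Dom C f)" "f \<bullet> inv_arr C f = Idn C (Cod C f)"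
  using inverse_pair_inv_arr[OF assms] by (auto simp: inverse_pair_def hom_def)

lemma iso_Arr: "is_iso C f \<Longrightarrow> f \<in> Arr C"
  by (auto simp: is_iso_def inverse_pair_def)

lemma inv_arr_Comp_cancel [simp]:
  assumes "is_iso C f" "g \<in> Arr C"
  shows "Cod C g = Dom C f \<Longrightarrow> inv_arr C f \<bullet> (f \<bullet> g) = g"
    "Cod C g = Cod C f \<Longrightarrow> f \<bullet> (inv_arr C f \<bullet> g) = g"
  using assms iso_Arr[OF assms(1)] by (simp_all flip: Comp_assoc')

lemma iso_cancel_right:
  assumes "is_iso C e" "f \<in> Arr C" "g \<in> Arr C" "Dom C f = Cod C e" "Dom C g = Cod C e"
    and "f \<bullet> e = g \<bullet> e"
  shows "f = g"
proof -
  have "h = (h \<bullet> e) \<bullet> inv_arr C e" if "h \<in> Arr C" "Dom C h = Cod C e" for h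
    using that assms(1) iso_Arr[OF assms(1)] by simp
  then show ?thesis using assms(2-6) by metis
qed

lemma iso_cancel_left:
  assumes "is_iso C e" "f \<in> Arr C" "g \<in> Arr C" "Cod C f = Dom C e" "Cod C g = Dom C e"
    and "e \<bullet> f = e \<bullet> g"
  shows "f = g"
  using inv_arr_Comp_cancel(1)[OF assms(1,2,4)] inv_arr_Comp_cancel(1)[OF assms(1,3,5)] assms(6)
  by metis

text \<open>Right-nested normal forms hide the middle pair b, c of a fourfold composite. This
  packages the reassociation around it; \<open>nec_Comp\<close> applies it to the square
  \<open>interchange\<close>.\<close>

lemma Comp_exchange:
  assumes "b \<bullet> c = d \<bullet> e"
    and "a \<in> Arr C" "b \<in> Arr C" "c \<in> Arr C" "d \<in> Arr C" "e \<in> Arr C" "f \<in> Arr C"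
    and "Dom C a = Cod C b" "Dom C b = Cod C c" "Dom C c = Cod C f"
    and "Dom C a = Cod C d" "Dom C d = Cod C e" "Dom C e = Cod C f"
  shows "(a \<bullet> b) \<bullet> (c \<bullet> f) = (a \<bullet> d) \<bullet> (e \<bullet> f)"
proof -
  have "(a \<bullet> b) \<bullet> (c \<bullet> f) = a \<bullet> (b \<bullet> c) \<bullet> f" using assms(2-10) by simp
  also have "\<dots> = (a \<bullet> d) \<bullet> (e \<bullet> f)" unfolding assms(1) using assms(2-) by simp
  finally show ?thesis .
qed

lemma inverse_pairI:
  assumes "f \<in> hom C x y" "g \<in> hom C y x" "g \<bullet> f = Idn C x" "f \<bullet> g = Idn C y"
  shows "inverse_pair C f g"
  using assms by (auto simp: inverse_pair_def hom_def)

lemma is_isoI: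
  assumes "f \<in> hom C x y" "g \<in> hom C y x" "g \<bullet> f = Idn C x" "f \<bullet> g = Idn C y"
  shows "is_iso C f"
  using inverse_pairI[OF assms] by (auto simp: is_iso_def)

lemma is_iso_Idn [simp]: "x \<in> Ob C \<Longrightarrow> is_iso C (Idn C x)"
  by (rule is_isoI[of _ x x "Idn C x"]) (auto simp: hom_def)

lemma inv_arr_Idn [simp]: "x \<in> Ob C \<Longrightarrow> inv_arr C (Idn C x) = Idn C x"
  by (rule inv_arr_eqI, rule inverse_pairI[of _ x x]) (auto simp: hom_def)

lemma is_iso_inv_arr [simp]: "is_iso C f \<Longrightarrow> is_iso C (inv_arr C f)"
  by (rule is_isoI[of _ "Cod C f" "Dom C f" f]) (auto simp: hom_def iso_Arr)

lemma inverse_pair_Comp: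
  assumes "is_iso C f" "is_iso C g" "Dom C g = Cod C f"
  shows "inverse_pair C (g \<bullet> f) (inv_arr C f \<bullet> inv_arr C g)"
  using assms iso_Arr[OF assms(1)] iso_Arr[OF assms(2)]
  by (intro inverse_pairI[of _ "Dom C f" "Cod C g"]) (auto simp: hom_def)

lemma is_iso_Comp [simp]: "is_iso C f \<Longrightarrow> is_iso C g \<Longrightarrow> Dom C g = Cod C f \<Longrightarrow> is_iso C (g \<bullet> f)"
  using inverse_pair_Comp unfolding is_iso_def by blast

end

section \<open>Coherence in monoidal categories\<close>

context monoidal_category
begin

lemma Arr_TenA [simp]:
  assumes "f \<in> Arr V" "g \<in> Arr V"
  shows "f \<odot> g \<in> Arr V" "Dom V (f \<odot> g) = Dom V f \<otimes> Dom V g" "Cod V (f \<odot> g) = Cod V f \<otimes> Cod V g"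
  using TenA_hom[of f "Dom V f" "Cod V f" g "Dom V g" "Cod V g"] assms by (auto simp: hom_def)

declare Unit_Ob [simp] TenO_Ob [simp] TenA_Idn [simp]
declare Assoc_iso [simp] LUn_iso [simp] RUn_iso [simp]

lemma Arr_Assoc [simp]:
  assumes "x \<in> Ob V" "y \<in> Ob V" "z \<in> Ob V"
  shows "Assoc V x y z \<in> Arr V" "Dom V (Assoc V x y z) = (x \<otimes> y) \<otimes> z"
    "Cod V (Assoc V x y z) = x \<otimes> (y \<otimes> z)"
  using Assoc_hom[OF assms] by (auto simp: hom_def)

lemma Arr_LUn [simp]:
  assumes "x \<in> Ob V"
  shows "LUn V x \<in> Arr V" "Dom V (LUn V x) = \<one> \<otimes> x" "Cod V (LUn V x) = x"
  using LUn_hom[OF assms] by (auto simp: hom_def)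

lemma Arr_RUn [simp]:
  assumes "x \<in> Ob V"
  shows "RUn V x \<in> Arr V" "Dom V (RUn V x) = x \<otimes> \<one>" "Cod V (RUn V x) = x"
  using RUn_hom[OF assms] by (auto simp: hom_def)

text \<open>As a simp rule, interchange fuses two tensor products into one. Calculations that must
  keep the factors apart, for instance to reach a naturality square of \<open>Assoc\<close>, delete
  it.\<close>

lemma TenA_Comp' [simp]:
  assumes "f \<in> Arr V" "f' \<in> Arr V" "g \<in> Arr V" "g' \<in> Arr V" "Dom V f' = Cod V f" "Dom V g' = Cod V g"
  shows "(f' \<odot> g') \<bullet> (f \<odot> g) = (f' \<bullet> f) \<odot> (g' \<bullet> g)"
  using TenA_Comp[of f "Dom V f" "Cod V f" f' "Cod V f'" g "Dom V g" "Cod V g" g' "Cod V g'"] assms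
  by (auto simp: hom_def)

lemma TenA_Comp_Comp [simp]:
  assumes "f \<in> Arr V" "f' \<in> Arr V" "g \<in> Arr V" "g' \<in> Arr V" "Dom V f' = Cod V f" "Dom V g' = Cod V g"
    and "h \<in> Arr V" "Cod V h = Dom V f \<otimes> Dom V g"
  shows "(f' \<odot> g') \<bullet> ((f \<odot> g) \<bullet> h) = ((f' \<bullet> f) \<odot> (g' \<bullet> g)) \<bullet> h"
  using assms by (simp flip: Comp_assoc')

lemma Assoc_natural':
  assumes "f \<in> Arr V" "g \<in> Arr V" "h \<in> Arr V"
  shows "Assoc V (Cod V f) (Cod V g) (Cod V h) \<bullet> ((f \<odot> g) \<odot> h) =
    (f \<odot> (g \<odot> h)) \<bullet> Assoc V (Dom V f) (Dom V g) (Dom V h)"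
  using Assoc_natural[of f "Dom V f" "Cod V f" g "Dom V g" "Cod V g" h "Dom V h" "Cod V h"] assms
  by (auto simp: hom_def)

lemma Assoc_natural_Comp:
  assumes "f \<in> Arr V" "g \<in> Arr V" "h \<in> Arr V"
    and "k \<in> Arr V" "Cod V k = (Dom V f \<otimes> Dom V g) \<otimes> Dom V h"
  shows "Assoc V (Cod V f) (Cod V g) (Cod V h) \<bullet> (((f \<odot> g) \<odot> h) \<bullet> k) =
    (f \<odot> (g \<odot> h)) \<bullet> (Assoc V (Dom V f) (Dom V g) (Dom V h) \<bullet> k)"
  using assms Assoc_natural'[OF assms(1-3)] by (simp flip: Comp_assoc')

lemma inverse_pair_TenA:
  assumes "is_iso V f" "is_iso V g"
  shows "inverse_pair V (f \<odot> g) (inv_arr V f \<odot> inv_arr V g)"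
  using assms iso_Arr[OF assms(1)] iso_Arr[OF assms(2)]
  by (intro inverse_pairI[of _ "Dom V f \<otimes> Dom V g" "Cod V f \<otimes> Cod V g"]) (auto simp: hom_def)

lemma is_iso_TenA [simp]: "is_iso V f \<Longrightarrow> is_iso V g \<Longrightarrow> is_iso V (f \<odot> g)"
  using inverse_pair_TenA unfolding is_iso_def by blast

text \<open>Tensoring with the unit is faithful, because naturality of \<open>LUn\<close> recovers f
  from \<open>Idn V \<one> \<odot> f\<close> up to invertible arrows. The unit identities below are
  proved after tensoring with \<open>\<one>\<close>, where the pentagon becomes available.\<close>

lemma Unit_TenA_cancel:
  assumes "f \<in> Arr V" "g \<in> Arr V" "Dom V f = Dom V g" "Cod V f = Cod V g"
    and "Idn V \<one> \<odot> f = Idn V \<one> \<odot> g"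
  shows "f = g"
proof (rule iso_cancel_right[of "LUn V (Dom V f)"])
  show "f \<bullet> LUn V (Dom V f) = g \<bullet> LUn V (Dom V f)"
    using LUn_natural[of f "Dom V f" "Cod V f"] LUn_natural[of g "Dom V g" "Cod V g"] assms
    by (auto simp: hom_def)
qed (use assms in simp_all)

lemma TenA_Unit_cancel:
  assumes "f \<in> Arr V" "g \<in> Arr V" "Dom V f = Dom V g" "Cod V f = Cod V g"
    and "f \<odot> Idn V \<one> = g \<odot> Idn V \<one>"
  shows "f = g"
proof (rule iso_cancel_right[of "RUn V (Dom V f)"])
  show "f \<bullet> RUn V (Dom V f) = g \<bullet> RUn V (Dom V f)"
    using RUn_natural[of f "Dom V f" "Cod V f"] RUn_natural[of g "Dom V g" "Cod V g"] assms
    by (auto simp: hom_def)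
qed (use assms in simp_all)

text \<open>
  Kelly's observation that these unit identities follow from the pentagon and the triangle.
\<close>

lemma LUn_TenO:
  assumes "x \<in> Ob V" "y \<in> Ob V"
  shows "LUn V (x \<otimes> y) \<bullet> Assoc V \<one> x y = LUn V x \<odot> Idn V y"
proof (rule Unit_TenA_cancel)
  \<comment> \<open>This invertible arrow completes the left-hand side to the long side of the
    pentagon at \<open>\<one>\<close>, \<open>\<one>\<close>, x, y; it is cancelled at the
    end.\<close>
  let ?e = "Assoc V \<one> (\<one> \<otimes> x) y \<bullet> (Assoc V \<one> \<one> x \<odot> Idn V y)"
  have "(Idn V \<one> \<odot> (LUn V (x \<otimes> y) \<bullet> Assoc V \<one> x y)) \<bullet> ?e =
      (Idn V \<one> \<odot> LUn V (x \<otimes> y)) \<bullet> ((Idn V \<one> \<odot> Assoc V \<one> x y) \<bullet> ?e)"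
    using assms by simp
  also have "\<dots> = (Idn V \<one> \<odot> LUn V (x \<otimes> y)) \<bullet> (Assoc V \<one> \<one> (x \<otimes> y) \<bullet> Assoc V (\<one> \<otimes> \<one>) x y)"
    using pentagon[of \<one> \<one> x y] assms by simp
  also have "\<dots> = (RUn V \<one> \<odot> Idn V (x \<otimes> y)) \<bullet> Assoc V (\<one> \<otimes> \<one>) x y"
    using triangle[of \<one> "x \<otimes> y"] assms by (simp flip: Comp_assoc')
  also have "\<dots> = Assoc V \<one> x y \<bullet> ((RUn V \<one> \<odot> Idn V x) \<odot> Idn V y)"
    using Assoc_natural'[of "RUn V \<one>" "Idn V x" "Idn V y"] assms by simp
  also have "\<dots> = Assoc V \<one> x y \<bullet> (((Idn V \<one> \<odot> LUn V x) \<odot> Idn V y) \<bullet> (Assoc V \<one> \<one> x \<odot> Idn V y))"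
    using triangle[of \<one> x] assms by simp
  also have "\<dots> = (Idn V \<one> \<odot> (LUn V x \<odot> Idn V y)) \<bullet> ?e"
    using Assoc_natural'[of "Idn V \<one>" "LUn V x" "Idn V y"] assms
    by (simp del: TenA_Comp' flip: Comp_assoc')
  finally show "Idn V \<one> \<odot> (LUn V (x \<otimes> y) \<bullet> Assoc V \<one> x y) = Idn V \<one> \<odot> (LUn V x \<odot> Idn V y)"
    by (rule iso_cancel_right[rotated -1]) (use assms in simp_all)
qed (use assms in simp_all)

lemma RUn_TenO:
  assumes "x \<in> Ob V" "y \<in> Ob V"
  shows "(Idn V x \<odot> RUn V y) \<bullet> Assoc V x y \<one> = RUn V (x \<otimes> y)"
proof (rule TenA_Unit_cancel)
  \<comment> \<open>Here the auxiliary isomorphism is composed on the left, and the pentagon enters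
    at x, y, \<open>\<one>\<close>, \<open>\<one>\<close>.\<close>
  have "Assoc V x y \<one> \<bullet> (((Idn V x \<odot> RUn V y) \<bullet> Assoc V x y \<one>) \<odot> Idn V \<one>) =
     (Assoc V x y \<one> \<bullet> ((Idn V x \<odot> RUn V y) \<odot> Idn V \<one>)) \<bullet> (Assoc V x y \<one> \<odot> Idn V \<one>)"
    using assms by simp
  also have "\<dots> = (Idn V x \<odot> (RUn V y \<odot> Idn V \<one>)) \<bullet>
      (Assoc V x (y \<otimes> \<one>) \<one> \<bullet> (Assoc V x y \<one> \<odot> Idn V \<one>))"
    using Assoc_natural'[of "Idn V x" "RUn V y" "Idn V \<one>"] assms
    by simp
  also have "\<dots> = (Idn V x \<odot> (Idn V y \<odot> LUn V \<one>)) \<bullet> ((Idn V x \<odot> Assoc V y \<one> \<one>) \<bullet>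
      (Assoc V x (y \<otimes> \<one>) \<one> \<bullet> (Assoc V x y \<one> \<odot> Idn V \<one>)))"
    using triangle[of y \<one>] assms by simp
  also have "\<dots> = (Idn V x \<odot> (Idn V y \<odot> LUn V \<one>)) \<bullet> (Assoc V x y (\<one> \<otimes> \<one>) \<bullet> Assoc V (x \<otimes> y) \<one> \<one>)"
    using pentagon[of x y \<one> \<one>] assms by simp
  also have "\<dots> = Assoc V x y \<one> \<bullet> ((Idn V (x \<otimes> y) \<odot> LUn V \<one>) \<bullet> Assoc V (x \<otimes> y) \<one> \<one>)"
    using Assoc_natural'[of "Idn V x" "Idn V y" "LUn V \<one>"] assms
    by (simp flip: Comp_assoc')
  also have "\<dots> = Assoc V x y \<one> \<bullet> (RUn V (x \<otimes> y) \<odot> Idn V \<one>)"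
    using triangle[of "x \<otimes> y" \<one>] assms by simp
  finally show "((Idn V x \<odot> RUn V y) \<bullet> Assoc V x y \<one>) \<odot> Idn V \<one> = RUn V (x \<otimes> y) \<odot> Idn V \<one>"
    by (rule iso_cancel_left[rotated -1]) (use assms in simp_all)
qed (use assms in simp_all)

lemma LUn_Unit: "LUn V \<one> = RUn V \<one>"
proof (rule TenA_Unit_cancel)
  \<comment> \<open>Naturality of \<open>LUn\<close> at the arrow \<open>LUn V \<one>\<close>
    itself; cancelling the outer \<open>LUn V \<one>\<close> compares the two arrows that the
    triangle and \<open>LUn_TenO\<close> speak of.\<close>
  have "LUn V \<one> \<bullet> (Idn V \<one> \<odot> LUn V \<one>) = LUn V \<one> \<bullet> LUn V (\<one> \<otimes> \<one>)"
    by (rule LUn_natural) (simp add: hom_def)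
  then have "Idn V \<one> \<odot> LUn V \<one> = LUn V (\<one> \<otimes> \<one>)"
    by (rule iso_cancel_left[rotated -1]) simp_all
  then show "LUn V \<one> \<odot> Idn V \<one> = RUn V \<one> \<odot> Idn V \<one>"
    using triangle[of \<one> \<one>] LUn_TenO[of \<one> \<one>] by simp
qed simp_all

lemma tens_list_Ob [simp]: "set xs \<subseteq> Ob V \<Longrightarrow> tens_list V xs \<in> Ob V"
  by (induction xs rule: induct_list012) auto

lemma cons_iso_Arr [simp]:
  assumes "x \<in> Ob V" "set xs \<subseteq> Ob V"
  shows "cons_iso V x xs \<in> Arr V" "Dom V (cons_iso V x xs) = x \<otimes> tens_list V xs"
    "Cod V (cons_iso V x xs) = tens_list V (x # xs)" "is_iso V (cons_iso V x xs)"
  using assms by (cases xs; simp add: cons_iso_def)+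

lemma append_iso_Arr [simp]:
  assumes "set xs \<subseteq> Ob V" "set ys \<subseteq> Ob V"
  shows "append_iso V xs ys \<in> Arr V"
    "Dom V (append_iso V xs ys) = tens_list V xs \<otimes> tens_list V ys"
    "Cod V (append_iso V xs ys) = tens_list V (xs @ ys)" "is_iso V (append_iso V xs ys)"
  using assms by (induction xs) simp_all

text \<open>The defining recursion with its inverse arrow cleared. Inductions use this form, and the
  original equation leaves the simp set so that no inverse is reintroduced.\<close>

lemma append_iso_Cons:
  assumes "x \<in> Ob V" "set xs \<subseteq> Ob V" "set ys \<subseteq> Ob V"
  shows "append_iso V (x # xs) ys \<bullet> (cons_iso V x xs \<odot> Idn V (tens_list V ys)) =
    cons_iso V x (xs @ ys) \<bullet> (Idn V x \<odot> append_iso V xs ys) \<bullet> Assoc V x (tens_list V xs) (tens_list V ys)"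
  using assms by simp

declare append_iso.simps(2) [simp del]

text \<open>This coherence is what makes \<open>list_ten\<close> strictly associative. In the Cons
  case both sides are precomposed with the isomorphism coming from \<open>cons_iso\<close>, so that
  \<open>append_iso_Cons\<close> applies everywhere; after two naturality squares of
  \<open>Assoc\<close> the remaining discrepancy is the pentagon. The Nil case is naturality of
  \<open>LUn\<close> together with \<open>LUn_TenO\<close>.\<close>

lemma append_iso_assoc:
  assumes "set xs \<subseteq> Ob V" "set ys \<subseteq> Ob V" "set zs \<subseteq> Ob V"
  shows "append_iso V (xs @ ys) zs \<bullet> (append_iso V xs ys \<odot> Idn V (tens_list V zs)) =
    append_iso V xs (ys @ zs) \<bullet> (Idn V (tens_list V xs) \<odot> append_iso V ys zs) \<bullet>
    Assoc V (tens_list V xs) (tens_list V ys) (tens_list V zs)"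
  using assms(1)
proof (induction xs)
  case Nil
  have "LUn V (tens_list V (ys @ zs)) \<bullet> (Idn V \<one> \<odot> append_iso V ys zs) =
      append_iso V ys zs \<bullet> LUn V (tens_list V ys \<otimes> tens_list V zs)"
    by (rule LUn_natural) (use assms in \<open>simp add: hom_def\<close>)
  then show ?case
    using assms by (simp flip: Comp_assoc' LUn_TenO)
next
  case (Cons x xs)
  let ?X = "tens_list V xs" and ?Y = "tens_list V ys" and ?Z = "tens_list V zs"
  have [simp]: "x \<in> Ob V" "set xs \<subseteq> Ob V" "set ys \<subseteq> Ob V" "set zs \<subseteq> Ob V"
    using Cons.prems assms by auto
  note IH = Cons.IH[OF \<open>set xs \<subseteq> Ob V\<close>]
  have "(append_iso V ((x # xs) @ ys) zs \<bullet> (append_iso V (x # xs) ys \<odot> Idn V ?Z)) \<bullet>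
      ((cons_iso V x xs \<odot> Idn V ?Y) \<odot> Idn V ?Z) =
      append_iso V (x # xs @ ys) zs \<bullet> ((append_iso V (x # xs) ys \<bullet> (cons_iso V x xs \<odot> Idn V ?Y)) \<odot> Idn V ?Z)"
    by simp
  also have "\<dots> = append_iso V (x # xs @ ys) zs \<bullet> (cons_iso V x (xs @ ys) \<odot> Idn V ?Z) \<bullet>
      ((Idn V x \<odot> append_iso V xs ys) \<odot> Idn V ?Z) \<bullet> (Assoc V x ?X ?Y \<odot> Idn V ?Z)"
    by (simp add: append_iso_Cons)
  also have "\<dots> = (append_iso V (x # xs @ ys) zs \<bullet> (cons_iso V x (xs @ ys) \<odot> Idn V ?Z)) \<bullet>
      ((Idn V x \<odot> append_iso V xs ys) \<odot> Idn V ?Z) \<bullet> (Assoc V x ?X ?Y \<odot> Idn V ?Z)"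
    by (simp del: TenA_Comp' TenA_Comp_Comp)
  also have "\<dots> = cons_iso V x (xs @ ys @ zs) \<bullet> (Idn V x \<odot> append_iso V (xs @ ys) zs) \<bullet>
      (Assoc V x (tens_list V (xs @ ys)) ?Z \<bullet>
      ((Idn V x \<odot> append_iso V xs ys) \<odot> Idn V ?Z)) \<bullet> (Assoc V x ?X ?Y \<odot> Idn V ?Z)"
    by (subst append_iso_Cons) (simp_all del: TenA_Comp' TenA_Comp_Comp)
  also have "\<dots> = cons_iso V x (xs @ ys @ zs) \<bullet> (Idn V x \<odot> append_iso V (xs @ ys) zs) \<bullet>
      ((Idn V x \<odot> (append_iso V xs ys \<odot> Idn V ?Z)) \<bullet> Assoc V x (?X \<otimes> ?Y) ?Z) \<bullet>
      (Assoc V x ?X ?Y \<odot> Idn V ?Z)"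
    using Assoc_natural'[of "Idn V x" "append_iso V xs ys" "Idn V ?Z"]
    by (simp del: TenA_Comp' TenA_Comp_Comp)
  also have "\<dots> = cons_iso V x (xs @ ys @ zs) \<bullet>
      (Idn V x \<odot> (append_iso V (xs @ ys) zs \<bullet> (append_iso V xs ys \<odot> Idn V ?Z))) \<bullet>
      Assoc V x (?X \<otimes> ?Y) ?Z \<bullet> (Assoc V x ?X ?Y \<odot> Idn V ?Z)"
    by simp
  also have "\<dots> = cons_iso V x (xs @ ys @ zs) \<bullet> (Idn V x \<odot> append_iso V xs (ys @ zs)) \<bullet>
      (Idn V x \<odot> (Idn V ?X \<odot> append_iso V ys zs)) \<bullet>
      ((Idn V x \<odot> Assoc V ?X ?Y ?Z) \<bullet> Assoc V x (?X \<otimes> ?Y) ?Z \<bullet> (Assoc V x ?X ?Y \<odot> Idn V ?Z))"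
    unfolding IH by simp
  also have "\<dots> = cons_iso V x (xs @ ys @ zs) \<bullet> (Idn V x \<odot> append_iso V xs (ys @ zs)) \<bullet>
      ((Idn V x \<odot> (Idn V ?X \<odot> append_iso V ys zs)) \<bullet>
      Assoc V x ?X (?Y \<otimes> ?Z)) \<bullet> Assoc V (x \<otimes> ?X) ?Y ?Z"
    by (subst pentagon) (simp_all del: TenA_Comp' TenA_Comp_Comp)
  also have "\<dots> = (cons_iso V x (xs @ ys @ zs) \<bullet> (Idn V x \<odot> append_iso V xs (ys @ zs)) \<bullet>
      Assoc V x ?X (tens_list V (ys @ zs))) \<bullet>
      (Idn V (x \<otimes> ?X) \<odot> append_iso V ys zs) \<bullet> Assoc V (x \<otimes> ?X) ?Y ?Z"
    using Assoc_natural_Comp[of "Idn V x" "Idn V ?X" "append_iso V ys zs" "Assoc V (x \<otimes> ?X) ?Y ?Z"]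
    by (simp del: TenA_Comp' TenA_Comp_Comp)
  also have "\<dots> = append_iso V (x # xs) (ys @ zs) \<bullet>
      ((cons_iso V x xs \<odot> Idn V (tens_list V (ys @ zs))) \<bullet>
      (Idn V (x \<otimes> ?X) \<odot> append_iso V ys zs)) \<bullet> Assoc V (x \<otimes> ?X) ?Y ?Z"
    by (subst append_iso_Cons[symmetric]) (simp_all del: TenA_Comp' TenA_Comp_Comp)
  also have "\<dots> = append_iso V (x # xs) (ys @ zs) \<bullet> (Idn V (tens_list V (x # xs)) \<odot> append_iso V ys zs) \<bullet>
      ((cons_iso V x xs \<odot> Idn V (?Y \<otimes> ?Z)) \<bullet> Assoc V (x \<otimes> ?X) ?Y ?Z)"
    by simp
  also have "\<dots> = (append_iso V (x # xs) (ys @ zs) \<bullet> (Idn V (tens_list V (x # xs)) \<odot> append_iso V ys zs) \<bullet>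
      Assoc V (tens_list V (x # xs)) ?Y ?Z) \<bullet> ((cons_iso V x xs \<odot> Idn V ?Y) \<odot> Idn V ?Z)"
    using Assoc_natural'[of "cons_iso V x xs" "Idn V ?Y" "Idn V ?Z"]
    by (simp del: TenA_Comp' TenA_Comp_Comp)
  finally show ?case
    by (rule iso_cancel_right[rotated -1]) simp_all
qed

text \<open>\<open>append_iso\<close> treats its arguments asymmetrically, so the right unit needs
  an induction: \<open>LUn_Unit\<close> at the empty list and \<open>RUn_TenO\<close> in the
  step.\<close>

lemma append_iso_Nil_right: "set xs \<subseteq> Ob V \<Longrightarrow> append_iso V xs [] = RUn V (tens_list V xs)"
proof (induction xs)
  case (Cons x xs)
  then have [simp]: "x \<in> Ob V" "set xs \<subseteq> Ob V" by auto
  have "append_iso V (x # xs) [] \<bullet> (cons_iso V x xs \<odot> Idn V \<one>) =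
      RUn V (tens_list V (x # xs)) \<bullet> (cons_iso V x xs \<odot> Idn V \<one>)"
    using append_iso_Cons[of x xs "[]"] RUn_natural[of "cons_iso V x xs"] Cons.IH
    by (simp add: RUn_TenO hom_def)
  then show ?case
    by (rule iso_cancel_right[rotated -1]) simp_all
qed (simp add: LUn_Unit)

text \<open>An instance of the triangle. It identifies the isomorphisms \<open>cons_iso\<close>,
  from which \<open>comult\<close>, \<open>comults\<close> and \<open>fill\<close> are built, with
  those inside \<open>list_ten\<close>.\<close>

lemma append_iso_singleton:
  assumes "x \<in> Ob V" "set xs \<subseteq> Ob V"
  shows "append_iso V [x] xs = cons_iso V x xs"
proof -
  have "append_iso V [x] xs \<bullet> (cons_iso V x [] \<odot> Idn V (tens_list V xs)) =
      cons_iso V x xs \<bullet> (cons_iso V x [] \<odot> Idn V (tens_list V xs))"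
    using assms by (subst append_iso_Cons) (simp_all add: triangle cons_iso_def)
  then show ?thesis
    by (rule iso_cancel_right[rotated -1]) (use assms in simp_all)
qed

end

section \<open>Strict monoidal categories of lists\<close>

text \<open>With lists as objects and concatenation as their tensor product, associativity and unit
  laws on objects are list equations that the simplifier knows; only the laws for arrows have to be
  postulated.\<close>

locale strict_monoidal = category C
  for C :: "('x list, 'b, 'z) cat_scheme" (structure) +
  fixes ten :: "'b \<Rightarrow> 'b \<Rightarrow> 'b"  (infixr "\<star>" 70)
  assumes Nil_Ob [simp]: "[] \<in> Ob C"
    and append_Ob [simp]: "xs \<in> Ob C \<Longrightarrow> ys \<in> Ob C \<Longrightarrow> xs @ ys \<in> Ob C"
    and Arr_ten [simp]: "f \<in> Arr C \<Longrightarrow> g \<in> Arr C \<Longrightarrow> f \<star> g \<in> Arr C"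
    and Dom_ten [simp]: "f \<in> Arr C \<Longrightarrow> g \<in> Arr C \<Longrightarrow> Dom C (f \<star> g) = Dom C f @ Dom C g"
    and Cod_ten [simp]: "f \<in> Arr C \<Longrightarrow> g \<in> Arr C \<Longrightarrow> Cod C (f \<star> g) = Cod C f @ Cod C g"
    and ten_Idn [simp]: "xs \<in> Ob C \<Longrightarrow> ys \<in> Ob C \<Longrightarrow> Idn C xs \<star> Idn C ys = Idn C (xs @ ys)"
    and ten_Comp: "f \<in> Arr C \<Longrightarrow> f' \<in> Arr C \<Longrightarrow> g \<in> Arr C \<Longrightarrow> g' \<in> Arr C \<Longrightarrow>
      Dom C f' = Cod C f \<Longrightarrow> Dom C g' = Cod C g \<Longrightarrow>
      (f' \<bullet> f) \<star> (g' \<bullet> g) = (f' \<star> g') \<bullet> (f \<star> g)"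
    and ten_assoc: "f \<in> Arr C \<Longrightarrow> g \<in> Arr C \<Longrightarrow> h \<in> Arr C \<Longrightarrow> (f \<star> g) \<star> h = f \<star> (g \<star> h)"
    and Nil_ten [simp]: "f \<in> Arr C \<Longrightarrow> Idn C [] \<star> f = f"
    and ten_Nil [simp]: "f \<in> Arr C \<Longrightarrow> f \<star> Idn C [] = f"

text \<open>
  An arrow between lists is an arrow between their tensor products; the coherence isomorphisms
  \<^const>\<open>append_iso\<close> make concatenation a strict tensor product.
\<close>

definition list_cat :: "('o, 'a, 'z) moncat_scheme \<Rightarrow> ('o list, ('o list, 'a) arrow) cat" where
  "list_cat D = \<lparr>Ob = {xs. set xs \<subseteq> Ob D},
     Arr = {Arrow xs f ys | xs f ys. set xs \<subseteq> Ob D \<and> set ys \<subseteq> Ob D \<and>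
       f \<in> hom D (tens_list D xs) (tens_list D ys)},
     Dom = src, Cod = tgt, Idn = (\<lambda>xs. Arrow xs (Idn D (tens_list D xs)) xs),
     Comp = (\<lambda>g f. Arrow (src f) (amap g \<bullet>\<^bsub>D\<^esub> amap f) (tgt g))\<rparr>"

definition list_ten ::
  "('o, 'a, 'z) moncat_scheme \<Rightarrow> ('o list, 'a) arrow \<Rightarrow> ('o list, 'a) arrow \<Rightarrow> ('o list, 'a) arrow"
  where
  "list_ten D f g = Arrow (src f @ src g)
     (append_iso D (tgt f) (tgt g) \<bullet>\<^bsub>D\<^esub> (amap f \<odot>\<^bsub>D\<^esub> amap g) \<bullet>\<^bsub>D\<^esub>
      inv_arr D (append_iso D (src f) (src g)))
     (tgt f @ tgt g)"

lemma list_cat_simps [simp]: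
  "Ob (list_cat D) = {xs. set xs \<subseteq> Ob D}"
  "Arrow xs f ys \<in> Arr (list_cat D) \<longleftrightarrow> set xs \<subseteq> Ob D \<and> set ys \<subseteq> Ob D \<and>
     f \<in> Arr D \<and> Dom D f = tens_list D xs \<and> Cod D f = tens_list D ys"
  "Dom (list_cat D) f' = src f'" "Cod (list_cat D) f' = tgt f'"
  "Idn (list_cat D) xs = Arrow xs (Idn D (tens_list D xs)) xs"
  "g' \<bullet>\<^bsub>list_cat D\<^esub> f' = Arrow (src f') (amap g' \<bullet>\<^bsub>D\<^esub> amap f') (tgt g')"
  by (auto simp: list_cat_def hom_def)

lemma list_catE:
  assumes "f \<in> Arr (list_cat D)"
  obtains xs f' ys where "f = Arrow xs f' ys" "set xs \<subseteq> Ob D" "set ys \<subseteq> Ob D"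
    "f' \<in> Arr D" "Dom D f' = tens_list D xs" "Cod D f' = tens_list D ys"
  using assms by (auto simp: list_cat_def hom_def)

context monoidal_category
begin

lemma category_list_cat: "category (list_cat V)"
  by unfold_locales (auto simp: hom_def elim!: list_catE)

text \<open>Precomposing with \<open>?e\<close>, which assembles the product over xs @ ys @ zs from
  its three parts, removes all inverses. Then \<open>append_iso_assoc\<close> is used at the targets
  and at the sources, with one naturality square of \<open>Assoc\<close> in between.\<close>

lemma list_ten_assoc:
  assumes "f \<in> Arr (list_cat V)" "g \<in> Arr (list_cat V)" "h \<in> Arr (list_cat V)"
  shows "list_ten V (list_ten V f g) h = list_ten V f (list_ten V g h)"
proof -
  obtain xs f' xs' where f [simp]: "f = Arrow xs f' xs'" "set xs \<subseteq> Ob V" "set xs' \<subseteq> Ob V"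
    "f' \<in> Arr V" "Dom V f' = tens_list V xs" "Cod V f' = tens_list V xs'"
    using assms(1) by (elim list_catE)
  obtain ys g' ys' where g [simp]: "g = Arrow ys g' ys'" "set ys \<subseteq> Ob V" "set ys' \<subseteq> Ob V"
    "g' \<in> Arr V" "Dom V g' = tens_list V ys" "Cod V g' = tens_list V ys'"
    using assms(2) by (elim list_catE)
  obtain zs h' zs' where h [simp]: "h = Arrow zs h' zs'" "set zs \<subseteq> Ob V" "set zs' \<subseteq> Ob V"
    "h' \<in> Arr V" "Dom V h' = tens_list V zs" "Cod V h' = tens_list V zs'"
    using assms(3) by (elim list_catE)
  let ?X = "tens_list V xs" and ?Y = "tens_list V ys" and ?Z = "tens_list V zs"
  let ?X' = "tens_list V xs'" and ?Y' = "tens_list V ys'" and ?Z' = "tens_list V zs'"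
  let ?e = "append_iso V (xs @ ys) zs \<bullet> (append_iso V xs ys \<odot> Idn V ?Z)"
  let ?l = "append_iso V (xs' @ ys') zs' \<bullet> ((append_iso V xs' ys' \<bullet> (f' \<odot> g') \<bullet>
    inv_arr V (append_iso V xs ys)) \<odot> h') \<bullet> inv_arr V (append_iso V (xs @ ys) zs)"
  let ?r = "append_iso V xs' (ys' @ zs') \<bullet> (f' \<odot> (append_iso V ys' zs' \<bullet> (g' \<odot> h') \<bullet>
    inv_arr V (append_iso V ys zs))) \<bullet> inv_arr V (append_iso V xs (ys @ zs))"
  have "?l \<bullet> ?e = append_iso V (xs' @ ys') zs' \<bullet> ((append_iso V xs' ys' \<bullet> (f' \<odot> g')) \<odot> h')"
    by simp
  also have "\<dots> = (append_iso V (xs' @ ys') zs' \<bullet> (append_iso V xs' ys' \<odot> Idn V ?Z')) \<bullet> ((f' \<odot> g') \<odot> h')"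
    by simp
  also have "\<dots> = append_iso V xs' (ys' @ zs') \<bullet> (Idn V ?X' \<odot> append_iso V ys' zs') \<bullet>
      (Assoc V ?X' ?Y' ?Z' \<bullet> ((f' \<odot> g') \<odot> h'))"
    by (subst append_iso_assoc) (simp_all del: TenA_Comp' TenA_Comp_Comp)
  also have "\<dots> = append_iso V xs' (ys' @ zs') \<bullet> (Idn V ?X' \<odot> append_iso V ys' zs') \<bullet>
      (f' \<odot> (g' \<odot> h')) \<bullet> Assoc V ?X ?Y ?Z"
    using Assoc_natural'[of f' g' h'] by simp
  also have "\<dots> = ?r \<bullet> (append_iso V xs (ys @ zs) \<bullet> (Idn V ?X \<odot> append_iso V ys zs) \<bullet> Assoc V ?X ?Y ?Z)"
    by simp
  also have "\<dots> = ?r \<bullet> ?e"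
    by (subst append_iso_assoc) simp_all
  finally have "?l = ?r"
    by (rule iso_cancel_right[rotated -1]) simp_all
  then show ?thesis
    by (simp add: list_ten_def)
qed

lemma strict_monoidal_list_cat: "strict_monoidal (list_cat V) (list_ten V)"
proof -
  interpret L: category "list_cat V" by (rule category_list_cat)
  show ?thesis
  proof
    fix f g h assume "f \<in> Arr (list_cat V)" "g \<in> Arr (list_cat V)" "h \<in> Arr (list_cat V)"
    then show "list_ten V (list_ten V f g) h = list_ten V f (list_ten V g h)"
      by (rule list_ten_assoc)
  next
    fix f assume "f \<in> Arr (list_cat V)"
    then show "list_ten V (Idn (list_cat V) []) f = f"
    proof (elim list_catE)
      fix xs f' ys assume f: "f = Arrow xs f' ys" "set xs \<subseteq> Ob V" "set ys \<subseteq> Ob V"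
        "f' \<in> Arr V" "Dom V f' = tens_list V xs" "Cod V f' = tens_list V ys"
      then have "LUn V (tens_list V ys) \<bullet> (Idn V \<one> \<odot> f') = f' \<bullet> LUn V (tens_list V xs)"
        by (intro LUn_natural) (simp add: hom_def)
      then have "LUn V (tens_list V ys) \<bullet> (Idn V \<one> \<odot> f') \<bullet> inv_arr V (LUn V (tens_list V xs)) = f'"
        using f(2-) by (simp flip: Comp_assoc')(simp)
      with f show ?thesis by (simp add: list_ten_def)
    qed
  next
    fix f assume "f \<in> Arr (list_cat V)"
    then show "list_ten V f (Idn (list_cat V) []) = f"
    proof (elim list_catE)
      fix xs f' ys assume f: "f = Arrow xs f' ys" "set xs \<subseteq> Ob V" "set ys \<subseteq> Ob V"
        "f' \<in> Arr V" "Dom V f' = tens_list V xs" "Cod V f' = tens_list V ys"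
      then have "RUn V (tens_list V ys) \<bullet> (f' \<odot> Idn V \<one>) = f' \<bullet> RUn V (tens_list V xs)"
        by (intro RUn_natural) (simp add: hom_def)
      then have "RUn V (tens_list V ys) \<bullet> (f' \<odot> Idn V \<one>) \<bullet> inv_arr V (RUn V (tens_list V xs)) = f'"
        using f(2-) by (simp flip: Comp_assoc')(simp)
      with f show ?thesis by (simp add: list_ten_def append_iso_Nil_right)
    qed
  qed (auto simp: list_ten_def elim!: list_catE)
qed

end

context strict_monoidal
begin

definition tens :: "'b list \<Rightarrow> 'b" where
  "tens fs = foldr (\<star>) fs (Idn C [])"

lemma tens_simps [simp]: "tens [] = Idn C []" "tens (f # fs) = f \<star> tens fs"
  by (simp_all add: tens_def)

lemma tens_Arr [simp]:
  assumes "set fs \<subseteq> Arr C"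
  shows "tens fs \<in> Arr C" "Dom C (tens fs) = concat (map (Dom C) fs)"
    "Cod C (tens fs) = concat (map (Cod C) fs)"
  using assms by (induction fs) auto

lemma concat_Ob [simp]: "set xss \<subseteq> Ob C \<Longrightarrow> concat xss \<in> Ob C"
  by (induction xss) auto

lemma tens_append:
  assumes "set fs \<subseteq> Arr C" "set gs \<subseteq> Arr C"
  shows "tens (fs @ gs) = tens fs \<star> tens gs"
  using assms by (induction fs) (auto simp: ten_assoc)

lemma tens_concat:
  assumes "set (concat fss) \<subseteq> Arr C"
  shows "tens (concat fss) = tens (map tens fss)"
  using assms
proof (induction fss)
  case (Cons fs fss)
  then show ?case using tens_append[of fs "concat fss"] by auto
qed simp

lemma tens_Comp:
  assumes "\<And>i. i \<in> set is \<Longrightarrow> f i \<in> Arr C \<and> g i \<in> Arr C \<and> Dom C (g i) = Cod C (f i)"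
  shows "tens (map (\<lambda>i. g i \<bullet> f i) is) = tens (map g is) \<bullet> tens (map f is)"
  using assms
proof (induction "is")
  case (Cons i "is")
  then have *: "f i \<in> Arr C" "g i \<in> Arr C" "Dom C (g i) = Cod C (f i)"
    "set (map f is) \<subseteq> Arr C" "set (map g is) \<subseteq> Arr C"
    "map (Dom C) (map g is) = map (Cod C) (map f is)"
    by auto
  have "tens (map f is) \<in> Arr C" "tens (map g is) \<in> Arr C"
    "Dom C (tens (map g is)) = Cod C (tens (map f is))"
    unfolding tens_Arr[OF *(4)] tens_Arr[OF *(5)] *(6) by (rule tens_Arr *)+ rule
  then show ?case using Cons * by (simp add: ten_Comp)
qed simp

lemma tens_Idn: "(\<And>i. i \<in> set is \<Longrightarrow> x i \<in> Ob C) \<Longrightarrow>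
    tens (map (\<lambda>i. Idn C (x i)) is) = Idn C (concat (map x is))"
  by (induction "is") (simp_all add: image_subset_iff)

text \<open>Identities of the empty list are strict units, so such factors may be dropped or put
  back. In the normal case collapsed pairs of joints give exactly such factors.\<close>

lemma tens_filter:
  assumes "\<And>i. i \<in> set is \<Longrightarrow> f i \<in> Arr C" "\<And>i. i \<in> set is \<Longrightarrow> \<not> P i \<Longrightarrow> f i = Idn C []"
  shows "tens (map f (filter P is)) = tens (map f is)"
  using assms by (induction "is") (simp_all add: image_subset_iff)

end

section \<open>Consecutive pairs and segments of monotone maps\<close>

lemma consec_empty [simp]: "consec {} = []"
  by (simp add: consec_def)

lemma consec_singleton [simp]: "consec {x} = []"
  by (simp add: consec_def)

lemma consec_insert:
  assumes "finite A" "A \<noteq> {}" "\<forall>a\<in>A. x < a"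
  shows "consec (insert x A) = (x, Min A) # consec A"
proof -
  have le: "x \<le> a" if "a \<in> A" for a
    using assms(3) that by (simp add: less_imp_le)
  have 1: "sorted_list_of_set (insert x A) = x # sorted_list_of_set A"
    using assms(1,3) le by (subst sorted_list_of_set_insert) (auto intro!: insort_is_Cons)
  have 2: "sorted_list_of_set A = Min A # sorted_list_of_set (A - {Min A})"
    using assms by (intro sorted_list_of_set_nonempty)
  show ?thesis
    unfolding consec_def 1 Let_def by (subst (1 2) 2) simp
qed

text \<open>Adding a new minimum matches the recursion \<open>consec_insert\<close>; starting from
  singletons keeps the set nonempty, so that \<open>Min A\<close> is always meaningful.\<close>

lemma finite_ne_min_induct [consumes 2, case_names singleton insert]:
  assumes "finite A" "A \<noteq> {}" "\<And>x. P {x}"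
    and "\<And>x A. finite A \<Longrightarrow> A \<noteq> {} \<Longrightarrow> \<forall>a\<in>A. x < a \<Longrightarrow> P A \<Longrightarrow> P (insert x A)"
  shows "P (A :: nat set)"
proof -
  have "A \<noteq> {} \<longrightarrow> P A"
    using assms(1)
  proof (induction A rule: finite_linorder_min_induct)
    case (insert b A)
    then show ?case using assms(3)[of b] assms(4)[of A b] by (cases "A = {}") auto
  qed simp
  with assms(2) show ?thesis by simp
qed

lemma consec_mem:
  assumes "finite A" "(s, t) \<in> set (consec A)"
  shows "s \<in> A \<and> t \<in> A \<and> s < t"
proof -
  have "A \<noteq> {}" using assms(2) by auto
  from assms(1) this assms(2) show ?thesis
  proof (induction A rule: finite_ne_min_induct)
    case (insert x A)
    then have "Min A \<in> A" by simp
    with insert show ?case by (auto simp: consec_insert simp del: Min_in)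
  qed simp
qed

lemma gaps_pos:
  assumes "finite A"
  shows "0 \<notin> set (gaps A)"
proof
  assume "0 \<in> set (gaps A)"
  then obtain s t where "(s, t) \<in> set (consec A)" "t - s = 0"
    unfolding gaps_def by auto
  with consec_mem[OF assms] show False by fastforce
qed

lemma consec_between:
  assumes "finite A" "(s, t) \<in> set (consec A)"
  shows "A \<inter> {s..t} = {s, t}"
proof -
  have "A \<noteq> {}" using assms(2) by auto
  from assms(1) this assms(2) show ?thesis
  proof (induction A rule: finite_ne_min_induct)
    case (insert x A)
    note less = Min_in[OF insert.hyps(1,2)] Min_le[OF insert.hyps(1)]
    from insert.prems insert.hyps consider "s = x" "t = Min A" | "(s, t) \<in> set (consec A)"
      by (auto simp: consec_insert)
    then show ?case
    proof cases
      case 1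
      have "x < Min A" using insert.hyps(3) less(1) by blast
      with 1 less show ?thesis by (auto intro: le_antisym simp del: Min_in Min_less_iff)
    next
      case 2
      then show ?thesis
        using insert.IH[OF 2] insert.hyps(3) consec_mem[OF insert.hyps(1) 2]
        by (auto simp: Int_insert_left)
    qed
  qed simp
qed

text \<open>The wedge of two necklaces: as m belongs to both sets, no consecutive pair of the union
  straddles it.\<close>

lemma consec_Un:
  assumes "finite A" "finite B" "m \<in> A" "m \<in> B" "\<forall>a\<in>A. a \<le> m" "\<forall>b\<in>B. m \<le> b"
  shows "consec (A \<union> B) = consec A @ consec B"
proof -
  have "A \<noteq> {}" using assms(3) by auto
  from assms(1) this assms(3,5) show ?thesis
  proof (induction A rule: finite_ne_min_induct)
    case (singleton x)
    then have "insert x B = B" using assms(4) by auto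
    then show ?case by simp
  next
    case (insert x A)
    then obtain a where "a \<in> A" "x < a" by auto
    with insert.prems have "m \<in> A" by auto
    have "\<forall>c\<in>A \<union> B. x < c"
      using insert.hyps insert.prems assms(6) \<open>m \<in> A\<close> by (meson UnE less_le_trans)
    moreover have "Min (A \<union> B) = Min A"
      using insert.hyps \<open>m \<in> A\<close> assms(2,6)
      by (intro Min_eqI) (auto intro: Min_le order_trans[OF Min_le])
    ultimately show ?case
      using insert \<open>m \<in> A\<close> assms(2) by (simp add: consec_insert)
  qed
qed

text \<open>The list form of writing U as the wedge of its parts between consecutive joints of W.
  Each induction step cuts at \<open>Min A\<close> by \<open>consec_Un\<close>.\<close>

lemma consec_refine:
  assumes "finite W" "W \<noteq> {}" "W \<subseteq> U" "finite U"
  shows "consec (U \<inter> {Min W..Max W}) = concat (map (\<lambda>(u, v). consec (U \<inter> {u..v})) (consec W))"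
  using assms
proof (induction W rule: finite_ne_min_induct)
  case (singleton x)
  then have "U \<inter> {x..x} = {x}" by auto
  then show ?case by simp
next
  case (insert x A)
  have A: "Min A \<in> A" "x < Min A" "Min A \<le> Max A"
    using insert.hyps by auto
  have "U \<inter> {x..Max A} = U \<inter> {x..Min A} \<union> U \<inter> {Min A..Max A}"
    using A by auto
  moreover have "consec (U \<inter> {x..Min A} \<union> U \<inter> {Min A..Max A}) =
      consec (U \<inter> {x..Min A}) @ consec (U \<inter> {Min A..Max A})"
    by (rule consec_Un[of _ _ "Min A"]) (use A insert.prems in auto)
  ultimately show ?case
    using insert by (simp add: consec_insert)
qed

text \<open>A monotone map may identify neighbouring joints, and the filter drops the resulting
  pairs (y, y). In the induction the new value f x either equals the old minimum of the image, which
  is then unchanged, or lies strictly below it.\<close>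

lemma consec_image:
  assumes "finite A" "mono_on A (f :: nat \<Rightarrow> nat)"
  shows "consec (f ` A) = filter (\<lambda>(s, t). s \<noteq> t) (map (\<lambda>(s, t). (f s, f t)) (consec A))"
proof (cases "A = {}")
  case False
  from assms(1) this assms(2) show ?thesis
  proof (induction A rule: finite_ne_min_induct)
    case (insert x A)
    have "mono_on A f" using insert.prems by (rule mono_on_subset) auto
    then have m: "Min (f ` A) = f (Min A)"
      using insert.hyps(1) Min_in[OF insert.hyps(1,2)]
      by (intro Min_eqI) (auto intro!: mono_onD[of A f "Min A"])
    have le: "f x \<le> f a" if "a \<in> A" for a
      using insert.prems insert.hyps that by (auto simp: mono_on_def less_imp_le)
    have "Min A \<in> A" using insert.hyps by simp
    show ?case
    proof (cases "f x = f (Min A)")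
      case True
      then have "f ` insert x A = f ` A" using \<open>Min A \<in> A\<close> by auto
      then show ?thesis
        using insert True \<open>mono_on A f\<close> by (simp add: consec_insert)
    next
      case False
      then have "f x < Min (f ` A)" using le[OF \<open>Min A \<in> A\<close>] m by simp
      then have "\<forall>a\<in>f ` A. f x < a" using insert.hyps by auto
      then show ?thesis
        using insert False \<open>mono_on A f\<close> by (simp add: consec_insert m)
    qed
  qed simp
qed simp

text \<open>Telescoping; monotonicity keeps the truncated subtraction exact.\<close>

lemma sum_list_consec:
  assumes "finite A" "A \<noteq> {}" "mono_on A (f :: nat \<Rightarrow> nat)"
  shows "sum_list (map (\<lambda>(s, t). f t - f s) (consec A)) = f (Max A) - f (Min A)"
  using assms
proof (induction A rule: finite_ne_min_induct)
  case (insert x A)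
  have "mono_on A f" using insert.prems by (rule mono_on_subset) auto
  moreover have "f x \<le> f (Min A)" "f (Min A) \<le> f (Max A)"
    using insert.prems insert.hyps by (auto simp: mono_on_def less_imp_le)
  ultimately show ?case
    using insert by (simp add: consec_insert)
qed simp

lemma sum_list_gaps:
  assumes "finite A" "A \<noteq> {}"
  shows "sum_list (gaps A) = Max A - Min A"
  using sum_list_consec[OF assms, of "\<lambda>x. x"] by (simp add: gaps_def mono_on_def)

lemma gaps_image:
  assumes "finite A" "mono_on A (f :: nat \<Rightarrow> nat)"
  shows "gaps (f ` A) = filter (\<lambda>n. n \<noteq> 0) (map (\<lambda>(s, t). f t - f s) (consec A))"
proof -
  have "f s \<le> f t" if "(s, t) \<in> set (consec A)" for s t
    using consec_mem[OF assms(1) that] assms(2) by (auto simp: mono_on_def)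
  then have "filter (\<lambda>(s, t). f s \<noteq> f t) (consec A) = filter (\<lambda>(s, t). f t - f s \<noteq> 0) (consec A)"
    by (intro filter_cong) force+
  then show ?thesis
    by (simp add: gaps_def consec_image[OF assms] filter_map o_def case_prod_unfold not_le)
qed

text \<open>The part of f over the bead from s to t, translated so that it starts at 0. It is
  written exactly like the arrow inside \<open>active_arr\<close>, so that the definition can be
  folded there.\<close>

definition seg :: "(nat \<Rightarrow> nat) \<Rightarrow> nat \<Rightarrow> nat \<Rightarrow> mon_map" where
  "seg f s t = Arrow (t - s) (\<lambda>j\<in>{..t - s}. f (s + j) - f s) (f t - f s)"

lemma src_seg [simp]: "src (seg f s t) = t - s" and tgt_seg [simp]: "tgt (seg f s t) = f t - f s"
  by (simp_all add: seg_def)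

lemma delta_simps [simp]:
  "Ob delta = UNIV" "Dom delta = src" "Cod delta = tgt"
  "Idn delta n = Arrow n (\<lambda>i\<in>{..n}. i) n"
  "Comp delta g f = Arrow (src f) (compose {..src f} (amap g) (amap f)) (tgt g)"
  by (simp_all add: delta_def)

lemma delta_f_simps [simp]:
  "Ob delta_f = UNIV" "Dom delta_f = src" "Cod delta_f = tgt" "Idn delta_f = Idn delta"
  "Comp delta_f = Comp delta" "TenO delta_f = (+)" "Unit delta_f = 0"
  "Assoc delta_f k m n = Idn delta (k + m + n)" "LUn delta_f = Idn delta" "RUn delta_f = Idn delta"
  by (simp_all add: delta_f_def)

lemma delta_Arr:
  "Arrow m f n \<in> Arr delta \<longleftrightarrow> f \<in> extensional {..m} \<and> (\<forall>i\<le>m. f i \<le> n) \<and> mono_on {..m} f"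
  by (auto simp: delta_def PiE_iff)

lemma delta_f_Arr:
  "Arrow m f n \<in> Arr delta_f \<longleftrightarrow> Arrow m f n \<in> Arr delta \<and> f 0 = 0 \<and> f m = n"
  by (auto simp: delta_f_def)

lemma category_delta: "category delta"
proof
  fix f assume "f \<in> Arr delta"
  then show "Dom delta f \<in> Ob delta" "Cod delta f \<in> Ob delta" by simp_all
next
  fix x assume "x \<in> Ob delta"
  then show "Idn delta x \<in> hom delta x x"
    by (auto simp: hom_def delta_Arr mono_on_def)
next
  fix f g x y z assume "f \<in> hom delta x y" "g \<in> hom delta y z"
  then show "g \<bullet>\<^bsub>delta\<^esub> f \<in> hom delta x z"
    by (cases f; cases g) (auto simp: hom_def delta_Arr mono_on_def compose_eq)
next
  fix f x y assume "f \<in> hom delta x y"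
  then show "Idn delta y \<bullet>\<^bsub>delta\<^esub> f = f" "f \<bullet>\<^bsub>delta\<^esub> Idn delta x = f"
    by (cases f; auto simp: hom_def delta_Arr compose_def extensional_def fun_eq_iff)+
next
  fix f g h w x y z assume "f \<in> hom delta w x" "g \<in> hom delta x y" "h \<in> hom delta y z"
  then show "(h \<bullet>\<^bsub>delta\<^esub> g) \<bullet>\<^bsub>delta\<^esub> f = h \<bullet>\<^bsub>delta\<^esub> g \<bullet>\<^bsub>delta\<^esub> f"
    by (cases f; cases g; cases h) (auto simp: hom_def delta_Arr compose_def fun_eq_iff)
qed

lemma category_delta_f: "category delta_f"
proof -
  interpret category delta by (rule category_delta)
  have hom: "f \<in> hom delta_f x y \<longleftrightarrow> f \<in> hom delta x y \<and> amap f 0 = 0 \<and> amap f x = y" for f x y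
    by (cases f) (auto simp: hom_def delta_f_Arr)
  have Arr: "f \<in> Arr delta_f \<Longrightarrow> f \<in> Arr delta" for f
    by (cases f) (simp add: delta_f_Arr)
  show ?thesis
  proof
    fix f g x y z assume "f \<in> hom delta_f x y" "g \<in> hom delta_f y z"
    then show "g \<bullet>\<^bsub>delta_f\<^esub> f \<in> hom delta_f x z"
      using Comp_hom[of f x y g z] by (auto simp: hom compose_eq) (simp add: hom_def compose_eq)
  next
    fix x assume "x \<in> Ob delta_f"
    then show "Idn delta_f x \<in> hom delta_f x x"
      using Idn_hom[of x] by (auto simp: hom)
  next
    fix f x y assume "f \<in> hom delta_f x y"
    then show "Idn delta_f y \<bullet>\<^bsub>delta_f\<^esub> f = f" "f \<bullet>\<^bsub>delta_f\<^esub> Idn delta_f x = f"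
      using Comp_Idn_left[of f x y] Comp_Idn_right[of f x y] by (auto simp: hom)
  next
    fix f g h w x y z assume "f \<in> hom delta_f w x" "g \<in> hom delta_f x y" "h \<in> hom delta_f y z"
    then show "(h \<bullet>\<^bsub>delta_f\<^esub> g) \<bullet>\<^bsub>delta_f\<^esub> f = h \<bullet>\<^bsub>delta_f\<^esub> g \<bullet>\<^bsub>delta_f\<^esub> f"
      using Comp_assoc[of f w x g y h z] by (auto simp: hom)
  qed simp_all
qed

lemma delta_f_TenA_Arr:
  assumes "f \<in> Arr delta_f" "g \<in> Arr delta_f"
  shows "f \<odot>\<^bsub>delta_f\<^esub> g \<in> Arr delta_f"
proof (cases f)
  case f: (Arrow m f' m')
  show ?thesis
  proof (cases g)
    case g: (Arrow n g' n')
    have f': "\<forall>i\<le>m. f' i \<le> m'" "mono_on {..m} f'" "f' 0 = 0" "f' m = m'"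
      and g': "\<forall>i\<le>n. g' i \<le> n'" "mono_on {..n} g'" "g' 0 = 0" "g' n = n'"
      using assms f g by (auto simp: delta_f_Arr delta_Arr)
    have *: "g' (i - m) \<le> g' (j - m)" if "i \<le> j" "j \<le> m + n" for i j
      by (rule mono_onD[OF g'(2)]) (use that in auto)
    from * f' g' show ?thesis
      unfolding f g
      by (auto simp: delta_f_def delta_Arr mono_on_def trans_le_add1 le_diff_conv)
  qed
qed

lemma seg_Arr [simp]:
  assumes "mono_on {..p} f" "s \<le> t" "t \<le> p"
  shows "seg f s t \<in> Arr delta_f"
proof -
  have "f (s + i) \<le> f (s + j)" if "i \<le> j" "j \<le> t - s" for i j
    by (rule mono_onD[OF assms(1)]) (use assms that in auto)
  from this[of _ "t - s"] this show ?thesis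
    using assms(2) by (auto simp: seg_def delta_f_Arr delta_Arr mono_on_def diff_le_mono)
qed

lemma seg_refl [simp]: "seg f s s = Idn delta 0"
  by (auto simp: seg_def fun_eq_iff)

lemma seg_Idn: "s \<le> t \<Longrightarrow> t \<le> p \<Longrightarrow> seg (\<lambda>i\<in>{..p}. i) s t = Idn delta (t - s)"
  by (auto simp: seg_def fun_eq_iff)

lemma seg_TenA:
  assumes "mono_on {..p} f" "s \<le> t" "t \<le> u" "u \<le> p"
  shows "seg f s t \<odot>\<^bsub>delta_f\<^esub> seg f t u = seg f s u"
proof -
  have le: "f i \<le> f j" if "i \<le> j" "j \<le> p" for i j
    using assms that by (auto simp: mono_on_def)
  \<comment> \<open>On the second half of the sum the translations cancel; with truncated
    subtraction this needs f t \<le> f (s + i).\<close>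
  have "f t + (f (s + i) - f t) - f s = f (s + i) - f s" if "t \<le> s + i" "i \<le> u - s" for i
    using le[of s t] le[of t "s + i"] that assms(2-4) by simp
  then show ?thesis
    using assms(2,3) le[of s t] le[of t u] assms(4)
    by (auto simp: delta_f_def seg_def fun_eq_iff add.commute)
qed

lemma seg_Comp:
  assumes "mono_on {..p} f" "\<forall>i\<le>p. f i \<le> q" "mono_on {..q} g" "s \<le> t" "t \<le> p"
  shows "seg g (f s) (f t) \<bullet>\<^bsub>delta_f\<^esub> seg f s t = seg (compose {..p} g f) s t"
proof -
  have le: "f i \<le> f j" if "i \<le> j" "j \<le> p" for i j
    using assms that by (auto simp: mono_on_def)
  show ?thesis
    using assms(4,5) le[of s] le[of _ t] by (auto simp: seg_def fun_eq_iff compose_def diff_le_mono)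
qed

section \<open>Colax functors to strict monoidal categories\<close>

lemma necklacesD:
  assumes "(T, p) \<in> necklaces"
  shows "finite T" "T \<noteq> {}" "Min T = 0" "Max T = p" "T \<subseteq> {..p}" "0 \<in> T" "p \<in> T"
    "T \<inter> {0..p} = T"
proof -
  have *: "0 \<in> T" "p \<in> T" "T \<subseteq> {..p}" using assms by (auto simp: necklaces_def)
  then show "finite T" using finite_subset by blast
  with * show "Min T = 0" "Max T = p" by (auto intro!: Min_eqI Max_eqI)
qed (use assms in \<open>auto simp: necklaces_def\<close>)

lemma necklaces_image:
  assumes "(T, p) \<in> necklaces" "Arrow p f q \<in> Arr delta_f"
  shows "(f ` T, q) \<in> necklaces"
proof -
  have "f 0 = 0" "f p = q" "\<forall>i\<le>p. f i \<le> q"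
    using assms(2) by (auto simp: delta_f_Arr delta_Arr)
  then show ?thesis
    using assms(1) by (auto simp: necklaces_def image_iff)
qed

text \<open>Everything but the counit, because it is instantiated for two functors: the given one
  with counit \<open>eps\<close>, and its normalisation with X_0 empty. \<open>Xa\<close> reverses
  composites since X lives on the opposite of \<open>delta_f\<close>.\<close>

locale strict_semicolax = strict_monoidal C ten
  for C :: "('x list, 'b, 'z) cat_scheme" (structure) and ten (infixr "\<star>" 70) +
  fixes Xo :: "nat \<Rightarrow> 'x list" and Xa :: "mon_map \<Rightarrow> 'b" and mu :: "nat \<Rightarrow> nat \<Rightarrow> 'b"
  assumes Xo_Ob [simp]: "Xo n \<in> Ob C"
    and Xa_Arr [simp]: "f \<in> Arr delta_f \<Longrightarrow> Xa f \<in> Arr C"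
    and Dom_Xa [simp]: "f \<in> Arr delta_f \<Longrightarrow> Dom C (Xa f) = Xo (tgt f)"
    and Cod_Xa [simp]: "f \<in> Arr delta_f \<Longrightarrow> Cod C (Xa f) = Xo (src f)"
    and Xa_Idn: "Xa (Idn delta n) = Idn C (Xo n)"
    and Xa_Comp: "f \<in> Arr delta_f \<Longrightarrow> g \<in> Arr delta_f \<Longrightarrow> src g = tgt f \<Longrightarrow>
      Xa (g \<bullet>\<^bsub>delta_f\<^esub> f) = Xa f \<bullet> Xa g"
    and mu_Arr [simp]: "mu m n \<in> Arr C"
    and Dom_mu [simp]: "Dom C (mu m n) = Xo (m + n)"
    and Cod_mu [simp]: "Cod C (mu m n) = Xo m @ Xo n"
    and mu_natural: "f \<in> Arr delta_f \<Longrightarrow> g \<in> Arr delta_f \<Longrightarrow>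
      mu (src f) (src g) \<bullet> Xa (f \<odot>\<^bsub>delta_f\<^esub> g) = (Xa f \<star> Xa g) \<bullet> mu (tgt f) (tgt g)"
    and mu_coassoc: "(mu k m \<star> Idn C (Xo n)) \<bullet> mu (k + m) n =
      (Idn C (Xo k) \<star> mu m n) \<bullet> mu k (m + n)"

locale normal_colax = strict_semicolax C ten Xo Xa mu
  for C :: "('x list, 'b, 'z) cat_scheme" (structure) and ten (infixr "\<star>" 70)
    and Xo :: "nat \<Rightarrow> 'x list" and Xa :: "mon_map \<Rightarrow> 'b" and mu :: "nat \<Rightarrow> nat \<Rightarrow> 'b" +
  assumes Xo_0 [simp]: "Xo 0 = []"
    and mu_0_left [simp]: "mu 0 n = Idn C (Xo n)"
    and mu_0_right [simp]: "mu n 0 = Idn C (Xo n)"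
begin

section \<open>Iterated comultiplication of a normal colax functor\<close>

fun comul :: "nat list \<Rightarrow> 'b" where
  "comul [] = Idn C []"
| "comul (n # ns) = (Idn C (Xo n) \<star> comul ns) \<bullet> mu n (sum_list ns)"

lemma comul_Arr [simp]: "comul ns \<in> Arr C" "Dom C (comul ns) = Xo (sum_list ns)"
  "Cod C (comul ns) = concat (map Xo ns)"
  by (induction ns) auto

lemma Xo_append_Ob [simp]: "concat (map Xo ns) \<in> Ob C"
  by (rule concat_Ob) auto

text \<open>Iterated coassociativity: each step moves the leading factor across the cut by
  \<open>mu_coassoc\<close>.\<close>

lemma comul_append: "comul (ms @ ns) = (comul ms \<star> comul ns) \<bullet> mu (sum_list ms) (sum_list ns)"
proof (induction ms)
  case (Cons m ms)
  let ?a = "sum_list ms" and ?b = "sum_list ns"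
  have "comul ((m # ms) @ ns) = (Idn C (Xo m) \<star> ((comul ms \<star> comul ns) \<bullet> mu ?a ?b)) \<bullet> mu m (?a + ?b)"
    by (simp add: Cons.IH)
  also have "\<dots> = (Idn C (Xo m) \<star> (comul ms \<star> comul ns)) \<bullet> ((Idn C (Xo m) \<star> mu ?a ?b) \<bullet> mu m (?a + ?b))"
    using ten_Comp[of "Idn C (Xo m)" "Idn C (Xo m)" "mu ?a ?b" "comul ms \<star> comul ns"] by simp
  also have "\<dots> = ((Idn C (Xo m) \<star> comul ms) \<star> comul ns) \<bullet> ((mu m ?a \<star> Idn C (Xo ?b)) \<bullet> mu (m + ?a) ?b)"
    by (subst mu_coassoc) (simp add: ten_assoc)
  also have "\<dots> = (((Idn C (Xo m) \<star> comul ms) \<bullet> mu m ?a) \<star> comul ns) \<bullet> mu (m + ?a) ?b"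
    using ten_Comp[of "mu m ?a" "Idn C (Xo m) \<star> comul ms" "Idn C (Xo ?b)" "comul ns"] by simp
  finally show ?case by simp
qed simp

text \<open>Splitting in two stages, first into blocks and then inside each block. Within one bead
  this is the composition law of inert maps.\<close>

lemma comul_concat:
  "comul (concat nss) = tens (map comul nss) \<bullet> comul (map sum_list nss)"
proof (induction nss)
  case (Cons ns nss)
  let ?t = "tens (map comul nss)" and ?c = "comul (map sum_list nss)"
  have "set (map comul nss) \<subseteq> Arr C" by auto
  from tens_Arr(1,2)[OF this]
  have [simp]: "?t \<in> Arr C" "Dom C ?t = concat (map Xo (map sum_list nss))"
    by (simp_all add: o_def)
  have [simp]: "sum_list (concat nss) = sum_list (map sum_list nss)"
    by (induction nss) auto
  have "comul (concat (ns # nss)) =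
      ((comul ns \<bullet> Idn C (Xo (sum_list ns))) \<star> (?t \<bullet> ?c)) \<bullet> mu (sum_list ns) (sum_list (concat nss))"
    by (simp add: comul_append Cons.IH)
  also have "\<dots> = (comul ns \<star> ?t) \<bullet> (Idn C (Xo (sum_list ns)) \<star> ?c) \<bullet>
      mu (sum_list ns) (sum_list (map sum_list nss))"
    by (subst ten_Comp) simp_all
  finally show ?case by simp
qed simp

text \<open>An entry 0 contributes the empty object and the identity \<open>mu 0 n\<close>, so it
  leaves no trace. This is the gain from normality: the gaps of an image can be replaced by the
  unfiltered list of differences.\<close>

lemma comul_filter: "comul (filter (\<lambda>n. n \<noteq> 0) ns) = comul ns"
proof (induction ns)
  case (Cons n ns)
  have "sum_list (filter (\<lambda>n. 0 < n) ns) = sum_list ns"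
    by (induction ns) auto
  with Cons show ?case by (simp split: if_splits)
qed simp

text \<open>Naturality of the iterated comultiplication with respect to g, cut at the points of A.
  The list of differences on the left may contain zeros and so need not be \<open>gaps\<close> of
  the image; \<open>comul_filter\<close> bridges this later. The induction splits off the first bead
  by \<open>mu_natural\<close>, and \<open>seg_TenA\<close> glues the segments.\<close>

lemma comul_seg:
  assumes "finite A" "A \<noteq> {}" "A \<subseteq> {..p}" "mono_on {..p} g"
  shows "tens (map (\<lambda>(s, t). Xa (seg g s t)) (consec A)) \<bullet>
      comul (map (\<lambda>(s, t). g t - g s) (consec A)) =
    comul (gaps A) \<bullet> Xa (seg g (Min A) (Max A))"
  using assms(1-3)
proof (induction A rule: finite_ne_min_induct)
  case (singleton x)
  then show ?case using Xa_Idn[of 0] by (simp add: gaps_def)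
next
  case (insert x A)
  let ?m = "Min A" and ?M = "Max A"
  have m: "?m \<in> A" "x < ?m" "?m \<le> ?M" "?M \<in> A" using insert.hyps by auto
  then have le: "x \<le> ?m" "?m \<le> ?M" "?m \<le> p" "?M \<le> p" "x \<le> p" using insert.prems by auto
  have mono: "mono_on A g" using assms(4) insert.prems by (auto elim: mono_on_subset)
  let ?t = "tens (map (\<lambda>(s, t). Xa (seg g s t)) (consec A))"
  let ?c = "comul (map (\<lambda>(s, t). g t - g s) (consec A))"
  have seg: "Xa (seg g s t) \<in> Arr C \<and> Dom C (Xa (seg g s t)) = Xo (g t - g s)"
    if "(s, t) \<in> set (consec A)" for s t
    using consec_mem[OF insert.hyps(1) that] seg_Arr[OF assms(4), of s t] insert.prems by auto
  have t: "?t \<in> Arr C"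
    by (rule tens_Arr) (use seg in auto)
  have "Dom C ?t = concat (map (Dom C) (map (\<lambda>(s, t). Xa (seg g s t)) (consec A)))"
    by (rule tens_Arr) (use seg in auto)
  also have "\<dots> = concat (map Xo (map (\<lambda>(s, t). g t - g s) (consec A)))"
    using seg by (auto intro!: arg_cong[where f=concat])
  finally have t_Dom: "Dom C ?t = concat (map Xo (map (\<lambda>(s, t). g t - g s) (consec A)))" .
  have sum: "sum_list (map (\<lambda>(s, t). g t - g s) (consec A)) = g ?M - g ?m"
    using insert.hyps mono by (intro sum_list_consec)
  have sum': "sum_list (gaps A) = ?M - ?m" using insert.hyps by (intro sum_list_gaps)
  have IH: "?t \<bullet> ?c = comul (gaps A) \<bullet> Xa (seg g ?m ?M)" using insert by auto
  have "tens (map (\<lambda>(s, t). Xa (seg g s t)) (consec (insert x A))) \<bullet>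
      comul (map (\<lambda>(s, t). g t - g s) (consec (insert x A))) =
      (Xa (seg g x ?m) \<star> ?t) \<bullet> (Idn C (Xo (g ?m - g x)) \<star> ?c) \<bullet> mu (g ?m - g x) (g ?M - g ?m)"
    using insert.hyps by (simp add: consec_insert sum)
  also have "\<dots> = ((Xa (seg g x ?m) \<star> ?t) \<bullet> (Idn C (Xo (g ?m - g x)) \<star> ?c)) \<bullet> mu (g ?m - g x) (g ?M - g ?m)"
    using t t_Dom seg_Arr[OF assms(4) le(1,3)] sum by simp
  also have "\<dots> = ((Xa (seg g x ?m) \<bullet> Idn C (Xo (g ?m - g x))) \<star> (?t \<bullet> ?c)) \<bullet> mu (g ?m - g x) (g ?M - g ?m)"
    by (subst ten_Comp) (use t t_Dom seg_Arr[OF assms(4) le(1,3)] in simp_all)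
  also have "\<dots> = ((Idn C (Xo (?m - x)) \<bullet> Xa (seg g x ?m)) \<star> (comul (gaps A) \<bullet> Xa (seg g ?m ?M))) \<bullet>
      mu (g ?m - g x) (g ?M - g ?m)"
    unfolding IH using seg_Arr[OF assms(4) le(1,3)] by simp
  also have "\<dots> = (Idn C (Xo (?m - x)) \<star> comul (gaps A)) \<bullet> (Xa (seg g x ?m) \<star> Xa (seg g ?m ?M)) \<bullet>
      mu (g ?m - g x) (g ?M - g ?m)"
    using sum' seg_Arr[OF assms(4) le(1,3)] seg_Arr[OF assms(4) le(2,4)] by (subst ten_Comp) simp_all
  also have "\<dots> = (Idn C (Xo (?m - x)) \<star> comul (gaps A)) \<bullet> mu (?m - x) (?M - ?m) \<bullet> Xa (seg g x ?M)"
    using mu_natural[of "seg g x ?m" "seg g ?m ?M"] seg_TenA[OF assms(4) le(1,2,4)]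
      seg_Arr[OF assms(4) le(1,3)] seg_Arr[OF assms(4) le(2,4)] by simp
  also have "\<dots> = comul (gaps (insert x A)) \<bullet> Xa (seg g x ?M)"
    using insert.hyps sum' seg_Arr[OF assms(4), of x ?M] le by (simp add: gaps_def consec_insert)
  finally show ?case
    using insert.hyps by simp
qed

section \<open>Inert and active necklace maps, and their interchange\<close>

definition nobj :: "nat set \<Rightarrow> 'x list" where
  "nobj T = concat (map Xo (gaps T))"

text \<open>Strict counterpart of \<open>inert_arr\<close>, without rebracketing. In
  \<open>nactive\<close> below the \<open>fill\<close> of \<open>active_arr\<close> has vanished as
  well, because here \<open>Xo 0\<close> is the empty list.\<close>

definition ninert :: "nat set \<Rightarrow> nat set \<Rightarrow> 'b" where
  "ninert T U = tens (map (\<lambda>(u, v). comul (gaps (T \<inter> {u..v}))) (consec U))"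

definition nactive :: "nat set \<Rightarrow> (nat \<Rightarrow> nat) \<Rightarrow> 'b" where
  "nactive T f = tens (map (\<lambda>(s, t). Xa (seg f s t)) (consec T))"

lemma nobj_Ob [simp]: "nobj T \<in> Ob C"
  by (simp add: nobj_def)

lemma restrict_consec:
  assumes "(u, v) \<in> set (consec U)" "U \<subseteq> T" "finite T"
  shows "finite (T \<inter> {u..v})" "T \<inter> {u..v} \<noteq> {}" "Min (T \<inter> {u..v}) = u" "Max (T \<inter> {u..v}) = v"
    "sum_list (gaps (T \<inter> {u..v})) = v - u" "u \<in> T" "v \<in> T" "u \<le> v"
proof -
  have uv: "u \<in> T" "v \<in> T" "u < v"
    using consec_mem[OF _ assms(1)] assms(2,3) finite_subset by auto
  then show "u \<in> T" "v \<in> T" "u \<le> v" by auto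
  from uv show *: "T \<inter> {u..v} \<noteq> {}" "Min (T \<inter> {u..v}) = u" "Max (T \<inter> {u..v}) = v"
    using assms(3) by (auto intro!: Min_eqI Max_eqI)
  show "sum_list (gaps (T \<inter> {u..v})) = v - u"
    using sum_list_gaps[OF _ *(1)] assms(3) *(2,3) by simp
qed (use assms(3) in simp)

lemma consec_refine':
  assumes "(u, v) \<in> set (consec W)" "W \<subseteq> U" "U \<subseteq> T" "finite T"
  shows "consec (T \<inter> {u..v}) = concat (map (\<lambda>(s, t). consec (T \<inter> {s..t})) (consec (U \<inter> {u..v})))"
proof -
  have fin: "finite U" using assms(3,4) by (rule finite_subset)
  note r = restrict_consec[OF assms(1,2) fin]
  have "consec (T \<inter> {u..v} \<inter> {u..v}) =
    concat (map (\<lambda>(s, t). consec (T \<inter> {u..v} \<inter> {s..t})) (consec (U \<inter> {u..v})))"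
    using consec_refine[of "U \<inter> {u..v}" "T \<inter> {u..v}"] r assms(3,4) by auto
  also have "\<dots> = concat (map (\<lambda>(s, t). consec (T \<inter> {s..t})) (consec (U \<inter> {u..v})))"
  proof (intro arg_cong[where f=concat] map_cong refl, clarsimp)
    fix s t assume "(s, t) \<in> set (consec (U \<inter> {u..v}))"
    from consec_mem[OF _ this] fin have "T \<inter> {u..v} \<inter> {s..t} = T \<inter> {s..t}" by auto
    then show "consec (T \<inter> {u..v} \<inter> {s..t}) = consec (T \<inter> {s..t})"
      by (simp only:)
  qed
  finally show ?thesis by (simp add: Int_assoc)
qed

lemma consec_refine_necklace:
  assumes "(T, p) \<in> necklaces" "(U, p) \<in> necklaces" "U \<subseteq> T"
  shows "consec T = concat (map (\<lambda>(s, t). consec (T \<inter> {s..t})) (consec U))"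
  using consec_refine[of U T] necklacesD[OF assms(1)] necklacesD[OF assms(2)] assms(3) by simp

lemma concat_concat: "concat (concat xsss) = concat (map concat xsss)"
  by (induction xsss) auto

lemma ninert_Arr:
  assumes "(T, p) \<in> necklaces" "(U, p) \<in> necklaces" "U \<subseteq> T"
  shows "ninert T U \<in> Arr C" "Dom C (ninert T U) = nobj U" "Cod C (ninert T U) = nobj T"
proof -
  let ?f = "\<lambda>(u, v). comul (gaps (T \<inter> {u..v}))"
  have *: "set (map ?f (consec U)) \<subseteq> Arr C" by auto
  show "ninert T U \<in> Arr C" unfolding ninert_def by (rule tens_Arr[OF *])
  have "Dom C (ninert T U) = concat (map (\<lambda>(u, v). Xo (sum_list (gaps (T \<inter> {u..v})))) (consec U))"
    unfolding ninert_def tens_Arr[OF *] by (simp add: o_def case_prod_unfold)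
  also have "\<dots> = nobj U"
    unfolding nobj_def gaps_def[of U]
    using restrict_consec[OF _ assms(3) necklacesD(1)[OF assms(1)]]
    by (auto intro!: arg_cong[where f=concat])
  finally show "Dom C (ninert T U) = nobj U" .
  have "Cod C (ninert T U) = concat (map (\<lambda>(u, v). concat (map Xo (gaps (T \<inter> {u..v})))) (consec U))"
    unfolding ninert_def tens_Arr[OF *] by (simp add: o_def case_prod_unfold)
  also have "\<dots> = nobj T"
    unfolding nobj_def gaps_def consec_refine_necklace[OF assms]
    by (simp add: o_def case_prod_unfold map_concat concat_concat)
  finally show "Cod C (ninert T U) = nobj T" .
qed

text \<open>Both sides are grouped as products over the beads of W; inside one bead the claim is
  \<open>comul_concat\<close> for the blocks that U cuts out of T.\<close>

lemma ninert_Comp: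
  assumes T: "(T, p) \<in> necklaces" and U: "(U, p) \<in> necklaces" and W: "(W, p) \<in> necklaces"
    and "W \<subseteq> U" "U \<subseteq> T"
  shows "ninert T U \<bullet> ninert U W = ninert T W"
proof -
  note fT = necklacesD(1)[OF T] and fU = necklacesD(1)[OF U]
  let ?p = "\<lambda>(w, w'). tens (map (\<lambda>(u, v). comul (gaps (T \<inter> {u..v}))) (consec (U \<inter> {w..w'})))"
  let ?q = "\<lambda>(w, w'). comul (gaps (U \<inter> {w..w'}))"
  \<comment> \<open>The block sums of T are the gaps of U, which identifies \<open>?q\<close> with
    the first stage of \<open>comul_concat\<close>.\<close>
  have sub: "map (\<lambda>(u, v). sum_list (gaps (T \<inter> {u..v}))) (consec (U \<inter> {w..w'})) = gaps (U \<inter> {w..w'})"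
    for w w'
    unfolding gaps_def[of "U \<inter> {w..w'}"]
    using restrict_consec(5)[of _ _ "U \<inter> {w..w'}" T] assms(5) fT by auto
  have pq: "?p i \<in> Arr C \<and> ?q i \<in> Arr C \<and> Dom C (?p i) = Cod C (?q i)" for i
  proof (cases i)
    case (Pair w w')
    let ?l = "map (\<lambda>(u, v). comul (gaps (T \<inter> {u..v}))) (consec (U \<inter> {w..w'}))"
    have *: "set ?l \<subseteq> Arr C" by auto
    have "map (Dom C) ?l = map Xo (map (\<lambda>(u, v). sum_list (gaps (T \<inter> {u..v}))) (consec (U \<inter> {w..w'})))"
      by auto
    then show ?thesis unfolding Pair prod.case tens_Arr(2)[OF *] sub using tens_Arr(1)[OF *] by simp
  qed
  have "ninert T U = tens (concat (map (\<lambda>(w, w'). map (\<lambda>(u, v). comul (gaps (T \<inter> {u..v})))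
      (consec (U \<inter> {w..w'}))) (consec W)))"
    unfolding ninert_def consec_refine_necklace[OF U W assms(4)]
    by (simp add: map_concat o_def case_prod_unfold)
  also have "\<dots> = tens (map ?p (consec W))"
    by (subst tens_concat) (auto simp: o_def case_prod_unfold)
  finally have "ninert T U \<bullet> ninert U W = tens (map ?p (consec W)) \<bullet> tens (map ?q (consec W))"
    by (simp add: ninert_def)
  also have "\<dots> = tens (map (\<lambda>i. ?p i \<bullet> ?q i) (consec W))"
    using pq by (intro tens_Comp[symmetric]) auto
  also have "\<dots> = ninert T W"
    unfolding ninert_def
  proof (intro arg_cong[where f=tens] map_cong refl)
    fix i assume "i \<in> set (consec W)"
    then obtain w w' where i: "i = (w, w')" and w: "(w, w') \<in> set (consec W)"
      by (metis surj_pair)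
    have "gaps (T \<inter> {w..w'}) = concat (map (\<lambda>(u, v). gaps (T \<inter> {u..v})) (consec (U \<inter> {w..w'})))"
      unfolding gaps_def consec_refine'[OF w assms(4,5) fT]
      by (simp add: map_concat o_def case_prod_unfold)
    then show "?p i \<bullet> ?q i = (case i of (w, w') \<Rightarrow> comul (gaps (T \<inter> {w..w'})))"
      unfolding i using sub[of w w'] by (simp add: comul_concat o_def case_prod_unfold)
  qed
  finally show ?thesis .
qed

lemma tens_consec_image:
  assumes "finite T" "mono_on T f" "\<And>i. h i \<in> Arr C" "\<And>x. h (x, x) = Idn C []"
  shows "tens (map h (consec (f ` T))) = tens (map (\<lambda>(s, t). h (f s, f t)) (consec T))"
proof -
  have "tens (map h (consec (f ` T))) =
      tens (map h (map (\<lambda>(s, t). (f s, f t)) (consec T)))"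
    unfolding consec_image[OF assms(1,2)] by (rule tens_filter) (use assms(3,4) in auto)
  then show ?thesis by (simp add: o_def case_prod_unfold)
qed

lemma concat_consec_image:
  assumes "finite T" "mono_on T f" "\<And>x. h (x, x) = []"
  shows "concat (map h (consec (f ` T))) = concat (map (\<lambda>(s, t). h (f s, f t)) (consec T))"
proof -
  have "concat (map h (filter (\<lambda>(s, t). s \<noteq> t) is)) = concat (map h is)" for "is"
    using assms(3) by (induction "is") auto
  then show ?thesis
    unfolding consec_image[OF assms(1,2)] by (simp add: o_def case_prod_unfold)
qed

lemma delta_fD:
  assumes "Arrow p f q \<in> Arr delta_f"
  shows "mono_on {..p} f" "\<forall>i\<le>p. f i \<le> q" "f 0 = 0" "f p = q"
  using assms by (auto simp: delta_f_Arr delta_Arr)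

lemma nactive_Arr:
  assumes T: "(T, p) \<in> necklaces" and f: "Arrow p f q \<in> Arr delta_f"
  shows "nactive T f \<in> Arr C" "Dom C (nactive T f) = nobj (f ` T)" "Cod C (nactive T f) = nobj T"
proof -
  let ?l = "map (\<lambda>(s, t). Xa (seg f s t)) (consec T)"
  have mono: "mono_on T f"
    using mono_on_subset[OF delta_fD(1)[OF f] necklacesD(5)[OF T]] .
  have seg: "seg f s t \<in> Arr delta_f" if "(s, t) \<in> set (consec T)" for s t
    using consec_mem[OF necklacesD(1)[OF T] that] necklacesD(5)[OF T]
    by (intro seg_Arr[OF delta_fD(1)[OF f]]) auto
  then have *: "set ?l \<subseteq> Arr C" by auto
  show "nactive T f \<in> Arr C" unfolding nactive_def by (rule tens_Arr[OF *])
  have "Dom C (nactive T f) = concat (map (\<lambda>(s, t). Xo (f t - f s)) (consec T))"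
    unfolding nactive_def tens_Arr[OF *] using seg by (auto intro!: arg_cong[where f=concat])
  also have "\<dots> = concat (map (\<lambda>(x, y). Xo (y - x)) (consec (f ` T)))"
    by (subst concat_consec_image) (use necklacesD[OF T] mono in auto)
  also have "\<dots> = nobj (f ` T)"
    by (simp add: nobj_def gaps_def o_def case_prod_unfold)
  finally show "Dom C (nactive T f) = nobj (f ` T)" .
  show "Cod C (nactive T f) = nobj T"
    unfolding nactive_def tens_Arr[OF *] nobj_def gaps_def using seg
    by (auto intro!: arg_cong[where f=concat])
qed

text \<open>Once both products run over the same list \<open>consec T\<close>, the claim is
  \<open>seg_Comp\<close> in every factor.\<close>

lemma nactive_Comp:
  assumes T: "(T, p) \<in> necklaces" and f: "Arrow p f q \<in> Arr delta_f" and g: "Arrow q g r \<in> Arr delta_f"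
  shows "nactive T f \<bullet> nactive (f ` T) g = nactive T (compose {..p} g f)"
proof -
  note nT = necklacesD[OF T]
  have mono: "mono_on T f"
    using mono_on_subset[OF delta_fD(1)[OF f] necklacesD(5)[OF T]] .
  have st: "s \<le> t \<and> t \<le> p" if "(s, t) \<in> set (consec T)" for s t
    using consec_mem[OF nT(1) that] nT(5) by auto
  have fst: "f s \<le> f t \<and> f t \<le> q" if "(s, t) \<in> set (consec T)" for s t
    using st[OF that] delta_fD[OF f] by (auto simp: mono_on_def)
  have seg_f: "seg f s t \<in> Arr delta_f" if "(s, t) \<in> set (consec T)" for s t
    using st[OF that] by (intro seg_Arr[OF delta_fD(1)[OF f]]) auto
  have seg_g: "seg g (f s) (f t) \<in> Arr delta_f" if "(s, t) \<in> set (consec T)" for s t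
    using fst[OF that] by (intro seg_Arr[OF delta_fD(1)[OF g]]) auto
  \<comment> \<open>The pairs that f collapses are put back: their factors are
    \<open>Xa (Idn delta 0)\<close>, an identity of the empty list.\<close>
  have "nactive (f ` T) g = tens (map (\<lambda>(s, t). Xa (seg g (f s) (f t))) (consec T))"
  proof -
    have "nactive (f ` T) g = tens (map (\<lambda>(x, y). Xa (seg g x y)) (map (\<lambda>(s, t). (f s, f t)) (consec T)))"
      unfolding nactive_def consec_image[OF nT(1) mono]
      by (rule tens_filter) (use seg_g Xa_Idn[of 0] in auto)
    then show ?thesis by (simp add: o_def case_prod_unfold)
  qed
  then have "nactive T f \<bullet> nactive (f ` T) g =
      tens (map (\<lambda>i. (case i of (s, t) \<Rightarrow> Xa (seg f s t)) \<bullet> (case i of (s, t) \<Rightarrow> Xa (seg g (f s) (f t)))) (consec T))"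
    unfolding nactive_def using seg_f seg_g by (subst tens_Comp) auto
  also have "\<dots> = nactive T (compose {..p} g f)"
    unfolding nactive_def
  proof (intro arg_cong[where f=tens] map_cong refl, clarify)
    fix s t assume *: "(s, t) \<in> set (consec T)"
    have "Xa (seg g (f s) (f t) \<bullet>\<^bsub>delta_f\<^esub> seg f s t) = Xa (seg f s t) \<bullet> Xa (seg g (f s) (f t))"
      using seg_f[OF *] seg_g[OF *] by (intro Xa_Comp) auto
    then show "Xa (seg f s t) \<bullet> Xa (seg g (f s) (f t)) = Xa (seg (compose {..p} g f) s t)"
      using seg_Comp[OF delta_fD(1,2)[OF f] delta_fD(1)[OF g], of s t] st[OF *] by simp
  qed
  finally show ?thesis .
qed

text \<open>Refining joints commutes with pushing forward along g. Over each bead of U this is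
  \<open>comul_seg\<close>; collapsed joints of T yield zeros and collapsed beads of U yield unit
  factors, and both are invisible by normality.\<close>

lemma interchange:
  assumes T: "(T, p) \<in> necklaces" and U: "(U, p) \<in> necklaces" and "U \<subseteq> T"
    and g: "Arrow p g q \<in> Arr delta_f"
  shows "ninert T U \<bullet> nactive U g = nactive T g \<bullet> ninert (g ` T) (g ` U)"
proof -
  note nT = necklacesD[OF T] and nU = necklacesD[OF U]
  have mono: "mono_on {..p} g" using delta_fD[OF g] by auto
  have monoU: "mono_on U g" and monoT: "mono_on T g"
    using mono_on_subset[OF mono] nU nT by auto
  have seg: "seg g s t \<in> Arr delta_f" if "s \<in> T" "t \<in> T" "s \<le> t" for s t
    using that nT(5) by (intro seg_Arr[OF mono]) auto
  let ?a = "\<lambda>(u, v). comul (gaps (T \<inter> {u..v}))"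
  let ?b = "\<lambda>(u, v). Xa (seg g u v)"
  let ?c = "\<lambda>(u, v). tens (map (\<lambda>(s, t). Xa (seg g s t)) (consec (T \<inter> {u..v})))"
  let ?d = "\<lambda>(u, v). comul (gaps (g ` T \<inter> {g u..g v}))"
  note r = restrict_consec[OF _ assms(3) nT(1)]
  \<comment> \<open>The gaps of the image are the nonzero differences, and \<open>comul\<close> does
    not see zeros.\<close>
  have d: "?d (u, v) = comul (map (\<lambda>(s, t). g t - g s) (consec (T \<inter> {u..v})))"
    if "u \<in> T" "v \<in> T" "u \<le> v" for u v
  proof -
    \<comment> \<open>A joint outside [u, v] whose image lies between g u and g v must, by
      monotonicity, have the same image as u or v.\<close>
    have "g ` T \<inter> {g u..g v} = g ` (T \<inter> {u..v})"
    proof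
      show "g ` T \<inter> {g u..g v} \<subseteq> g ` (T \<inter> {u..v})"
      proof
        fix y assume "y \<in> g ` T \<inter> {g u..g v}"
        then obtain t where t: "t \<in> T" "y = g t" "g u \<le> g t" "g t \<le> g v" by auto
        show "y \<in> g ` (T \<inter> {u..v})"
        proof (cases "t \<in> {u..v}")
          case False
          then have "t \<le> u \<or> v \<le> t" by auto
          then have "g t = g u \<or> g t = g v"
            using t(3,4) mono_onD[OF monoT t(1) that(1)] mono_onD[OF monoT that(2) t(1)] by auto
          then show ?thesis using that t(2) by auto
        qed (use t in auto)
      qed
      show "g ` (T \<inter> {u..v}) \<subseteq> g ` T \<inter> {g u..g v}"
        using monoT that by (auto simp: mono_on_def)
    qed
    then have "gaps (g ` T \<inter> {g u..g v}) =
        filter (\<lambda>n. n \<noteq> 0) (map (\<lambda>(s, t). g t - g s) (consec (T \<inter> {u..v})))"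
      using gaps_image[of "T \<inter> {u..v}" g] nT(1) mono_on_subset[OF monoT, of "T \<inter> {u..v}"] by simp
    then show ?thesis by (simp only: comul_filter prod.case)
  qed
  have "ninert T U \<bullet> nactive U g = tens (map (\<lambda>i. ?a i \<bullet> ?b i) (consec U))"
    unfolding ninert_def nactive_def
  proof (rule tens_Comp[symmetric])
    fix i assume "i \<in> set (consec U)"
    then obtain u v where i: "i = (u, v)" and uv: "(u, v) \<in> set (consec U)"
      by (metis surj_pair)
    show "?b i \<in> Arr C \<and> ?a i \<in> Arr C \<and> Dom C (?a i) = Cod C (?b i)"
      unfolding i using r[OF uv] seg[of u v] by simp
  qed
  also have "\<dots> = tens (map (\<lambda>i. ?c i \<bullet> ?d i) (consec U))"
  proof (intro arg_cong[where f=tens] map_cong refl)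
    fix i assume "i \<in> set (consec U)"
    then obtain u v where i: "i = (u, v)" and uv: "(u, v) \<in> set (consec U)"
      by (metis surj_pair)
    have "?c (u, v) \<bullet> comul (map (\<lambda>(s, t). g t - g s) (consec (T \<inter> {u..v}))) =
        comul (gaps (T \<inter> {u..v})) \<bullet> Xa (seg g u v)"
      using comul_seg[of "T \<inter> {u..v}" p g] r[OF uv] mono nT(5) by auto
    then show "?a i \<bullet> ?b i = ?c i \<bullet> ?d i"
      unfolding i using d[of u v] r[OF uv] by simp
  qed
  also have "\<dots> = tens (map ?c (consec U)) \<bullet> tens (map ?d (consec U))"
  proof (rule tens_Comp)
    fix i assume "i \<in> set (consec U)"
    then obtain u v where i: "i = (u, v)" and uv: "(u, v) \<in> set (consec U)"
      by (metis surj_pair)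
    let ?l = "map (\<lambda>(s, t). Xa (seg g s t)) (consec (T \<inter> {u..v}))"
    have s: "seg g s t \<in> Arr delta_f" if "(s, t) \<in> set (consec (T \<inter> {u..v}))" for s t
      using consec_mem[OF _ that] nT(1) by (intro seg) auto
    then have *: "set ?l \<subseteq> Arr C" by auto
    have "Dom C (tens ?l) = concat (map Xo (map (\<lambda>(s, t). g t - g s) (consec (T \<inter> {u..v}))))"
      unfolding tens_Arr[OF *] using s by (auto intro!: arg_cong[where f=concat])
    then show "?d i \<in> Arr C \<and> ?c i \<in> Arr C \<and> Dom C (?c i) = Cod C (?d i)"
      unfolding i using d[of u v] r[OF uv] tens_Arr(1)[OF *] by simp
  qed
  \<comment> \<open>A bead of U collapsed by g gives \<open>comul\<close> of an empty gap list, so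
    it may be omitted from the product.\<close>
  also have "tens (map ?d (consec U)) = ninert (g ` T) (g ` U)"
    unfolding ninert_def
    using tens_consec_image[OF nU(1) monoU, of "\<lambda>(x, y). comul (gaps (g ` T \<inter> {x..y}))"]
    by (simp add: gaps_def Int_insert_right case_prod_unfold)
  also have "tens (map ?c (consec U)) = nactive T g"
  proof -
    let ?ll = "map (\<lambda>(u, v). map (\<lambda>(s, t). Xa (seg g s t)) (consec (T \<inter> {u..v}))) (consec U)"
    have "nactive T g = tens (concat ?ll)"
      unfolding nactive_def consec_refine_necklace[OF T U assms(3)]
      by (simp add: map_concat o_def case_prod_unfold)
    also have "\<dots> = tens (map tens ?ll)"
    proof (rule tens_concat)
      show "set (concat ?ll) \<subseteq> Arr C"
      proof (clarsimp intro!: Xa_Arr)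
        fix u v s t assume "(s, t) \<in> set (consec (T \<inter> {u..v}))"
        from consec_mem[OF _ this] nT(1) show "seg g s t \<in> Arr delta_f" by (intro seg) auto
      qed
    qed
    finally show ?thesis by (simp add: o_def case_prod_unfold)
  qed
  finally show ?thesis .
qed

text \<open>In the middle an inert factor meets an active one. After \<open>interchange\<close> the
  two active factors are adjacent and the two inert factors are adjacent, and each pair composes by
  its own law.\<close>

lemma nec_Comp:
  assumes T: "(T, p) \<in> necklaces" and U: "(U, q) \<in> necklaces" and W: "(W, r) \<in> necklaces"
    and f: "Arrow p f q \<in> Arr delta_f" and g: "Arrow q g r \<in> Arr delta_f"
    and UT: "U \<subseteq> f ` T" and WU: "W \<subseteq> g ` U"
  shows "(nactive T f \<bullet> ninert (f ` T) U) \<bullet> (nactive U g \<bullet> ninert (g ` U) W) =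
    nactive T (compose {..p} g f) \<bullet> ninert (compose {..p} g f ` T) W"
proof -
  have im: "compose {..p} g f ` T = g ` f ` T"
    unfolding image_image using necklacesD(5)[OF T] by (intro image_cong) (auto simp: compose_eq)
  note fT = necklaces_image[OF T f] and gU = necklaces_image[OF U g]
  note gfT = necklaces_image[OF fT g]
  have sub: "g ` U \<subseteq> g ` f ` T" by (rule image_mono[OF UT])
  have "(nactive T f \<bullet> ninert (f ` T) U) \<bullet> (nactive U g \<bullet> ninert (g ` U) W) =
      (nactive T f \<bullet> nactive (f ` T) g) \<bullet> (ninert (g ` f ` T) (g ` U) \<bullet> ninert (g ` U) W)"
    by (rule Comp_exchange[OF interchange[OF fT U UT g]])
      (simp_all only: nactive_Arr[OF T f] ninert_Arr[OF fT U UT] nactive_Arr[OF U g]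
        ninert_Arr[OF gU W WU] nactive_Arr[OF fT g] ninert_Arr[OF gfT gU sub])
  also have "\<dots> = nactive T (compose {..p} g f) \<bullet> ninert (g ` f ` T) W"
    unfolding nactive_Comp[OF T f g] ninert_Comp[OF gfT gU W WU sub] ..
  finally show ?thesis by (simp add: im)
qed

lemma nec_Idn:
  assumes T: "(T, p) \<in> necklaces"
  shows "nactive T (\<lambda>i\<in>{..p}. i) \<bullet> ninert T T = Idn C (nobj T)"
proof -
  note nT = necklacesD[OF T]
  have c: "s \<le> t \<and> t \<le> p" if "(s, t) \<in> set (consec T)" for s t
    using consec_mem[OF nT(1) that] nT(5) by auto
  \<comment> \<open>Between consecutive joints the gap list has one entry m, and
    \<open>comul [m]\<close> is an identity because \<open>mu m 0\<close> is.\<close>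
  have "comul (gaps (T \<inter> {s..t})) = Idn C (Xo (t - s))" if "(s, t) \<in> set (consec T)" for s t
    using consec_between[OF nT(1) that] consec_mem[OF nT(1) that] consec_insert[of "{t}" s]
    by (simp add: gaps_def)
  then have 1: "ninert T T = tens (map (\<lambda>i. Idn C (case i of (s, t) \<Rightarrow> Xo (t - s))) (consec T))"
    unfolding ninert_def by (auto intro!: arg_cong[where f=tens])
  have 2: "nactive T (\<lambda>i\<in>{..p}. i) = tens (map (\<lambda>i. Idn C (case i of (s, t) \<Rightarrow> Xo (t - s))) (consec T))"
    unfolding nactive_def using c
    by (auto intro!: arg_cong[where f=tens] simp: seg_Idn Xa_Idn simp del: delta_simps)
  have "tens (map (\<lambda>i. Idn C (case i of (s, t) \<Rightarrow> Xo (t - s))) (consec T)) = Idn C (nobj T)"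
    by (subst tens_Idn) (auto simp: nobj_def gaps_def o_def case_prod_unfold)
  then show ?thesis unfolding 1 2 by simp
qed

end

section \<open>Normalising the counit\<close>

locale strict_colax = strict_semicolax C ten Xo Xa mu
  for C :: "('x list, 'b, 'z) cat_scheme" (structure) and ten (infixr "\<star>" 70)
    and Xo :: "nat \<Rightarrow> 'x list" and Xa :: "mon_map \<Rightarrow> 'b" and mu :: "nat \<Rightarrow> nat \<Rightarrow> 'b" +
  fixes eps :: 'b
  assumes Dom_eps [simp]: "Dom C eps = Xo 0"
    and Cod_eps [simp]: "Cod C eps = []"
    and iso_eps [simp]: "is_iso C eps"
    and counit_left: "(eps \<star> Idn C (Xo n)) \<bullet> mu 0 n = Idn C (Xo n)"
    and counit_right: "(Idn C (Xo n) \<star> eps) \<bullet> mu n 0 = Idn C (Xo n)"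
begin

text \<open>Replacing \<open>X\<^sub>0\<close> by the unit along the counit makes the functor normal.\<close>

definition norm :: "nat \<Rightarrow> 'b" where
  "norm n = (if n = 0 then eps else Idn C (Xo n))"

definition Yo :: "nat \<Rightarrow> 'x list" where
  "Yo n = (if n = 0 then [] else Xo n)"

definition Ya :: "mon_map \<Rightarrow> 'b" where
  "Ya f = norm (src f) \<bullet> Xa f \<bullet> inv_arr C (norm (tgt f))"

definition nu :: "nat \<Rightarrow> nat \<Rightarrow> 'b" where
  "nu m n = (norm m \<star> norm n) \<bullet> mu m n \<bullet> inv_arr C (norm (m + n))"

text \<open>The unnormalised iterated comultiplication, ending in the counit as
  \<open>comult\<close> does; \<open>comul_pos\<close> compares it with the normalised one.\<close>

fun comulX :: "nat list \<Rightarrow> 'b" where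
  "comulX [] = eps"
| "comulX (n # ns) = (Idn C (Xo n) \<star> comulX ns) \<bullet> mu n (sum_list ns)"

lemma eps_Arr [simp]: "eps \<in> Arr C"
  by (rule iso_Arr) simp

lemma Yo_Ob [simp]: "Yo n \<in> Ob C"
  by (simp add: Yo_def)

lemma norm_Arr [simp]: "norm n \<in> Arr C" "Dom C (norm n) = Xo n" "Cod C (norm n) = Yo n"
  "is_iso C (norm n)"
  by (simp_all add: norm_def Yo_def)

lemma delta_f_Comp_Arr:
  assumes "f \<in> Arr delta_f" "g \<in> Arr delta_f" "src g = tgt f"
  shows "g \<bullet>\<^bsub>delta_f\<^esub> f \<in> Arr delta_f" "src (g \<bullet>\<^bsub>delta_f\<^esub> f) = src f" "tgt (g \<bullet>\<^bsub>delta_f\<^esub> f) = tgt g"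
  using category.Arr_Comp[OF category_delta_f, of f g] assms by simp_all

lemma Ya_Comp:
  assumes "f \<in> Arr delta_f" "g \<in> Arr delta_f" "src g = tgt f"
  shows "Ya (g \<bullet>\<^bsub>delta_f\<^esub> f) = Ya f \<bullet> Ya g"
  using assms delta_f_Comp_Arr(2,3)[OF assms] unfolding Ya_def Xa_Comp[OF assms] by simp

text \<open>\<open>nu\<close> is \<open>mu\<close> conjugated by \<open>norm\<close>. The inner
  isomorphisms cancel, and both sides become \<open>mu_coassoc\<close> conjugated by the product of
  three \<open>norm\<close> arrows.\<close>

lemma nu_coassoc: "(nu k m \<star> Idn C (Yo n)) \<bullet> nu (k + m) n = (Idn C (Yo k) \<star> nu m n) \<bullet> nu k (m + n)"
proof -
  have "(nu k m \<star> Idn C (Yo n)) \<bullet> nu (k + m) n =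
      ((nu k m \<star> Idn C (Yo n)) \<bullet> (norm (k + m) \<star> norm n)) \<bullet> mu (k + m) n \<bullet> inv_arr C (norm (k + m + n))"
    unfolding nu_def by simp
  also have "(nu k m \<star> Idn C (Yo n)) \<bullet> (norm (k + m) \<star> norm n) =
      (((norm k \<star> norm m) \<bullet> mu k m) \<star> (norm n \<bullet> Idn C (Xo n)))"
    by (subst ten_Comp[symmetric]) (simp_all add: nu_def)
  also have "\<dots> = ((norm k \<star> norm m) \<star> norm n) \<bullet> (mu k m \<star> Idn C (Xo n))"
    by (subst ten_Comp) simp_all
  also have "(\<dots>) \<bullet> mu (k + m) n \<bullet> inv_arr C (norm (k + m + n)) =
      (norm k \<star> norm m \<star> norm n) \<bullet> ((mu k m \<star> Idn C (Xo n)) \<bullet> mu (k + m) n) \<bullet> inv_arr C (norm (k + m + n))"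
    by (simp add: ten_assoc)
  also have "\<dots> = ((norm k \<star> (norm m \<star> norm n)) \<bullet> (Idn C (Xo k) \<star> mu m n)) \<bullet> mu k (m + n) \<bullet>
      inv_arr C (norm (k + m + n))"
    unfolding mu_coassoc by (simp add: add.assoc)
  also have "(norm k \<star> (norm m \<star> norm n)) \<bullet> (Idn C (Xo k) \<star> mu m n) =
      (Idn C (Yo k) \<bullet> norm k) \<star> (nu m n \<bullet> norm (m + n))"
    by (subst ten_Comp[symmetric]) (simp_all add: nu_def)
  also have "\<dots> = (Idn C (Yo k) \<star> nu m n) \<bullet> (norm k \<star> norm (m + n))"
    by (subst ten_Comp) (simp_all add: nu_def)
  also have "(\<dots>) \<bullet> mu k (m + n) \<bullet> inv_arr C (norm (k + m + n)) = (Idn C (Yo k) \<star> nu m n) \<bullet> nu k (m + n)"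
    unfolding nu_def by (simp add: add.assoc)
  finally show ?thesis .
qed

lemma nu_natural:
  assumes "f \<in> Arr delta_f" "g \<in> Arr delta_f"
  shows "nu (src f) (src g) \<bullet> Ya (f \<odot>\<^bsub>delta_f\<^esub> g) = (Ya f \<star> Ya g) \<bullet> nu (tgt f) (tgt g)"
proof -
  let ?h = "f \<odot>\<^bsub>delta_f\<^esub> g"
  have fg: "?h \<in> Arr delta_f" "src ?h = src f + src g" "tgt ?h = tgt f + tgt g"
    by (rule delta_f_TenA_Arr[OF assms]) (simp_all add: delta_f_def)
  have "nu (src f) (src g) \<bullet> Ya ?h =
      (norm (src f) \<star> norm (src g)) \<bullet> (mu (src f) (src g) \<bullet> Xa ?h) \<bullet> inv_arr C (norm (tgt f + tgt g))"
    using fg unfolding nu_def Ya_def by simp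
  also have "\<dots> = ((norm (src f) \<star> norm (src g)) \<bullet> (Xa f \<star> Xa g)) \<bullet> mu (tgt f) (tgt g) \<bullet>
      inv_arr C (norm (tgt f + tgt g))"
    unfolding mu_natural[OF assms] using assms by simp
  also have "(norm (src f) \<star> norm (src g)) \<bullet> (Xa f \<star> Xa g) =
      (Ya f \<bullet> norm (tgt f)) \<star> (Ya g \<bullet> norm (tgt g))"
    by (subst ten_Comp[symmetric]) (use assms in \<open>simp_all add: Ya_def\<close>)
  also have "\<dots> = (Ya f \<star> Ya g) \<bullet> (norm (tgt f) \<star> norm (tgt g))"
    by (subst ten_Comp) (use assms in \<open>simp_all add: Ya_def\<close>)
  also have "(\<dots>) \<bullet> mu (tgt f) (tgt g) \<bullet> inv_arr C (norm (tgt f + tgt g)) =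
      (Ya f \<star> Ya g) \<bullet> nu (tgt f) (tgt g)"
    using assms by (simp add: nu_def Ya_def)
  finally show ?thesis .
qed

text \<open>Factoring \<open>eps\<close> out of \<open>norm 0 \<star> norm n\<close> exposes the
  counit law, so conjugation by \<open>norm\<close> turns it into strict normality.\<close>

lemma nu_0_left: "nu 0 n = Idn C (Yo n)"
proof -
  have "norm 0 \<star> norm n = (Idn C [] \<bullet> eps) \<star> (norm n \<bullet> Idn C (Xo n))"
    by (simp add: norm_def)
  also have "\<dots> = (Idn C [] \<star> norm n) \<bullet> (eps \<star> Idn C (Xo n))"
    by (subst ten_Comp) simp_all
  finally have "nu 0 n = norm n \<bullet> ((eps \<star> Idn C (Xo n)) \<bullet> mu 0 n) \<bullet> inv_arr C (norm n)"
    by (simp add: nu_def)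
  then show ?thesis unfolding counit_left by simp
qed

lemma nu_0_right: "nu n 0 = Idn C (Yo n)"
proof -
  have "norm n \<star> norm 0 = (norm n \<bullet> Idn C (Xo n)) \<star> (Idn C [] \<bullet> eps)"
    by (simp add: norm_def)
  also have "\<dots> = (norm n \<star> Idn C []) \<bullet> (Idn C (Xo n) \<star> eps)"
    by (subst ten_Comp) simp_all
  finally have "nu n 0 = norm n \<bullet> ((Idn C (Xo n) \<star> eps) \<bullet> mu n 0) \<bullet> inv_arr C (norm n)"
    by (simp add: nu_def)
  then show ?thesis unfolding counit_right by simp
qed

sublocale N: normal_colax C ten Yo Ya nu
proof
  show "Ya (Idn delta n) = Idn C (Yo n)" for n
    by (simp add: Ya_def Xa_Idn del: delta_simps) (simp add: Xa_Idn[simplified])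
  show "Ya (g \<bullet>\<^bsub>delta_f\<^esub> f) = Ya f \<bullet> Ya g"
    if "f \<in> Arr delta_f" "g \<in> Arr delta_f" "src g = tgt f" for f g
    using that by (rule Ya_Comp)
  show "nu (src f) (src g) \<bullet> Ya (f \<odot>\<^bsub>delta_f\<^esub> g) = (Ya f \<star> Ya g) \<bullet> nu (tgt f) (tgt g)"
    if "f \<in> Arr delta_f" "g \<in> Arr delta_f" for f g
    using that by (rule nu_natural)
  show "(nu k m \<star> Idn C (Yo n)) \<bullet> nu (k + m) n = (Idn C (Yo k) \<star> nu m n) \<bullet> nu k (m + n)" for k m n
    by (rule nu_coassoc)
qed (simp_all add: Ya_def nu_def[of _ "Suc _"] nu_0_left nu_0_right, simp_all add: nu_def Yo_def)

lemma comulX_Arr [simp]: "comulX ns \<in> Arr C" "Dom C (comulX ns) = Xo (sum_list ns)"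
  "Cod C (comulX ns) = concat (map Xo ns)"
  by (induction ns) auto

lemma tens_norm [simp]: "tens (map norm ns) \<in> Arr C"
  "Dom C (tens (map norm ns)) = concat (map Xo ns)" "Cod C (tens (map norm ns)) = concat (map Yo ns)"
  by (induction ns) auto

lemma comul_eq: "N.comul ns = tens (map norm ns) \<bullet> comulX ns \<bullet> inv_arr C (norm (sum_list ns))"
proof (induction ns)
  case Nil
  then show ?case by (simp add: norm_def)
next
  case (Cons n ns)
  let ?s = "sum_list ns" and ?t = "tens (map norm ns)"
  have "N.comul (n # ns) = ((Idn C (Yo n) \<star> N.comul ns) \<bullet> (norm n \<star> norm ?s)) \<bullet> mu n ?s \<bullet>
      inv_arr C (norm (n + ?s))"
    by (simp add: nu_def)
  also have "(Idn C (Yo n) \<star> N.comul ns) \<bullet> (norm n \<star> norm ?s) = (norm n \<bullet> Idn C (Xo n)) \<star> (?t \<bullet> comulX ns)"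
    by (subst ten_Comp[symmetric]) (simp_all add: Cons.IH)
  also have "\<dots> = (norm n \<star> ?t) \<bullet> (Idn C (Xo n) \<star> comulX ns)"
    by (subst ten_Comp) simp_all
  finally show ?case by simp
qed

text \<open>\<open>norm\<close> differs from an identity only at 0, so the conjugation in
  \<open>comul_eq\<close> is trivial for positive entries; nonemptiness makes the total positive
  too. The gap lists inside inert maps are of this kind, so they do not notice the
  normalisation.\<close>

lemma comul_pos:
  assumes "ns \<noteq> []" "0 \<notin> set ns"
  shows "N.comul ns = comulX ns"
proof -
  have "tens (map norm ns) = Idn C (concat (map Xo ns))"
    using assms(2) by (induction ns) (auto simp: norm_def image_subset_iff)
  moreover have "norm (sum_list ns) = Idn C (Xo (sum_list ns))"
    using assms by (cases ns) (auto simp: norm_def)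
  ultimately show ?thesis by (simp add: comul_eq)
qed

lemma ninert_eq:
  assumes "(T, p) \<in> necklaces" "U \<subseteq> T"
  shows "N.ninert T U = tens (map (\<lambda>(u, v). comulX (gaps (T \<inter> {u..v}))) (consec U))"
  unfolding N.ninert_def
proof (intro arg_cong[where f=tens] map_cong refl)
  fix i assume "i \<in> set (consec U)"
  then obtain u v where i: "i = (u, v)" and uv: "(u, v) \<in> set (consec U)"
    by (metis surj_pair)
  note r = N.restrict_consec[OF uv assms(2) necklacesD(1)[OF assms(1)]]
  have "u < v" using consec_mem[OF finite_subset[OF assms(2) necklacesD(1)[OF assms(1)]] uv] by simp
  then have "gaps (T \<inter> {u..v}) \<noteq> []" using r(5) by auto
  moreover have "0 \<notin> set (gaps (T \<inter> {u..v}))"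
    by (rule gaps_pos[OF r(1)])
  ultimately show "(case i of (u, v) \<Rightarrow> N.comul (gaps (T \<inter> {u..v}))) =
      (case i of (u, v) \<Rightarrow> comulX (gaps (T \<inter> {u..v})))"
    unfolding i by (simp add: comul_pos)
qed

text \<open>In each factor of \<open>N.nactive\<close> the source length t - s is positive, so one
  \<open>norm\<close> is an identity. The other one is the counit exactly where f collapses the
  bead; the product of its inverses becomes \<open>fill\<close>.\<close>

lemma nactive_eq:
  assumes T: "(T, p) \<in> necklaces" and f: "Arrow p f q \<in> Arr delta_f"
  shows "N.nactive T f = tens (map (\<lambda>(s, t). Xa (seg f s t)) (consec T)) \<bullet>
    tens (map (\<lambda>(s, t). inv_arr C (norm (f t - f s))) (consec T))"
proof -
  have seg: "seg f s t \<in> Arr delta_f" "s < t" if "(s, t) \<in> set (consec T)" for s t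
    using consec_mem[OF necklacesD(1)[OF T] that] necklacesD(5)[OF T]
    by (auto intro!: seg_Arr[OF N.delta_fD(1)[OF f]])
  let ?a = "\<lambda>i. case i of (s, t) \<Rightarrow> Xa (seg f s t)"
  let ?b = "\<lambda>i. case i of (s, t) \<Rightarrow> inv_arr C (norm (f t - f s))"
  have "tens (map ?a (consec T)) \<bullet> tens (map ?b (consec T)) = tens (map (\<lambda>i. ?a i \<bullet> ?b i) (consec T))"
    using seg by (intro tens_Comp[symmetric]) auto
  also have "\<dots> = N.nactive T f"
    unfolding N.nactive_def
  proof (intro arg_cong[where f=tens] map_cong refl)
    fix i assume "i \<in> set (consec T)"
    then obtain s t where i: "i = (s, t)" and st: "(s, t) \<in> set (consec T)"
      by (metis surj_pair)
    then show "?a i \<bullet> ?b i = (case i of (s, t) \<Rightarrow> Ya (seg f s t))"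
      unfolding i using seg[OF st] by (simp add: Ya_def norm_def[of "t - s"])
  qed
  finally show ?thesis by simp
qed

end

section \<open>The functor on necklaces of a strongly unital colax monoidal functor\<close>

lemma op_moncat_simps [simp]:
  "Ob (op_moncat C) = Ob C" "Arr (op_moncat C) = Arr C" "Dom (op_moncat C) = Cod C"
  "Cod (op_moncat C) = Dom C" "Idn (op_moncat C) = Idn C" "Comp (op_moncat C) g f = f \<bullet>\<^bsub>C\<^esub> g"
  "TenO (op_moncat C) = TenO C" "TenA (op_moncat C) = TenA C" "Unit (op_moncat C) = Unit C"
  "Assoc (op_moncat C) x y z = inv_arr C (Assoc C x y z)"
  "LUn (op_moncat C) x = inv_arr C (LUn C x)" "RUn (op_moncat C) x = inv_arr C (RUn C x)"
  by (simp_all add: op_moncat_def)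

lemma op_cat_simps [simp]:
  "Ob (op_cat C) = Ob C" "Arr (op_cat C) = Arr C" "Dom (op_cat C) = Cod C"
  "Cod (op_cat C) = Dom C" "Idn (op_cat C) = Idn C" "Comp (op_cat C) g f = f \<bullet>\<^bsub>C\<^esub> g"
  by (simp_all add: op_cat_def)

lemma mk_functor_simps [simp]:
  "x \<in> Ob J \<Longrightarrow> FO (mk_functor J fo fa) x = fo x" "f \<in> Arr J \<Longrightarrow> FA (mk_functor J fo fa) f = fa f"
  by (simp_all add: mk_functor_def)

lemma nec_simps [simp]:
  "Ob nec = necklaces" "Dom nec = src" "Cod nec = tgt"
  "Comp nec g f = Arrow (src f) (compose {..snd (src f)} (amap g) (amap f)) (tgt g)"
  "Idn nec (T, p) = Arrow (T, p) (\<lambda>i\<in>{..p}. i) (T, p)"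
  by (simp_all add: nec_def)

lemma nec_Arr:
  "Arrow (T, p) f (U, q) \<in> Arr nec \<longleftrightarrow> (T, p) \<in> necklaces \<and> (U, q) \<in> necklaces \<and>
    Arrow p f q \<in> Arr delta_f \<and> U \<subseteq> f ` T"
  by (auto simp: nec_def)

lemma nec_ArrE:
  assumes "\<phi> \<in> Arr nec"
  obtains T p f U q where "\<phi> = Arrow (T, p) f (U, q)" "(T, p) \<in> necklaces" "(U, q) \<in> necklaces"
    "Arrow p f q \<in> Arr delta_f" "U \<subseteq> f ` T"
  using assms by (auto simp: nec_def)

lemma list_ten_Arrow: "list_ten D (Arrow xs f xs') (Arrow ys g ys') =
    Arrow (xs @ ys) (append_iso D xs' ys' \<bullet>\<^bsub>D\<^esub> (f \<odot>\<^bsub>D\<^esub> g) \<bullet>\<^bsub>D\<^esub> inv_arr D (append_iso D xs ys)) (xs' @ ys')"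
  by (simp add: list_ten_def)

lemma inv_delta_f_Idn: "inv_arr delta_f (Arrow n (\<lambda>i\<in>{..n}. i) n) = Arrow n (\<lambda>i\<in>{..n}. i) n"
  using category.inv_arr_Idn[OF category_delta_f, of n] by simp

lemma category_nec: "category nec"
proof
  fix f assume "f \<in> Arr nec"
  then show "Dom nec f \<in> Ob nec" "Cod nec f \<in> Ob nec" by (auto elim!: nec_ArrE)
next
  fix x assume "x \<in> Ob nec"
  moreover have "Arrow n (\<lambda>i\<in>{..n}. i) n \<in> Arr delta_f" for n
    using category.Arr_Idn(1)[OF category_delta_f, of n] by simp
  ultimately show "Idn nec x \<in> hom nec x x"
    by (cases x) (auto simp: hom_def nec_Arr dest: necklacesD(5))
next
  fix f g x y z assume "f \<in> hom nec x y" "g \<in> hom nec y z"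
  then have f: "f \<in> Arr nec" "src f = x" "tgt f = y" and g: "g \<in> Arr nec" "src g = y" "tgt g = z"
    by (auto simp: hom_def)
  from f obtain T p f' U q where f': "f = Arrow (T, p) f' (U, q)" "(T, p) \<in> necklaces"
    "Arrow p f' q \<in> Arr delta_f" "U \<subseteq> f' ` T" by (elim nec_ArrE)
  from g obtain W r g' U' q' where g': "g = Arrow (U', q') g' (W, r)" "(W, r) \<in> necklaces"
    "Arrow q' g' r \<in> Arr delta_f" "W \<subseteq> g' ` U'" by (elim nec_ArrE)
  have [simp]: "U' = U" "q' = q" using f g f' g' by auto
  have "Arrow p (compose {..p} g' f') r \<in> Arr delta_f"
    using category.Arr_Comp(1)[OF category_delta_f, of "Arrow p f' q" "Arrow q g' r"] f' g' by simp
  moreover have "W \<subseteq> compose {..p} g' f' ` T"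
  proof
    fix w assume "w \<in> W"
    then obtain t where "t \<in> T" "w = g' (f' t)" using f'(4) g'(4) by auto blast
    then show "w \<in> compose {..p} g' f' ` T"
      using necklacesD(5)[OF f'(2)] by (auto simp: compose_def image_iff)
  qed
  ultimately show "g \<bullet>\<^bsub>nec\<^esub> f \<in> hom nec x z"
    using f'(2) g'(2) f(2) g(3) unfolding f'(1) g'(1) by (auto simp: hom_def nec_Arr)
next
  fix f x y assume "f \<in> hom nec x y"
  then show "Idn nec y \<bullet>\<^bsub>nec\<^esub> f = f" "f \<bullet>\<^bsub>nec\<^esub> Idn nec x = f"
    by (auto simp: hom_def delta_f_Arr delta_Arr compose_def extensional_def fun_eq_iff elim!: nec_ArrE)
next
  fix f g h w x y z assume "f \<in> hom nec w x" "g \<in> hom nec x y" "h \<in> hom nec y z"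
  then show "(h \<bullet>\<^bsub>nec\<^esub> g) \<bullet>\<^bsub>nec\<^esub> f = h \<bullet>\<^bsub>nec\<^esub> g \<bullet>\<^bsub>nec\<^esub> f"
    by (auto simp: hom_def delta_f_Arr delta_Arr compose_def fun_eq_iff elim!: nec_ArrE)
qed

section \<open>From the strict category back to the given monoidal category\<close>

locale strongly_unital = monoidal_category D
  for D :: "('o, 'a, 'z) moncat_scheme" (structure) +
  fixes X :: "(nat, mon_map, 'o, 'a) colax"
  assumes colax: "is_colax_monoidal (op_moncat delta_f) D X"
    and unital [simp]: "is_iso D (Eps X)"
begin

lemma FO_Ob [simp]: "FO X n \<in> Ob D"
  using colax by (auto simp: is_colax_monoidal_def is_functor_def)

lemma FA_Arr [simp]:
  assumes "f \<in> Arr delta_f"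
  shows "FA X f \<in> Arr D" "Dom D (FA X f) = FO X (tgt f)" "Cod D (FA X f) = FO X (src f)"
  using colax assms by (auto simp: is_colax_monoidal_def is_functor_def hom_def)

lemma Mu_Arr [simp]: "Mu X m n \<in> Arr D" "Dom D (Mu X m n) = FO X (m + n)"
  "Cod D (Mu X m n) = FO X m \<otimes> FO X n"
  using colax by (auto simp: is_colax_monoidal_def hom_def)

lemma Eps_Arr [simp]: "Eps X \<in> Arr D" "Dom D (Eps X) = FO X 0" "Cod D (Eps X) = \<one>"
  using colax by (auto simp: is_colax_monoidal_def hom_def)

abbreviation "list_ob n \<equiv> [FO X n]"
abbreviation "list_arr f \<equiv> Arrow [FO X (tgt f)] (FA X f) [FO X (src f)]"
abbreviation "list_mu m n \<equiv> Arrow [FO X (m + n)] (Mu X m n) [FO X m, FO X n]"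
abbreviation "list_eps \<equiv> Arrow [FO X 0] (Eps X) []"

lemma inverse_pair_list_cat:
  assumes "is_iso D f" "Dom D f = tens_list D xs" "Cod D f = tens_list D ys"
    and "set xs \<subseteq> Ob D" "set ys \<subseteq> Ob D"
  shows "inverse_pair (list_cat D) (Arrow xs f ys) (Arrow ys (inv_arr D f) xs)"
  using assms iso_Arr[OF assms(1)] by (auto simp: inverse_pair_def hom_def)

lemmas list_ten_simps = list_ten_Arrow append_iso_singleton append_iso_Nil_right cons_iso_def

lemma strict_colax: "strict_colax (list_cat D) (list_ten D) list_ob list_arr list_mu list_eps"
proof -
  interpret L: strict_monoidal "list_cat D" "list_ten D" by (rule strict_monoidal_list_cat)
  have Idn: "FA X (Idn delta n) = Idn D (FO X n)" for n
    using colax by (auto simp: is_colax_monoidal_def is_functor_def)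
  show ?thesis
  proof
    show "list_arr (Idn delta n) = Idn (list_cat D) (list_ob n)" for n
      using Idn[of n] by simp
    show "list_arr (g \<bullet>\<^bsub>delta_f\<^esub> f) = list_arr f \<bullet>\<^bsub>list_cat D\<^esub> list_arr g"
      if "f \<in> Arr delta_f" "g \<in> Arr delta_f" "src g = tgt f" for f g
    proof -
      have "FA X (g \<bullet>\<^bsub>delta_f\<^esub> f) = FA X f \<bullet> FA X g"
        using colax that unfolding is_colax_monoidal_def is_functor_def by fastforce
      then show ?thesis by simp
    qed
    show "list_mu (src f) (src g) \<bullet>\<^bsub>list_cat D\<^esub> list_arr (f \<odot>\<^bsub>delta_f\<^esub> g) =
        list_ten D (list_arr f) (list_arr g) \<bullet>\<^bsub>list_cat D\<^esub> list_mu (tgt f) (tgt g)"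
      if "f \<in> Arr delta_f" "g \<in> Arr delta_f" for f g
    proof -
      have "Mu X (src f) (src g) \<bullet> FA X (f \<odot>\<^bsub>delta_f\<^esub> g) = (FA X f \<odot> FA X g) \<bullet> Mu X (tgt f) (tgt g)"
        using colax that by (simp add: is_colax_monoidal_def)
      then show ?thesis
        using that by (simp add: list_ten_simps) (simp add: delta_f_def)
    qed
    show "list_ten D (list_mu k m) (Idn (list_cat D) (list_ob n)) \<bullet>\<^bsub>list_cat D\<^esub> list_mu (k + m) n =
        list_ten D (Idn (list_cat D) (list_ob k)) (list_mu m n) \<bullet>\<^bsub>list_cat D\<^esub> list_mu k (m + n)" for k m n
    proof -
      have "Assoc D (FO X k) (FO X m) (FO X n) \<bullet> (Mu X k m \<odot> Idn D (FO X n)) \<bullet> Mu X (k + m) n =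
          (Idn D (FO X k) \<odot> Mu X m n) \<bullet> Mu X k (m + n) \<bullet> Idn D (FO X (k + m + n))"
        using colax Idn by (simp add: is_colax_monoidal_def inv_delta_f_Idn)
      \<comment> \<open>With one-element lists this is the only rebracketing that is not an
        identity, so strict coassociativity is the given law with \<open>Assoc\<close>.\<close>
      moreover have "append_iso D [FO X k, FO X m] [FO X n] = Assoc D (FO X k) (FO X m) (FO X n)"
        by (subst append_iso.simps(2)) (simp add: list_ten_simps)
      ultimately show ?thesis
        by (simp add: list_ten_simps add.assoc)
    qed
    show "list_ten D list_eps (Idn (list_cat D) (list_ob n)) \<bullet>\<^bsub>list_cat D\<^esub> list_mu 0 n =
        Idn (list_cat D) (list_ob n)" for n
    proof -
      have "LUn D (FO X n) \<bullet> (Eps X \<odot> Idn D (FO X n)) \<bullet> Mu X 0 n = Idn D (FO X n)"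
        using colax Idn by (simp add: is_colax_monoidal_def inv_delta_f_Idn)
      then show ?thesis by (simp add: list_ten_simps)
    qed
    show "list_ten D (Idn (list_cat D) (list_ob n)) list_eps \<bullet>\<^bsub>list_cat D\<^esub> list_mu n 0 =
        Idn (list_cat D) (list_ob n)" for n
    proof -
      have "RUn D (FO X n) \<bullet> (Idn D (FO X n) \<odot> Eps X) \<bullet> Mu X n 0 = Idn D (FO X n)"
        using colax Idn by (simp add: is_colax_monoidal_def inv_delta_f_Idn)
      then show ?thesis by (simp add: list_ten_simps)
    qed
    show "is_iso (list_cat D) list_eps"
      unfolding is_iso_def by (rule exI, rule inverse_pair_list_cat) simp_all
  qed simp_all
qed

sublocale L: strict_colax "list_cat D" "list_ten D" list_ob list_arr list_mu list_eps
  by (rule strict_colax)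

lemma comult_Arr [simp]: "comult D X ns \<in> Arr D" "Dom D (comult D X ns) = FO X (sum_list ns)"
  "Cod D (comult D X ns) = tens_list D (map (FO X) ns)"
  by (induction ns) (simp_all add: image_subset_iff)

text \<open>First of the lemmas which show that a strict construction has the arrow of the
  corresponding definition underneath, its two lists recording only source and target.\<close>

lemma comulX_eq: "L.comulX ns = Arrow [FO X (sum_list ns)] (comult D X ns) (map (FO X) ns)"
  by (induction ns) (simp_all add: list_ten_simps image_subset_iff)

lemma comults_Arr [simp]: "comults D X nss \<in> Arr D"
  "Dom D (comults D X nss) = tens_list D (map (\<lambda>ns. FO X (sum_list ns)) nss)"
  "Cod D (comults D X nss) = tens_list D (map (FO X) (concat nss))"
  by (induction nss) (simp_all add: image_subset_iff)

lemma comults_eq: "L.tens (map L.comulX nss) =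
    Arrow (map (\<lambda>ns. FO X (sum_list ns)) nss) (comults D X nss) (map (FO X) (concat nss))"
  by (induction nss) (simp_all add: comulX_eq list_ten_Arrow append_iso_singleton image_subset_iff)

lemma tens_list_arr_Arr [simp]:
  assumes "set fs \<subseteq> Arr D"
  shows "tens_list_arr D fs \<in> Arr D" "Dom D (tens_list_arr D fs) = tens_list D (map (Dom D) fs)"
    "Cod D (tens_list_arr D fs) = tens_list D (map (Cod D) fs)"
  using assms by (induction fs rule: induct_list012) simp_all

lemma tens_list_arr_eq: "set fs \<subseteq> Arr D \<Longrightarrow> L.tens (map (\<lambda>f. Arrow [Dom D f] f [Cod D f]) fs) =
    Arrow (map (Dom D) fs) (tens_list_arr D fs) (map (Cod D) fs)"
proof (induction fs rule: induct_list012)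
  case (2 f)
  then show ?case using L.ten_Nil[of "Arrow [Dom D f] f [Cod D f]"] by simp
next
  case (3 f g fs)
  have "set (map (Dom D) fs) \<subseteq> Ob D" "set (map (Cod D) fs) \<subseteq> Ob D" using 3 by auto
  with 3 show ?case
    by (simp add: list_ten_simps)
qed simp

lemma inv_eps: "inv_arr (list_cat D) list_eps = Arrow [] (inv_arr D (Eps X)) [FO X 0]"
  by (rule L.inv_arr_eqI, rule inverse_pair_list_cat) simp_all

lemma fill_Arr [simp]: "fill D X ns \<in> Arr D"
  "Dom D (fill D X ns) = tens_list D (map (FO X) (filter (\<lambda>n. n \<noteq> 0) ns))"
  "Cod D (fill D X ns) = tens_list D (map (FO X) ns)"
  by (induction ns) (simp_all add: Let_def image_subset_iff del: neq0_conv)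

text \<open>At 0 the inverse of \<open>norm\<close> inserts X_0 from the empty list, elsewhere it is
  an identity; the product of these arrows is what the recursion of \<open>fill\<close> writes out
  with explicit unitors.\<close>

lemma fill_eq: "L.tens (map (\<lambda>n. inv_arr (list_cat D) (L.norm n)) ns) =
    Arrow (map (FO X) (filter (\<lambda>n. n \<noteq> 0) ns)) (fill D X ns) (map (FO X) ns)"
proof (induction ns)
  case (Cons n ns)
  have [simp]: "FO X ` A \<subseteq> Ob D" for A by auto
  show ?case
  proof (cases "n = 0")
    case True
    then show ?thesis
      using Cons by (simp add: L.norm_def inv_eps list_ten_Arrow append_iso_singleton Let_def)
  next
    case False
    have "inv_arr (list_cat D) (L.norm n) = Arrow [FO X n] (Idn D (FO X n)) [FO X n]"
      using False L.inv_arr_Idn[of "[FO X n]"] by (simp add: L.norm_def)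
    with False show ?thesis
      using Cons by (simp add: list_ten_Arrow append_iso_singleton Let_def)
  qed
qed simp

lemma nobj_eq:
  assumes "(T, p) \<in> necklaces"
  shows "L.N.nobj T = map (FO X) (gaps T)"
proof -
  have "concat (map L.Yo ns) = map (FO X) ns" if "0 \<notin> set ns" for ns
    using that by (induction ns) (auto simp: L.Yo_def)
  from this[OF gaps_pos[OF necklacesD(1)[OF assms]]] show ?thesis by (simp add: L.N.nobj_def)
qed

lemma inert_eq:
  assumes T: "(T, p) \<in> necklaces" and U: "(U, p) \<in> necklaces" and "U \<subseteq> T"
  shows "L.N.ninert T U = Arrow (map (FO X) (gaps U)) (inert_arr D X T U) (map (FO X) (gaps T))"
proof -
  have "L.N.ninert T U = L.tens (map L.comulX (map (\<lambda>(u, v). gaps (T \<inter> {u..v})) (consec U)))"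
    unfolding L.ninert_eq[OF T assms(3)] by (simp add: o_def case_prod_unfold)
  then have "amap (L.N.ninert T U) = inert_arr D X T U"
    unfolding comults_eq inert_arr_def by simp
  moreover have "src (L.N.ninert T U) = map (FO X) (gaps U)" "tgt (L.N.ninert T U) = map (FO X) (gaps T)"
    using L.N.ninert_Arr[OF assms] nobj_eq[OF T] nobj_eq[OF U] by simp_all
  ultimately show ?thesis by (cases "L.N.ninert T U") simp
qed

lemma active_eq:
  assumes T: "(T, p) \<in> necklaces" and f: "Arrow p f q \<in> Arr delta_f"
  shows "L.N.nactive T f = Arrow (map (FO X) (gaps (f ` T))) (active_arr D X T f) (map (FO X) (gaps T))"
proof -
  have seg: "seg f s t \<in> Arr delta_f" if "(s, t) \<in> set (consec T)" for s t
    using consec_mem[OF necklacesD(1)[OF T] that] necklacesD(5)[OF T]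
    by (auto intro!: seg_Arr[OF L.N.delta_fD(1)[OF f]])
  let ?fs = "map (\<lambda>(s, t). FA X (seg f s t)) (consec T)"
  have fs: "set ?fs \<subseteq> Arr D" using seg by auto
  have "L.tens (map (\<lambda>(s, t). list_arr (seg f s t)) (consec T)) =
      L.tens (map (\<lambda>f. Arrow [Dom D f] f [Cod D f]) ?fs)"
    using seg by (auto intro!: arg_cong[where f=L.tens])
  then have 1: "amap (L.tens (map (\<lambda>(s, t). list_arr (seg f s t)) (consec T))) = tens_list_arr D ?fs"
    unfolding tens_list_arr_eq[OF fs] by simp
  have "L.tens (map (\<lambda>(s, t). inv_arr (list_cat D) (L.norm (f t - f s))) (consec T)) =
      L.tens (map (\<lambda>n. inv_arr (list_cat D) (L.norm n)) (map (\<lambda>(s, t). f t - f s) (consec T)))"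
    by (simp add: o_def case_prod_unfold)
  then have 2: "amap (L.tens (map (\<lambda>(s, t). inv_arr (list_cat D) (L.norm (f t - f s))) (consec T))) =
      fill D X (map (\<lambda>(s, t). f t - f s) (consec T))"
    unfolding fill_eq by simp
  have "amap (L.N.nactive T f) = active_arr D X T f"
    unfolding L.nactive_eq[OF assms] active_arr_def seg_def[symmetric] by (simp only: list_cat_simps arrow.sel 1 2)
  moreover have "src (L.N.nactive T f) = map (FO X) (gaps (f ` T))" "tgt (L.N.nactive T f) = map (FO X) (gaps T)"
    using L.N.nactive_Arr[OF assms] nobj_eq[OF T] nobj_eq[OF necklaces_image[OF assms]] by simp_all
  ultimately show ?thesis by (cases "L.N.nactive T f") simp
qed

text \<open>The strict arrow of a necklace map. Its underlying arrow is the value of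
  \<open>nec_functor D X\<close>, so functoriality is read off from \<open>nec_Idn\<close> and
  \<open>nec_Comp\<close>.\<close>

definition nec_arr :: "nec_map \<Rightarrow> ('o list, 'a) arrow" where
  "nec_arr \<phi> = (case \<phi> of Arrow (T, p) f (U, q) \<Rightarrow> L.N.nactive T f \<bullet>\<^bsub>list_cat D\<^esub> L.N.ninert (f ` T) U)"

lemma nec_arr_eq:
  assumes "\<phi> \<in> Arr nec"
  shows "nec_arr \<phi> = Arrow (map (FO X) (gaps (fst (tgt \<phi>)))) (FA (nec_functor D X) \<phi>) (map (FO X) (gaps (fst (src \<phi>))))"
    "nec_arr \<phi> \<in> Arr (list_cat D)"
proof -
  obtain T p f U q where phi: "\<phi> = Arrow (T, p) f (U, q)" and T: "(T, p) \<in> necklaces"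
    and U: "(U, q) \<in> necklaces" and f: "Arrow p f q \<in> Arr delta_f" and UT: "U \<subseteq> f ` T"
    using assms by (elim nec_ArrE)
  note fT = necklaces_image[OF T f]
  show "nec_arr \<phi> = Arrow (map (FO X) (gaps (fst (tgt \<phi>)))) (FA (nec_functor D X) \<phi>) (map (FO X) (gaps (fst (src \<phi>))))"
    using assms unfolding nec_arr_def phi nec_functor_def
    by (simp add: active_eq[OF T f] inert_eq[OF fT U UT])
  show "nec_arr \<phi> \<in> Arr (list_cat D)"
    unfolding nec_arr_def phi arrow.case prod.case
    by (rule L.Arr_Comp(1)) (simp_all only: L.N.ninert_Arr[OF fT U UT] L.N.nactive_Arr[OF T f])
qed

lemma nec_functor: "is_functor (op_cat nec) D (nec_functor D X)"
proof -
  have FO: "FO (nec_functor D X) (T, p) = tens_list D (map (FO X) (gaps T))" if "(T, p) \<in> necklaces" for T p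
    using that by (simp add: nec_functor_def nec_obj_def)
  show ?thesis
    unfolding is_functor_def
  proof (intro conjI ballI impI)
    fix x assume "x \<in> Ob (op_cat nec)"
    then obtain T p where x: "x = (T, p)" "(T, p) \<in> necklaces" by (cases x) auto
    show "FO (nec_functor D X) x \<in> Ob D"
      unfolding x FO[OF x(2)] by (rule tens_list_Ob) auto
    have "Idn nec x \<in> Arr nec"
      using category.Arr_Idn(1)[OF category_nec, of x] x by simp
    moreover from this have "nec_arr (Idn nec x) = Idn (list_cat D) (L.N.nobj T)"
    proof -
      have "(\<lambda>i\<in>{..p}. i) ` T = T" using necklacesD(5)[OF x(2)] by force
      then show ?thesis
        unfolding x(1) nec_arr_def nec_simps arrow.case prod.case using L.N.nec_Idn[OF x(2)] by simp
    qed
    ultimately show "FA (nec_functor D X) (Idn (op_cat nec) x) = Idn D (FO (nec_functor D X) x)"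
      using nec_arr_eq(1)[of "Idn nec x"] FO[OF x(2)] nobj_eq[OF x(2)] by (simp add: x)
  next
    fix \<phi> assume "\<phi> \<in> Arr (op_cat nec)"
    then have phi: "\<phi> \<in> Arr nec" by simp
    have "src \<phi> \<in> necklaces" "tgt \<phi> \<in> necklaces"
      using phi by (auto elim!: nec_ArrE)
    then show "FA (nec_functor D X) \<phi> \<in> hom D (FO (nec_functor D X) (Dom (op_cat nec) \<phi>))
        (FO (nec_functor D X) (Cod (op_cat nec) \<phi>))"
      using nec_arr_eq(2)[OF phi] FO[of "fst (src \<phi>)" "snd (src \<phi>)"] FO[of "fst (tgt \<phi>)" "snd (tgt \<phi>)"]
      unfolding nec_arr_eq(1)[OF phi] by (simp add: hom_def)
  next
    fix \<psi> \<phi> assume "\<psi> \<in> Arr (op_cat nec)" "\<phi> \<in> Arr (op_cat nec)"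
      and eq: "Cod (op_cat nec) \<psi> = Dom (op_cat nec) \<phi>"
    then have phi: "\<phi> \<in> Arr nec" and psi: "\<psi> \<in> Arr nec" and eq: "src \<psi> = tgt \<phi>" by simp_all
    have comp: "\<psi> \<bullet>\<^bsub>nec\<^esub> \<phi> \<in> Arr nec"
      using category.Arr_Comp(1)[OF category_nec, of \<phi> \<psi>] phi psi eq by simp
    obtain T p f U q where phi': "\<phi> = Arrow (T, p) f (U, q)" and T: "(T, p) \<in> necklaces"
      and U: "(U, q) \<in> necklaces" and f: "Arrow p f q \<in> Arr delta_f" and UT: "U \<subseteq> f ` T"
      using phi by (elim nec_ArrE)
    obtain U' q' g W r where psi': "\<psi> = Arrow (U', q') g (W, r)" 
      and W: "(W, r) \<in> necklaces" and g: "Arrow q' g r \<in> Arr delta_f" and WU: "W \<subseteq> g ` U'"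
      using psi by (elim nec_ArrE)
    have [simp]: "U' = U" "q' = q" using eq phi' psi' by auto
    have "nec_arr (\<psi> \<bullet>\<^bsub>nec\<^esub> \<phi>) = nec_arr \<phi> \<bullet>\<^bsub>list_cat D\<^esub> nec_arr \<psi>"
      using L.N.nec_Comp[OF T U W f _ UT, of g] g WU unfolding nec_arr_def phi' psi' by simp
    then show "FA (nec_functor D X) (\<phi> \<bullet>\<^bsub>op_cat nec\<^esub> \<psi>) = FA (nec_functor D X) \<phi> \<bullet> FA (nec_functor D X) \<psi>"
      using nec_arr_eq(1)[OF comp] nec_arr_eq(1)[OF phi] nec_arr_eq(1)[OF psi] by simp
  qed
qed

end

section \<open>Coproducts\<close>

text \<open>Coproducts of bare families, freed from the discrete diagram;
  \<open>is_colimit_discrete\<close> translates. The index type is arbitrary, so flags, vertices and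
  pairs of vertices can all serve as indices.\<close>

definition is_coprod ::
  "('o, 'a, 'z) cat_scheme \<Rightarrow> 'i set \<Rightarrow> ('i \<Rightarrow> 'o) \<Rightarrow> 'o \<Rightarrow> ('i \<Rightarrow> 'a) \<Rightarrow> bool" where
  "is_coprod C A x L \<iota> \<longleftrightarrow> L \<in> Ob C \<and> (\<forall>i\<in>A. \<iota> i \<in> hom C (x i) L) \<and>
     (\<forall>M \<kappa>. M \<in> Ob C \<longrightarrow> (\<forall>i\<in>A. \<kappa> i \<in> hom C (x i) M) \<longrightarrow>
        (\<exists>!h. h \<in> hom C L M \<and> (\<forall>i\<in>A. h \<bullet>\<^bsub>C\<^esub> \<iota> i = \<kappa> i)))"

lemma discrete_cat_simps [simp]:
  "Ob (discrete_cat A) = A" "Arr (discrete_cat A) = A" "Dom (discrete_cat A) i = i"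
  "Cod (discrete_cat A) i = i" "Idn (discrete_cat A) i = i" "Comp (discrete_cat A) i j = j"
  by (simp_all add: discrete_cat_def)

lemma category_discrete_cat: "category (discrete_cat A)"
  by unfold_locales (auto simp: hom_def)

context category
begin

lemma is_coprodI:
  assumes "L \<in> Ob C" "\<And>i. i \<in> A \<Longrightarrow> \<iota> i \<in> hom C (x i) L"
    and "\<And>M \<kappa>. M \<in> Ob C \<Longrightarrow> (\<And>i. i \<in> A \<Longrightarrow> \<kappa> i \<in> hom C (x i) M) \<Longrightarrow>
      \<exists>h. h \<in> hom C L M \<and> (\<forall>i\<in>A. h \<bullet> \<iota> i = \<kappa> i)"
    and "\<And>M h h'. h \<in> hom C L M \<Longrightarrow> h' \<in> hom C L M \<Longrightarrow> (\<And>i. i \<in> A \<Longrightarrow> h \<bullet> \<iota> i = h' \<bullet> \<iota> i) \<Longrightarrow> h = h'"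
  shows "is_coprod C A x L \<iota>"
  unfolding is_coprod_def
proof (intro conjI ballI allI impI)
  fix M \<kappa> assume M: "M \<in> Ob C" "\<forall>i\<in>A. \<kappa> i \<in> hom C (x i) M"
  then obtain h where h: "h \<in> hom C L M" "\<forall>i\<in>A. h \<bullet> \<iota> i = \<kappa> i"
    using assms(3)[of M \<kappa>] by blast
  show "\<exists>!h. h \<in> hom C L M \<and> (\<forall>i\<in>A. h \<bullet> \<iota> i = \<kappa> i)"
  proof (rule ex1I[of _ h])
    fix k assume "k \<in> hom C L M \<and> (\<forall>i\<in>A. k \<bullet> \<iota> i = \<kappa> i)"
    then show "k = h" using h by (intro assms(4)[of k M h]) auto
  qed (use h in simp)
qed (use assms(1,2) in auto)

lemma coprod_Ob: "is_coprod C A x L \<iota> \<Longrightarrow> L \<in> Ob C"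
  by (simp add: is_coprod_def)

lemma coprod_hom: "is_coprod C A x L \<iota> \<Longrightarrow> i \<in> A \<Longrightarrow> \<iota> i \<in> hom C (x i) L"
  by (simp add: is_coprod_def)

lemma coprod_ex1:
  assumes "is_coprod C A x L \<iota>" "M \<in> Ob C" "\<And>i. i \<in> A \<Longrightarrow> \<kappa> i \<in> hom C (x i) M"
  shows "\<exists>!h. h \<in> hom C L M \<and> (\<forall>i\<in>A. h \<bullet> \<iota> i = \<kappa> i)"
  using assms unfolding is_coprod_def by blast

lemma coprod_ex:
  assumes "is_coprod C A x L \<iota>" "M \<in> Ob C" "\<And>i. i \<in> A \<Longrightarrow> \<kappa> i \<in> hom C (x i) M"
  obtains h where "h \<in> hom C L M" "\<And>i. i \<in> A \<Longrightarrow> h \<bullet> \<iota> i = \<kappa> i"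
  using coprod_ex1[OF assms] by blast

lemma coprod_ext:
  assumes "is_coprod C A x L \<iota>" "h \<in> hom C L M" "h' \<in> hom C L M"
    and "\<And>i. i \<in> A \<Longrightarrow> h \<bullet> \<iota> i = h' \<bullet> \<iota> i"
  shows "h = h'"
proof -
  have "h' \<bullet> \<iota> i \<in> hom C (x i) M" if "i \<in> A" for i
    using coprod_hom[OF assms(1) that] assms(3) by (rule Comp_hom)
  then have "\<exists>!k. k \<in> hom C L M \<and> (\<forall>i\<in>A. k \<bullet> \<iota> i = h' \<bullet> \<iota> i)"
    using assms(1,2) hom_Ob by (intro coprod_ex1) auto
  then show ?thesis using assms(2-4) by blast
qed

lemma is_colimit_discrete:
  assumes "\<And>i. i \<in> A \<Longrightarrow> x i \<in> Ob C"
  shows "is_colimit C (discrete_cat A) (mk_functor (discrete_cat A) x (\<lambda>i. Idn C (x i))) L \<iota> \<longleftrightarrow>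
    is_coprod C A x L \<iota>"
proof -
  have "is_cocone C (discrete_cat A) (mk_functor (discrete_cat A) x (\<lambda>i. Idn C (x i))) M \<kappa> \<longleftrightarrow>
      M \<in> Ob C \<and> (\<forall>i\<in>A. \<kappa> i \<in> hom C (x i) M)" for M \<kappa>
    using assms by (auto simp: is_cocone_def hom_def)
  then show ?thesis
    unfolding is_colimit_def is_coprod_def by (simp add: imp_conjL)
qed

lemma is_functor_discrete:
  assumes "\<And>i. i \<in> A \<Longrightarrow> x i \<in> Ob C"
  shows "is_functor (discrete_cat A) C (mk_functor (discrete_cat A) x (\<lambda>i. Idn C (x i)))"
  using assms by (auto simp: is_functor_def hom_def)

lemma coprod_Sigma:
  assumes L: "is_coprod C A x L \<iota>" and B: "\<And>i. i \<in> A \<Longrightarrow> is_coprod C (B i) (y i) (x i) (\<kappa> i)"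
  shows "is_coprod C (Sigma A B) (\<lambda>(i, j). y i j) L (\<lambda>(i, j). \<iota> i \<bullet> \<kappa> i j)"
proof (rule is_coprodI)
  show "L \<in> Ob C" using L by (rule coprod_Ob)
  show "(case p of (i, j) \<Rightarrow> \<iota> i \<bullet> \<kappa> i j) \<in> hom C (case p of (i, j) \<Rightarrow> y i j) L" if "p \<in> Sigma A B" for p
    using that Comp_hom[OF coprod_hom[OF B] coprod_hom[OF L]] by auto
next
  fix M and h :: "'b \<times> 'c \<Rightarrow> 'a"
  assume M: "M \<in> Ob C" and h: "\<And>p. p \<in> Sigma A B \<Longrightarrow> h p \<in> hom C (case p of (i, j) \<Rightarrow> y i j) M"
  have "\<exists>k. k \<in> hom C (x i) M \<and> (\<forall>j\<in>B i. k \<bullet> \<kappa> i j = h (i, j))" if "i \<in> A" for i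
  proof -
    have "h (i, j) \<in> hom C (y i j) M" if "j \<in> B i" for j
      using h[of "(i, j)"] \<open>i \<in> A\<close> that by simp
    from coprod_ex[OF B[OF that] M this] show ?thesis by metis
  qed
  then obtain k where k: "\<And>i. i \<in> A \<Longrightarrow> k i \<in> hom C (x i) M"
    "\<And>i j. i \<in> A \<Longrightarrow> j \<in> B i \<Longrightarrow> k i \<bullet> \<kappa> i j = h (i, j)"
    by metis
  obtain g where g: "g \<in> hom C L M" "\<And>i. i \<in> A \<Longrightarrow> g \<bullet> \<iota> i = k i"
    using coprod_ex[OF L M k(1)] by metis
  have "g \<bullet> (\<iota> i \<bullet> \<kappa> i j) = h (i, j)" if "i \<in> A" "j \<in> B i" for i j
    using Comp_assoc[OF coprod_hom[OF B[OF that(1)] that(2)] coprod_hom[OF L that(1)] g(1)]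
      g(2)[OF that(1)] k(2)[OF that] by simp
  with g(1) show "\<exists>g. g \<in> hom C L M \<and> (\<forall>p\<in>Sigma A B. g \<bullet> (case p of (i, j) \<Rightarrow> \<iota> i \<bullet> \<kappa> i j) = h p)"
    by auto
next
  fix M h h' assume h: "h \<in> hom C L M" "h' \<in> hom C L M"
    and eq: "\<And>p. p \<in> Sigma A B \<Longrightarrow>
      h \<bullet> (case p of (i, j) \<Rightarrow> \<iota> i \<bullet> \<kappa> i j) = h' \<bullet> (case p of (i, j) \<Rightarrow> \<iota> i \<bullet> \<kappa> i j)"
  show "h = h'"
  proof (rule coprod_ext[OF L h])
    fix i assume i: "i \<in> A"
    note \<iota> = coprod_hom[OF L i]
    show "h \<bullet> \<iota> i = h' \<bullet> \<iota> i"
    proof (rule coprod_ext[OF B[OF i] Comp_hom[OF \<iota> h(1)] Comp_hom[OF \<iota> h(2)]])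
      fix j assume j: "j \<in> B i"
      note \<kappa> = coprod_hom[OF B[OF i] j]
      show "(h \<bullet> \<iota> i) \<bullet> \<kappa> i j = (h' \<bullet> \<iota> i) \<bullet> \<kappa> i j"
        unfolding Comp_assoc[OF \<kappa> \<iota> h(1)] Comp_assoc[OF \<kappa> \<iota> h(2)] using eq[of "(i, j)"] i j by simp
    qed
  qed
qed

text \<open>From an initial summand there is exactly one arrow to any target, so it imposes no
  condition and can be left out. Applied to products with the unit quiver.\<close>

lemma coprod_subset:
  assumes L: "is_coprod C A x L \<iota>" and "B \<subseteq> A"
    and init: "\<And>i M. i \<in> A \<Longrightarrow> i \<notin> B \<Longrightarrow> M \<in> Ob C \<Longrightarrow> \<exists>!f. f \<in> hom C (x i) M"
  shows "is_coprod C B x L \<iota>"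
proof (rule is_coprodI)
  show "L \<in> Ob C" using L by (rule coprod_Ob)
  show "\<iota> i \<in> hom C (x i) L" if "i \<in> B" for i using coprod_hom[OF L] that assms(2) by blast
next
  fix M \<kappa> assume M: "M \<in> Ob C" and k: "\<And>i. i \<in> B \<Longrightarrow> \<kappa> i \<in> hom C (x i) M"
  have "\<exists>f. f \<in> hom C (x i) M \<and> (i \<in> B \<longrightarrow> f = \<kappa> i)" if "i \<in> A" for i
    using init[OF that _ M] k[of i] by blast
  then obtain f where f: "\<And>i. i \<in> A \<Longrightarrow> f i \<in> hom C (x i) M" "\<And>i. i \<in> A \<Longrightarrow> i \<in> B \<Longrightarrow> f i = \<kappa> i"
    by metis
  from coprod_ex[OF L M f(1)] obtain h where "h \<in> hom C L M" "\<And>i. i \<in> A \<Longrightarrow> h \<bullet> \<iota> i = f i"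
    by metis
  then show "\<exists>h. h \<in> hom C L M \<and> (\<forall>i\<in>B. h \<bullet> \<iota> i = \<kappa> i)"
    using f(2) assms(2) by (metis subsetD)
next
  fix M h h' assume h: "h \<in> hom C L M" "h' \<in> hom C L M" and eq: "\<And>i. i \<in> B \<Longrightarrow> h \<bullet> \<iota> i = h' \<bullet> \<iota> i"
  show "h = h'"
  proof (rule coprod_ext[OF L h])
    fix i assume "i \<in> A"
    note \<iota> = coprod_hom[OF L \<open>i \<in> A\<close>]
    show "h \<bullet> \<iota> i = h' \<bullet> \<iota> i"
    proof (cases "i \<in> B")
      case False
      from init[OF \<open>i \<in> A\<close> False] hom_Ob(2)[OF h(1)] Comp_hom[OF \<iota> h(1)] Comp_hom[OF \<iota> h(2)]
      show ?thesis by blast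
    qed (use eq in simp)
  qed
qed

lemma coprod_transport:
  assumes L: "is_coprod C A x L \<iota>" and e: "is_iso C e" "Dom C e = L"
    and e': "\<And>i. i \<in> A \<Longrightarrow> is_iso C (e' i) \<and> Cod C (e' i) = x i"
  shows "is_coprod C A (\<lambda>i. Dom C (e' i)) (Cod C e) (\<lambda>i. e \<bullet> \<iota> i \<bullet> e' i)"
proof (rule is_coprodI)
  note eA = iso_Arr[OF e(1)]
  have \<iota>: "\<iota> i \<in> Arr C \<and> Dom C (\<iota> i) = x i \<and> Cod C (\<iota> i) = L" if "i \<in> A" for i
    using coprod_hom[OF L that] by (simp add: hom_def)
  have e'A: "e' i \<in> Arr C" if "i \<in> A" for i using e'[OF that] by (simp add: iso_Arr)
  show "Cod C e \<in> Ob C" using eA by simp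
  show "e \<bullet> \<iota> i \<bullet> e' i \<in> hom C (Dom C (e' i)) (Cod C e)" if "i \<in> A" for i
    using eA e(2) \<iota>[OF that] e'A[OF that] e'[OF that] by (simp add: hom_def)
  show "\<exists>h. h \<in> hom C (Cod C e) M \<and> (\<forall>i\<in>A. h \<bullet> e \<bullet> \<iota> i \<bullet> e' i = \<kappa> i)"
    if M: "M \<in> Ob C" and k: "\<And>i. i \<in> A \<Longrightarrow> \<kappa> i \<in> hom C (Dom C (e' i)) M" for M \<kappa>
  proof -
    have "\<kappa> i \<bullet> inv_arr C (e' i) \<in> hom C (x i) M" if "i \<in> A" for i
      using k[OF that] e'[OF that] by (simp add: hom_def)
    from coprod_ex[OF L M this] obtain h where
      h: "h \<in> hom C L M" "\<And>i. i \<in> A \<Longrightarrow> h \<bullet> \<iota> i = \<kappa> i \<bullet> inv_arr C (e' i)" by metis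
    have "(h \<bullet> inv_arr C e) \<bullet> e \<bullet> \<iota> i \<bullet> e' i = \<kappa> i" if "i \<in> A" for i
    proof -
      have "(h \<bullet> inv_arr C e) \<bullet> e \<bullet> \<iota> i \<bullet> e' i = (h \<bullet> \<iota> i) \<bullet> e' i"
        using h(1) e eA \<iota>[OF that] e'A[OF that] e'[OF that] by (simp add: hom_def)
      also have "\<dots> = \<kappa> i"
        unfolding h(2)[OF that] using k[OF that] e'A[OF that] e'[OF that] by (simp add: hom_def)
      finally show ?thesis .
    qed
    moreover have "h \<bullet> inv_arr C e \<in> hom C (Cod C e) M" using h(1) e eA by (simp add: hom_def)
    ultimately show ?thesis by blast
  qed
  show "h = h'" if h: "h \<in> hom C (Cod C e) M" "h' \<in> hom C (Cod C e) M"
    and eq: "\<And>i. i \<in> A \<Longrightarrow> h \<bullet> e \<bullet> \<iota> i \<bullet> e' i = h' \<bullet> e \<bullet> \<iota> i \<bullet> e' i" for M h h'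
  proof (rule iso_cancel_right[OF e(1)])
    have he: "h \<bullet> e \<in> hom C L M" "h' \<bullet> e \<in> hom C L M" using h e eA by (auto simp: hom_def)
    show "h \<bullet> e = h' \<bullet> e"
    proof (rule coprod_ext[OF L he])
      fix i assume i: "i \<in> A"
      show "(h \<bullet> e) \<bullet> \<iota> i = (h' \<bullet> e) \<bullet> \<iota> i"
        by (rule iso_cancel_right[of "e' i"])
          (use i eq[OF i] h e eA \<iota>[OF i] e'A[OF i] e'[OF i] in \<open>simp_all add: hom_def\<close>)
    qed
  qed (use h in \<open>simp_all add: hom_def\<close>)
qed

lemma coprod_singleton:
  assumes "is_iso C (\<iota> a)"
  shows "is_coprod C {a} (\<lambda>i. Dom C (\<iota> i)) (Cod C (\<iota> a)) \<iota>"
proof (rule is_coprodI)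
  note A = iso_Arr[OF assms]
  show "Cod C (\<iota> a) \<in> Ob C" using A by simp
  show "\<iota> i \<in> hom C (Dom C (\<iota> i)) (Cod C (\<iota> a))" if "i \<in> {a}" for i
    using that A by (simp add: hom_def)
  show "\<exists>h. h \<in> hom C (Cod C (\<iota> a)) M \<and> (\<forall>i\<in>{a}. h \<bullet> \<iota> i = \<kappa> i)"
    if "M \<in> Ob C" "\<And>i. i \<in> {a} \<Longrightarrow> \<kappa> i \<in> hom C (Dom C (\<iota> i)) M" for M \<kappa>
    using that(2)[of a] A assms
    by (intro exI[of _ "\<kappa> a \<bullet> inv_arr C (\<iota> a)"]) (simp add: hom_def)
  show "h = h'" if "h \<in> hom C (Cod C (\<iota> a)) M" "h' \<in> hom C (Cod C (\<iota> a)) M"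
    "\<And>i. i \<in> {a} \<Longrightarrow> h \<bullet> \<iota> i = h' \<bullet> \<iota> i" for M h h'
    by (rule iso_cancel_right[OF assms]) (use that in \<open>simp_all add: hom_def\<close>)
qed

lemma coprod_unique_iso:
  assumes L: "is_coprod C A x L \<iota>" and M: "is_coprod C A x M \<kappa>"
    and h: "h \<in> hom C L M" "\<And>i. i \<in> A \<Longrightarrow> h \<bullet> \<iota> i = \<kappa> i"
  shows "is_iso C h"
proof -
  obtain g where g: "g \<in> hom C M L" "\<And>i. i \<in> A \<Longrightarrow> g \<bullet> \<kappa> i = \<iota> i"
    using coprod_ex[OF M coprod_Ob[OF L] coprod_hom[OF L]] by metis
  have "(g \<bullet> h) \<bullet> \<iota> i = Idn C L \<bullet> \<iota> i" if "i \<in> A" for i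
    using Comp_assoc[OF coprod_hom[OF L that] h(1) g(1)] h(2)[OF that] g(2)[OF that]
      Comp_Idn_left[OF coprod_hom[OF L that]] by simp
  then have "g \<bullet> h = Idn C L"
    using coprod_ext[OF L Comp_hom[OF h(1) g(1)] Idn_hom[OF coprod_Ob[OF L]]] by blast
  moreover have "(h \<bullet> g) \<bullet> \<kappa> i = Idn C M \<bullet> \<kappa> i" if "i \<in> A" for i
    using Comp_assoc[OF coprod_hom[OF M that] g(1) h(1)] h(2)[OF that] g(2)[OF that]
      Comp_Idn_left[OF coprod_hom[OF M that]] by simp
  then have "h \<bullet> g = Idn C M"
    using coprod_ext[OF M Comp_hom[OF g(1) h(1)] Idn_hom[OF coprod_Ob[OF M]]] by blast
  ultimately show ?thesis using h(1) g(1) by (intro is_isoI) auto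
qed

lemma coprod_reindex:
  assumes L: "is_coprod C A x L \<iota>" and f: "bij_betw f B A"
  shows "is_coprod C B (\<lambda>i. x (f i)) L (\<lambda>i. \<iota> (f i))"
proof (rule is_coprodI)
  have A: "A = f ` B" and inj: "inj_on f B" using f by (auto simp: bij_betw_def)
  show "L \<in> Ob C" using L by (rule coprod_Ob)
  show "\<iota> (f i) \<in> hom C (x (f i)) L" if "i \<in> B" for i using coprod_hom[OF L] that A by blast
  show "\<exists>h. h \<in> hom C L M \<and> (\<forall>i\<in>B. h \<bullet> \<iota> (f i) = \<kappa> i)"
    if M: "M \<in> Ob C" and k: "\<And>i. i \<in> B \<Longrightarrow> \<kappa> i \<in> hom C (x (f i)) M" for M \<kappa>
  proof -
    have "\<kappa> (the_inv_into B f i) \<in> hom C (x i) M" if "i \<in> A" for i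
      using that k A inj by (auto simp: the_inv_into_f_f)
    from coprod_ex[OF L M this] obtain h where
      "h \<in> hom C L M" "\<And>i. i \<in> A \<Longrightarrow> h \<bullet> \<iota> i = \<kappa> (the_inv_into B f i)" by metis
    then show ?thesis using A inj by (auto simp: the_inv_into_f_f)
  qed
  show "h = h'" if "h \<in> hom C L M" "h' \<in> hom C L M" "\<And>i. i \<in> B \<Longrightarrow> h \<bullet> \<iota> (f i) = h' \<bullet> \<iota> (f i)" for M h h'
    using coprod_ext[OF L that(1,2)] that(3) A by blast
qed

lemma coprod_cong:
  assumes "is_coprod C A x L \<iota>" "\<And>i. i \<in> A \<Longrightarrow> x i = x' i" "\<And>i. i \<in> A \<Longrightarrow> \<iota> i = \<iota>' i"
  shows "is_coprod C A x' L \<iota>'"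
  using assms unfolding is_coprod_def by simp

end

context closed_symmetric_monoidal_category
begin

text \<open>Tensoring on the right with y is a left adjoint: transpose the family along
  \<open>ev\<close>, use the universal property of L, and transpose back.\<close>

lemma coprod_TenO_right:
  assumes L: "is_coprod V A x L \<iota>" and y: "y \<in> Ob V"
  shows "is_coprod V A (\<lambda>i. x i \<otimes> y) (L \<otimes> y) (\<lambda>i. \<iota> i \<odot> Idn V y)"
proof (rule is_coprodI)
  note LOb = coprod_Ob[OF L] and \<iota> = coprod_hom[OF L]
  have IdnH: "Idn V y \<in> hom V y y" using y by (rule Idn_hom)
  show "L \<otimes> y \<in> Ob V" using LOb y by simp
  show "\<iota> i \<odot> Idn V y \<in> hom V (x i \<otimes> y) (L \<otimes> y)" if "i \<in> A" for i
    using \<iota>[OF that] IdnH by (rule TenA_hom)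
  fix M
  show "\<exists>h. h \<in> hom V (L \<otimes> y) M \<and> (\<forall>i\<in>A. h \<bullet> (\<iota> i \<odot> Idn V y) = \<kappa> i)"
    if M: "M \<in> Ob V" and k: "\<And>i. i \<in> A \<Longrightarrow> \<kappa> i \<in> hom V (x i \<otimes> y) M" for \<kappa>
  proof -
    obtain H ev where H: "H \<in> Ob V" "ev \<in> hom V (H \<otimes> y) M"
      and ev: "\<And>x f. x \<in> Ob V \<Longrightarrow> f \<in> hom V (x \<otimes> y) M \<Longrightarrow> \<exists>!g. g \<in> hom V x H \<and> ev \<bullet> (g \<odot> Idn V y) = f"
      using closed[OF y M] by metis
    have "\<exists>g. g \<in> hom V (x i) H \<and> ev \<bullet> (g \<odot> Idn V y) = \<kappa> i" if "i \<in> A" for i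
      using ev[of "x i" "\<kappa> i"] k[OF that] hom_Ob(1)[OF \<iota>[OF that]] by blast
    then obtain g where g: "\<And>i. i \<in> A \<Longrightarrow> g i \<in> hom V (x i) H"
      "\<And>i. i \<in> A \<Longrightarrow> ev \<bullet> (g i \<odot> Idn V y) = \<kappa> i" by metis
    obtain h where h: "h \<in> hom V L H" "\<And>i. i \<in> A \<Longrightarrow> h \<bullet> \<iota> i = g i"
      using coprod_ex[OF L H(1) g(1)] by metis
    have "(ev \<bullet> (h \<odot> Idn V y)) \<bullet> (\<iota> i \<odot> Idn V y) = \<kappa> i" if "i \<in> A" for i
      using h(1) \<iota>[OF that] H y h(2)[OF that] g(2)[OF that] by (simp add: hom_def)
    moreover have "ev \<bullet> (h \<odot> Idn V y) \<in> hom V (L \<otimes> y) M"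
      by (rule Comp_hom[OF TenA_hom[OF h(1) IdnH] H(2)])
    ultimately show ?thesis by blast
  qed
  show "h = h'" if h: "h \<in> hom V (L \<otimes> y) M" "h' \<in> hom V (L \<otimes> y) M"
    and eq: "\<And>i. i \<in> A \<Longrightarrow> h \<bullet> (\<iota> i \<odot> Idn V y) = h' \<bullet> (\<iota> i \<odot> Idn V y)" for h h'
  proof -
    have M: "M \<in> Ob V" using h(1) by (rule hom_Ob)
    obtain H ev where H: "H \<in> Ob V" "ev \<in> hom V (H \<otimes> y) M"
      and ev: "\<And>x f. x \<in> Ob V \<Longrightarrow> f \<in> hom V (x \<otimes> y) M \<Longrightarrow> \<exists>!g. g \<in> hom V x H \<and> ev \<bullet> (g \<odot> Idn V y) = f"
      using closed[OF y M] by metis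
    obtain g where g: "g \<in> hom V L H" "ev \<bullet> (g \<odot> Idn V y) = h" using ev[OF LOb h(1)] by blast
    obtain g' where g': "g' \<in> hom V L H" "ev \<bullet> (g' \<odot> Idn V y) = h'" using ev[OF LOb h(2)] by blast
    have "g = g'"
    proof (rule coprod_ext[OF L g(1) g'(1)])
      fix i assume i: "i \<in> A"
      have "ev \<bullet> ((g \<bullet> \<iota> i) \<odot> Idn V y) = h \<bullet> (\<iota> i \<odot> Idn V y)"
        using g H(2) \<iota>[OF i] y by (auto simp: hom_def)
      moreover have "ev \<bullet> ((g' \<bullet> \<iota> i) \<odot> Idn V y) = h' \<bullet> (\<iota> i \<odot> Idn V y)"
        using g' H(2) \<iota>[OF i] y by (auto simp: hom_def)
      moreover have "h \<bullet> (\<iota> i \<odot> Idn V y) \<in> hom V (x i \<otimes> y) M"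
        using TenA_hom[OF \<iota>[OF i] IdnH] h(1) by (rule Comp_hom)
      moreover note eq[OF i] Comp_hom[OF \<iota>[OF i] g(1)] Comp_hom[OF \<iota>[OF i] g'(1)]
      ultimately show "g \<bullet> \<iota> i = g' \<bullet> \<iota> i"
        using ev[OF hom_Ob(1)[OF \<iota>[OF i]]] by metis
    qed
    then show ?thesis using g g' by simp
  qed
qed

lemma Braid_Arr [simp]:
  assumes "x \<in> Ob V" "y \<in> Ob V"
  shows "Braid V x y \<in> Arr V" "Dom V (Braid V x y) = x \<otimes> y" "Cod V (Braid V x y) = y \<otimes> x"
  using Braid_hom[OF assms] by (auto simp: hom_def)

lemma is_iso_Braid [simp]: "x \<in> Ob V \<Longrightarrow> y \<in> Ob V \<Longrightarrow> is_iso V (Braid V x y)"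
  by (rule is_isoI[of _ "x \<otimes> y" "y \<otimes> x" "Braid V y x"]) (auto simp: hom_def Braid_Braid)

text \<open>Closedness is formulated for the left variable only; conjugating with the braiding
  carries the previous result to the other side.\<close>

lemma coprod_TenO_left:
  assumes L: "is_coprod V A x L \<iota>" and y: "y \<in> Ob V"
  shows "is_coprod V A (\<lambda>i. y \<otimes> x i) (y \<otimes> L) (\<lambda>i. Idn V y \<odot> \<iota> i)"
proof -
  note LOb = coprod_Ob[OF L] and \<iota> = coprod_hom[OF L]
  have x: "x i \<in> Ob V" if "i \<in> A" for i using hom_Ob(1)[OF \<iota>[OF that]] .
  have "is_coprod V A (\<lambda>i. Dom V (Braid V y (x i))) (Cod V (Braid V L y))
      (\<lambda>i. Braid V L y \<bullet> (\<iota> i \<odot> Idn V y) \<bullet> Braid V y (x i))"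
    by (rule coprod_transport[OF coprod_TenO_right[OF L y]]) (use x LOb y in simp_all)
  then show ?thesis
    unfolding Braid_Arr(3)[OF LOb y]
  proof (rule coprod_cong)
    fix i assume i: "i \<in> A"
    show "Dom V (Braid V y (x i)) = y \<otimes> x i" using x[OF i] y by simp
    have "Braid V L y \<bullet> (\<iota> i \<odot> Idn V y) = (Idn V y \<odot> \<iota> i) \<bullet> Braid V (x i) y"
      by (rule Braid_natural[OF \<iota>[OF i] Idn_hom[OF y]])
    then have "(Braid V L y \<bullet> (\<iota> i \<odot> Idn V y)) \<bullet> Braid V y (x i) =
        (Idn V y \<odot> \<iota> i) \<bullet> (Braid V (x i) y \<bullet> Braid V y (x i))"
      using x[OF i] y \<iota>[OF i] by (simp add: hom_def)
    then show "Braid V L y \<bullet> (\<iota> i \<odot> Idn V y) \<bullet> Braid V y (x i) = Idn V y \<odot> \<iota> i"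
      using x[OF i] y \<iota>[OF i] LOb by (simp add: hom_def Braid_Braid)
  qed
qed

end

section \<open>The monoidal category of quivers\<close>

lemma is_colimit_colimit:
  assumes "is_colimit C J D L \<iota>"
  shows "is_colimit C J D (fst (colimit C J D)) (snd (colimit C J D))"
proof -
  have "\<exists>p. case p of (L, \<iota>) \<Rightarrow> is_colimit C J D L \<iota>" using assms by auto
  from someI_ex[OF this] show ?thesis by (simp add: colimit_def case_prod_unfold)
qed

lemma (in category) coprod_coprod:
  fixes A :: "'u set"
  assumes "cocomplete_cat TYPE('u) C" "\<And>i. i \<in> A \<Longrightarrow> x i \<in> Ob C"
  shows "is_coprod C A x (fst (coprod C A x)) (snd (coprod C A x))"
proof -
  let ?D = "mk_functor (discrete_cat A) x (\<lambda>i. Idn C (x i))"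
  have "is_functor (discrete_cat A) C ?D" using assms(2) by (rule is_functor_discrete)
  then obtain L \<iota> where "is_colimit C (discrete_cat A) ?D L \<iota>"
    using assms(1)[unfolded cocomplete_cat_def, rule_format, OF category_discrete_cat] by metis
  from is_colimit_colimit[OF this] show ?thesis
    unfolding coprod_def by (rule iffD1[OF is_colimit_discrete, rotated]) (rule assms(2))
qed

text \<open>The vertices live in the type 'u that measures smallness, so coproducts over S are among
  the colimits that V is assumed to have.\<close>

locale quivers = closed_symmetric_monoidal_category V
  for V :: "('o, 'a) smoncat" (structure) +
  fixes S :: "'u set"
  assumes cocomplete: "cocomplete_cat TYPE('u) V"
begin

definition QOb :: "('u, 'o) quiver set" where
  "QOb = S \<times> S \<rightarrow>\<^sub>E Ob V"

abbreviation "QV \<equiv> quiv V S"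
abbreviation "qten \<equiv> quiv_ten V S"
abbreviation "qinj \<equiv> quiv_inj V S"
abbreviation "qunit \<equiv> quiv_unit V S"

lemma initial: "initial_obj V \<in> Ob V" "M \<in> Ob V \<Longrightarrow> \<exists>!f. f \<in> hom V (initial_obj V) M"
proof -
  have "is_coprod V ({} :: 'u set) (\<lambda>_. undefined) (fst (coprod V ({} :: 'u set) (\<lambda>_. undefined)))
      (snd (coprod V ({} :: 'u set) (\<lambda>_. undefined)))"
    by (rule coprod_coprod[OF cocomplete]) simp
  then have "\<exists>z. z \<in> Ob V \<and> (\<forall>x\<in>Ob V. \<exists>!f. f \<in> hom V z x)"
    by (intro exI[of _ "fst (coprod V ({} :: 'u set) (\<lambda>_. undefined))"]) (simp add: is_coprod_def)
  from someI_ex[OF this, folded initial_obj_def]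
  have *: "initial_obj V \<in> Ob V \<and> (\<forall>x\<in>Ob V. \<exists>!f. f \<in> hom V (initial_obj V) x)" .
  show "initial_obj V \<in> Ob V" by (rule conjunct1[OF *])
  show "M \<in> Ob V \<Longrightarrow> \<exists>!f. f \<in> hom V (initial_obj V) M" by (rule bspec[OF conjunct2[OF *]])
qed

lemma initial_coprod: "is_coprod V {} x (initial_obj V) \<iota>"
  using initial by (simp add: is_coprod_def)

lemma initial_TenO:
  assumes "y \<in> Ob V" "M \<in> Ob V"
  shows "\<exists>!f. f \<in> hom V (initial_obj V \<otimes> y) M" "\<exists>!f. f \<in> hom V (y \<otimes> initial_obj V) M"
  using coprod_TenO_right[OF initial_coprod assms(1)] coprod_TenO_left[OF initial_coprod assms(1)] assms(2)
  by (simp_all add: is_coprod_def)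

lemma QOb_Ob [simp]: "Q \<in> QOb \<Longrightarrow> a \<in> S \<Longrightarrow> b \<in> S \<Longrightarrow> Q (a, b) \<in> Ob V"
  by (auto simp: QOb_def)

lemma qinj_coprod:
  assumes "Q \<in> QOb" "P \<in> QOb" "a \<in> S" "b \<in> S"
  shows "is_coprod V S (\<lambda>c. Q (a, c) \<otimes> P (c, b)) (qten Q P (a, b)) (qinj Q P a b)"
proof -
  have "is_coprod V S (\<lambda>c. Q (a, c) \<otimes> P (c, b)) (fst (coprod V S (\<lambda>c. Q (a, c) \<otimes> P (c, b))))
      (snd (coprod V S (\<lambda>c. Q (a, c) \<otimes> P (c, b))))"
    by (rule coprod_coprod[OF cocomplete]) (use assms in simp)
  then show ?thesis using assms(3,4) by (simp add: quiv_ten_def quiv_inj_def[abs_def])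
qed

lemma qten_QOb [simp]: "Q \<in> QOb \<Longrightarrow> P \<in> QOb \<Longrightarrow> qten Q P \<in> QOb"
  using coprod_Ob[OF qinj_coprod] by (auto simp: QOb_def PiE_iff quiv_ten_def)

lemma qunit_QOb [simp]: "qunit \<in> QOb"
  using initial by (auto simp: QOb_def PiE_iff quiv_unit_def)

lemma qunit_eq [simp]: "a \<in> S \<Longrightarrow> qunit (a, a) = \<one>"
  "a \<in> S \<Longrightarrow> b \<in> S \<Longrightarrow> a \<noteq> b \<Longrightarrow> qunit (a, b) = initial_obj V"
  by (simp_all add: quiv_unit_def)

lemma qinj_Arr [simp]:
  assumes "Q \<in> QOb" "P \<in> QOb" "a \<in> S" "b \<in> S" "c \<in> S"
  shows "qinj Q P a b c \<in> Arr V" "Dom V (qinj Q P a b c) = Q (a, c) \<otimes> P (c, b)"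
    "Cod V (qinj Q P a b c) = qten Q P (a, b)"
  using coprod_hom[OF qinj_coprod[OF assms(1-4)] assms(5)] by (simp_all add: hom_def)

lemma quiv_simps [simp]:
  "Ob QV = QOb" "Dom QV = src" "Cod QV = tgt" "Idn QV Q = Arrow Q (\<lambda>x\<in>S \<times> S. Idn V (Q x)) Q"
  "\<beta> \<bullet>\<^bsub>QV\<^esub> \<alpha> = Arrow (src \<alpha>) (\<lambda>x\<in>S \<times> S. amap \<beta> x \<bullet> amap \<alpha> x) (tgt \<beta>)"
  "TenO QV = qten" "TenA QV = quiv_ten_arr V S" "Unit QV = qunit" "Assoc QV = quiv_assoc V S"
  "LUn QV = quiv_lun V S" "RUn QV = quiv_run V S"
  by (simp_all add: quiv_def Let_def QOb_def)

lemma quiv_Arr: "\<alpha> \<in> Arr QV \<longleftrightarrow> src \<alpha> \<in> QOb \<and> tgt \<alpha> \<in> QOb \<and> amap \<alpha> \<in> extensional (S \<times> S) \<and>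
    (\<forall>a\<in>S. \<forall>b\<in>S. amap \<alpha> (a, b) \<in> hom V (src \<alpha> (a, b)) (tgt \<alpha> (a, b)))"
  by (cases \<alpha>) (auto simp: quiv_def Let_def QOb_def PiE_iff)

lemma quiv_ArrD [simp]:
  assumes "\<alpha> \<in> Arr QV"
  shows "src \<alpha> \<in> QOb" "tgt \<alpha> \<in> QOb"
    "a \<in> S \<Longrightarrow> b \<in> S \<Longrightarrow> amap \<alpha> (a, b) \<in> Arr V"
    "a \<in> S \<Longrightarrow> b \<in> S \<Longrightarrow> Dom V (amap \<alpha> (a, b)) = src \<alpha> (a, b)"
    "a \<in> S \<Longrightarrow> b \<in> S \<Longrightarrow> Cod V (amap \<alpha> (a, b)) = tgt \<alpha> (a, b)"
  using assms unfolding quiv_Arr by (auto simp: hom_def)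

lemma quiv_Arr_Arrow [simp]: "Arrow Q f P \<in> Arr QV \<longleftrightarrow> Q \<in> QOb \<and> P \<in> QOb \<and> f \<in> extensional (S \<times> S) \<and>
    (\<forall>a\<in>S. \<forall>b\<in>S. f (a, b) \<in> Arr V \<and> Dom V (f (a, b)) = Q (a, b) \<and> Cod V (f (a, b)) = P (a, b))"
  by (simp add: quiv_Arr hom_def)

lemma quiv_hom: "\<alpha> \<in> Arr QV \<Longrightarrow> a \<in> S \<Longrightarrow> b \<in> S \<Longrightarrow> amap \<alpha> (a, b) \<in> hom V (src \<alpha> (a, b)) (tgt \<alpha> (a, b))"
  unfolding quiv_Arr by blast

lemma quiv_eqI:
  assumes "\<alpha> \<in> Arr QV" "\<beta> \<in> Arr QV" "src \<alpha> = src \<beta>" "tgt \<alpha> = tgt \<beta>"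
    and "\<And>a b. a \<in> S \<Longrightarrow> b \<in> S \<Longrightarrow> amap \<alpha> (a, b) = amap \<beta> (a, b)"
  shows "\<alpha> = \<beta>"
proof (rule arrow.expand, intro conjI)
  show "amap \<alpha> = amap \<beta>"
  proof (rule extensionalityI)
    show "amap \<alpha> \<in> extensional (S \<times> S)" "amap \<beta> \<in> extensional (S \<times> S)"
      using assms(1,2) unfolding quiv_Arr by blast+
  qed (use assms(5) in auto)
qed (use assms(3,4) in auto)

lemma category_quiv: "category QV"
proof
  fix f assume "f \<in> Arr QV"
  then show "Dom QV f \<in> Ob QV" "Cod QV f \<in> Ob QV"
    by simp_all
next
  fix f g x y z assume "f \<in> hom QV x y" "g \<in> hom QV y z"
  then have f: "f \<in> Arr QV" "src f = x" "tgt f = y" and g: "g \<in> Arr QV" "src g = y" "tgt g = z"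
    by (simp_all add: hom_def)
  from f g have "x \<in> QOb" "z \<in> QOb" by auto
  then show "g \<bullet>\<^bsub>QV\<^esub> f \<in> hom QV x z"
    using f g by (simp add: hom_def)
next
  fix x assume "x \<in> Ob QV"
  then show "Idn QV x \<in> hom QV x x" by (simp add: hom_def)
next
  fix f x y assume "f \<in> hom QV x y"
  then have f: "f \<in> Arr QV" "src f = x" "tgt f = y" by (simp_all add: hom_def)
  then have x: "x \<in> QOb" "y \<in> QOb" by auto
  show "Idn QV y \<bullet>\<^bsub>QV\<^esub> f = f" "f \<bullet>\<^bsub>QV\<^esub> Idn QV x = f"
    by (rule quiv_eqI; use f x in simp)+
next
  fix f g h w x y z assume "f \<in> hom QV w x" "g \<in> hom QV x y" "h \<in> hom QV y z"
  then have f: "f \<in> Arr QV" "src f = w" "tgt f = x" and g: "g \<in> Arr QV" "src g = x" "tgt g = y"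
    and h: "h \<in> Arr QV" "src h = y" "tgt h = z"
    by (simp_all add: hom_def)
  from f g h have "w \<in> QOb" "x \<in> QOb" "y \<in> QOb" "z \<in> QOb" by auto
  then show "(h \<bullet>\<^bsub>QV\<^esub> g) \<bullet>\<^bsub>QV\<^esub> f = h \<bullet>\<^bsub>QV\<^esub> g \<bullet>\<^bsub>QV\<^esub> f"
    by (intro quiv_eqI) (use f g h in simp_all)
qed

lemma inverse_pair_quiv:
  assumes f: "f \<in> Arr QV" and iso: "\<And>a b. a \<in> S \<Longrightarrow> b \<in> S \<Longrightarrow> is_iso V (amap f (a, b))"
  shows "inverse_pair QV f (Arrow (tgt f) (\<lambda>x\<in>S \<times> S. inv_arr V (amap f x)) (src f))"
proof -
  let ?g = "Arrow (tgt f) (\<lambda>x\<in>S \<times> S. inv_arr V (amap f x)) (src f)"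
  have g: "?g \<in> Arr QV" using assms by simp
  have "?g \<bullet>\<^bsub>QV\<^esub> f = Idn QV (src f)" "f \<bullet>\<^bsub>QV\<^esub> ?g = Idn QV (tgt f)"
    by (rule quiv_eqI; use assms in simp)+
  then show ?thesis using f g unfolding inverse_pair_def hom_def by simp
qed

lemma is_iso_quiv:
  assumes "f \<in> Arr QV" "\<And>a b. a \<in> S \<Longrightarrow> b \<in> S \<Longrightarrow> is_iso V (amap f (a, b))"
  shows "is_iso QV f"
  using inverse_pair_quiv[OF assms] by (auto simp: is_iso_def)

subsection \<open>The tensor product of arrows\<close>

text \<open>Replaces the \<open>THE\<close> of the definition by its characterising equation, which
  is legitimate by the universal property of \<open>qinj_coprod\<close>. The lemmas
  \<open>qassoc\<close>, \<open>qlun\<close> and \<open>qrun\<close> do the same for the other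
  coherence arrows.\<close>

lemma qten_arr:
  assumes \<alpha>: "\<alpha> \<in> Arr QV" and \<beta>: "\<beta> \<in> Arr QV"
  shows "quiv_ten_arr V S \<alpha> \<beta> \<in> Arr QV" "src (quiv_ten_arr V S \<alpha> \<beta>) = qten (src \<alpha>) (src \<beta>)"
    "tgt (quiv_ten_arr V S \<alpha> \<beta>) = qten (tgt \<alpha>) (tgt \<beta>)"
    and "a \<in> S \<Longrightarrow> b \<in> S \<Longrightarrow> c \<in> S \<Longrightarrow>
      amap (quiv_ten_arr V S \<alpha> \<beta>) (a, b) \<bullet> qinj (src \<alpha>) (src \<beta>) a b c =
      qinj (tgt \<alpha>) (tgt \<beta>) a b c \<bullet> (amap \<alpha> (a, c) \<odot> amap \<beta> (c, b))"
proof -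
  have *: "amap (quiv_ten_arr V S \<alpha> \<beta>) (a, b) \<in>
        hom V (qten (src \<alpha>) (src \<beta>) (a, b)) (qten (tgt \<alpha>) (tgt \<beta>) (a, b)) \<and>
      (\<forall>c\<in>S. amap (quiv_ten_arr V S \<alpha> \<beta>) (a, b) \<bullet> qinj (src \<alpha>) (src \<beta>) a b c =
        qinj (tgt \<alpha>) (tgt \<beta>) a b c \<bullet> (amap \<alpha> (a, c) \<odot> amap \<beta> (c, b)))"
    if "a \<in> S" "b \<in> S" for a b
  proof -
    have "\<exists>!h. h \<in> hom V (qten (src \<alpha>) (src \<beta>) (a, b)) (qten (tgt \<alpha>) (tgt \<beta>) (a, b)) \<and>
      (\<forall>c\<in>S. h \<bullet> qinj (src \<alpha>) (src \<beta>) a b c =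
        qinj (tgt \<alpha>) (tgt \<beta>) a b c \<bullet> (amap \<alpha> (a, c) \<odot> amap \<beta> (c, b)))"
      using assms that by (intro coprod_ex1[OF qinj_coprod]) (simp_all add: hom_def)
    from theI'[OF this] show ?thesis using that by (simp add: quiv_ten_arr_def Let_def)
  qed
  show 1: "src (quiv_ten_arr V S \<alpha> \<beta>) = qten (src \<alpha>) (src \<beta>)"
    "tgt (quiv_ten_arr V S \<alpha> \<beta>) = qten (tgt \<alpha>) (tgt \<beta>)"
    by (simp_all add: quiv_ten_arr_def Let_def)
  have "amap (quiv_ten_arr V S \<alpha> \<beta>) \<in> extensional (S \<times> S)"
    by (simp add: quiv_ten_arr_def Let_def)
  then show "quiv_ten_arr V S \<alpha> \<beta> \<in> Arr QV"
    unfolding quiv_Arr 1 using assms * by simp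
  show "a \<in> S \<Longrightarrow> b \<in> S \<Longrightarrow> c \<in> S \<Longrightarrow>
      amap (quiv_ten_arr V S \<alpha> \<beta>) (a, b) \<bullet> qinj (src \<alpha>) (src \<beta>) a b c =
      qinj (tgt \<alpha>) (tgt \<beta>) a b c \<bullet> (amap \<alpha> (a, c) \<odot> amap \<beta> (c, b))"
    using * by blast
qed

declare qten_arr(1-3) [simp]

lemma qten_arr_Comp:
  assumes "\<alpha> \<in> Arr QV" "\<beta> \<in> Arr QV" "a \<in> S" "b \<in> S" "c \<in> S" "src \<alpha> = Q" "src \<beta> = P"
    and "k \<in> Arr V" "Cod V k = Q (a, c) \<otimes> P (c, b)"
  shows "amap (quiv_ten_arr V S \<alpha> \<beta>) (a, b) \<bullet> (qinj Q P a b c \<bullet> k) =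
    qinj (tgt \<alpha>) (tgt \<beta>) a b c \<bullet> ((amap \<alpha> (a, c) \<odot> amap \<beta> (c, b)) \<bullet> k)"
proof -
  have Q: "Q \<in> QOb" "P \<in> QOb"
    using quiv_ArrD(1)[OF assms(1)] quiv_ArrD(1)[OF assms(2)] assms(6,7) by simp_all
  have "amap (quiv_ten_arr V S \<alpha> \<beta>) (a, b) \<bullet> (qinj Q P a b c \<bullet> k) =
      (amap (quiv_ten_arr V S \<alpha> \<beta>) (a, b) \<bullet> qinj (src \<alpha>) (src \<beta>) a b c) \<bullet> k"
    using assms Q by simp
  also have "\<dots> = qinj (tgt \<alpha>) (tgt \<beta>) a b c \<bullet> ((amap \<alpha> (a, c) \<odot> amap \<beta> (c, b)) \<bullet> k)"
    unfolding qten_arr(4)[OF assms(1-5)] using assms Q by simp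
  finally show ?thesis .
qed

lemma quiv_ext2:
  assumes "\<alpha> \<in> Arr QV" "\<beta> \<in> Arr QV" "src \<alpha> = qten Q P" "src \<beta> = qten Q P" "tgt \<alpha> = tgt \<beta>"
    and "Q \<in> QOb" "P \<in> QOb"
    and "\<And>a b c. a \<in> S \<Longrightarrow> b \<in> S \<Longrightarrow> c \<in> S \<Longrightarrow>
      amap \<alpha> (a, b) \<bullet> qinj Q P a b c = amap \<beta> (a, b) \<bullet> qinj Q P a b c"
  shows "\<alpha> = \<beta>"
proof (rule quiv_eqI[OF assms(1,2)])
  fix a b assume ab: "a \<in> S" "b \<in> S"
  show "amap \<alpha> (a, b) = amap \<beta> (a, b)"
    by (rule coprod_ext[OF qinj_coprod[OF assms(6,7) ab] _ _ assms(8)[OF ab]])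
      (use quiv_hom[OF assms(1) ab] quiv_hom[OF assms(2) ab] assms(3-5) in simp_all)
qed (use assms in simp_all)

subsection \<open>Associativity\<close>

lemma qinj3_coprod:
  assumes "Q \<in> QOb" "P \<in> QOb" "R \<in> QOb" "a \<in> S" "b \<in> S"
  shows "is_coprod V (S \<times> S) (\<lambda>(d, c). (Q (a, c) \<otimes> P (c, d)) \<otimes> R (d, b)) (qten (qten Q P) R (a, b))
    (\<lambda>(d, c). qinj (qten Q P) R a b d \<bullet> (qinj Q P a d c \<odot> Idn V (R (d, b))))"
proof (rule coprod_Sigma)
  show "is_coprod V S (\<lambda>d. qten Q P (a, d) \<otimes> R (d, b)) (qten (qten Q P) R (a, b)) (qinj (qten Q P) R a b)"
    by (rule qinj_coprod) (use assms in simp_all)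
  show "is_coprod V S (\<lambda>c. (Q (a, c) \<otimes> P (c, d)) \<otimes> R (d, b)) (qten Q P (a, d) \<otimes> R (d, b))
      (\<lambda>c. qinj Q P a d c \<odot> Idn V (R (d, b)))" if "d \<in> S" for d
    by (rule coprod_TenO_right, rule qinj_coprod) (use assms that in simp_all)
qed

text \<open>The summands are those of \<open>qinj3_coprod\<close>, brackets included, so the two
  threefold products are coproducts of one family and the associator is the comparison between them.
  Here c is the outer index, hence the reindexing by \<open>prod.swap\<close>.\<close>

lemma qinj3_coprod':
  assumes "Q \<in> QOb" "P \<in> QOb" "R \<in> QOb" "a \<in> S" "b \<in> S"
  shows "is_coprod V (S \<times> S) (\<lambda>(d, c). (Q (a, c) \<otimes> P (c, d)) \<otimes> R (d, b)) (qten Q (qten P R) (a, b))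
    (\<lambda>(d, c). qinj Q (qten P R) a b c \<bullet> (Idn V (Q (a, c)) \<odot> qinj P R c b d) \<bullet>
      Assoc V (Q (a, c)) (P (c, d)) (R (d, b)))"
proof -
  let ?M = "qten Q (qten P R) (a, b)"
  have "is_coprod V (S \<times> S) (\<lambda>(c, d). Q (a, c) \<otimes> (P (c, d) \<otimes> R (d, b))) ?M
      (\<lambda>(c, d). qinj Q (qten P R) a b c \<bullet> (Idn V (Q (a, c)) \<odot> qinj P R c b d))"
  proof (rule coprod_Sigma)
    show "is_coprod V S (\<lambda>c. Q (a, c) \<otimes> qten P R (c, b)) ?M (qinj Q (qten P R) a b)"
      by (rule qinj_coprod) (use assms in simp_all)
    show "is_coprod V S (\<lambda>d. Q (a, c) \<otimes> (P (c, d) \<otimes> R (d, b))) (Q (a, c) \<otimes> qten P R (c, b))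
        (\<lambda>d. Idn V (Q (a, c)) \<odot> qinj P R c b d)" if "c \<in> S" for c
      by (rule coprod_TenO_left, rule qinj_coprod) (use assms that in simp_all)
  qed
  moreover have "bij_betw prod.swap (S \<times> S) (S \<times> S)"
    by (rule bij_betwI[of _ _ _ prod.swap]) auto
  ultimately
  have *: "is_coprod V (S \<times> S) (\<lambda>(d, c). Q (a, c) \<otimes> (P (c, d) \<otimes> R (d, b))) ?M
      (\<lambda>(d, c). qinj Q (qten P R) a b c \<bullet> (Idn V (Q (a, c)) \<odot> qinj P R c b d))"
    by (rule coprod_reindex[THEN coprod_cong]) auto
  have M: "?M \<in> Ob V" using assms by simp
  have "is_coprod V (S \<times> S) (\<lambda>i. Dom V (case i of (d, c) \<Rightarrow> Assoc V (Q (a, c)) (P (c, d)) (R (d, b))))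
      (Cod V (Idn V ?M))
      (\<lambda>i. Idn V ?M \<bullet> (case i of (d, c) \<Rightarrow> qinj Q (qten P R) a b c \<bullet> (Idn V (Q (a, c)) \<odot> qinj P R c b d)) \<bullet>
        (case i of (d, c) \<Rightarrow> Assoc V (Q (a, c)) (P (c, d)) (R (d, b))))"
    by (rule coprod_transport[OF *]) (use assms M in auto)
  then show ?thesis
    unfolding Arr_Idn(3)[OF M] by (rule coprod_cong) (use assms M in auto)
qed

lemma qassoc:
  assumes Q: "Q \<in> QOb" "P \<in> QOb" "R \<in> QOb"
  shows "quiv_assoc V S Q P R \<in> Arr QV" "src (quiv_assoc V S Q P R) = qten (qten Q P) R"
    "tgt (quiv_assoc V S Q P R) = qten Q (qten P R)"
    and "is_iso QV (quiv_assoc V S Q P R)"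
    and "a \<in> S \<Longrightarrow> b \<in> S \<Longrightarrow> c \<in> S \<Longrightarrow> d \<in> S \<Longrightarrow> amap (quiv_assoc V S Q P R) (a, b) \<bullet>
        qinj (qten Q P) R a b d \<bullet> (qinj Q P a d c \<odot> Idn V (R (d, b))) =
      qinj Q (qten P R) a b c \<bullet> (Idn V (Q (a, c)) \<odot> qinj P R c b d) \<bullet>
        Assoc V (Q (a, c)) (P (c, d)) (R (d, b))"
proof -
  let ?h = "\<lambda>a b. amap (quiv_assoc V S Q P R) (a, b)"
  have *: "?h a b \<in> hom V (qten (qten Q P) R (a, b)) (qten Q (qten P R) (a, b)) \<and>
      (\<forall>c\<in>S. \<forall>d\<in>S. ?h a b \<bullet> qinj (qten Q P) R a b d \<bullet> (qinj Q P a d c \<odot> Idn V (R (d, b))) =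
      qinj Q (qten P R) a b c \<bullet> (Idn V (Q (a, c)) \<odot> qinj P R c b d) \<bullet>
        Assoc V (Q (a, c)) (P (c, d)) (R (d, b)))"
    if "a \<in> S" "b \<in> S" for a b
  proof -
    note M = qinj3_coprod'[OF assms that]
    have eq: "(\<forall>i\<in>S \<times> S. h \<bullet> (case i of (d, c) \<Rightarrow> f d c) = (case i of (d, c) \<Rightarrow> g d c)) \<longleftrightarrow>
        (\<forall>c\<in>S. \<forall>d\<in>S. h \<bullet> f d c = g d c)" for h f g by auto
    have "\<exists>!h. h \<in> hom V (qten (qten Q P) R (a, b)) (qten Q (qten P R) (a, b)) \<and>
      (\<forall>c\<in>S. \<forall>d\<in>S. h \<bullet> qinj (qten Q P) R a b d \<bullet> (qinj Q P a d c \<odot> Idn V (R (d, b))) =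
      qinj Q (qten P R) a b c \<bullet> (Idn V (Q (a, c)) \<odot> qinj P R c b d) \<bullet>
        Assoc V (Q (a, c)) (P (c, d)) (R (d, b)))"
      using coprod_ex1[OF qinj3_coprod[OF assms that] coprod_Ob[OF M] coprod_hom[OF M]]
      unfolding eq by blast
    from theI'[OF this] show ?thesis using that by (simp add: quiv_assoc_def Let_def)
  qed
  show 1: "src (quiv_assoc V S Q P R) = qten (qten Q P) R"
    "tgt (quiv_assoc V S Q P R) = qten Q (qten P R)"
    by (simp_all add: quiv_assoc_def Let_def)
  have "amap (quiv_assoc V S Q P R) \<in> extensional (S \<times> S)"
    by (simp add: quiv_assoc_def Let_def)
  then show arr: "quiv_assoc V S Q P R \<in> Arr QV"
    unfolding quiv_Arr 1 using assms * by simp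
  have "is_iso V (?h a b)" if "a \<in> S" "b \<in> S" for a b
    by (rule coprod_unique_iso[OF qinj3_coprod[OF assms that] qinj3_coprod'[OF assms that]])
      (use *[OF that] in auto)
  then show "is_iso QV (quiv_assoc V S Q P R)" by (rule is_iso_quiv[OF arr])
  show "a \<in> S \<Longrightarrow> b \<in> S \<Longrightarrow> c \<in> S \<Longrightarrow> d \<in> S \<Longrightarrow> ?h a b \<bullet>
        qinj (qten Q P) R a b d \<bullet> (qinj Q P a d c \<odot> Idn V (R (d, b))) =
      qinj Q (qten P R) a b c \<bullet> (Idn V (Q (a, c)) \<odot> qinj P R c b d) \<bullet>
        Assoc V (Q (a, c)) (P (c, d)) (R (d, b))"
    using * by blast
qed

declare qassoc(1-4) [simp]

lemma qassoc_Comp: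
  assumes Q: "Q \<in> QOb" "P \<in> QOb" "R \<in> QOb" and S: "a \<in> S" "b \<in> S" "c \<in> S" "d \<in> S"
    and k: "k \<in> Arr V" "Cod V k = Q (a, c) \<otimes> P (c, d)" and m: "m \<in> Arr V" "Cod V m = R (d, b)"
  shows "amap (quiv_assoc V S Q P R) (a, b) \<bullet> (qinj (qten Q P) R a b d \<bullet> ((qinj Q P a d c \<bullet> k) \<odot> m)) =
    qinj Q (qten P R) a b c \<bullet> ((Idn V (Q (a, c)) \<odot> qinj P R c b d) \<bullet>
      (Assoc V (Q (a, c)) (P (c, d)) (R (d, b)) \<bullet> (k \<odot> m)))"
proof -
  have "amap (quiv_assoc V S Q P R) (a, b) \<bullet> (qinj (qten Q P) R a b d \<bullet> ((qinj Q P a d c \<bullet> k) \<odot> m)) =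
    (amap (quiv_assoc V S Q P R) (a, b) \<bullet> qinj (qten Q P) R a b d \<bullet> (qinj Q P a d c \<odot> Idn V (R (d, b)))) \<bullet> (k \<odot> m)"
    using assms by simp
  also have "\<dots> = qinj Q (qten P R) a b c \<bullet> ((Idn V (Q (a, c)) \<odot> qinj P R c b d) \<bullet>
      (Assoc V (Q (a, c)) (P (c, d)) (R (d, b)) \<bullet> (k \<odot> m)))"
    unfolding qassoc(5)[OF Q S] using assms by simp
  finally show ?thesis .
qed

lemma quiv_ext3:
  assumes "\<alpha> \<in> Arr QV" "\<beta> \<in> Arr QV" "src \<alpha> = qten (qten Q P) R" "src \<beta> = qten (qten Q P) R"
    and "tgt \<alpha> = tgt \<beta>" and Q: "Q \<in> QOb" "P \<in> QOb" "R \<in> QOb"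
    and eq: "\<And>a b c d. a \<in> S \<Longrightarrow> b \<in> S \<Longrightarrow> c \<in> S \<Longrightarrow> d \<in> S \<Longrightarrow>
      amap \<alpha> (a, b) \<bullet> qinj (qten Q P) R a b d \<bullet> (qinj Q P a d c \<odot> Idn V (R (d, b))) =
      amap \<beta> (a, b) \<bullet> qinj (qten Q P) R a b d \<bullet> (qinj Q P a d c \<odot> Idn V (R (d, b)))"
  shows "\<alpha> = \<beta>"
proof (rule quiv_eqI[OF assms(1,2)])
  fix a b assume ab: "a \<in> S" "b \<in> S"
  show "amap \<alpha> (a, b) = amap \<beta> (a, b)"
  proof (rule coprod_ext[OF qinj3_coprod[OF Q ab]])
    show "amap \<alpha> (a, b) \<in> hom V (qten (qten Q P) R (a, b)) (tgt \<beta> (a, b))"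
      "amap \<beta> (a, b) \<in> hom V (qten (qten Q P) R (a, b)) (tgt \<beta> (a, b))"
      using quiv_hom[OF assms(1) ab] quiv_hom[OF assms(2) ab] assms(3-5) by simp_all
    fix i assume "i \<in> S \<times> S"
    then show "amap \<alpha> (a, b) \<bullet> (case i of (d, c) \<Rightarrow> qinj (qten Q P) R a b d \<bullet> (qinj Q P a d c \<odot> Idn V (R (d, b)))) =
        amap \<beta> (a, b) \<bullet> (case i of (d, c) \<Rightarrow> qinj (qten Q P) R a b d \<bullet> (qinj Q P a d c \<odot> Idn V (R (d, b))))"
      using eq[OF ab] by (cases i) simp
  qed
qed (use assms in simp_all)

text \<open>Arrows out of a threefold product are determined by the coprojections along paths a, c,
  d, b. On each of them the claim reduces to naturality of \<open>Assoc\<close> in V; the triangle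
  and the pentagon are treated in the same way.\<close>

lemma qassoc_natural:
  assumes "f \<in> Arr QV" "g \<in> Arr QV" "h \<in> Arr QV"
  shows "quiv_assoc V S (tgt f) (tgt g) (tgt h) \<bullet>\<^bsub>QV\<^esub> quiv_ten_arr V S (quiv_ten_arr V S f g) h =
    quiv_ten_arr V S f (quiv_ten_arr V S g h) \<bullet>\<^bsub>QV\<^esub> quiv_assoc V S (src f) (src g) (src h)"
proof -
  interpret QV: category QV by (rule category_quiv)
  let ?fg = "quiv_ten_arr V S f g" and ?gh = "quiv_ten_arr V S g h"
  have [simp]: "src f \<in> QOb" "tgt f \<in> QOb" "src g \<in> QOb" "tgt g \<in> QOb" "src h \<in> QOb" "tgt h \<in> QOb"
    using assms by auto
  show ?thesis
  proof (rule quiv_ext3[of _ _ "src f" "src g" "src h"])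
    fix a b c d assume S [simp]: "a \<in> S" "b \<in> S" "c \<in> S" "d \<in> S"
    let ?A' = "amap (quiv_assoc V S (tgt f) (tgt g) (tgt h)) (a, b)"
    let ?A = "amap (quiv_assoc V S (src f) (src g) (src h)) (a, b)"
    let ?F = "amap f (a, c)" and ?G = "amap g (c, d)" and ?H = "amap h (d, b)"
    let ?j = "qinj (qten (src f) (src g)) (src h) a b d"
      and ?j' = "qinj (src f) (src g) a d c \<odot> Idn V (src h (d, b))"
    let ?r = "qinj (tgt f) (qten (tgt g) (tgt h)) a b c" 
    have "amap (quiv_ten_arr V S ?fg h) (a, b) \<bullet> (?j \<bullet> ?j') =
        qinj (qten (tgt f) (tgt g)) (tgt h) a b d \<bullet> ((amap ?fg (a, d) \<bullet> qinj (src f) (src g) a d c) \<odot> ?H)"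
      using assms by (subst qten_arr_Comp) simp_all
    also have "\<dots> = qinj (qten (tgt f) (tgt g)) (tgt h) a b d \<bullet> ((qinj (tgt f) (tgt g) a d c \<bullet> (?F \<odot> ?G)) \<odot> ?H)"
      by (subst qten_arr(4)[OF assms(1,2)]) simp_all
    finally have "?A' \<bullet> (amap (quiv_ten_arr V S ?fg h) (a, b) \<bullet> (?j \<bullet> ?j')) =
        ?r \<bullet> ((Idn V (tgt f (a, c)) \<odot> qinj (tgt g) (tgt h) c b d) \<bullet>
        (Assoc V (tgt f (a, c)) (tgt g (c, d)) (tgt h (d, b)) \<bullet> ((?F \<odot> ?G) \<odot> ?H)))"
      using assms by (simp only:) (subst qassoc_Comp, simp_all)
    also have "\<dots> = ?r \<bullet> ((Idn V (tgt f (a, c)) \<odot> qinj (tgt g) (tgt h) c b d) \<bullet>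
        ((?F \<odot> (?G \<odot> ?H)) \<bullet> Assoc V (src f (a, c)) (src g (c, d)) (src h (d, b))))"
      using assms Assoc_natural'[of ?F ?G ?H] by simp
    also have "\<dots> = ?r \<bullet> ((?F \<odot> (qinj (tgt g) (tgt h) c b d \<bullet> (?G \<odot> ?H))) \<bullet>
        Assoc V (src f (a, c)) (src g (c, d)) (src h (d, b)))"
      using assms by simp
    also have "\<dots> = ?r \<bullet> ((?F \<odot> (amap ?gh (c, b) \<bullet> qinj (src g) (src h) c b d)) \<bullet>
        Assoc V (src f (a, c)) (src g (c, d)) (src h (d, b)))"
      by (subst qten_arr(4)[OF assms(2,3)]) simp_all
    also have "\<dots> = ?r \<bullet> ((?F \<odot> amap ?gh (c, b)) \<bullet> ((Idn V (src f (a, c)) \<odot> qinj (src g) (src h) c b d) \<bullet>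
        Assoc V (src f (a, c)) (src g (c, d)) (src h (d, b))))"
      using assms by simp
    also have "\<dots> = amap (quiv_ten_arr V S f ?gh) (a, b) \<bullet> (qinj (src f) (qten (src g) (src h)) a b c \<bullet>
        ((Idn V (src f (a, c)) \<odot> qinj (src g) (src h) c b d) \<bullet>
        Assoc V (src f (a, c)) (src g (c, d)) (src h (d, b))))"
      using assms by (subst qten_arr_Comp) (simp_all del: TenA_Comp_Comp)
    also have "\<dots> = amap (quiv_ten_arr V S f ?gh) (a, b) \<bullet> (?A \<bullet> (?j \<bullet> ?j'))"
      by (subst qassoc(5)) simp_all
    finally show "amap (quiv_assoc V S (tgt f) (tgt g) (tgt h) \<bullet>\<^bsub>QV\<^esub> quiv_ten_arr V S ?fg h) (a, b) \<bullet> ?j \<bullet> ?j' =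
      amap (quiv_ten_arr V S f ?gh \<bullet>\<^bsub>QV\<^esub> quiv_assoc V S (src f) (src g) (src h)) (a, b) \<bullet> ?j \<bullet> ?j'"
      using assms by simp
  next
    show "quiv_assoc V S (tgt f) (tgt g) (tgt h) \<bullet>\<^bsub>QV\<^esub> quiv_ten_arr V S ?fg h \<in> Arr QV"
      "quiv_ten_arr V S f ?gh \<bullet>\<^bsub>QV\<^esub> quiv_assoc V S (src f) (src g) (src h) \<in> Arr QV"
      using assms by (intro QV.Arr_Comp(1); simp)+
  qed (use assms in simp_all)
qed

end

context quivers
begin

lemma qIdn_simps [simp]: "Q \<in> QOb \<Longrightarrow> Idn QV Q \<in> Arr QV" "src (Idn QV Q) = Q" "tgt (Idn QV Q) = Q"
  by simp_all

subsection \<open>Units\<close>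

text \<open>For c \<noteq> a the summand is an initial object tensored with something, which is
  initial again by closedness; only c = a survives.\<close>

lemma lun_coprod:
  assumes "Q \<in> QOb" "a \<in> S" "b \<in> S"
  shows "is_coprod V {a} (\<lambda>c. qunit (a, c) \<otimes> Q (c, b)) (qten qunit Q (a, b)) (qinj qunit Q a b)"
proof (rule coprod_subset)
  show "is_coprod V S (\<lambda>c. qunit (a, c) \<otimes> Q (c, b)) (qten qunit Q (a, b)) (qinj qunit Q a b)"
    by (rule qinj_coprod) (use assms in simp_all)
  show "\<exists>!f. f \<in> hom V (qunit (a, c) \<otimes> Q (c, b)) M" if "c \<in> S" "c \<notin> {a}" "M \<in> Ob V" for c M
  proof -
    have "qunit (a, c) = initial_obj V" using assms(2) that by (intro qunit_eq(2)) auto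
    then show ?thesis using initial_TenO(1)[of "Q (c, b)" M] assms that(1,3) by simp
  qed
qed (use assms in simp)

lemma run_coprod:
  assumes "Q \<in> QOb" "a \<in> S" "b \<in> S"
  shows "is_coprod V {b} (\<lambda>c. Q (a, c) \<otimes> qunit (c, b)) (qten Q qunit (a, b)) (qinj Q qunit a b)"
proof (rule coprod_subset)
  show "is_coprod V S (\<lambda>c. Q (a, c) \<otimes> qunit (c, b)) (qten Q qunit (a, b)) (qinj Q qunit a b)"
    by (rule qinj_coprod) (use assms in simp_all)
  show "\<exists>!f. f \<in> hom V (Q (a, c) \<otimes> qunit (c, b)) M" if "c \<in> S" "c \<notin> {b}" "M \<in> Ob V" for c M
  proof -
    have "qunit (c, b) = initial_obj V" using assms(3) that by (intro qunit_eq(2)) auto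
    then show ?thesis using initial_TenO(2)[of "Q (a, c)" M] assms that(1,3) by simp
  qed
qed (use assms in simp)

lemma qlun:
  assumes Q: "Q \<in> QOb"
  shows "quiv_lun V S Q \<in> Arr QV" "src (quiv_lun V S Q) = qten qunit Q" "tgt (quiv_lun V S Q) = Q"
    "is_iso QV (quiv_lun V S Q)"
    "a \<in> S \<Longrightarrow> b \<in> S \<Longrightarrow> amap (quiv_lun V S Q) (a, b) \<bullet> qinj qunit Q a b a = LUn V (Q (a, b))"
proof -
  let ?h = "\<lambda>a b. amap (quiv_lun V S Q) (a, b)"
  have *: "?h a b \<in> hom V (qten qunit Q (a, b)) (Q (a, b)) \<and> ?h a b \<bullet> qinj qunit Q a b a = LUn V (Q (a, b))"
    if "a \<in> S" "b \<in> S" for a b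
  proof -
    have "\<exists>!h. h \<in> hom V (qten qunit Q (a, b)) (Q (a, b)) \<and> (\<forall>i\<in>{a}. h \<bullet> qinj qunit Q a b i = LUn V (Q (a, b)))"
      by (rule coprod_ex1[OF lun_coprod[OF Q that]]) (use Q that in \<open>simp_all add: hom_def\<close>)
    then have "\<exists>!h. h \<in> hom V (qten qunit Q (a, b)) (Q (a, b)) \<and> h \<bullet> qinj qunit Q a b a = LUn V (Q (a, b))"
      by simp
    from theI'[OF this] show ?thesis using that by (simp add: quiv_lun_def Let_def)
  qed
  show 1: "src (quiv_lun V S Q) = qten qunit Q" "tgt (quiv_lun V S Q) = Q"
    by (simp_all add: quiv_lun_def Let_def)
  have "amap (quiv_lun V S Q) \<in> extensional (S \<times> S)"
    by (simp add: quiv_lun_def Let_def)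
  then show arr: "quiv_lun V S Q \<in> Arr QV"
    unfolding quiv_Arr 1 using Q * by simp
  show "is_iso QV (quiv_lun V S Q)"
  proof (rule is_iso_quiv[OF arr])
    fix a b assume ab: "a \<in> S" "b \<in> S"
    have "is_coprod V {a} (\<lambda>c. Dom V (LUn V (Q (a, b)))) (Cod V (LUn V (Q (a, b)))) (\<lambda>_. LUn V (Q (a, b)))"
      by (rule coprod_singleton) (use Q ab in simp)
    then have "is_coprod V {a} (\<lambda>c. qunit (a, c) \<otimes> Q (c, b)) (Q (a, b)) (\<lambda>_. LUn V (Q (a, b)))"
      unfolding Arr_LUn(3)[OF QOb_Ob[OF Q ab]] by (rule coprod_cong) (use Q ab in simp_all)
    from coprod_unique_iso[OF lun_coprod[OF Q ab] this] show "is_iso V (?h a b)"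
      using *[OF ab] by simp
  qed
  show "a \<in> S \<Longrightarrow> b \<in> S \<Longrightarrow> ?h a b \<bullet> qinj qunit Q a b a = LUn V (Q (a, b))"
    using * by blast
qed

lemma qrun:
  assumes Q: "Q \<in> QOb"
  shows "quiv_run V S Q \<in> Arr QV" "src (quiv_run V S Q) = qten Q qunit" "tgt (quiv_run V S Q) = Q"
    "is_iso QV (quiv_run V S Q)"
    "a \<in> S \<Longrightarrow> b \<in> S \<Longrightarrow> amap (quiv_run V S Q) (a, b) \<bullet> qinj Q qunit a b b = RUn V (Q (a, b))"
proof -
  let ?h = "\<lambda>a b. amap (quiv_run V S Q) (a, b)"
  have *: "?h a b \<in> hom V (qten Q qunit (a, b)) (Q (a, b)) \<and> ?h a b \<bullet> qinj Q qunit a b b = RUn V (Q (a, b))"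
    if "a \<in> S" "b \<in> S" for a b
  proof -
    have "\<exists>!h. h \<in> hom V (qten Q qunit (a, b)) (Q (a, b)) \<and> (\<forall>i\<in>{b}. h \<bullet> qinj Q qunit a b i = RUn V (Q (a, b)))"
      by (rule coprod_ex1[OF run_coprod[OF Q that]]) (use Q that in \<open>simp_all add: hom_def\<close>)
    then have "\<exists>!h. h \<in> hom V (qten Q qunit (a, b)) (Q (a, b)) \<and> h \<bullet> qinj Q qunit a b b = RUn V (Q (a, b))"
      by simp
    from theI'[OF this] show ?thesis using that by (simp add: quiv_run_def Let_def)
  qed
  show 1: "src (quiv_run V S Q) = qten Q qunit" "tgt (quiv_run V S Q) = Q"
    by (simp_all add: quiv_run_def Let_def)
  have "amap (quiv_run V S Q) \<in> extensional (S \<times> S)"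
    by (simp add: quiv_run_def Let_def)
  then show arr: "quiv_run V S Q \<in> Arr QV"
    unfolding quiv_Arr 1 using Q * by simp
  show "is_iso QV (quiv_run V S Q)"
  proof (rule is_iso_quiv[OF arr])
    fix a b assume ab: "a \<in> S" "b \<in> S"
    have "is_coprod V {b} (\<lambda>c. Dom V (RUn V (Q (a, b)))) (Cod V (RUn V (Q (a, b)))) (\<lambda>_. RUn V (Q (a, b)))"
      by (rule coprod_singleton) (use Q ab in simp)
    then have "is_coprod V {b} (\<lambda>c. Q (a, c) \<otimes> qunit (c, b)) (Q (a, b)) (\<lambda>_. RUn V (Q (a, b)))"
      unfolding Arr_RUn(3)[OF QOb_Ob[OF Q ab]] by (rule coprod_cong) (use Q ab in simp_all)
    from coprod_unique_iso[OF run_coprod[OF Q ab] this] show "is_iso V (?h a b)"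
      using *[OF ab] by simp
  qed
  show "a \<in> S \<Longrightarrow> b \<in> S \<Longrightarrow> ?h a b \<bullet> qinj Q qunit a b b = RUn V (Q (a, b))"
    using * by blast
qed

declare qlun(1-4) [simp] qrun(1-4) [simp]

lemma qlun_Comp:
  assumes "Q \<in> QOb" "a \<in> S" "b \<in> S" "k \<in> Arr V" "Cod V k = \<one> \<otimes> Q (a, b)"
  shows "amap (quiv_lun V S Q) (a, b) \<bullet> (qinj qunit Q a b a \<bullet> k) = LUn V (Q (a, b)) \<bullet> k"
  unfolding qlun(5)[OF assms(1-3), symmetric] using assms by simp

lemma qrun_Comp:
  assumes "Q \<in> QOb" "a \<in> S" "b \<in> S" "k \<in> Arr V" "Cod V k = Q (a, b) \<otimes> \<one>"
  shows "amap (quiv_run V S Q) (a, b) \<bullet> (qinj Q qunit a b b \<bullet> k) = RUn V (Q (a, b)) \<bullet> k"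
  unfolding qrun(5)[OF assms(1-3), symmetric] using assms by simp

lemma qlun_natural:
  assumes f: "f \<in> Arr QV"
  shows "quiv_lun V S (tgt f) \<bullet>\<^bsub>QV\<^esub> quiv_ten_arr V S (Idn QV qunit) f = f \<bullet>\<^bsub>QV\<^esub> quiv_lun V S (src f)"
proof -
  interpret QV: category QV by (rule category_quiv)
  let ?l = "quiv_lun V S (tgt f) \<bullet>\<^bsub>QV\<^esub> quiv_ten_arr V S (Idn QV qunit) f"
  let ?r = "f \<bullet>\<^bsub>QV\<^esub> quiv_lun V S (src f)"
  have fQ [simp]: "src f \<in> QOb" "tgt f \<in> QOb" and I: "Idn QV qunit \<in> Arr QV" using f by simp_all
  have l: "?l \<in> Arr QV" "src ?l = qten qunit (src f)" "tgt ?l = tgt f"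
    by (rule QV.Arr_Comp(1)) (use f in simp_all)
  have r: "?r \<in> Arr QV" "src ?r = qten qunit (src f)" "tgt ?r = tgt f"
    by (rule QV.Arr_Comp(1)) (use f in simp_all)
  show ?thesis
  proof (rule quiv_eqI[OF l(1) r(1)])
    fix a b assume ab [simp]: "a \<in> S" "b \<in> S"
    show "amap ?l (a, b) = amap ?r (a, b)"
    proof (rule coprod_ext[OF lun_coprod[OF fQ(1) ab]])
      show "amap ?l (a, b) \<in> hom V (qten qunit (src f) (a, b)) (tgt f (a, b))"
        "amap ?r (a, b) \<in> hom V (qten qunit (src f) (a, b)) (tgt f (a, b))"
        using quiv_hom[OF l(1) ab] quiv_hom[OF r(1) ab] unfolding l r .
      fix i assume "i \<in> {a}"
      then have i [simp]: "i = a" by simp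
      have "amap (quiv_ten_arr V S (Idn QV qunit) f) (a, b) \<bullet> qinj qunit (src f) a b a =
          qinj qunit (tgt f) a b a \<bullet> (Idn V \<one> \<odot> amap f (a, b))"
        using qten_arr(4)[OF I f ab ab(1)] by simp
      then have "amap ?l (a, b) \<bullet> qinj qunit (src f) a b a = LUn V (tgt f (a, b)) \<bullet> (Idn V \<one> \<odot> amap f (a, b))"
        using f I by (simp del: quiv_simps(4) add: qlun_Comp)
      also have "\<dots> = amap f (a, b) \<bullet> LUn V (src f (a, b))"
        using quiv_hom[OF f ab] by (rule LUn_natural)
      also have "\<dots> = amap ?r (a, b) \<bullet> qinj qunit (src f) a b a"
        using f by (simp add: qlun(5))
      finally show "amap ?l (a, b) \<bullet> qinj qunit (src f) a b i = amap ?r (a, b) \<bullet> qinj qunit (src f) a b i"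
        unfolding i .
    qed
  qed (simp_all only: l r)
qed

lemma qrun_natural:
  assumes f: "f \<in> Arr QV"
  shows "quiv_run V S (tgt f) \<bullet>\<^bsub>QV\<^esub> quiv_ten_arr V S f (Idn QV qunit) = f \<bullet>\<^bsub>QV\<^esub> quiv_run V S (src f)"
proof -
  interpret QV: category QV by (rule category_quiv)
  let ?l = "quiv_run V S (tgt f) \<bullet>\<^bsub>QV\<^esub> quiv_ten_arr V S f (Idn QV qunit)"
  let ?r = "f \<bullet>\<^bsub>QV\<^esub> quiv_run V S (src f)"
  have fQ [simp]: "src f \<in> QOb" "tgt f \<in> QOb" and I: "Idn QV qunit \<in> Arr QV" using f by simp_all
  have l: "?l \<in> Arr QV" "src ?l = qten (src f) qunit" "tgt ?l = tgt f"
    by (rule QV.Arr_Comp(1)) (use f in simp_all)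
  have r: "?r \<in> Arr QV" "src ?r = qten (src f) qunit" "tgt ?r = tgt f"
    by (rule QV.Arr_Comp(1)) (use f in simp_all)
  show ?thesis
  proof (rule quiv_eqI[OF l(1) r(1)])
    fix a b assume ab [simp]: "a \<in> S" "b \<in> S"
    show "amap ?l (a, b) = amap ?r (a, b)"
    proof (rule coprod_ext[OF run_coprod[OF fQ(1) ab]])
      show "amap ?l (a, b) \<in> hom V (qten (src f) qunit (a, b)) (tgt f (a, b))"
        "amap ?r (a, b) \<in> hom V (qten (src f) qunit (a, b)) (tgt f (a, b))"
        using quiv_hom[OF l(1) ab] quiv_hom[OF r(1) ab] unfolding l r .
      fix i assume "i \<in> {b}"
      then have i [simp]: "i = b" by simp
      have "amap (quiv_ten_arr V S f (Idn QV qunit)) (a, b) \<bullet> qinj (src f) qunit a b b =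
          qinj (tgt f) qunit a b b \<bullet> (amap f (a, b) \<odot> Idn V \<one>)"
        using qten_arr(4)[OF f I ab ab(2)] by simp
      then have "amap ?l (a, b) \<bullet> qinj (src f) qunit a b b = RUn V (tgt f (a, b)) \<bullet> (amap f (a, b) \<odot> Idn V \<one>)"
        using f I by (simp del: quiv_simps(4) add: qrun_Comp)
      also have "\<dots> = amap f (a, b) \<bullet> RUn V (src f (a, b))"
        using quiv_hom[OF f ab] by (rule RUn_natural)
      also have "\<dots> = amap ?r (a, b) \<bullet> qinj (src f) qunit a b b"
        using f by (simp add: qrun(5))
      finally show "amap ?l (a, b) \<bullet> qinj (src f) qunit a b i = amap ?r (a, b) \<bullet> qinj (src f) qunit a b i"
        unfolding i .
    qed
  qed (simp_all only: l r)
qed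

lemma qten_Idn:
  assumes Q: "Q \<in> QOb" "P \<in> QOb"
  shows "quiv_ten_arr V S (Idn QV Q) (Idn QV P) = Idn QV (qten Q P)"
proof (rule quiv_ext2[of _ _ Q P])
  have I: "Idn QV Q \<in> Arr QV" "Idn QV P \<in> Arr QV" using Q by simp_all
  then show "quiv_ten_arr V S (Idn QV Q) (Idn QV P) \<in> Arr QV" by (rule qten_arr)
  fix a b c assume S: "a \<in> S" "b \<in> S" "c \<in> S"
  show "amap (quiv_ten_arr V S (Idn QV Q) (Idn QV P)) (a, b) \<bullet> qinj Q P a b c =
      amap (Idn QV (qten Q P)) (a, b) \<bullet> qinj Q P a b c"
    using qten_arr(4)[OF I S] Q S by simp
qed (use Q in \<open>simp_all add: quiv_ten_arr_def Let_def\<close>)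

lemma qten_Comp:
  assumes f: "f \<in> Arr QV" "f' \<in> Arr QV" "src f' = tgt f" and g: "g \<in> Arr QV" "g' \<in> Arr QV" "src g' = tgt g"
  shows "quiv_ten_arr V S (f' \<bullet>\<^bsub>QV\<^esub> f) (g' \<bullet>\<^bsub>QV\<^esub> g) = quiv_ten_arr V S f' g' \<bullet>\<^bsub>QV\<^esub> quiv_ten_arr V S f g"
proof -
  interpret QV: category QV by (rule category_quiv)
  have F: "f' \<bullet>\<^bsub>QV\<^esub> f \<in> Arr QV" and G: "g' \<bullet>\<^bsub>QV\<^esub> g \<in> Arr QV"
    using f g by (intro QV.Arr_Comp(1); simp)+
  have [simp]: "src f \<in> QOb" "src g \<in> QOb" "tgt f \<in> QOb" "tgt g \<in> QOb" "tgt f' \<in> QOb" "tgt g' \<in> QOb"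
    using f g by simp_all
  show ?thesis
  proof (rule quiv_ext2[of _ _ "src f" "src g"])
    show "quiv_ten_arr V S (f' \<bullet>\<^bsub>QV\<^esub> f) (g' \<bullet>\<^bsub>QV\<^esub> g) \<in> Arr QV" using F G by (rule qten_arr)
    show "quiv_ten_arr V S f' g' \<bullet>\<^bsub>QV\<^esub> quiv_ten_arr V S f g \<in> Arr QV"
      using f g by (intro QV.Arr_Comp(1); simp)+
    fix a b c assume S: "a \<in> S" "b \<in> S" "c \<in> S"
    have "amap (quiv_ten_arr V S f' g' \<bullet>\<^bsub>QV\<^esub> quiv_ten_arr V S f g) (a, b) \<bullet> qinj (src f) (src g) a b c =
        amap (quiv_ten_arr V S f' g') (a, b) \<bullet> (amap (quiv_ten_arr V S f g) (a, b) \<bullet> qinj (src f) (src g) a b c)"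
      using f g S by simp
    also have "\<dots> = amap (quiv_ten_arr V S f' g') (a, b) \<bullet>
        (qinj (tgt f) (tgt g) a b c \<bullet> (amap f (a, c) \<odot> amap g (c, b)))"
      unfolding qten_arr(4)[OF f(1) g(1) S] ..
    also have "\<dots> = qinj (tgt f') (tgt g') a b c \<bullet> ((amap f' (a, c) \<odot> amap g' (c, b)) \<bullet> (amap f (a, c) \<odot> amap g (c, b)))"
      using f g S by (intro qten_arr_Comp) simp_all
    finally show "amap (quiv_ten_arr V S (f' \<bullet>\<^bsub>QV\<^esub> f) (g' \<bullet>\<^bsub>QV\<^esub> g)) (a, b) \<bullet> qinj (src f) (src g) a b c =
        amap (quiv_ten_arr V S f' g' \<bullet>\<^bsub>QV\<^esub> quiv_ten_arr V S f g) (a, b) \<bullet> qinj (src f) (src g) a b c"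
      using qten_arr(4)[OF F G S] f g S by simp
  qed (use f g in \<open>simp_all add: quiv_ten_arr_def Let_def\<close>)
qed

lemma qtriangle:
  assumes Q: "Q \<in> QOb" and P: "P \<in> QOb"
  shows "quiv_ten_arr V S (Idn QV Q) (quiv_lun V S P) \<bullet>\<^bsub>QV\<^esub> quiv_assoc V S Q qunit P =
    quiv_ten_arr V S (quiv_run V S Q) (Idn QV P)"
proof -
  interpret QV: category QV by (rule category_quiv)
  have I: "Idn QV Q \<in> Arr QV" "Idn QV P \<in> Arr QV" using Q P by simp_all
  note l = qlun(1)[OF P] and r = qrun(1)[OF Q]
  let ?l = "quiv_ten_arr V S (Idn QV Q) (quiv_lun V S P) \<bullet>\<^bsub>QV\<^esub> quiv_assoc V S Q qunit P"
  let ?r = "quiv_ten_arr V S (quiv_run V S Q) (Idn QV P)"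
  have L: "?l \<in> Arr QV" "src ?l = qten (qten Q qunit) P" "tgt ?l = qten Q P"
    by (rule QV.Arr_Comp(1)) (use Q P in simp_all)
  have R: "?r \<in> Arr QV" "src ?r = qten (qten Q qunit) P" "tgt ?r = qten Q P"
    using Q P I by simp_all
  show ?thesis
  proof (rule quiv_eqI[OF L(1) R(1)])
    fix a b assume ab [simp]: "a \<in> S" "b \<in> S"
    \<comment> \<open>The middle factor is the unit quiver, so by \<open>run_coprod\<close> only the
      paths with c = d contribute and the coproduct runs over the diagonal.\<close>
    have cp: "is_coprod V (Sigma S (\<lambda>d. {d})) (\<lambda>(d, c). (Q (a, c) \<otimes> qunit (c, d)) \<otimes> P (d, b))
        (qten (qten Q qunit) P (a, b))
        (\<lambda>(d, c). qinj (qten Q qunit) P a b d \<bullet> (qinj Q qunit a d c \<odot> Idn V (P (d, b))))"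
    proof (rule coprod_Sigma)
      show "is_coprod V S (\<lambda>d. qten Q qunit (a, d) \<otimes> P (d, b)) (qten (qten Q qunit) P (a, b))
          (qinj (qten Q qunit) P a b)"
        by (rule qinj_coprod) (use Q P in simp_all)
      show "is_coprod V {d} (\<lambda>c. (Q (a, c) \<otimes> qunit (c, d)) \<otimes> P (d, b)) (qten Q qunit (a, d) \<otimes> P (d, b))
          (\<lambda>c. qinj Q qunit a d c \<odot> Idn V (P (d, b)))" if "d \<in> S" for d
        by (rule coprod_TenO_right, rule run_coprod) (use Q P that in simp_all)
    qed
    show "amap ?l (a, b) = amap ?r (a, b)"
    proof (rule coprod_ext[OF cp])
      show "amap ?l (a, b) \<in> hom V (qten (qten Q qunit) P (a, b)) (qten Q P (a, b))"
        "amap ?r (a, b) \<in> hom V (qten (qten Q qunit) P (a, b)) (qten Q P (a, b))"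
        using quiv_hom[OF L(1) ab] quiv_hom[OF R(1) ab] unfolding L R .
      fix i assume "i \<in> Sigma S (\<lambda>d. {d})"
      then obtain d where i: "i = (d, d)" and d [simp]: "d \<in> S" by auto
      let ?j = "qinj (qten Q qunit) P a b d \<bullet> (qinj Q qunit a d d \<odot> Idn V (P (d, b)))"
      have "amap ?l (a, b) \<bullet> ?j = amap (quiv_ten_arr V S (Idn QV Q) (quiv_lun V S P)) (a, b) \<bullet>
          (amap (quiv_assoc V S Q qunit P) (a, b) \<bullet> ?j)"
        using Q P I l by (simp del: quiv_simps(4))
      also have "\<dots> = amap (quiv_ten_arr V S (Idn QV Q) (quiv_lun V S P)) (a, b) \<bullet>
          (qinj Q (qten qunit P) a b d \<bullet> ((Idn V (Q (a, d)) \<odot> qinj qunit P d b d) \<bullet>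
          Assoc V (Q (a, d)) \<one> (P (d, b))))"
        using qassoc(5)[OF Q qunit_QOb P ab d d] by simp
      also have "\<dots> = qinj Q P a b d \<bullet> ((Idn V (Q (a, d)) \<odot> amap (quiv_lun V S P) (d, b)) \<bullet>
          ((Idn V (Q (a, d)) \<odot> qinj qunit P d b d) \<bullet> Assoc V (Q (a, d)) \<one> (P (d, b))))"
        using qten_arr_Comp[OF I(1) l ab d, of Q "qten qunit P"
            "(Idn V (Q (a, d)) \<odot> qinj qunit P d b d) \<bullet> Assoc V (Q (a, d)) \<one> (P (d, b))"] Q P
        by (simp del: TenA_Comp_Comp)
      also have "\<dots> = qinj Q P a b d \<bullet> ((Idn V (Q (a, d)) \<odot> LUn V (P (d, b))) \<bullet> Assoc V (Q (a, d)) \<one> (P (d, b)))"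
        using Q P by (simp add: qlun(5))
      also have "\<dots> = qinj Q P a b d \<bullet> (RUn V (Q (a, d)) \<odot> Idn V (P (d, b)))"
        using Q P by (simp add: triangle)
      also have "\<dots> = qinj Q P a b d \<bullet> ((amap (quiv_run V S Q) (a, d) \<odot> Idn V (P (d, b))) \<bullet> (qinj Q qunit a d d \<odot> Idn V (P (d, b))))"
        using Q P by (simp add: qrun(5))
      also have "\<dots> = amap ?r (a, b) \<bullet> ?j"
        using qten_arr_Comp[OF r I(2) ab d, of "qten Q qunit" P "qinj Q qunit a d d \<odot> Idn V (P (d, b))"] Q P
        by simp
      finally show "amap ?l (a, b) \<bullet> (case i of (d, c) \<Rightarrow> qinj (qten Q qunit) P a b d \<bullet> (qinj Q qunit a d c \<odot> Idn V (P (d, b)))) =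
        amap ?r (a, b) \<bullet> (case i of (d, c) \<Rightarrow> qinj (qten Q qunit) P a b d \<bullet> (qinj Q qunit a d c \<odot> Idn V (P (d, b))))"
        unfolding i prod.case .
    qed
  qed (simp_all only: L R)
qed

subsection \<open>The pentagon\<close>

lemma Assoc_natural_left:
  assumes "f \<in> Arr V" "g \<in> Arr V" "h \<in> Arr V" "k \<in> Arr V" "Cod V k = Dom V f \<otimes> Dom V g"
  shows "Assoc V (Cod V f) (Cod V g) (Cod V h) \<bullet> (((f \<odot> g) \<bullet> k) \<odot> h) =
    (f \<odot> (g \<odot> h)) \<bullet> (Assoc V (Dom V f) (Dom V g) (Dom V h) \<bullet> (k \<odot> Idn V (Dom V h)))"
proof -
  have "((f \<odot> g) \<bullet> k) \<odot> h = ((f \<odot> g) \<odot> h) \<bullet> (k \<odot> Idn V (Dom V h))" using assms by simp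
  then show ?thesis
    using Assoc_natural_Comp[of f g h "k \<odot> Idn V (Dom V h)"] assms by simp
qed

lemma qpentagon:
  assumes Q: "Q \<in> QOb" "P \<in> QOb" "R \<in> QOb" "K \<in> QOb"
  shows "quiv_ten_arr V S (Idn QV Q) (quiv_assoc V S P R K) \<bullet>\<^bsub>QV\<^esub>
      quiv_assoc V S Q (qten P R) K \<bullet>\<^bsub>QV\<^esub> quiv_ten_arr V S (quiv_assoc V S Q P R) (Idn QV K) =
    quiv_assoc V S Q P (qten R K) \<bullet>\<^bsub>QV\<^esub> quiv_assoc V S (qten Q P) R K"
proof -
  interpret QV: category QV by (rule category_quiv)
  let ?A1 = "quiv_ten_arr V S (quiv_assoc V S Q P R) (Idn QV K)"
    and ?A2 = "quiv_assoc V S Q (qten P R) K"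
    and ?A3 = "quiv_ten_arr V S (Idn QV Q) (quiv_assoc V S P R K)"
    and ?B1 = "quiv_assoc V S (qten Q P) R K" and ?B2 = "quiv_assoc V S Q P (qten R K)"
  note Q' = qten_QOb[OF Q(1,2)] qten_QOb[OF Q(2,3)] qten_QOb[OF Q(3,4)]
  have A: "?A1 \<in> Arr QV" "?A2 \<in> Arr QV" "?A3 \<in> Arr QV" "?B1 \<in> Arr QV" "?B2 \<in> Arr QV"
    and As: "src ?A1 = qten (qten (qten Q P) R) K" "tgt ?A1 = qten (qten Q (qten P R)) K"
    "src ?A2 = qten (qten Q (qten P R)) K" "tgt ?A2 = qten Q (qten (qten P R) K)"
    "src ?A3 = qten Q (qten (qten P R) K)" "tgt ?A3 = qten Q (qten P (qten R K))"
    "src ?B1 = qten (qten (qten Q P) R) K" "tgt ?B1 = qten (qten Q P) (qten R K)"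
    "src ?B2 = qten (qten Q P) (qten R K)" "tgt ?B2 = qten Q (qten P (qten R K))"
    using Q by (simp_all del: quiv_simps(4))
  let ?l = "?A3 \<bullet>\<^bsub>QV\<^esub> ?A2 \<bullet>\<^bsub>QV\<^esub> ?A1" and ?r = "?B2 \<bullet>\<^bsub>QV\<^esub> ?B1"
  have L: "?l \<in> Arr QV" "src ?l = qten (qten (qten Q P) R) K" "tgt ?l = qten Q (qten P (qten R K))"
    using A As QV.Arr_Comp[of ?A1 ?A2] QV.Arr_Comp[of "?A2 \<bullet>\<^bsub>QV\<^esub> ?A1" ?A3]
    by (simp_all only: quiv_simps arrow.sel)
  have R: "?r \<in> Arr QV" "src ?r = qten (qten (qten Q P) R) K" "tgt ?r = qten Q (qten P (qten R K))"
    using A As QV.Arr_Comp[of ?B1 ?B2] by (simp_all only: quiv_simps arrow.sel)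
  show ?thesis
  proof (rule quiv_eqI[OF L(1) R(1)])
    fix a b assume ab [simp]: "a \<in> S" "b \<in> S"
    \<comment> \<open>The fourfold product as a coproduct over the paths a, x, y, z, b.\<close>
    have cp: "is_coprod V (Sigma S (\<lambda>z. S \<times> S))
        (\<lambda>(z, i). (case i of (y, x) \<Rightarrow> (Q (a, x) \<otimes> P (x, y)) \<otimes> R (y, z)) \<otimes> K (z, b))
        (qten (qten (qten Q P) R) K (a, b))
        (\<lambda>(z, i). qinj (qten (qten Q P) R) K a b z \<bullet>
          ((case i of (y, x) \<Rightarrow> qinj (qten Q P) R a z y \<bullet> (qinj Q P a y x \<odot> Idn V (R (y, z)))) \<odot> Idn V (K (z, b))))"
    proof (rule coprod_Sigma)
      show "is_coprod V S (\<lambda>z. qten (qten Q P) R (a, z) \<otimes> K (z, b)) (qten (qten (qten Q P) R) K (a, b))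
          (qinj (qten (qten Q P) R) K a b)"
        by (rule qinj_coprod) (use Q in simp_all)
      show "is_coprod V (S \<times> S) (\<lambda>i. (case i of (y, x) \<Rightarrow> (Q (a, x) \<otimes> P (x, y)) \<otimes> R (y, z)) \<otimes> K (z, b))
          (qten (qten Q P) R (a, z) \<otimes> K (z, b))
          (\<lambda>i. (case i of (y, x) \<Rightarrow> qinj (qten Q P) R a z y \<bullet> (qinj Q P a y x \<odot> Idn V (R (y, z)))) \<odot> Idn V (K (z, b)))"
        if "z \<in> S" for z
        by (rule coprod_TenO_right, rule qinj3_coprod) (use Q that in simp_all)
    qed
    show "amap ?l (a, b) = amap ?r (a, b)"
    proof (rule coprod_ext[OF cp])
      show "amap ?l (a, b) \<in> hom V (qten (qten (qten Q P) R) K (a, b)) (qten Q (qten P (qten R K)) (a, b))"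
        "amap ?r (a, b) \<in> hom V (qten (qten (qten Q P) R) K (a, b)) (qten Q (qten P (qten R K)) (a, b))"
        using quiv_hom[OF L(1) ab] quiv_hom[OF R(1) ab] unfolding L R .
      fix i assume "i \<in> Sigma S (\<lambda>z. S \<times> S)"
      then obtain x y z where i: "i = (z, y, x)" and xyz [simp]: "x \<in> S" "y \<in> S" "z \<in> S" by auto
      have ob [simp]: "Q (a, x) \<in> Ob V" "P (x, y) \<in> Ob V" "R (y, z) \<in> Ob V" "K (z, b) \<in> Ob V"
        using Q by simp_all
      let ?q = "Q (a, x)" and ?p = "P (x, y)" and ?R = "R (y, z)" and ?k = "K (z, b)"
      let ?e = "qinj (qten Q P) R a z y \<bullet> (qinj Q P a y x \<odot> Idn V ?R)"
      let ?j = "qinj (qten (qten Q P) R) K a b z \<bullet> (?e \<odot> Idn V ?k)"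
      \<comment> \<open>One side of the pentagon in V. Both composites of quiver associators are
        moved past the coprojection of the path until they differ only in the two sides of this
        pentagon.\<close>
      let ?t = "(Idn V ?q \<odot> Assoc V ?p ?R ?k) \<bullet> (Assoc V ?q (?p \<otimes> ?R) ?k \<bullet> (Assoc V ?q ?p ?R \<odot> Idn V ?k))"
      let ?u = "Assoc V ?q (?p \<otimes> ?R) ?k \<bullet> (Assoc V ?q ?p ?R \<odot> Idn V ?k)"
      let ?m = "(Idn V ?q \<odot> qinj P R x z y) \<bullet> Assoc V ?q ?p ?R"
      have "amap ?A1 (a, b) \<bullet> ?j = qinj (qten Q (qten P R)) K a b z \<bullet>
          ((amap (quiv_assoc V S Q P R) (a, z) \<odot> Idn V ?k) \<bullet> (?e \<odot> Idn V ?k))"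
        using qten_arr_Comp[of "quiv_assoc V S Q P R" "Idn QV K" a b z "qten (qten Q P) R" K "?e \<odot> Idn V ?k"] Q
        by (simp del: TenA_Comp' TenA_Comp_Comp)
      also have "\<dots> = qinj (qten Q (qten P R)) K a b z \<bullet>
          ((amap (quiv_assoc V S Q P R) (a, z) \<bullet> ?e) \<odot> Idn V ?k)"
        using Q by simp
      also have "\<dots> = qinj (qten Q (qten P R)) K a b z \<bullet> ((qinj Q (qten P R) a z x \<bullet> ?m) \<odot> Idn V ?k)"
        unfolding qassoc(5)[OF Q(1-3) ab(1) xyz(3) xyz(1,2)] ..
      finally have 1: "amap ?A1 (a, b) \<bullet> ?j =
        qinj (qten Q (qten P R)) K a b z \<bullet> ((qinj Q (qten P R) a z x \<bullet> ?m) \<odot> Idn V ?k)" .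
      have "amap ?A2 (a, b) \<bullet> (amap ?A1 (a, b) \<bullet> ?j) = qinj Q (qten (qten P R) K) a b x \<bullet>
          ((Idn V ?q \<odot> qinj (qten P R) K x b z) \<bullet> (Assoc V ?q (qten P R (x, z)) ?k \<bullet> (?m \<odot> Idn V ?k)))"
        unfolding 1 by (rule qassoc_Comp) (use Q in simp_all)
      also have "Assoc V ?q (qten P R (x, z)) ?k \<bullet> (?m \<odot> Idn V ?k) =
          (Idn V ?q \<odot> (qinj P R x z y \<odot> Idn V ?k)) \<bullet> ?u"
        using Assoc_natural_left[of "Idn V ?q" "qinj P R x z y" "Idn V ?k" "Assoc V ?q ?p ?R"] Q by simp
      also have "(Idn V ?q \<odot> qinj (qten P R) K x b z) \<bullet> ((Idn V ?q \<odot> (qinj P R x z y \<odot> Idn V ?k)) \<bullet> ?u) =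
          (Idn V ?q \<odot> (qinj (qten P R) K x b z \<bullet> (qinj P R x z y \<odot> Idn V ?k))) \<bullet> ?u"
        using Q by simp
      finally have 2: "amap ?A2 (a, b) \<bullet> (amap ?A1 (a, b) \<bullet> ?j) = qinj Q (qten (qten P R) K) a b x \<bullet>
          ((Idn V ?q \<odot> (qinj (qten P R) K x b z \<bullet> (qinj P R x z y \<odot> Idn V ?k))) \<bullet> ?u)" .
      have "amap ?A3 (a, b) \<bullet> (amap ?A2 (a, b) \<bullet> (amap ?A1 (a, b) \<bullet> ?j)) = qinj Q (qten P (qten R K)) a b x \<bullet>
          ((Idn V ?q \<odot> amap (quiv_assoc V S P R K) (x, b)) \<bullet>
          ((Idn V ?q \<odot> (qinj (qten P R) K x b z \<bullet> (qinj P R x z y \<odot> Idn V ?k))) \<bullet> ?u))"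
        unfolding 2
        using qten_arr_Comp[of "Idn QV Q" "quiv_assoc V S P R K" a b x Q "qten (qten P R) K"
          "(Idn V ?q \<odot> (qinj (qten P R) K x b z \<bullet> (qinj P R x z y \<odot> Idn V ?k))) \<bullet> ?u"] Q
        by (simp del: TenA_Comp' TenA_Comp_Comp)
      also have "\<dots> = qinj Q (qten P (qten R K)) a b x \<bullet>
          ((Idn V ?q \<odot> (amap (quiv_assoc V S P R K) (x, b) \<bullet> (qinj (qten P R) K x b z \<bullet> (qinj P R x z y \<odot> Idn V ?k)))) \<bullet> ?u)"
        using Q by simp
      also have "\<dots> = qinj Q (qten P (qten R K)) a b x \<bullet>
          ((Idn V ?q \<odot> (qinj P (qten R K) x b y \<bullet> ((Idn V ?p \<odot> qinj R K y b z) \<bullet> Assoc V ?p ?R ?k))) \<bullet> ?u)"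
        unfolding qassoc(5)[OF Q(2-4) xyz(1) ab(2) xyz(2,3)] ..
      also have "\<dots> = qinj Q (qten P (qten R K)) a b x \<bullet>
          ((Idn V ?q \<odot> qinj P (qten R K) x b y) \<bullet> ((Idn V ?q \<odot> (Idn V ?p \<odot> qinj R K y b z)) \<bullet> ?t))"
        using Q by simp
      finally have l: "amap ?A3 (a, b) \<bullet> (amap ?A2 (a, b) \<bullet> (amap ?A1 (a, b) \<bullet> ?j)) =
        qinj Q (qten P (qten R K)) a b x \<bullet>
          ((Idn V ?q \<odot> qinj P (qten R K) x b y) \<bullet> ((Idn V ?q \<odot> (Idn V ?p \<odot> qinj R K y b z)) \<bullet> ?t))" .
      let ?n = "Assoc V (?q \<otimes> ?p) ?R ?k"
      have "amap ?B1 (a, b) \<bullet> ?j = qinj (qten Q P) (qten R K) a b y \<bullet>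
          ((Idn V (qten Q P (a, y)) \<odot> qinj R K y b z) \<bullet>
          (Assoc V (qten Q P (a, y)) ?R ?k \<bullet> ((qinj Q P a y x \<odot> Idn V ?R) \<odot> Idn V ?k)))"
        by (rule qassoc_Comp) (use Q in simp_all)
      also have "Assoc V (qten Q P (a, y)) ?R ?k \<bullet> ((qinj Q P a y x \<odot> Idn V ?R) \<odot> Idn V ?k) =
          (qinj Q P a y x \<odot> Idn V (?R \<otimes> ?k)) \<bullet> ?n"
        using Assoc_natural'[of "qinj Q P a y x" "Idn V ?R" "Idn V ?k"] Q by simp
      also have "(Idn V (qten Q P (a, y)) \<odot> qinj R K y b z) \<bullet> ((qinj Q P a y x \<odot> Idn V (?R \<otimes> ?k)) \<bullet> ?n) =
          ((qinj Q P a y x \<bullet> Idn V (?q \<otimes> ?p)) \<odot> qinj R K y b z) \<bullet> ?n"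
        using Q by simp
      finally have 3: "amap ?B1 (a, b) \<bullet> ?j = qinj (qten Q P) (qten R K) a b y \<bullet>
          (((qinj Q P a y x \<bullet> Idn V (?q \<otimes> ?p)) \<odot> qinj R K y b z) \<bullet> ?n)" .
      have "amap ?B2 (a, b) \<bullet> (amap ?B1 (a, b) \<bullet> ?j) =
          (amap ?B2 (a, b) \<bullet> (qinj (qten Q P) (qten R K) a b y \<bullet>
          ((qinj Q P a y x \<bullet> Idn V (?q \<otimes> ?p)) \<odot> qinj R K y b z))) \<bullet> ?n"
        unfolding 3 using Q A As by simp
      also have "amap ?B2 (a, b) \<bullet> (qinj (qten Q P) (qten R K) a b y \<bullet>
          ((qinj Q P a y x \<bullet> Idn V (?q \<otimes> ?p)) \<odot> qinj R K y b z)) =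
          qinj Q (qten P (qten R K)) a b x \<bullet> ((Idn V ?q \<odot> qinj P (qten R K) x b y) \<bullet>
          (Assoc V ?q ?p (qten R K (y, b)) \<bullet> (Idn V (?q \<otimes> ?p) \<odot> qinj R K y b z)))"
        by (rule qassoc_Comp) (use Q in simp_all)
      also have "Assoc V ?q ?p (qten R K (y, b)) \<bullet> (Idn V (?q \<otimes> ?p) \<odot> qinj R K y b z) =
          (Idn V ?q \<odot> (Idn V ?p \<odot> qinj R K y b z)) \<bullet> Assoc V ?q ?p (?R \<otimes> ?k)"
        using Assoc_natural'[of "Idn V ?q" "Idn V ?p" "qinj R K y b z"] Q by simp
      finally have "amap ?B2 (a, b) \<bullet> (amap ?B1 (a, b) \<bullet> ?j) = qinj Q (qten P (qten R K)) a b x \<bullet>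
          ((Idn V ?q \<odot> qinj P (qten R K) x b y) \<bullet> ((Idn V ?q \<odot> (Idn V ?p \<odot> qinj R K y b z)) \<bullet>
          (Assoc V ?q ?p (?R \<otimes> ?k) \<bullet> ?n)))"
        using Q by (simp del: TenA_Comp' TenA_Comp_Comp)
      also have "Assoc V ?q ?p (?R \<otimes> ?k) \<bullet> ?n = ?t" by (rule pentagon[symmetric]) simp_all
      finally have "amap ?A3 (a, b) \<bullet> (amap ?A2 (a, b) \<bullet> (amap ?A1 (a, b) \<bullet> ?j)) =
          amap ?B2 (a, b) \<bullet> (amap ?B1 (a, b) \<bullet> ?j)"
        unfolding l ..
      moreover have "?j \<in> Arr V" "Cod V ?j = qten (qten (qten Q P) R) K (a, b)" using Q by simp_all
      ultimately have "amap ?l (a, b) \<bullet> ?j = amap ?r (a, b) \<bullet> ?j"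
        using quiv_ArrD(3-5)[OF A(1) ab] quiv_ArrD(3-5)[OF A(2) ab] quiv_ArrD(3-5)[OF A(3) ab]
          quiv_ArrD(3-5)[OF A(4) ab] quiv_ArrD(3-5)[OF A(5) ab] As
        by (simp del: quiv_simps(4) quiv_ArrD qten_arr qassoc TenA_Comp' TenA_Comp_Comp)
      then show "amap ?l (a, b) \<bullet> (case i of (z, i) \<Rightarrow> qinj (qten (qten Q P) R) K a b z \<bullet>
          ((case i of (y, x) \<Rightarrow> qinj (qten Q P) R a z y \<bullet> (qinj Q P a y x \<odot> Idn V (R (y, z)))) \<odot> Idn V (K (z, b)))) =
        amap ?r (a, b) \<bullet> (case i of (z, i) \<Rightarrow> qinj (qten (qten Q P) R) K a b z \<bullet>
          ((case i of (y, x) \<Rightarrow> qinj (qten Q P) R a z y \<bullet> (qinj Q P a y x \<odot> Idn V (R (y, z)))) \<odot> Idn V (K (z, b))))"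
        unfolding i prod.case .
    qed
  qed (simp_all only: L R)
qed

lemma monoidal_category_quiv: "monoidal_category QV"
proof -
  interpret QV: category QV by (rule category_quiv)
  have homD: "f \<in> Arr QV" "src f = x" "tgt f = y" if "f \<in> hom QV x y" for f x y
    using that by (simp_all add: hom_def)
  show ?thesis
  proof
    show "Unit QV \<in> Ob QV" by simp
    show "x \<otimes>\<^bsub>QV\<^esub> y \<in> Ob QV" if "x \<in> Ob QV" "y \<in> Ob QV" for x y using that by simp
    show "f \<odot>\<^bsub>QV\<^esub> g \<in> hom QV (x \<otimes>\<^bsub>QV\<^esub> y) (x' \<otimes>\<^bsub>QV\<^esub> y')" if "f \<in> hom QV x x'" "g \<in> hom QV y y'" for f g x x' y y'
      using homD[OF that(1)] homD[OF that(2)] by (simp add: hom_def)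
    show "Idn QV x \<odot>\<^bsub>QV\<^esub> Idn QV y = Idn QV (x \<otimes>\<^bsub>QV\<^esub> y)" if "x \<in> Ob QV" "y \<in> Ob QV" for x y
      using qten_Idn[of x y] that by simp
    show "(f' \<bullet>\<^bsub>QV\<^esub> f) \<odot>\<^bsub>QV\<^esub> (g' \<bullet>\<^bsub>QV\<^esub> g) = (f' \<odot>\<^bsub>QV\<^esub> g') \<bullet>\<^bsub>QV\<^esub> (f \<odot>\<^bsub>QV\<^esub> g)"
      if "f \<in> hom QV x x'" "f' \<in> hom QV x' x''" "g \<in> hom QV y y'" "g' \<in> hom QV y' y''" for f f' g g' x x' x'' y y' y''
      using qten_Comp[of f f' g g'] homD[OF that(1)] homD[OF that(2)] homD[OF that(3)] homD[OF that(4)] by simp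
    show "Assoc QV x y z \<in> hom QV ((x \<otimes>\<^bsub>QV\<^esub> y) \<otimes>\<^bsub>QV\<^esub> z) (x \<otimes>\<^bsub>QV\<^esub> (y \<otimes>\<^bsub>QV\<^esub> z))"
      "is_iso QV (Assoc QV x y z)" if "x \<in> Ob QV" "y \<in> Ob QV" "z \<in> Ob QV" for x y z
      using that by (simp_all add: hom_def)
    show "Assoc QV x' y' z' \<bullet>\<^bsub>QV\<^esub> ((f \<odot>\<^bsub>QV\<^esub> g) \<odot>\<^bsub>QV\<^esub> h) = (f \<odot>\<^bsub>QV\<^esub> (g \<odot>\<^bsub>QV\<^esub> h)) \<bullet>\<^bsub>QV\<^esub> Assoc QV x y z"
      if "f \<in> hom QV x x'" "g \<in> hom QV y y'" "h \<in> hom QV z z'" for f g h x x' y y' z z'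
      using qassoc_natural[of f g h] homD[OF that(1)] homD[OF that(2)] homD[OF that(3)] by simp
    show "LUn QV x \<in> hom QV (Unit QV \<otimes>\<^bsub>QV\<^esub> x) x" "is_iso QV (LUn QV x)"
      "RUn QV x \<in> hom QV (x \<otimes>\<^bsub>QV\<^esub> Unit QV) x" "is_iso QV (RUn QV x)" if "x \<in> Ob QV" for x
      using that by (simp_all add: hom_def)
    show "LUn QV y \<bullet>\<^bsub>QV\<^esub> (Idn QV (Unit QV) \<odot>\<^bsub>QV\<^esub> f) = f \<bullet>\<^bsub>QV\<^esub> LUn QV x"
      "RUn QV y \<bullet>\<^bsub>QV\<^esub> (f \<odot>\<^bsub>QV\<^esub> Idn QV (Unit QV)) = f \<bullet>\<^bsub>QV\<^esub> RUn QV x" if "f \<in> hom QV x y" for f x y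
      using qlun_natural[of f] qrun_natural[of f] homD[OF that] by simp_all
    show "(Idn QV w \<odot>\<^bsub>QV\<^esub> Assoc QV x y z) \<bullet>\<^bsub>QV\<^esub> Assoc QV w (x \<otimes>\<^bsub>QV\<^esub> y) z \<bullet>\<^bsub>QV\<^esub> (Assoc QV w x y \<odot>\<^bsub>QV\<^esub> Idn QV z) =
        Assoc QV w x (y \<otimes>\<^bsub>QV\<^esub> z) \<bullet>\<^bsub>QV\<^esub> Assoc QV (w \<otimes>\<^bsub>QV\<^esub> x) y z"
      if "w \<in> Ob QV" "x \<in> Ob QV" "y \<in> Ob QV" "z \<in> Ob QV" for w x y z
      using qpentagon[of w x y z] that by simp
    show "(Idn QV x \<odot>\<^bsub>QV\<^esub> LUn QV y) \<bullet>\<^bsub>QV\<^esub> Assoc QV x (Unit QV) y = RUn QV x \<odot>\<^bsub>QV\<^esub> Idn QV y"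
      if "x \<in> Ob QV" "y \<in> Ob QV" for x y
      using qtriangle[of x y] that by simp
  qed
qed

end

section \<open>Flags\<close>

text \<open>The flags of length n on T are the n-simplices of N(P_T); writing them so makes them at
  once the index set of the copower that F produces.\<close>

abbreviation flags :: "nat \<Rightarrow> necklace \<Rightarrow> simplex set" where
  "flags n T \<equiv> nerve_simplices (nec_poset T) n"

lemma flags_iff:
  "\<tau> \<in> flags n (T, p) \<longleftrightarrow> \<tau> \<in> extensional {..n} \<and> (\<forall>i\<le>n. T \<subseteq> \<tau> i \<and> \<tau> i \<subseteq> {..p}) \<and>
    (\<forall>i j. i \<le> j \<longrightarrow> j \<le> n \<longrightarrow> \<tau> i \<subseteq> \<tau> j)"
proof -
  have "mono_on {..n} \<tau> \<longleftrightarrow> (\<forall>i j. i \<le> j \<longrightarrow> j \<le> n \<longrightarrow> \<tau> i \<subseteq> \<tau> j)"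
    unfolding mono_on_def by (meson atMost_iff order_trans)
  then show ?thesis
    by (auto simp: nerve_simplices_def nec_poset_def PiE_iff)
qed

lemma is_flag_iff: "is_flag n (T, p) \<tau> \<longleftrightarrow> \<tau> \<in> flags n (T, p)"
proof
  assume *: "is_flag n (T, p) \<tau>"
  have mono: "\<tau> i \<subseteq> \<tau> j" if "i \<le> j" "j \<le> n" for i j
    using that
  proof (induction j)
    case (Suc j)
    show ?case
    proof (cases "i = Suc j")
      case False
      then have "\<tau> i \<subseteq> \<tau> j" using Suc by simp
      also have "\<tau> j \<subseteq> \<tau> (Suc j)" using * Suc.prems by (simp add: is_flag_def)
      finally show ?thesis .
    qed simp
  qed simp
  then show "\<tau> \<in> flags n (T, p)"
    using * mono[of 0] mono[of _ n] unfolding flags_iff is_flag_def by fastforce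
qed (auto simp: flags_iff is_flag_def)

lemma flanked_flags_iff: "((T, p), \<tau>) \<in> flanked_flags n \<longleftrightarrow>
    (T, p) \<in> necklaces \<and> \<tau> \<in> flags n (T, p) \<and> \<tau> 0 = T \<and> \<tau> n = {..p}"
  by (auto simp: flanked_flags_def is_flag_iff is_flanked_def)

lemma finite_flags: "finite (flags n T)"
proof -
  obtain U p where T: "T = (U, p)" by (cases T)
  have "flags n T \<subseteq> {..n} \<rightarrow>\<^sub>E Pow {..p}" unfolding T by (rule subsetI) (simp add: flags_iff PiE_iff)
  then show ?thesis by (rule finite_subset) (intro finite_PiE; simp)
qed

definition push :: "nat \<Rightarrow> (nat \<Rightarrow> nat) \<Rightarrow> simplex \<Rightarrow> simplex" where
  "push n f \<tau> = (\<lambda>i\<in>{..n}. f ` \<tau> i)"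

lemma push_flags:
  assumes "Arrow (T, p) f (U, q) \<in> Arr nec" "\<tau> \<in> flags n (T, p)"
  shows "push n f \<tau> \<in> flags n (U, q)"
proof -
  have f: "U \<subseteq> f ` T" "\<forall>i\<le>p. f i \<le> q" using assms(1) by (auto simp: nec_Arr delta_f_Arr delta_Arr)
  have "U \<subseteq> f ` \<tau> i \<and> f ` \<tau> i \<subseteq> {..q}" if "i \<le> n" for i
  proof -
    have "T \<subseteq> \<tau> i" "\<tau> i \<subseteq> {..p}" using assms(2) that by (auto simp: flags_iff)
    then show ?thesis using f by (auto simp: image_iff subset_iff) blast
  qed
  moreover have "f ` \<tau> i \<subseteq> f ` \<tau> j" if "i \<le> j" "j \<le> n" for i j
    using assms(2) that by (intro image_mono) (auto simp: flags_iff)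
  ultimately show ?thesis by (auto simp: push_def flags_iff)
qed

lemma nec_flanked_simps [simp]:
  "Ob (nec_flanked n) = flanked_flags n" "Dom (nec_flanked n) = src" "Cod (nec_flanked n) = tgt"
  "Idn (nec_flanked n) (T, \<tau>) = Arrow (T, \<tau>) (amap (Idn nec T)) (T, \<tau>)"
  "Comp (nec_flanked n) g f = Arrow (src f) (compose {..snd (fst (src f))} (amap g) (amap f)) (tgt g)"
  by (simp_all add: nec_flanked_def)

lemma nec_flanked_Arr: "Arrow (T, \<tau>) f (U, \<upsilon>) \<in> Arr (nec_flanked n) \<longleftrightarrow>
    (T, \<tau>) \<in> flanked_flags n \<and> (U, \<upsilon>) \<in> flanked_flags n \<and> Arrow T f U \<in> Arr nec \<and> (\<forall>i\<le>n. f ` \<tau> i = \<upsilon> i)"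
  by (cases T; cases U) (simp add: nec_flanked_def)

lemma flanked_flags_necklaces: "(T, \<tau>) \<in> flanked_flags n \<Longrightarrow> T \<in> necklaces"
  by (simp add: flanked_flags_def)

lemma category_op_cat: "category C \<Longrightarrow> category (op_cat C)"
  unfolding category_def by (auto simp: hom_def)

lemma category_nec_flanked: "category (nec_flanked n)"
proof -
  interpret nec: category nec by (rule category_nec)
  have ArrE: "\<exists>T \<tau> f U \<upsilon>. \<phi> = Arrow (T, \<tau>) f (U, \<upsilon>)" for \<phi> :: "(necklace \<times> simplex, nat \<Rightarrow> nat) arrow"
    by (cases \<phi>) (metis surj_pair)
  show ?thesis
  proof
    fix \<phi> assume "\<phi> \<in> Arr (nec_flanked n)"
    then show "Dom (nec_flanked n) \<phi> \<in> Ob (nec_flanked n)" "Cod (nec_flanked n) \<phi> \<in> Ob (nec_flanked n)"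
      by (auto simp: nec_flanked_def)
  next
    fix x assume x: "x \<in> Ob (nec_flanked n)"
    obtain T p \<tau> where x': "x = ((T, p), \<tau>)" by (metis surj_pair)
    have "Idn nec (T, p) \<in> Arr nec"
      using x by (intro nec.Arr_Idn) (auto simp: x' intro: flanked_flags_necklaces)
    moreover have "(\<lambda>i\<in>{..p}. i) ` \<tau> i = \<tau> i" if "i \<le> n" for i
    proof -
      have "\<tau> i \<subseteq> {..p}" using x that by (simp add: x' flanked_flags_iff flags_iff)
      then show ?thesis by force
    qed
    ultimately show "Idn (nec_flanked n) x \<in> hom (nec_flanked n) x x"
      using x by (simp add: x' hom_def nec_flanked_Arr)
  next
    fix \<phi> \<psi> x y z assume phi: "\<phi> \<in> hom (nec_flanked n) x y" and psi: "\<psi> \<in> hom (nec_flanked n) y z"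
    obtain T p \<tau> f U q \<upsilon> where phi': "\<phi> = Arrow ((T, p), \<tau>) f ((U, q), \<upsilon>)"
      using ArrE[of \<phi>] by (metis surj_pair)
    obtain U' \<upsilon>' g W \<omega> where psi': "\<psi> = Arrow (U', \<upsilon>') g (W, \<omega>)"
      using ArrE[of \<psi>] by metis
    have U [simp]: "U' = (U, q)" "\<upsilon>' = \<upsilon>" and xz: "x = ((T, p), \<tau>)" "z = (W, \<omega>)"
      using phi psi phi' psi' by (auto simp: hom_def)
    have f: "((T, p), \<tau>) \<in> flanked_flags n" "Arrow (T, p) f (U, q) \<in> Arr nec" "\<forall>i\<le>n. f ` \<tau> i = \<upsilon> i"
      using phi by (auto simp: phi' hom_def nec_flanked_Arr)
    have g: "(W, \<omega>) \<in> flanked_flags n" "Arrow (U, q) g W \<in> Arr nec" "\<forall>i\<le>n. g ` \<upsilon> i = \<omega> i"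
      using psi by (auto simp: psi' hom_def nec_flanked_Arr)
    have "Arrow (T, p) (compose {..p} g f) W \<in> Arr nec"
      using nec.Arr_Comp(1)[OF f(2) g(2)] by simp
    moreover have "compose {..p} g f ` \<tau> i = \<omega> i" if "i \<le> n" for i
    proof -
      have "\<tau> i \<subseteq> {..p}" using f(1) that by (simp add: flanked_flags_iff flags_iff)
      then have "compose {..p} g f ` \<tau> i = g ` f ` \<tau> i"
        unfolding image_image by (intro image_cong) (auto simp: compose_eq)
      then show ?thesis using f(3) g(3) that by simp
    qed
    ultimately show "\<psi> \<bullet>\<^bsub>nec_flanked n\<^esub> \<phi> \<in> hom (nec_flanked n) x z"
      using f(1) g(1) unfolding xz by (simp add: phi' psi' hom_def nec_flanked_Arr)
  next
    fix \<phi> x y assume phi: "\<phi> \<in> hom (nec_flanked n) x y"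
    obtain T \<tau> f U \<upsilon> where phi': "\<phi> = Arrow (T, \<tau>) f (U, \<upsilon>)" using ArrE[of \<phi>] by metis
    have f: "Arrow T f U \<in> Arr nec" using phi by (simp add: phi' hom_def nec_flanked_Arr)
    show "Idn (nec_flanked n) y \<bullet>\<^bsub>nec_flanked n\<^esub> \<phi> = \<phi>" "\<phi> \<bullet>\<^bsub>nec_flanked n\<^esub> Idn (nec_flanked n) x = \<phi>"
      using nec.Idn_Comp[OF f] nec.Comp_Idn[OF f] phi
      by (cases T; cases U; auto simp: phi' hom_def)+
  next
    fix \<phi> \<psi> \<chi> w x y z assume phi: "\<phi> \<in> hom (nec_flanked n) w x" and psi: "\<psi> \<in> hom (nec_flanked n) x y"
      and chi: "\<chi> \<in> hom (nec_flanked n) y z"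
    obtain T \<tau> f U \<upsilon> where phi': "\<phi> = Arrow (T, \<tau>) f (U, \<upsilon>)" using ArrE[of \<phi>] by metis
    obtain U' \<upsilon>' g W \<omega> where psi': "\<psi> = Arrow (U', \<upsilon>') g (W, \<omega>)" using ArrE[of \<psi>] by metis
    obtain W' \<omega>' h Z \<zeta> where chi': "\<chi> = Arrow (W', \<omega>') h (Z, \<zeta>)" using ArrE[of \<chi>] by metis
    have [simp]: "U' = U" "\<upsilon>' = \<upsilon>" "W' = W" "\<omega>' = \<omega>"
      using phi psi chi by (auto simp: phi' psi' chi' hom_def)
    have f: "Arrow T f U \<in> Arr nec" and g: "Arrow U g W \<in> Arr nec" and h: "Arrow W h Z \<in> Arr nec"
      using phi psi chi by (auto simp: phi' psi' chi' hom_def nec_flanked_Arr)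
    show "(\<chi> \<bullet>\<^bsub>nec_flanked n\<^esub> \<psi>) \<bullet>\<^bsub>nec_flanked n\<^esub> \<phi> = \<chi> \<bullet>\<^bsub>nec_flanked n\<^esub> \<psi> \<bullet>\<^bsub>nec_flanked n\<^esub> \<phi>"
      using nec.Comp_assoc'[OF f g h] by (simp add: phi' psi' chi')
  qed
qed

subsection \<open>The coreflection of flags onto flanked flags\<close>

text \<open>
  A flag on \<open>(T, p)\<close> with top \<open>Z\<close> becomes flanked after restricting along the increasing
  enumeration \<open>[card Z - 1] \<rightarrow> [p]\<close> of \<open>Z\<close>, with the bottom of the flag as joints.
\<close>

definition enum :: "nat set \<Rightarrow> nat \<Rightarrow> nat" where
  "enum Z = (\<lambda>i\<in>{..card Z - 1}. sorted_list_of_set Z ! i)"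

definition flank :: "nat \<Rightarrow> simplex \<Rightarrow> necklace \<times> simplex" where
  "flank n \<tau> = (let e = enum (\<tau> n); P = {..card (\<tau> n) - 1} in
     (({i \<in> P. e i \<in> \<tau> 0}, card (\<tau> n) - 1), \<lambda>j\<in>{..n}. {i \<in> P. e i \<in> \<tau> j}))"

lemma enum:
  assumes "finite Z" "Z \<noteq> {}"
  shows "enum Z ` {..card Z - 1} = Z" "i < j \<Longrightarrow> j \<le> card Z - 1 \<Longrightarrow> enum Z i < enum Z j"
proof -
  have len: "length (sorted_list_of_set Z) = card Z" by simp
  have pos: "card Z > 0" using assms by (simp add: card_gt_0_iff)
  have "enum Z ` {..card Z - 1} = (\<lambda>i. sorted_list_of_set Z ! i) ` {..<card Z}"
    using pos by (intro image_cong) (auto simp: enum_def)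
  also have "\<dots> = set (sorted_list_of_set Z)"
    by (metis len atLeast_upt image_set map_nth)
  finally show "enum Z ` {..card Z - 1} = Z" using assms(1) by simp
  show "enum Z i < enum Z j" if "i < j" "j \<le> card Z - 1"
    using sorted_wrt_nth_less[OF strict_sorted_list_of_set[of Z], of i j] that pos
    by (auto simp: enum_def)
qed

lemma enum_le_iff:
  assumes "finite Z" "Z \<noteq> {}" "i \<le> card Z - 1" "j \<le> card Z - 1"
  shows "enum Z i \<le> enum Z j \<longleftrightarrow> i \<le> j"
  using enum(2)[OF assms(1,2)] assms(3,4) by (metis le_less linorder_not_less)

lemma enum_atMost: "enum {..p} = (\<lambda>i\<in>{..p}. i)"
proof -
  have "sorted_list_of_set {..p} = [0..<Suc p]"
    by (metis atLeast0AtMost atLeastLessThanSuc_atLeastAtMost sorted_list_of_set_range)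
  then show ?thesis by (auto simp: enum_def fun_eq_iff simp del: upt_Suc)
qed

text \<open>The counit of the coreflection at (T, \<tau>). As 0 and p are joints, they lie in the
  top of the flag, so its enumeration preserves endpoints; as T lies in the bottom of the flag, the
  enumeration is a necklace map.\<close>

lemma flank:
  assumes T: "(T, p) \<in> necklaces" and \<tau>: "\<tau> \<in> flags n (T, p)"
  shows "flank n \<tau> \<in> flanked_flags n"
    and "Arrow (fst (flank n \<tau>)) (enum (\<tau> n)) (T, p) \<in> Arr nec"
    and "push n (enum (\<tau> n)) (snd (flank n \<tau>)) = \<tau>"
proof -
  define Z where "Z = \<tau> n"
  define q where "q = card Z - 1"
  define e where "e = enum Z"
  define T' where "T' = {i \<in> {..q}. e i \<in> \<tau> 0}"
  define \<tau>' where "\<tau>' = (\<lambda>j\<in>{..n}. {i \<in> {..q}. e i \<in> \<tau> j})"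
  have fl: "flank n \<tau> = ((T', q), \<tau>')"
    by (simp add: flank_def Let_def T'_def \<tau>'_def e_def q_def Z_def)
  have Tp: "0 \<in> T" "p \<in> T" "T \<subseteq> {..p}" using necklacesD[OF T] by auto
  have \<tau>D: "T \<subseteq> \<tau> i" "\<tau> i \<subseteq> {..p}" "\<tau> i \<subseteq> Z" if "i \<le> n" for i
    using \<tau> that by (auto simp: flags_iff Z_def)
  have Z: "finite Z" "Z \<noteq> {}" "Z \<subseteq> {..p}" "0 \<in> Z" "p \<in> Z"
    using \<tau>D[of n] Tp finite_subset[of Z "{..p}"] by (auto simp: Z_def)
  have eZ: "e ` {..q} = Z" using enum(1)[OF Z(1,2)] by (simp add: e_def q_def)
  have e_le: "e i \<le> e j \<longleftrightarrow> i \<le> j" if "i \<le> q" "j \<le> q" for i j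
    using enum_le_iff[OF Z(1,2)] that by (simp add: e_def q_def)
  have e_in: "e i \<in> Z" if "i \<le> q" for i using eZ that by auto
  have e0: "e 0 = 0"
  proof -
    obtain i where "i \<le> q" "e i = 0" using eZ Z(4) by (auto simp: image_iff)
    then show ?thesis using e_le[of 0 i] by simp
  qed
  have eq: "e q = p"
  proof -
    obtain i where "i \<le> q" "e i = p" using eZ Z(5) by (auto simp: image_iff)
    then have "p \<le> e q" using e_le[of i q] by simp
    moreover have "e q \<le> p" using e_in[of q] Z(3) by auto
    ultimately show ?thesis by simp
  qed
  have e_img: "e ` {i \<in> {..q}. e i \<in> \<tau> j} = \<tau> j" if "j \<le> n" for j
    using \<tau>D(3)[OF that] eZ by auto
  have T'N: "(T', q) \<in> necklaces"
    using e0 eq \<tau>D(1)[of 0] Tp by (auto simp: necklaces_def T'_def)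
  have "\<tau>' \<in> flags n (T', q)"
    unfolding flags_iff
  proof (intro conjI allI impI)
    show "T' \<subseteq> \<tau>' i" if "i \<le> n" for i
    proof -
      have "\<tau> 0 \<subseteq> \<tau> i" using \<tau> that by (auto simp: flags_iff)
      then show ?thesis using that by (auto simp: T'_def \<tau>'_def)
    qed
    show "\<tau>' i \<subseteq> \<tau>' j" if "i \<le> j" "j \<le> n" for i j
    proof -
      have "\<tau> i \<subseteq> \<tau> j" using \<tau> that by (auto simp: flags_iff)
      then show ?thesis using that by (auto simp: \<tau>'_def)
    qed
  qed (auto simp: \<tau>'_def)
  moreover have "\<tau>' 0 = T'" "\<tau>' n = {..q}"
    using e_in by (auto simp: T'_def \<tau>'_def Z_def)
  ultimately show "flank n \<tau> \<in> flanked_flags n"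
    unfolding fl flanked_flags_iff using T'N by simp
  have "Arrow q e p \<in> Arr delta_f"
    using e0 eq e_le e_in Z(3)
    by (auto simp: delta_f_Arr delta_Arr mono_on_def e_def q_def enum_def)
  moreover have "T \<subseteq> e ` T'" using e_img[of 0] \<tau>D(1)[of 0] by (simp add: T'_def)
  ultimately show "Arrow (fst (flank n \<tau>)) (enum (\<tau> n)) (T, p) \<in> Arr nec"
    unfolding fl using T'N T by (simp add: nec_Arr e_def Z_def)
  show "push n (enum (\<tau> n)) (snd (flank n \<tau>)) = \<tau>"
  proof
    fix i
    have "\<tau> \<in> extensional {..n}" using \<tau> by (simp add: flags_iff)
    then show "push n (enum (\<tau> n)) (snd (flank n \<tau>)) i = \<tau> i"
      using e_img[of i] by (cases "i \<le> n") (auto simp: fl push_def \<tau>'_def e_def Z_def extensional_def)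
  qed
qed

text \<open>For top \<open>{..p}\<close> the enumeration is the identity, so the coreflection fixes
  flanked flags on the nose. This is why \<open>kap\<close> below extends
  \<open>lam\<close>.\<close>

lemma flank_flanked:
  assumes "((T, p), \<tau>) \<in> flanked_flags n"
  shows "flank n \<tau> = ((T, p), \<tau>)" "enum (\<tau> n) = (\<lambda>i\<in>{..p}. i)"
proof -
  have \<tau>: "(T, p) \<in> necklaces" "\<tau> \<in> flags n (T, p)" "\<tau> 0 = T" "\<tau> n = {..p}"
    using assms by (auto simp: flanked_flags_iff)
  show e: "enum (\<tau> n) = (\<lambda>i\<in>{..p}. i)" by (simp add: \<tau>(4) enum_atMost)
  have "\<tau> i \<subseteq> {..p}" if "i \<le> n" for i using \<tau>(2) that by (simp add: flags_iff)
  then have 1: "{j \<in> {..p}. (\<lambda>i\<in>{..p}. i) j \<in> \<tau> i} = \<tau> i" if "i \<le> n" for i using that by fastforce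
  have "(\<lambda>i\<in>{..n}. {j \<in> {..p}. (\<lambda>i\<in>{..p}. i) j \<in> \<tau> i}) = \<tau>"
  proof
    fix i
    show "(\<lambda>i\<in>{..n}. {j \<in> {..p}. (\<lambda>i\<in>{..p}. i) j \<in> \<tau> i}) i = \<tau> i"
    proof (cases "i \<le> n")
      case True
      then show ?thesis using 1[OF True] by simp
    next
      case False
      then show ?thesis using \<tau>(2) by (simp add: flags_iff extensional_def)
    qed
  qed
  moreover have "{j \<in> {..p}. (\<lambda>i\<in>{..p}. i) j \<in> \<tau> 0} = T" using 1[of 0] \<tau>(3) by simp
  moreover have "card (\<tau> n) - 1 = p" by (simp add: \<tau>(4))
  ultimately show "flank n \<tau> = ((T, p), \<tau>)"
    unfolding flank_def Let_def e by (simp only: )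
qed

text \<open>The factorisation through the counit. Since \<upsilon> has top \<open>{..q}\<close>, the
  image of f is exactly the top of \<tau>, so f lifts along the enumeration. The lift takes each
  \<upsilon> i onto the corresponding term of the restricted flag because the enumeration is
  injective.\<close>

lemma flank_factor:
  assumes U: "((U, q), \<upsilon>) \<in> flanked_flags n" and T: "(T, p) \<in> necklaces" and \<tau>: "\<tau> \<in> flags n (T, p)"
    and f: "Arrow (U, q) f (T, p) \<in> Arr nec" and push: "push n f \<upsilon> = \<tau>"
  obtains g where "Arrow ((U, q), \<upsilon>) g (flank n \<tau>) \<in> Arr (nec_flanked n)"
    "compose {..q} (enum (\<tau> n)) g = f"
proof -
  define Z where "Z = \<tau> n"
  define e where "e = enum Z"
  define r where "r = card Z - 1"
  obtain T' \<tau>' where fl: "flank n \<tau> = ((T', r), \<tau>')" and T': "T' = {i \<in> {..r}. e i \<in> \<tau> 0}"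
    and \<tau>': "\<tau>' = (\<lambda>j\<in>{..n}. {i \<in> {..r}. e i \<in> \<tau> j})"
    by (simp add: flank_def Let_def e_def r_def Z_def)
  note F = flank[OF T \<tau>]
  have \<upsilon>: "(U, q) \<in> necklaces" "\<upsilon> \<in> flags n (U, q)" "\<upsilon> 0 = U" "\<upsilon> n = {..q}"
    using U by (auto simp: flanked_flags_iff)
  have \<tau>_eq: "\<tau> i = f ` \<upsilon> i" if "i \<le> n" for i
    using push that by (auto simp: push_def)
  have fD: "f \<in> extensional {..q}" "f 0 = 0" "f q = p" "mono_on {..q} f"
    using f by (auto simp: nec_Arr delta_f_Arr delta_Arr)
  have Zf: "Z = f ` {..q}" using \<tau>_eq[of n] \<upsilon>(4) by (simp add: Z_def)
  then have Z: "finite Z" "Z \<noteq> {}" by auto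
  have eZ: "e ` {..r} = Z" using enum(1)[OF Z] by (simp add: e_def r_def)
  have e_le: "e i \<le> e j \<longleftrightarrow> i \<le> j" if "i \<le> r" "j \<le> r" for i j
    using enum_le_iff[OF Z] that by (simp add: e_def r_def)
  have "\<exists>i\<le>r. e i = f x" if "x \<le> q" for x
  proof -
    have "f x \<in> e ` {..r}" unfolding eZ Zf using that by blast
    then show ?thesis by auto
  qed
  \<comment> \<open>Positions of the values of f in the enumeration; restricting to
    \<open>{..q}\<close> afterwards makes the map extensional, as arrows must be.\<close>
  then obtain g0 where g0: "\<And>x. x \<le> q \<Longrightarrow> g0 x \<le> r \<and> e (g0 x) = f x" by metis
  define g where "g = (\<lambda>x\<in>{..q}. g0 x)"
  have g: "g x \<le> r" "e (g x) = f x" if "x \<le> q" for x using g0[OF that] that by (auto simp: g_def)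
  have e_inj: "i = j" if "e i = e j" "i \<le> r" "j \<le> r" for i j
    using e_le[of i j] e_le[of j i] that by simp
  have eA: "Arrow r e p \<in> Arr delta_f" using F(2) by (simp add: fl nec_Arr e_def Z_def)
  then have e0: "e 0 = 0" "e r = p" by (auto simp: delta_f_Arr)
  have g_img: "g ` \<upsilon> i = \<tau>' i" if i: "i \<le> n" for i
  proof -
    have \<upsilon>q: "\<upsilon> i \<subseteq> {..q}" using \<upsilon>(2) i by (simp add: flags_iff)
    show ?thesis
    proof
      show "g ` \<upsilon> i \<subseteq> \<tau>' i"
        using \<upsilon>q i g \<tau>_eq[OF i] by (auto simp: \<tau>')
      show "\<tau>' i \<subseteq> g ` \<upsilon> i"
      proof
        fix j assume "j \<in> \<tau>' i"
        then have j: "j \<le> r" "e j \<in> f ` \<upsilon> i" using i \<tau>_eq[OF i] by (auto simp: \<tau>')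
        then obtain x where x: "x \<in> \<upsilon> i" "e j = f x" by auto
        then have xq: "x \<le> q" using \<upsilon>q by auto
        have "j = g x" by (rule e_inj) (use x g[OF xq] j in auto)
        with x show "j \<in> g ` \<upsilon> i" by simp
      qed
    qed
  qed
  have "mono_on {..q} g"
  proof (rule mono_onI)
    fix x y assume xy: "x \<in> {..q}" "y \<in> {..q}" "x \<le> y"
    then have "e (g x) \<le> e (g y)" using g mono_onD[OF fD(4) xy] by simp
    then show "g x \<le> g y" using e_le[of "g x" "g y"] g xy by simp
  qed
  moreover have "g 0 = 0" by (rule e_inj) (use g[of 0] e0 fD in auto)
  moreover have "g q = r" by (rule e_inj) (use g[of q] e0 fD in auto)
  ultimately have "Arrow q g r \<in> Arr delta_f"
    using g by (auto simp: delta_f_Arr delta_Arr g_def)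
  moreover have "T' = g ` U" using g_img[of 0] \<upsilon>(3) by (simp add: \<tau>' T')
  ultimately have "Arrow ((U, q), \<upsilon>) g (flank n \<tau>) \<in> Arr (nec_flanked n)"
    using F(1) U \<upsilon>(1) g_img flanked_flags_necklaces[OF F(1)[unfolded fl]]
    unfolding fl by (simp add: nec_flanked_Arr nec_Arr)
  moreover have "compose {..q} (enum (\<tau> n)) g = f"
  proof
    fix x
    show "compose {..q} (enum (\<tau> n)) g x = f x"
      using g[of x] fD(1) by (cases "x \<le> q") (auto simp: compose_def e_def Z_def extensional_def)
  qed
  ultimately show ?thesis by (rule that)
qed

section \<open>Small colimits and copowers\<close>

text \<open>Transport of a small category along injections of its objects and arrows into \<open>'u\<close>.\<close>

lemma (in category) small_colimit:
  fixes J :: "('i, 'j) cat"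
  assumes cc: "cocomplete_cat TYPE('u) C" and J: "category J" and D: "is_functor J C D"
    and Ob: "Ob J \<lesssim> (UNIV :: 'u set)" and Arr: "Arr J \<lesssim> (UNIV :: 'u set)"
  shows "\<exists>L \<iota>. is_colimit C J D L \<iota>"
proof -
  interpret J: category J by (rule J)
  obtain f :: "'i \<Rightarrow> 'u" where f: "inj_on f (Ob J)" using Ob by (auto simp: lepoll_def)
  obtain g :: "'j \<Rightarrow> 'u" where g: "inj_on g (Arr J)" using Arr by (auto simp: lepoll_def)
  define f' where "f' = the_inv_into (Ob J) f"
  define g' where "g' = the_inv_into (Arr J) g"
  have f': "f' (f x) = x" if "x \<in> Ob J" for x using that f by (simp add: f'_def the_inv_into_f_f)
  have g': "g' (g x) = x" if "x \<in> Arr J" for x using that g by (simp add: g'_def the_inv_into_f_f)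
  define K :: "('u, 'u) cat" where "K = \<lparr>Ob = f ` Ob J, Arr = g ` Arr J, Dom = (\<lambda>x. f (Dom J (g' x))),
    Cod = (\<lambda>x. f (Cod J (g' x))), Idn = (\<lambda>x. g (Idn J (f' x))), Comp = (\<lambda>x y. g (g' x \<bullet>\<^bsub>J\<^esub> g' y))\<rparr>"
  define E :: "('u, 'u, 'o, 'a) ftr" where "E = \<lparr>FO = (\<lambda>x. FO D (f' x)), FA = (\<lambda>x. FA D (g' x))\<rparr>"
  have K: "Ob K = f ` Ob J" "Arr K = g ` Arr J" "x \<in> Arr J \<Longrightarrow> Dom K (g x) = f (Dom J x)"
    "x \<in> Arr J \<Longrightarrow> Cod K (g x) = f (Cod J x)" "y \<in> Ob J \<Longrightarrow> Idn K (f y) = g (Idn J y)"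
    "x \<in> Arr J \<Longrightarrow> z \<in> Arr J \<Longrightarrow> Comp K (g x) (g z) = g (x \<bullet>\<^bsub>J\<^esub> z)" for x y z
    by (simp_all add: K_def f' g')
  have E: "x \<in> Ob J \<Longrightarrow> FO E (f x) = FO D x" "y \<in> Arr J \<Longrightarrow> FA E (g y) = FA D y" for x y
    by (simp_all add: E_def f' g')
  have f_eq: "f x = f y \<longleftrightarrow> x = y" if "x \<in> Ob J" "y \<in> Ob J" for x y
    using inj_on_eq_iff[OF f that] .
  have homK: "h \<in> hom K x y \<longleftrightarrow> (\<exists>k\<in>Arr J. h = g k \<and> x = f (Dom J k) \<and> y = f (Cod J k))" for h x y
    by (auto simp: hom_def K)
  have catK: "category K"
  proof
    fix k assume "k \<in> Arr K"
    then show "Dom K k \<in> Ob K" "Cod K k \<in> Ob K" by (auto simp: K)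
  next
    fix x assume "x \<in> Ob K"
    then show "Idn K x \<in> hom K x x" by (auto simp: K homK intro!: bexI[of _ "Idn J _"])
  next
    fix k l x y z assume "k \<in> hom K x y" "l \<in> hom K y z"
    then obtain k' l' where "k = g k'" "x = f (Dom J k')" "y = f (Cod J k')" "k' \<in> Arr J"
      "l = g l'" "y = f (Dom J l')" "z = f (Cod J l')" "l' \<in> Arr J" by (auto simp: homK)
    moreover from this have "Dom J l' = Cod J k'" using f_eq[of "Dom J l'" "Cod J k'"] by simp
    ultimately show "l \<bullet>\<^bsub>K\<^esub> k \<in> hom K x z"
      unfolding homK by (intro bexI[of _ "l' \<bullet>\<^bsub>J\<^esub> k'"]) (simp_all add: K)
  next
    fix k x y assume "k \<in> hom K x y"
    then obtain k' where "k = g k'" "x = f (Dom J k')" "y = f (Cod J k')" "k' \<in> Arr J" by (auto simp: homK)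
    then show "Idn K y \<bullet>\<^bsub>K\<^esub> k = k" "k \<bullet>\<^bsub>K\<^esub> Idn K x = k" by (simp_all add: K)
  next
    fix k l m w x y z assume "k \<in> hom K w x" "l \<in> hom K x y" "m \<in> hom K y z"
    then obtain k' l' m' where "k = g k'" "x = f (Cod J k')" "k' \<in> Arr J"
      "l = g l'" "x = f (Dom J l')" "y = f (Cod J l')" "l' \<in> Arr J"
      "m = g m'" "y = f (Dom J m')" "m' \<in> Arr J" by (auto simp: homK)
    moreover from this have "Dom J l' = Cod J k'" "Dom J m' = Cod J l'"
      using f_eq[of "Dom J l'" "Cod J k'"] f_eq[of "Dom J m'" "Cod J l'"] by simp_all
    ultimately show "(m \<bullet>\<^bsub>K\<^esub> l) \<bullet>\<^bsub>K\<^esub> k = m \<bullet>\<^bsub>K\<^esub> l \<bullet>\<^bsub>K\<^esub> k" by (simp add: K)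
  qed
  have D': "x \<in> Ob J \<Longrightarrow> FO D x \<in> Ob C" "y \<in> Arr J \<Longrightarrow> FA D y \<in> hom C (FO D (Dom J y)) (FO D (Cod J y))"
    "x \<in> Ob J \<Longrightarrow> FA D (Idn J x) = Idn C (FO D x)" for x y
    using D by (auto simp: is_functor_def)
  have D'': "FA D (z \<bullet>\<^bsub>J\<^esub> y) = FA D z \<bullet> FA D y" if "y \<in> Arr J" "z \<in> Arr J" "Cod J y = Dom J z" for y z
    using D that unfolding is_functor_def by blast
  have "is_functor K C E"
    unfolding is_functor_def
  proof (intro conjI ballI impI)
    fix k l assume "k \<in> Arr K" "l \<in> Arr K" and eq: "Cod K k = Dom K l"
    then obtain k' l' where k: "k = g k'" "k' \<in> Arr J" and l: "l = g l'" "l' \<in> Arr J" by (auto simp: K)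
    from eq k l have "Cod J k' = Dom J l'" using f_eq[of "Cod J k'" "Dom J l'"] by (simp add: K)
    then show "FA E (l \<bullet>\<^bsub>K\<^esub> k) = FA E l \<bullet> FA E k"
      using k l D''[of k' l'] by (simp add: K E)
  qed (use D' in \<open>auto simp: K E\<close>)
  then obtain L \<kappa> where L: "is_colimit C K E L \<kappa>"
    using cc[unfolded cocomplete_cat_def, rule_format, OF catK] by blast
  have cocone: "is_cocone C J D M \<mu> \<longleftrightarrow> is_cocone C K E M (\<lambda>x. \<mu> (f' x))" for M \<mu>
    by (auto simp: is_cocone_def K E f')
  have cocone': "is_cocone C K E M \<mu> \<longleftrightarrow> is_cocone C J D M (\<lambda>x. \<mu> (f x))" for M \<mu>
    by (auto simp: is_cocone_def K E f')
  have "is_colimit C J D L (\<lambda>x. \<kappa> (f x))"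
    unfolding is_colimit_def
  proof (intro conjI allI impI)
    show "is_cocone C J D L (\<lambda>x. \<kappa> (f x))"
      using L unfolding is_colimit_def cocone'[symmetric] by blast
    fix M \<mu> assume "is_cocone C J D M \<mu>"
    then have "\<exists>!h. h \<in> hom C L M \<and> (\<forall>j\<in>Ob K. h \<bullet> \<kappa> j = \<mu> (f' j))"
      using L unfolding is_colimit_def cocone by blast
    then show "\<exists>!h. h \<in> hom C L M \<and> (\<forall>j\<in>Ob J. h \<bullet> \<kappa> (f j) = \<mu> j)"
      by (simp add: K f')
  qed
  then show ?thesis by blast
qed

lemma countable_lepoll_infinite:
  assumes "countable A" "infinite (UNIV :: 'u set)"
  shows "A \<lesssim> (UNIV :: 'u set)"
proof -
  have "A \<lesssim> (UNIV :: nat set)" using assms(1) by (auto simp: countable_def lepoll_def)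
  also have "\<dots> \<lesssim> (UNIV :: 'u set)" using assms(2) by (simp add: infinite_le_lepoll)
  finally show ?thesis .
qed

text \<open>Objects and arrows are finite data, coded injectively by finite lists. With 'u infinite
  the diagram of flanked pairs is therefore small, so its colimit exists.\<close>

lemma countable_nec_flanked: "countable (Ob (nec_flanked n))" "countable (Arr (nec_flanked n))"
proof -
  define c :: "necklace \<times> simplex \<Rightarrow> nat list \<times> nat \<times> nat list list" where
    "c = (\<lambda>((T, p), \<tau>). (sorted_list_of_set T, p, map (\<lambda>i. sorted_list_of_set (\<tau> i)) [0..<Suc n]))"
  have "inj_on c (flanked_flags n)"
  proof (rule inj_onI)
    fix x y assume x: "x \<in> flanked_flags n" and y: "y \<in> flanked_flags n" and eq: "c x = c y"
    obtain T p \<tau> where x': "x = ((T, p), \<tau>)" by (metis surj_pair)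
    obtain U q \<upsilon> where y': "y = ((U, q), \<upsilon>)" by (metis surj_pair)
    have \<tau>: "finite (\<tau> i)" and \<upsilon>: "finite (\<upsilon> i)" if "i \<le> n" for i
      using x y that finite_subset[of _ "{..p}"] finite_subset[of _ "{..q}"]
      by (auto simp: x' y' flanked_flags_iff flags_iff)
    have "sorted_list_of_set (\<tau> i) = sorted_list_of_set (\<upsilon> i)" if "i \<le> n" for i
      using eq that by (auto simp: x' y' c_def simp del: upt_Suc)
    then have "\<tau> i = \<upsilon> i" if "i \<le> n" for i
      using that \<tau> \<upsilon> by (metis sorted_list_of_set.set_sorted_key_list_of_set)
    moreover have "\<tau> \<in> extensional {..n}" "\<upsilon> \<in> extensional {..n}"
      using x y by (auto simp: x' y' flanked_flags_iff flags_iff)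
    ultimately have "\<tau> = \<upsilon>" by (intro extensionalityI[of _ "{..n}"]) auto
    moreover have "T = \<tau> 0" "U = \<upsilon> 0" using x y by (auto simp: x' y' flanked_flags_iff)
    ultimately show "x = y" using eq by (simp add: x' y' c_def)
  qed
  then have c: "countable (flanked_flags n)" by (rule countableI')
  then show "countable (Ob (nec_flanked n))" by simp
  define d :: "(necklace \<times> simplex, nat \<Rightarrow> nat) arrow \<Rightarrow> (necklace \<times> simplex) \<times> nat list \<times> (necklace \<times> simplex)" where
    "d = (\<lambda>\<phi>. (src \<phi>, map (amap \<phi>) [0..<Suc (snd (fst (src \<phi>)))], tgt \<phi>))"
  have "inj_on d (Arr (nec_flanked n))"
  proof (rule inj_onI)
    fix \<phi> \<psi> assume phi: "\<phi> \<in> Arr (nec_flanked n)" and psi: "\<psi> \<in> Arr (nec_flanked n)" and eq: "d \<phi> = d \<psi>"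
    obtain T p \<tau> f x where phi': "\<phi> = Arrow ((T, p), \<tau>) f x" by (cases \<phi>) (metis surj_pair)
    obtain g where psi': "\<psi> = Arrow ((T, p), \<tau>) g x" using eq by (cases \<psi>) (simp add: phi' d_def)
    obtain U q \<upsilon> where x: "x = ((U, q), \<upsilon>)" by (metis surj_pair)
    have "f \<in> extensional {..p}" "g \<in> extensional {..p}"
      using phi psi by (auto simp: phi' psi' x nec_flanked_Arr nec_Arr delta_f_Arr delta_Arr)
    moreover have "f i = g i" if "i \<le> p" for i
      using eq that by (auto simp: phi' psi' d_def simp del: upt_Suc)
    ultimately have "f = g" by (intro extensionalityI[of _ "{..p}"]) auto
    then show "\<phi> = \<psi>" by (simp add: phi' psi')
  qed
  moreover have "d ` Arr (nec_flanked n) \<subseteq> flanked_flags n \<times> UNIV \<times> flanked_flags n"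
    by (auto simp: d_def nec_flanked_def)
  ultimately show "countable (Arr (nec_flanked n))"
    using c by (meson countable_SIGMA countable_image_inj_on countable_subset countableI_type)
qed

section \<open>Small sets as copowers of a point\<close>

lemma set_cat_simps [simp]:
  "Ob (set_cat U) = {A. A \<lesssim> (UNIV :: 'u set)}" "Dom (set_cat U) = src" "Cod (set_cat U) = tgt"
  "Idn (set_cat U) A = Arrow A (\<lambda>x\<in>A. x) A"
  "Comp (set_cat U) g f = Arrow (src f) (compose (src f) (amap g) (amap f)) (tgt g)" for U :: "'u itself"
  by (simp_all add: set_cat_def)

lemma set_cat_Arr: "Arrow A f B \<in> Arr (set_cat U) \<longleftrightarrow> A \<lesssim> (UNIV :: 'u set) \<and> B \<lesssim> (UNIV :: 'u set) \<and> f \<in> A \<rightarrow>\<^sub>E B"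
  for U :: "'u itself"
  by (auto simp: set_cat_def)

lemma category_set_cat: "category (set_cat U)" for U :: "'u itself"
proof
  fix f assume "f \<in> Arr (set_cat U)"
  then show "Dom (set_cat U) f \<in> Ob (set_cat U)" "Cod (set_cat U) f \<in> Ob (set_cat U)"
    by (cases f; simp add: set_cat_Arr)+
next
  fix x :: "'b set" assume "x \<in> Ob (set_cat U)"
  then show "Idn (set_cat U) x \<in> hom (set_cat U) x x" by (simp add: hom_def set_cat_Arr)
next
  fix f g :: "('b set, 'b \<Rightarrow> 'b) arrow" and x y z
  assume "f \<in> hom (set_cat U) x y" "g \<in> hom (set_cat U) y z"
  then show "g \<bullet>\<^bsub>set_cat U\<^esub> f \<in> hom (set_cat U) x z"
    by (cases f; cases g) (auto simp: hom_def set_cat_Arr compose_def PiE_iff)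
next
  fix f :: "('b set, 'b \<Rightarrow> 'b) arrow" and x y assume "f \<in> hom (set_cat U) x y"
  then show "Idn (set_cat U) y \<bullet>\<^bsub>set_cat U\<^esub> f = f" "f \<bullet>\<^bsub>set_cat U\<^esub> Idn (set_cat U) x = f"
    by (cases f; auto simp: hom_def set_cat_Arr compose_def PiE_iff extensional_def fun_eq_iff)+
next
  fix f g h :: "('b set, 'b \<Rightarrow> 'b) arrow" and w x y z
  assume "f \<in> hom (set_cat U) w x" "g \<in> hom (set_cat U) x y" "h \<in> hom (set_cat U) y z"
  then show "(h \<bullet>\<^bsub>set_cat U\<^esub> g) \<bullet>\<^bsub>set_cat U\<^esub> f = h \<bullet>\<^bsub>set_cat U\<^esub> g \<bullet>\<^bsub>set_cat U\<^esub> f"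
    by (cases f; cases g; cases h) (auto simp: hom_def set_cat_Arr compose_def PiE_iff fun_eq_iff)
qed

definition pick :: "'x \<Rightarrow> 'x set \<Rightarrow> 'x \<Rightarrow> ('x set, 'x \<Rightarrow> 'x) arrow" where
  "pick pt A x = Arrow {pt} (\<lambda>y\<in>{pt}. x) A"

lemma singleton_lepoll_UNIV: "{x} \<lesssim> (UNIV :: 'u set)"
  using singleton_lepoll[of x undefined "UNIV :: 'u set"] by simp

lemma pick_hom:
  assumes "A \<lesssim> (UNIV :: 'u set)" "x \<in> A"
  shows "pick pt A x \<in> hom (set_cat (U :: 'u itself)) {pt} A"
  using assms singleton_lepoll_UNIV[of pt] by (simp add: pick_def hom_def set_cat_Arr)

text \<open>A set is the coproduct of its points. The points are indexed by a set B in 'u, since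
  \<open>preserves_colimits\<close> speaks only of diagrams indexed in that type.\<close>

lemma set_cat_coprod:
  fixes h :: "'u \<Rightarrow> 'x" and U :: "'u itself"
  assumes A: "A \<lesssim> (UNIV :: 'u set)" and h: "bij_betw h B A"
  shows "is_coprod (set_cat U) B (\<lambda>_. {pt}) A (\<lambda>b. pick pt A (h b))"
proof -
  interpret category "set_cat U :: ('x set, ('x set, 'x \<Rightarrow> 'x) arrow) cat" by (rule category_set_cat)
  have hA: "h b \<in> A" if "b \<in> B" for b using h that by (auto simp: bij_betw_def)
  define h' where "h' = the_inv_into B h"
  have h': "h' (h b) = b" if "b \<in> B" for b
    using h that by (simp add: h'_def bij_betw_def the_inv_into_f_f)
  show ?thesis
  proof (rule is_coprodI)
    show "A \<in> Ob (set_cat U)" using A by simp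
    show "pick pt A (h b) \<in> hom (set_cat U) {pt} A" if "b \<in> B" for b by (rule pick_hom[OF A hA[OF that]])
    fix M :: "'x set"
    show "\<exists>k. k \<in> hom (set_cat U) A M \<and> (\<forall>b\<in>B. k \<bullet>\<^bsub>set_cat U\<^esub> pick pt A (h b) = \<kappa> b)"
      if M: "M \<in> Ob (set_cat U)" and \<kappa>: "\<And>b. b \<in> B \<Longrightarrow> \<kappa> b \<in> hom (set_cat U) {pt} M" for \<kappa>
    proof -
      define k where "k = Arrow A (\<lambda>a\<in>A. amap (\<kappa> (h' a)) pt) M"
      have \<kappa>': "\<exists>m\<in>M. \<kappa> b = pick pt M m" if b: "b \<in> B" for b
      proof -
        obtain f where f: "\<kappa> b = Arrow {pt} f M" "f \<in> {pt} \<rightarrow>\<^sub>E M"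
          using \<kappa>[OF b] by (cases "\<kappa> b") (auto simp: hom_def set_cat_Arr)
        then have "f = (\<lambda>y\<in>{pt}. f pt)" "f pt \<in> M" by (auto simp: PiE_iff extensional_def fun_eq_iff)
        with f(1) show ?thesis unfolding pick_def by metis
      qed
      have amap: "amap (\<kappa> b) pt \<in> M \<and> pick pt M (amap (\<kappa> b) pt) = \<kappa> b" if "b \<in> B" for b
        using \<kappa>'[OF that] by (auto simp: pick_def)
      have hB: "A = h ` B" using h by (simp add: bij_betw_def)
      have "k \<in> hom (set_cat U) A M"
        using amap h' M A by (auto simp: k_def hom_def set_cat_Arr hB)
      moreover have "k \<bullet>\<^bsub>set_cat U\<^esub> pick pt A (h b) = \<kappa> b" if "b \<in> B" for b
      proof -
        have "k \<bullet>\<^bsub>set_cat U\<^esub> pick pt A (h b) = pick pt M (amap (\<kappa> b) pt)"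
          using hA[OF that] h'[OF that] by (auto simp: k_def pick_def compose_def fun_eq_iff)
        then show ?thesis using amap[OF that] by simp
      qed
      ultimately show ?thesis by blast
    qed
    show "k = k'" if k: "k \<in> hom (set_cat U) A M" "k' \<in> hom (set_cat U) A M"
      and eq: "\<And>b. b \<in> B \<Longrightarrow> k \<bullet>\<^bsub>set_cat U\<^esub> pick pt A (h b) = k' \<bullet>\<^bsub>set_cat U\<^esub> pick pt A (h b)" for k k'
    proof -
      obtain f where f: "k = Arrow A f M" "f \<in> A \<rightarrow>\<^sub>E M"
        using k(1) by (cases k) (auto simp: hom_def set_cat_Arr)
      obtain f' where f': "k' = Arrow A f' M" "f' \<in> A \<rightarrow>\<^sub>E M"
        using k(2) by (cases k') (auto simp: hom_def set_cat_Arr)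
      have "f (h b) = f' (h b)" if "b \<in> B" for b
        using fun_cong[OF arg_cong[OF eq[OF that], of amap], of pt] by (simp add: f(1) f'(1) pick_def compose_def)
      then have "f a = f' a" if "a \<in> A" for a using that h by (auto simp: bij_betw_def)
      then have "f = f'" using f(2) f'(2) by (intro PiE_ext) auto
      then show ?thesis using f f' by simp
    qed
  qed
qed

lemma pick_Comp:
  "x \<in> A \<Longrightarrow> Arrow A f B \<bullet>\<^bsub>set_cat U\<^esub> pick pt A x = pick pt B (f x)"
  by (auto simp: pick_def compose_def fun_eq_iff)

text \<open>The index set is moved into 'u along an injection, F is applied to the coproduct of
  points, and the result is reindexed by A itself.\<close>

lemma (in category) copower:
  fixes F :: "('x set, ('x set, 'x \<Rightarrow> 'x) arrow, 'o, 'a) ftr"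
  assumes F: "is_functor (set_cat TYPE('u)) C F" and pres: "preserves_colimits TYPE('u) (set_cat TYPE('u)) C F"
    and A: "A \<lesssim> (UNIV :: 'u set)"
  shows "is_coprod C A (\<lambda>_. FO F {pt}) (FO F A) (\<lambda>x. FA F (pick pt A x))"
proof -
  interpret Set: category "set_cat TYPE('u) :: ('x set, ('x set, 'x \<Rightarrow> 'x) arrow) cat" by (rule category_set_cat)
  obtain f :: "'x \<Rightarrow> 'u" where f: "inj_on f A" using A by (auto simp: lepoll_def)
  define B where "B = f ` A"
  define h where "h = the_inv_into A f"
  have h: "bij_betw h B A" using f by (auto simp: B_def h_def bij_betw_the_inv_into bij_betw_imageI)
  let ?J = "discrete_cat B"
  let ?D = "mk_functor ?J (\<lambda>_. {pt}) (\<lambda>_. Idn (set_cat TYPE('u)) {pt})"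
  have pt: "{pt} \<in> Ob (set_cat TYPE('u))" using singleton_lepoll_UNIV by simp
  have "is_colimit (set_cat TYPE('u)) ?J ?D A (\<lambda>b. pick pt A (h b))"
    using set_cat_coprod[OF A h] by (subst Set.is_colimit_discrete) (use pt in auto)
  moreover have "is_functor ?J (set_cat TYPE('u)) ?D"
    by (rule Set.is_functor_discrete) (use pt in auto)
  ultimately have "is_colimit C ?J (comp_functor ?J F ?D) (FO F A) (\<lambda>b. FA F (pick pt A (h b)))"
    using pres[unfolded preserves_colimits_def, rule_format, OF category_discrete_cat] by blast
  moreover have "FA F (Idn (set_cat TYPE('u)) {pt}) = Idn C (FO F {pt})" "FO F {pt} \<in> Ob C"
    using F pt unfolding is_functor_def by blast+
  moreover have "comp_functor ?J F ?D = mk_functor ?J (\<lambda>_. FO F {pt}) (\<lambda>_. FA F (Idn (set_cat TYPE('u)) {pt}))"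
    by (auto simp: comp_functor_def mk_functor_def fun_eq_iff)
  ultimately have "is_coprod C B (\<lambda>_. FO F {pt}) (FO F A) (\<lambda>b. FA F (pick pt A (h b)))"
    by (simp only:) (subst (asm) is_colimit_discrete, auto)
  from coprod_reindex[OF this, of f A] f
  have "is_coprod C A (\<lambda>_. FO F {pt}) (FO F A) (\<lambda>x. FA F (pick pt A (h (f x))))"
    by (simp add: B_def bij_betw_imageI)
  then show ?thesis
    by (rule coprod_cong) (use f in \<open>auto simp: h_def the_inv_into_f_f\<close>)
qed

section \<open>Simplicial objects and coends\<close>

context category
begin

lemma simplicial_Ob:
  "Y \<in> Ob (simplicial C) \<longleftrightarrow> is_functor (op_cat delta) C Y \<and> FA Y \<in> extensional (Arr delta)"
  by (simp add: simplicial_def functor_cat_def Let_def)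

lemma simplicial_Arr: "Arrow Y \<alpha> Z \<in> Arr (simplicial C) \<longleftrightarrow> Y \<in> Ob (simplicial C) \<and> Z \<in> Ob (simplicial C) \<and>
    (\<forall>n. \<alpha> n \<in> hom C (FO Y n) (FO Z n)) \<and>
    (\<forall>\<theta>\<in>Arr delta. \<alpha> (src \<theta>) \<bullet> FA Y \<theta> = FA Z \<theta> \<bullet> \<alpha> (tgt \<theta>))"
  by (auto simp: simplicial_def functor_cat_def Let_def nat_trans_def PiE_iff)

lemma simplicial_simps [simp]:
  "Dom (simplicial C) = src" "Cod (simplicial C) = tgt"
  "Idn (simplicial C) Y = Arrow Y (\<lambda>n. Idn C (FO Y n)) Y"
  "\<beta> \<bullet>\<^bsub>simplicial C\<^esub> \<alpha> = Arrow (src \<alpha>) (\<lambda>n. amap \<beta> n \<bullet> amap \<alpha> n) (tgt \<beta>)"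
  by (simp_all add: simplicial_def functor_cat_def Let_def restrict_def)

lemma simplicial_functor:
  assumes "Y \<in> Ob (simplicial C)"
  shows "FO Y n \<in> Ob C" "\<theta> \<in> Arr delta \<Longrightarrow> FA Y \<theta> \<in> Arr C"
    "\<theta> \<in> Arr delta \<Longrightarrow> Dom C (FA Y \<theta>) = FO Y (tgt \<theta>)" "\<theta> \<in> Arr delta \<Longrightarrow> Cod C (FA Y \<theta>) = FO Y (src \<theta>)"
  using assms by (auto simp: simplicial_Ob is_functor_def hom_def)

lemma simplicial_hom: "\<alpha> \<in> hom (simplicial C) Y Z \<longleftrightarrow> (\<exists>f. \<alpha> = Arrow Y f Z \<and> Arrow Y f Z \<in> Arr (simplicial C))"
  by (cases \<alpha>) (auto simp: hom_def)

lemma category_simplicial: "category (simplicial C)"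
proof
  fix \<alpha> assume "\<alpha> \<in> Arr (simplicial C)"
  then show "Dom (simplicial C) \<alpha> \<in> Ob (simplicial C)" "Cod (simplicial C) \<alpha> \<in> Ob (simplicial C)"
    by (cases \<alpha>; simp add: simplicial_Arr)+
next
  fix Y assume Y: "Y \<in> Ob (simplicial C)"
  show "Idn (simplicial C) Y \<in> hom (simplicial C) Y Y"
    using Y simplicial_functor[OF Y] by (simp add: simplicial_hom simplicial_Arr) (simp add: hom_def)
next
  fix \<alpha> \<beta> X Y Z assume "\<alpha> \<in> hom (simplicial C) X Y" "\<beta> \<in> hom (simplicial C) Y Z"
  then obtain f g where f: "\<alpha> = Arrow X f Y" "Arrow X f Y \<in> Arr (simplicial C)"
    and g: "\<beta> = Arrow Y g Z" "Arrow Y g Z \<in> Arr (simplicial C)"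
    by (auto simp: simplicial_hom)
  have X: "X \<in> Ob (simplicial C)" "Y \<in> Ob (simplicial C)" "Z \<in> Ob (simplicial C)"
    using f g by (auto simp: simplicial_Arr)
  have fn: "f n \<in> Arr C" "Dom C (f n) = FO X n" "Cod C (f n) = FO Y n"
    and gn: "g n \<in> Arr C" "Dom C (g n) = FO Y n" "Cod C (g n) = FO Z n" for n
    using f g by (auto simp: simplicial_Arr hom_def)
  have "(g (src \<theta>) \<bullet> f (src \<theta>)) \<bullet> FA X \<theta> = FA Z \<theta> \<bullet> (g (tgt \<theta>) \<bullet> f (tgt \<theta>))" if t: "\<theta> \<in> Arr delta" for \<theta>
  proof -
    note F = simplicial_functor[OF X(1)] simplicial_functor[OF X(2)] simplicial_functor[OF X(3)]
    have "(g (src \<theta>) \<bullet> f (src \<theta>)) \<bullet> FA X \<theta> = g (src \<theta>) \<bullet> (f (src \<theta>) \<bullet> FA X \<theta>)"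
      using t F fn gn by simp
    also have "\<dots> = g (src \<theta>) \<bullet> (FA Y \<theta> \<bullet> f (tgt \<theta>))" using f t by (simp add: simplicial_Arr)
    also have "\<dots> = (g (src \<theta>) \<bullet> FA Y \<theta>) \<bullet> f (tgt \<theta>)" using t F fn gn by simp
    also have "\<dots> = (FA Z \<theta> \<bullet> g (tgt \<theta>)) \<bullet> f (tgt \<theta>)" using g t by (simp add: simplicial_Arr)
    also have "\<dots> = FA Z \<theta> \<bullet> (g (tgt \<theta>) \<bullet> f (tgt \<theta>))" using t F fn gn by simp
    finally show ?thesis .
  qed
  then show "\<beta> \<bullet>\<^bsub>simplicial C\<^esub> \<alpha> \<in> hom (simplicial C) X Z"
    using X fn gn by (simp add: f(1) g(1) simplicial_hom simplicial_Arr) (simp add: hom_def)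
next
  fix \<alpha> X Y assume "\<alpha> \<in> hom (simplicial C) X Y"
  then obtain f where f: "\<alpha> = Arrow X f Y" "Arrow X f Y \<in> Arr (simplicial C)" by (auto simp: simplicial_hom)
  have "f n \<in> Arr C" "Dom C (f n) = FO X n" "Cod C (f n) = FO Y n" for n
    using f by (auto simp: simplicial_Arr hom_def)
  then show "Idn (simplicial C) Y \<bullet>\<^bsub>simplicial C\<^esub> \<alpha> = \<alpha>" "\<alpha> \<bullet>\<^bsub>simplicial C\<^esub> Idn (simplicial C) X = \<alpha>"
    by (simp_all add: f(1))
next
  fix \<alpha> \<beta> \<gamma> W X Y Z
  assume "\<alpha> \<in> hom (simplicial C) W X" "\<beta> \<in> hom (simplicial C) X Y" "\<gamma> \<in> hom (simplicial C) Y Z"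
  then obtain f g h where f: "\<alpha> = Arrow W f X" "Arrow W f X \<in> Arr (simplicial C)"
    and g: "\<beta> = Arrow X g Y" "Arrow X g Y \<in> Arr (simplicial C)"
    and h: "\<gamma> = Arrow Y h Z" "Arrow Y h Z \<in> Arr (simplicial C)"
    by (auto simp: simplicial_hom)
  have "f n \<in> Arr C" "Cod C (f n) = FO X n" "g n \<in> Arr C" "Dom C (g n) = FO X n"
    "Cod C (g n) = FO Y n" "h n \<in> Arr C" "Dom C (h n) = FO Y n" for n
    using f g h by (auto simp: simplicial_Arr hom_def)
  then show "(\<gamma> \<bullet>\<^bsub>simplicial C\<^esub> \<beta>) \<bullet>\<^bsub>simplicial C\<^esub> \<alpha> = \<gamma> \<bullet>\<^bsub>simplicial C\<^esub> \<beta> \<bullet>\<^bsub>simplicial C\<^esub> \<alpha>"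
    by (simp add: f(1) g(1) h(1))
qed

text \<open>Composites and identities of simplicial maps are computed level by level, so an inverse
  evaluates to inverses.\<close>

lemma simplicial_iso_level:
  assumes "is_iso (simplicial C) \<alpha>"
  shows "is_iso C (amap \<alpha> n)"
proof -
  obtain \<beta> where "inverse_pair (simplicial C) \<alpha> \<beta>" using assms by (auto simp: is_iso_def)
  then have ab: "\<alpha> \<in> hom (simplicial C) (src \<alpha>) (tgt \<alpha>)" "\<beta> \<in> hom (simplicial C) (tgt \<alpha>) (src \<alpha>)"
    "\<beta> \<bullet>\<^bsub>simplicial C\<^esub> \<alpha> = Idn (simplicial C) (src \<alpha>)" "\<alpha> \<bullet>\<^bsub>simplicial C\<^esub> \<beta> = Idn (simplicial C) (tgt \<alpha>)"
    unfolding inverse_pair_def by (auto simp: hom_def)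
  obtain f where f: "\<alpha> = Arrow (src \<alpha>) f (tgt \<alpha>)" "Arrow (src \<alpha>) f (tgt \<alpha>) \<in> Arr (simplicial C)"
    using ab(1) unfolding simplicial_hom by blast
  obtain g where g: "\<beta> = Arrow (tgt \<alpha>) g (src \<alpha>)" "Arrow (tgt \<alpha>) g (src \<alpha>) \<in> Arr (simplicial C)"
    using ab(2) unfolding simplicial_hom by blast
  have "amap \<alpha> = f" "amap \<beta> = g" using f(1) g(1) by (metis arrow.sel(2))+
  moreover have "amap (\<beta> \<bullet>\<^bsub>simplicial C\<^esub> \<alpha>) n = amap (Idn (simplicial C) (src \<alpha>)) n"
    "amap (\<alpha> \<bullet>\<^bsub>simplicial C\<^esub> \<beta>) n = amap (Idn (simplicial C) (tgt \<alpha>)) n"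
    using ab(3,4) by simp_all
  ultimately have "g n \<bullet> f n = Idn C (FO (src \<alpha>) n)" "f n \<bullet> g n = Idn C (FO (tgt \<alpha>) n)"
    by simp_all
  moreover have "f n \<in> hom C (FO (src \<alpha>) n) (FO (tgt \<alpha>) n)" "g n \<in> hom C (FO (tgt \<alpha>) n) (FO (src \<alpha>) n)"
    using f(2) g(2) by (simp_all add: simplicial_Arr)
  ultimately show ?thesis using \<open>amap \<alpha> = f\<close> by (auto intro: is_isoI)
qed

lemma coend_unique:
  assumes E: "is_coend C J G E \<omega>" and E': "is_coend C J G E' \<omega>'"
  obtains h where "h \<in> hom C E E'" "is_iso C h" "\<And>j. j \<in> Ob J \<Longrightarrow> h \<bullet> \<omega> j = \<omega>' j"
proof -
  have cw: "is_cowedge C J G E \<omega>" "is_cowedge C J G E' \<omega>'" using E E' by (auto simp: is_coend_def)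
  have \<omega>: "\<omega> j \<in> hom C (FO G (j, j)) E" "\<omega>' j \<in> hom C (FO G (j, j)) E'" if "j \<in> Ob J" for j
    using cw that by (auto simp: is_cowedge_def)
  have Ob: "E \<in> Ob C" "E' \<in> Ob C" using cw by (auto simp: is_cowedge_def)
  obtain h where h: "h \<in> hom C E E'" "\<And>j. j \<in> Ob J \<Longrightarrow> h \<bullet> \<omega> j = \<omega>' j"
    using E cw(2) unfolding is_coend_def by blast
  obtain g where g: "g \<in> hom C E' E" "\<And>j. j \<in> Ob J \<Longrightarrow> g \<bullet> \<omega>' j = \<omega> j"
    using E' cw(1) unfolding is_coend_def by blast
  have uniq: "k = Idn C E" if "k \<in> hom C E E" "\<And>j. j \<in> Ob J \<Longrightarrow> k \<bullet> \<omega> j = \<omega> j" for k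
  proof -
    have "\<exists>!k. k \<in> hom C E E \<and> (\<forall>j\<in>Ob J. k \<bullet> \<omega> j = \<omega> j)" using E cw(1) unfolding is_coend_def by blast
    moreover have "Idn C E \<bullet> \<omega> j = \<omega> j" if "j \<in> Ob J" for j using Comp_Idn_left[OF \<omega>(1)[OF that]] .
    ultimately show ?thesis using that Idn_hom[OF Ob(1)] by blast
  qed
  have uniq': "k = Idn C E'" if "k \<in> hom C E' E'" "\<And>j. j \<in> Ob J \<Longrightarrow> k \<bullet> \<omega>' j = \<omega>' j" for k
  proof -
    have "\<exists>!k. k \<in> hom C E' E' \<and> (\<forall>j\<in>Ob J. k \<bullet> \<omega>' j = \<omega>' j)" using E' cw(2) unfolding is_coend_def by blast
    moreover have "Idn C E' \<bullet> \<omega>' j = \<omega>' j" if "j \<in> Ob J" for j using Comp_Idn_left[OF \<omega>(2)[OF that]] .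
    ultimately show ?thesis using that Idn_hom[OF Ob(2)] by blast
  qed
  have "g \<bullet> h = Idn C E"
    by (rule uniq[OF Comp_hom[OF h(1) g(1)]]) (simp add: Comp_assoc[OF \<omega>(1) h(1) g(1)] h(2) g(2))
  moreover have "h \<bullet> g = Idn C E'"
    by (rule uniq'[OF Comp_hom[OF g(1) h(1)]]) (simp add: Comp_assoc[OF \<omega>(2) g(1) h(1)] h(2) g(2))
  ultimately have "is_iso C h" using h(1) g(1) by (intro is_isoI)
  with h show ?thesis using that by blast
qed

end

text \<open>\<open>coend\<close> is a choice, so it has its universal property as soon as some coend
  has been exhibited; \<open>ws_coend\<close> does that.\<close>

lemma is_coend_coend:
  assumes "is_coend C J G E \<omega>"
  shows "is_coend C J G (fst (coend C J G)) (snd (coend C J G))"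
proof -
  have "\<exists>p. case p of (E, \<omega>) \<Rightarrow> is_coend C J G E \<omega>" using assms by auto
  from someI_ex[OF this] show ?thesis by (simp add: coend_def case_prod_unfold)
qed

section \<open>Weighted colimits over necklaces\<close>

text \<open>From here on templicial objects are absent: A stands for an arbitrary functor on the
  opposite of \<open>nec\<close>, to be instantiated with T \<mapsto> X_T(a, b).\<close>

locale weighted = quivers V S
  for V :: "('o, 'a) smoncat" (structure) and S :: "'u set" +
  fixes A :: "(necklace, nec_map, 'o, 'a) ftr" and F :: "(simplex set, set_map, 'o, 'a) ftr"
    and pt :: simplex
  assumes inf: "infinite (UNIV :: 'u set)"
    and A: "is_functor (op_cat nec) V A"
    and F: "is_functor (set_cat TYPE('u)) V F"
    and pres: "preserves_colimits TYPE('u) (set_cat TYPE('u)) V F"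
    and F_pt: "FO F {pt} = \<one>"
begin

lemma A_Ob [simp]: "T \<in> necklaces \<Longrightarrow> FO A T \<in> Ob V"
  using A by (simp add: is_functor_def)

lemma A_Arr [simp]:
  assumes "g \<in> Arr nec"
  shows "FA A g \<in> Arr V" "Dom V (FA A g) = FO A (tgt g)" "Cod V (FA A g) = FO A (src g)"
  using A assms by (simp_all add: is_functor_def hom_def)

lemma A_Idn: "T \<in> necklaces \<Longrightarrow> FA A (Idn nec T) = Idn V (FO A T)"
  using A by (simp add: is_functor_def)

lemma A_Comp:
  assumes "f \<in> Arr nec" "g \<in> Arr nec" "src g = tgt f"
  shows "FA A (g \<bullet>\<^bsub>nec\<^esub> f) = FA A f \<bullet> FA A g"
  using A assms by (simp add: is_functor_def)

lemma nec_Arr_necklaces: "g \<in> Arr nec \<Longrightarrow> src g \<in> necklaces" "g \<in> Arr nec \<Longrightarrow> tgt g \<in> necklaces"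
  by (auto elim!: nec_ArrE)

lemma flags_lepoll [simp]: "flags n T \<lesssim> (UNIV :: 'u set)"
  by (rule finite_lepoll_infinite[OF inf finite_flags])

abbreviation FN :: "necklace \<Rightarrow> nat \<Rightarrow> 'o" where "FN T n \<equiv> FO F (flags n T)"

lemma FO_F_Ob [simp]: "B \<lesssim> (UNIV :: 'u set) \<Longrightarrow> FO F B \<in> Ob V"
  using F by (simp add: is_functor_def)

lemma FA_F_Arr [simp]:
  assumes "f \<in> Arr (set_cat TYPE('u))"
  shows "FA F f \<in> Arr V" "Dom V (FA F f) = FO F (src f)" "Cod V (FA F f) = FO F (tgt f)"
  using F assms by (simp_all add: is_functor_def hom_def)

lemma FA_F_Comp:
  assumes "f \<in> Arr (set_cat TYPE('u))" "g \<in> Arr (set_cat TYPE('u))" "src g = tgt f"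
  shows "FA F (g \<bullet>\<^bsub>set_cat TYPE('u)\<^esub> f) = FA F g \<bullet> FA F f"
  using F assms by (simp add: is_functor_def)

lemma pick_Arr [simp]:
  assumes "\<tau> \<in> flags n T"
  shows "pick pt (flags n T) \<tau> \<in> Arr (set_cat TYPE('u))" "src (pick pt (flags n T) \<tau>) = {pt}"
    "tgt (pick pt (flags n T) \<tau>) = flags n T"
  using pick_hom[OF flags_lepoll assms, of pt "TYPE('u)"] by (simp_all add: hom_def)

text \<open>The coprojection at the flag \<tau> of the copower of a by the flags on T. For a =
  \<open>FO A T\<close> it is the part of \<open>flag_map\<close> that precedes the structure map of
  the coend.\<close>

definition tinj :: "'o \<Rightarrow> necklace \<Rightarrow> nat \<Rightarrow> simplex \<Rightarrow> 'a" where
  "tinj a T n \<tau> = (Idn V a \<odot> FA F (pick pt (flags n T) \<tau>)) \<bullet> inv_arr V (RUn V a)"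

lemma tinj_coprod:
  assumes a: "a \<in> Ob V"
  shows "is_coprod V (flags n T) (\<lambda>_. a) (a \<otimes> FN T n) (tinj a T n)"
proof -
  have "is_coprod V (flags n T) (\<lambda>_. a \<otimes> \<one>) (a \<otimes> FN T n) (\<lambda>\<tau>. Idn V a \<odot> FA F (pick pt (flags n T) \<tau>))"
    by (rule coprod_TenO_left[OF copower[OF F pres flags_lepoll, where pt = pt, unfolded F_pt] a])
  then have "is_coprod V (flags n T) (\<lambda>i. Dom V (inv_arr V (RUn V a))) (Cod V (Idn V (a \<otimes> FN T n)))
      (\<lambda>\<tau>. Idn V (a \<otimes> FN T n) \<bullet> (Idn V a \<odot> FA F (pick pt (flags n T) \<tau>)) \<bullet> inv_arr V (RUn V a))"
    by (rule coprod_transport) (use a in simp_all)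
  then have "is_coprod V (flags n T) (\<lambda>i. Dom V (inv_arr V (RUn V a))) (a \<otimes> FN T n)
      (\<lambda>\<tau>. Idn V (a \<otimes> FN T n) \<bullet> (Idn V a \<odot> FA F (pick pt (flags n T) \<tau>)) \<bullet> inv_arr V (RUn V a))"
    using a by simp
  then show ?thesis
    by (rule coprod_cong) (use a in \<open>simp_all add: tinj_def F_pt\<close>)
qed

lemma tinj_Arr [simp]:
  assumes "a \<in> Ob V" "\<tau> \<in> flags n T"
  shows "tinj a T n \<tau> \<in> Arr V" "Dom V (tinj a T n \<tau>) = a" "Cod V (tinj a T n \<tau>) = a \<otimes> FN T n"
  using coprod_hom[OF tinj_coprod[OF assms(1)] assms(2)] by (simp_all add: hom_def)

lemma tinj_left:
  assumes u: "u \<in> hom V a b" and \<tau>: "\<tau> \<in> flags n T"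
  shows "(u \<odot> Idn V (FN T n)) \<bullet> tinj a T n \<tau> = tinj b T n \<tau> \<bullet> u"
proof -
  have ab [simp]: "a \<in> Ob V" "b \<in> Ob V" "u \<in> Arr V" "Dom V u = a" "Cod V u = b"
    using u hom_Ob[OF u] by (auto simp: hom_def)
  let ?p = "FA F (pick pt (flags n T) \<tau>)"
  have p [simp]: "?p \<in> Arr V" "Dom V ?p = \<one>" "Cod V ?p = FN T n" using \<tau> F_pt by simp_all
  have "RUn V b \<bullet> ((u \<odot> Idn V \<one>) \<bullet> inv_arr V (RUn V a)) = (RUn V b \<bullet> (u \<odot> Idn V \<one>)) \<bullet> inv_arr V (RUn V a)"
    by simp
  also have "\<dots> = RUn V b \<bullet> (inv_arr V (RUn V b) \<bullet> u)"
    unfolding RUn_natural[OF u] by simp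
  finally have *: "(u \<odot> Idn V \<one>) \<bullet> inv_arr V (RUn V a) = inv_arr V (RUn V b) \<bullet> u"
    by (rule iso_cancel_left[rotated -1]) simp_all
  have "(u \<odot> Idn V (FN T n)) \<bullet> tinj a T n \<tau> = (Idn V b \<odot> ?p) \<bullet> ((u \<odot> Idn V \<one>) \<bullet> inv_arr V (RUn V a))"
    by (simp add: tinj_def)
  also have "\<dots> = tinj b T n \<tau> \<bullet> u" unfolding * by (simp add: tinj_def)
  finally show ?thesis .
qed

text \<open>Naturality in the indexing set, by functoriality of F along \<open>pick_Comp\<close>. It
  is specialised to necklace maps, which push flags forward, and to simplicial operators, which
  restrict them.\<close>

lemma tinj_right:
  assumes a: "a \<in> Ob V" and f: "Arrow (flags n T) f (flags m U) \<in> Arr (set_cat TYPE('u))"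
    and \<tau>: "\<tau> \<in> flags n T"
  shows "(Idn V a \<odot> FA F (Arrow (flags n T) f (flags m U))) \<bullet> tinj a T n \<tau> = tinj a U m (f \<tau>)"
proof -
  let ?f = "Arrow (flags n T) f (flags m U)"
  have "?f \<bullet>\<^bsub>set_cat TYPE('u)\<^esub> pick pt (flags n T) \<tau> = pick pt (flags m U) (f \<tau>)"
    using \<tau> by (rule pick_Comp)
  moreover have "FA F (?f \<bullet>\<^bsub>set_cat TYPE('u)\<^esub> pick pt (flags n T) \<tau>) = FA F ?f \<bullet> FA F (pick pt (flags n T) \<tau>)"
    by (rule FA_F_Comp) (use f \<tau> in simp_all)
  ultimately have "FA F ?f \<bullet> FA F (pick pt (flags n T) \<tau>) = FA F (pick pt (flags m U) (f \<tau>))"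
    by simp
  then show ?thesis
    using a f \<tau> F_pt by (simp add: tinj_def)
qed

definition nmap :: "nec_map \<Rightarrow> nat \<Rightarrow> set_map" where
  "nmap g n = Arrow (flags n (src g)) (\<lambda>\<sigma>\<in>flags n (src g). push n (amap g) \<sigma>) (flags n (tgt g))"

definition pull :: "mon_map \<Rightarrow> simplex \<Rightarrow> simplex" where
  "pull \<theta> \<tau> = compose {..src \<theta>} \<tau> (amap \<theta>)"

definition smap :: "necklace \<Rightarrow> mon_map \<Rightarrow> set_map" where
  "smap T \<theta> = Arrow (flags (tgt \<theta>) T) (\<lambda>\<sigma>\<in>flags (tgt \<theta>) T. pull \<theta> \<sigma>) (flags (src \<theta>) T)"

lemma push_flags': "g \<in> Arr nec \<Longrightarrow> \<tau> \<in> flags n (src g) \<Longrightarrow> push n (amap g) \<tau> \<in> flags n (tgt g)"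
  by (erule nec_ArrE) (auto intro: push_flags simp: nec_Arr)

lemma pull_flags:
  assumes "\<theta> \<in> Arr delta" "\<tau> \<in> flags (tgt \<theta>) T"
  shows "pull \<theta> \<tau> \<in> flags (src \<theta>) T"
proof -
  obtain m f n where \<theta>: "\<theta> = Arrow m f n" by (cases \<theta>)
  have f: "\<forall>i\<le>m. f i \<le> n" "mono_on {..m} f" using assms(1) by (auto simp: \<theta> delta_Arr)
  obtain U p where T: "T = (U, p)" by (cases T)
  have "\<tau> (f i) \<subseteq> \<tau> (f j)" if "i \<le> j" "j \<le> m" for i j
    using assms(2) f mono_onD[OF f(2), of i j] that by (simp add: \<theta> T flags_iff)
  then show ?thesis
    using assms(2) f(1) by (simp add: \<theta> T flags_iff pull_def compose_def)
qed

lemma nmap_Arr [simp]: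
  assumes "g \<in> Arr nec"
  shows "nmap g n \<in> Arr (set_cat TYPE('u))" "src (nmap g n) = flags n (src g)" "tgt (nmap g n) = flags n (tgt g)"
  using push_flags'[OF assms] by (auto simp: nmap_def set_cat_Arr)

lemma smap_Arr [simp]:
  assumes "\<theta> \<in> Arr delta"
  shows "smap T \<theta> \<in> Arr (set_cat TYPE('u))" "src (smap T \<theta>) = flags (tgt \<theta>) T"
    "tgt (smap T \<theta>) = flags (src \<theta>) T"
  using pull_flags[OF assms] by (auto simp: smap_def set_cat_Arr)

lemma tinj_nmap:
  assumes "a \<in> Ob V" "g \<in> Arr nec" "\<tau> \<in> flags n (src g)"
  shows "(Idn V a \<odot> FA F (nmap g n)) \<bullet> tinj a (src g) n \<tau> = tinj a (tgt g) n (push n (amap g) \<tau>)"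
  using tinj_right[OF assms(1) nmap_Arr(1)[OF assms(2), of n, unfolded nmap_def] assms(3)] assms(3)
  by (simp add: nmap_def)

lemma tinj_smap:
  assumes "a \<in> Ob V" "\<theta> \<in> Arr delta" "\<tau> \<in> flags (tgt \<theta>) T"
  shows "(Idn V a \<odot> FA F (smap T \<theta>)) \<bullet> tinj a T (tgt \<theta>) \<tau> = tinj a T (src \<theta>) (pull \<theta> \<tau>)"
  using tinj_right[OF assms(1) smap_Arr(1)[OF assms(2), of T, unfolded smap_def] assms(3)] assms(3)
  by (simp add: smap_def)

subsection \<open>The level-wise universal property\<close>

text \<open>
  By the copower description of \<open>A\<^sub>T \<otimes> FN(P\<^sub>T)\<^sub>n\<close>, cowedges at level \<open>n\<close> with vertex \<open>M\<close>
  correspond to the following families, which are cocones over the category of all flags.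
\<close>

definition compat :: "nat \<Rightarrow> 'o \<Rightarrow> (necklace \<Rightarrow> simplex \<Rightarrow> 'a) \<Rightarrow> bool" where
  "compat n M m \<longleftrightarrow> M \<in> Ob V \<and> (\<forall>T\<in>necklaces. \<forall>\<tau>\<in>flags n T. m T \<tau> \<in> hom V (FO A T) M) \<and>
     (\<forall>g\<in>Arr nec. \<forall>\<tau>\<in>flags n (src g). m (src g) \<tau> \<bullet> FA A g = m (tgt g) (push n (amap g) \<tau>))"

definition fdiag :: "nat \<Rightarrow> (necklace \<times> simplex, (necklace \<times> simplex, nat \<Rightarrow> nat) arrow, 'o, 'a) ftr" where
  "fdiag n = mk_functor (op_cat (nec_flanked n)) (\<lambda>(T, \<tau>). FO A T)
     (\<lambda>\<phi>. FA A (Arrow (fst (src \<phi>)) (amap \<phi>) (fst (tgt \<phi>))))"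

lemma fdiag_simps [simp]:
  "(T, \<tau>) \<in> flanked_flags n \<Longrightarrow> FO (fdiag n) (T, \<tau>) = FO A T"
  "\<phi> \<in> Arr (nec_flanked n) \<Longrightarrow> FA (fdiag n) \<phi> = FA A (Arrow (fst (src \<phi>)) (amap \<phi>) (fst (tgt \<phi>)))"
  by (simp_all add: fdiag_def)

lemma nec_flankedE:
  assumes "\<phi> \<in> Arr (nec_flanked n)"
  obtains T \<tau> f U \<upsilon> where "\<phi> = Arrow (T, \<tau>) f (U, \<upsilon>)" "(T, \<tau>) \<in> flanked_flags n"
    "(U, \<upsilon>) \<in> flanked_flags n" "Arrow T f U \<in> Arr nec" "\<And>i. i \<le> n \<Longrightarrow> f ` \<tau> i = \<upsilon> i"
proof -
  obtain T \<tau> f U \<upsilon> where "\<phi> = Arrow (T, \<tau>) f (U, \<upsilon>)" by (cases \<phi>) (metis surj_pair)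
  with assms that show ?thesis by (auto simp: nec_flanked_Arr)
qed

lemma fdiag_functor: "is_functor (op_cat (nec_flanked n)) V (fdiag n)"
  unfolding is_functor_def
proof (intro conjI ballI impI)
  fix x assume x: "x \<in> Ob (op_cat (nec_flanked n))"
  obtain T p \<tau> where x': "x = ((T, p), \<tau>)" by (metis surj_pair)
  have T: "(T, p) \<in> necklaces" using x by (auto simp: x' flanked_flags_iff)
  show "FO (fdiag n) x \<in> Ob V" using x T by (simp add: x')
  have "Idn (nec_flanked n) x \<in> Arr (nec_flanked n)"
    using category.Arr_Idn(1)[OF category_nec_flanked, of x n] x by simp
  then show "FA (fdiag n) (Idn (op_cat (nec_flanked n)) x) = Idn V (FO (fdiag n) x)"
    using A_Idn[OF T] x by (simp add: x')
next
  fix \<phi> assume "\<phi> \<in> Arr (op_cat (nec_flanked n))"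
  then have phi: "\<phi> \<in> Arr (nec_flanked n)" by simp
  then show "FA (fdiag n) \<phi> \<in> hom V (FO (fdiag n) (Dom (op_cat (nec_flanked n)) \<phi>))
      (FO (fdiag n) (Cod (op_cat (nec_flanked n)) \<phi>))"
    by (elim nec_flankedE) (use phi in \<open>simp add: hom_def\<close>)
next
  fix \<psi> \<phi> assume "\<psi> \<in> Arr (op_cat (nec_flanked n))" "\<phi> \<in> Arr (op_cat (nec_flanked n))"
    and "Cod (op_cat (nec_flanked n)) \<psi> = Dom (op_cat (nec_flanked n)) \<phi>"
  then have phi: "\<phi> \<in> Arr (nec_flanked n)" and psi: "\<psi> \<in> Arr (nec_flanked n)" and eq: "src \<psi> = tgt \<phi>"
    by simp_all
  have comp: "\<psi> \<bullet>\<^bsub>nec_flanked n\<^esub> \<phi> \<in> Arr (nec_flanked n)"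
    using category.Arr_Comp(1)[OF category_nec_flanked phi psi] eq by simp
  obtain T \<tau> f U \<upsilon> where phi': "\<phi> = Arrow (T, \<tau>) f (U, \<upsilon>)" "Arrow T f U \<in> Arr nec"
    using phi by (elim nec_flankedE)
  obtain U' \<upsilon>' g W \<omega> where psi': "\<psi> = Arrow (U', \<upsilon>') g (W, \<omega>)" "Arrow U' g W \<in> Arr nec"
    using psi by (elim nec_flankedE)
  have [simp]: "U' = U" "\<upsilon>' = \<upsilon>" using eq by (auto simp: phi'(1) psi'(1))
  have "FA (fdiag n) (\<phi> \<bullet>\<^bsub>op_cat (nec_flanked n)\<^esub> \<psi>) = FA A (Arrow U g W \<bullet>\<^bsub>nec\<^esub> Arrow T f U)"
    using comp by (simp add: phi'(1) psi'(1))
  also have "\<dots> = FA A (Arrow T f U) \<bullet> FA A (Arrow U g W)"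
    using phi'(2) psi'(2) by (intro A_Comp) simp_all
  finally show "FA (fdiag n) (\<phi> \<bullet>\<^bsub>op_cat (nec_flanked n)\<^esub> \<psi>) = FA (fdiag n) \<phi> \<bullet> FA (fdiag n) \<psi>"
    using phi psi by (simp add: phi'(1) psi'(1))
qed

definition L :: "nat \<Rightarrow> 'o" where
  "L n = fst (colimit V (op_cat (nec_flanked n)) (fdiag n))"

definition lam :: "nat \<Rightarrow> necklace \<times> simplex \<Rightarrow> 'a" where
  "lam n = snd (colimit V (op_cat (nec_flanked n)) (fdiag n))"

text \<open>The extension of the colimit coprojections from flanked pairs to all pairs, by composing
  with the action of the counit of the coreflection.\<close>

definition kap :: "nat \<Rightarrow> necklace \<Rightarrow> simplex \<Rightarrow> 'a" where
  "kap n T \<tau> = lam n (flank n \<tau>) \<bullet> FA A (Arrow (fst (flank n \<tau>)) (enum (\<tau> n)) T)"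

lemma L_colimit: "is_colimit V (op_cat (nec_flanked n)) (fdiag n) (L n) (lam n)"
proof -
  have "\<exists>M \<iota>. is_colimit V (op_cat (nec_flanked n)) (fdiag n) M \<iota>"
  proof (rule small_colimit[OF cocomplete category_op_cat[OF category_nec_flanked] fdiag_functor])
    show "Ob (op_cat (nec_flanked n)) \<lesssim> (UNIV :: 'u set)" "Arr (op_cat (nec_flanked n)) \<lesssim> (UNIV :: 'u set)"
      unfolding op_cat_simps by (rule countable_lepoll_infinite[OF countable_nec_flanked(1) inf]
        countable_lepoll_infinite[OF countable_nec_flanked(2) inf])+
  qed
  then obtain M \<iota> where "is_colimit V (op_cat (nec_flanked n)) (fdiag n) M \<iota>" by metis
  from is_colimit_colimit[OF this] show ?thesis unfolding L_def lam_def .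
qed

lemma L_ex1: "is_cocone V (op_cat (nec_flanked n)) (fdiag n) M \<mu> \<Longrightarrow>
    \<exists>!h. h \<in> hom V (L n) M \<and> (\<forall>j\<in>flanked_flags n. h \<bullet> lam n j = \<mu> j)"
  using conjunct2[OF L_colimit[of n, unfolded is_colimit_def], rule_format, of M \<mu>] by simp

lemma L_Ob [simp]: "L n \<in> Ob V"
  using L_colimit[of n] by (simp add: is_colimit_def is_cocone_def)

lemma lam_hom: "(T, \<tau>) \<in> flanked_flags n \<Longrightarrow> lam n (T, \<tau>) \<in> hom V (FO A T) (L n)"
  using L_colimit[of n] by (auto simp: is_colimit_def is_cocone_def)

lemma lam_natural:
  assumes "Arrow (T, \<tau>) f (U, \<upsilon>) \<in> Arr (nec_flanked n)"
  shows "lam n (T, \<tau>) \<bullet> FA A (Arrow T f U) = lam n (U, \<upsilon>)"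
  using L_colimit[of n] assms unfolding is_colimit_def is_cocone_def by fastforce

lemma lam_ex:
  assumes "M \<in> Ob V" "\<And>T \<tau>. (T, \<tau>) \<in> flanked_flags n \<Longrightarrow> m T \<tau> \<in> hom V (FO A T) M"
    and nat: "\<And>T \<tau> f U \<upsilon>. Arrow (T, \<tau>) f (U, \<upsilon>) \<in> Arr (nec_flanked n) \<Longrightarrow>
      m T \<tau> \<bullet> FA A (Arrow T f U) = m U \<upsilon>"
  obtains h where "h \<in> hom V (L n) M" "\<And>T \<tau>. (T, \<tau>) \<in> flanked_flags n \<Longrightarrow> h \<bullet> lam n (T, \<tau>) = m T \<tau>"
proof -
  have "is_cocone V (op_cat (nec_flanked n)) (fdiag n) M (\<lambda>(T, \<tau>). m T \<tau>)"
    unfolding is_cocone_def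
  proof (intro conjI ballI)
    fix \<phi> assume "\<phi> \<in> Arr (op_cat (nec_flanked n))"
    then have phi: "\<phi> \<in> Arr (nec_flanked n)" by simp
    then obtain T \<tau> f U \<upsilon> where phi': "\<phi> = Arrow (T, \<tau>) f (U, \<upsilon>)" by (elim nec_flankedE)
    show "(case Cod (op_cat (nec_flanked n)) \<phi> of (T, \<tau>) \<Rightarrow> m T \<tau>) \<bullet> FA (fdiag n) \<phi> =
        (case Dom (op_cat (nec_flanked n)) \<phi> of (T, \<tau>) \<Rightarrow> m T \<tau>)"
      using nat phi by (simp add: phi')
  qed (use assms in auto)
  from ex1_implies_ex[OF L_ex1[OF this]] obtain h where
    h: "h \<in> hom V (L n) M" "\<forall>j\<in>flanked_flags n. h \<bullet> lam n j = (case j of (T, \<tau>) \<Rightarrow> m T \<tau>)"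
    by (elim exE conjE)
  show ?thesis
  proof (rule that[OF h(1)])
    show "h \<bullet> lam n (T, \<tau>) = m T \<tau>" if "(T, \<tau>) \<in> flanked_flags n" for T \<tau>
      using bspec[OF h(2) that] by simp
  qed
qed

lemma lam_ext:
  assumes h: "h \<in> hom V (L n) M" "h' \<in> hom V (L n) M"
    and eq: "\<And>T \<tau>. (T, \<tau>) \<in> flanked_flags n \<Longrightarrow> h \<bullet> lam n (T, \<tau>) = h' \<bullet> lam n (T, \<tau>)"
  shows "h = h'"
proof -
  have cc: "is_cocone V (op_cat (nec_flanked n)) (fdiag n) M (\<lambda>j. h' \<bullet> lam n j)"
    unfolding is_cocone_def
  proof (intro conjI ballI)
    show "M \<in> Ob V" using h(1) by (rule hom_Ob)
    show "h' \<bullet> lam n j \<in> hom V (FO (fdiag n) j) M" if "j \<in> Ob (op_cat (nec_flanked n))" for j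
      using that Comp_hom[OF lam_hom h(2)] by (cases j) simp
    fix \<phi> assume "\<phi> \<in> Arr (op_cat (nec_flanked n))"
    then have phi: "\<phi> \<in> Arr (nec_flanked n)" by simp
    then obtain T \<tau> f U \<upsilon> where phi': "\<phi> = Arrow (T, \<tau>) f (U, \<upsilon>)" "(T, \<tau>) \<in> flanked_flags n" "Arrow T f U \<in> Arr nec"
      by (elim nec_flankedE)
    have "(h' \<bullet> lam n (T, \<tau>)) \<bullet> FA A (Arrow T f U) = h' \<bullet> lam n (U, \<upsilon>)"
      using lam_natural[of T \<tau> f U \<upsilon> n] phi lam_hom[OF phi'(2)] h(2) phi'(3) by (simp add: phi'(1) hom_def)
    then show "(h' \<bullet> lam n (Cod (op_cat (nec_flanked n)) \<phi>)) \<bullet> FA (fdiag n) \<phi> = h' \<bullet> lam n (Dom (op_cat (nec_flanked n)) \<phi>)"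
      using phi by (simp add: phi'(1))
  qed
  have "\<forall>j\<in>flanked_flags n. h \<bullet> lam n j = h' \<bullet> lam n j" using eq by auto
  then show ?thesis using L_ex1[OF cc] h by blast
qed

lemma kap_flanked:
  assumes "(T, \<tau>) \<in> flanked_flags n"
  shows "kap n T \<tau> = lam n (T, \<tau>)"
proof -
  obtain U p where T: "T = (U, p)" by (cases T)
  have "(U, p) \<in> necklaces" using assms by (simp add: T flanked_flags_iff)
  moreover have "Arrow (fst (flank n \<tau>)) (enum (\<tau> n)) T = Idn nec T"
    using flank_flanked[OF assms[unfolded T]] by (simp add: T)
  ultimately show ?thesis
    using flank_flanked(1)[OF assms[unfolded T]] A_Idn[of T] lam_hom[OF assms]
    by (simp add: kap_def T hom_def)
qed

lemma kap_hom:
  assumes "T \<in> necklaces" "\<tau> \<in> flags n T"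
  shows "kap n T \<tau> \<in> hom V (FO A T) (L n)"
proof -
  obtain U p where T: "T = (U, p)" by (cases T)
  obtain T' \<tau>' where fl: "flank n \<tau> = (T', \<tau>')" by (cases "flank n \<tau>")
  show ?thesis
    using flank[of U p \<tau> n] assms lam_hom[of T' \<tau>' n] unfolding kap_def by (simp add: fl T hom_def)
qed

text \<open>For an arbitrary necklace map g, composing g with the enumeration of the top of \<tau>
  gives a map from a flanked pair which pushes its flag to \<upsilon>. By
  \<open>flank_factor\<close> this map passes through the flanked pair of \<upsilon>, by an arrow of
  \<open>nec_flanked n\<close>, and along that arrow \<open>lam\<close> is natural.\<close>

lemma kap_natural:
  assumes g: "g \<in> Arr nec" and \<tau>: "\<tau> \<in> flags n (src g)"
  shows "kap n (src g) \<tau> \<bullet> FA A g = kap n (tgt g) (push n (amap g) \<tau>)"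
proof -
  interpret nec: category nec by (rule category_nec)
  obtain T p f U q where g': "g = Arrow (T, p) f (U, q)" "(T, p) \<in> necklaces" "(U, q) \<in> necklaces"
    using g by (elim nec_ArrE)
  have \<tau>': "\<tau> \<in> flags n (T, p)" using \<tau> by (simp add: g'(1))
  define \<upsilon> where "\<upsilon> = push n f \<tau>"
  have \<upsilon>: "\<upsilon> \<in> flags n (U, q)" using push_flags'[OF g \<tau>] by (simp add: \<upsilon>_def g'(1))
  obtain T' p' \<tau>'' where fl: "flank n \<tau> = ((T', p'), \<tau>'')" by (metis surj_pair)
  obtain U' q' \<upsilon>'' where fl': "flank n \<upsilon> = ((U', q'), \<upsilon>'')" by (metis surj_pair)
  let ?e = "enum (\<tau> n)" and ?e' = "enum (\<upsilon> n)"
  note F = flank[OF g'(2) \<tau>', unfolded fl fst_conv snd_conv]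
  note F' = flank[OF g'(3) \<upsilon>, unfolded fl' fst_conv snd_conv]
  have fe: "Arrow (T', p') (compose {..p'} f ?e) (U, q) \<in> Arr nec"
    using nec.Arr_Comp(1)[OF F(2) g] by (simp add: g'(1))
  have "push n (compose {..p'} f ?e) \<tau>'' = \<upsilon>"
  proof -
    have "compose {..p'} f ?e ` \<tau>'' i = f ` \<tau> i" if i: "i \<le> n" for i
    proof -
      have "\<tau>'' i \<subseteq> {..p'}" using F(1) i by (simp add: flanked_flags_iff flags_iff)
      then have "compose {..p'} f ?e ` \<tau>'' i = f ` ?e ` \<tau>'' i"
        unfolding image_image by (intro image_cong) (auto simp: compose_eq)
      also have "?e ` \<tau>'' i = \<tau> i" using fun_cong[OF F(3), of i] i by (simp add: push_def)
      finally show ?thesis .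
    qed
    then show ?thesis by (auto simp: push_def \<upsilon>_def fun_eq_iff)
  qed
  from flank_factor[OF F(1) g'(3) \<upsilon> fe this] obtain h where
    h: "Arrow ((T', p'), \<tau>'') h (flank n \<upsilon>) \<in> Arr (nec_flanked n)" "compose {..p'} ?e' h = compose {..p'} f ?e"
    by metis
  have hA: "Arrow (T', p') h (U', q') \<in> Arr nec" using h(1) by (simp add: fl' nec_flanked_Arr)
  have l: "lam n ((T', p'), \<tau>'') \<in> Arr V" "Dom V (lam n ((T', p'), \<tau>'')) = FO A (T', p')"
    using lam_hom[OF F(1)] by (auto simp: hom_def)
  have "kap n (src g) \<tau> \<bullet> FA A g = lam n ((T', p'), \<tau>'') \<bullet> (FA A (Arrow (T', p') ?e (T, p)) \<bullet> FA A g)"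
    using l F(2) g by (simp add: kap_def fl g'(1))
  also have "FA A (Arrow (T', p') ?e (T, p)) \<bullet> FA A g = FA A (g \<bullet>\<^bsub>nec\<^esub> Arrow (T', p') ?e (T, p))"
    using F(2) g by (intro A_Comp[symmetric]) (simp_all add: g'(1))
  also have "g \<bullet>\<^bsub>nec\<^esub> Arrow (T', p') ?e (T, p) = Arrow (U', q') ?e' (U, q) \<bullet>\<^bsub>nec\<^esub> Arrow (T', p') h (U', q')"
    using h(2) by (simp add: g'(1))
  also have "FA A (\<dots>) = FA A (Arrow (T', p') h (U', q')) \<bullet> FA A (Arrow (U', q') ?e' (U, q))"
    using F'(2) hA by (intro A_Comp) simp_all
  also have "lam n ((T', p'), \<tau>'') \<bullet> (\<dots>) =
      (lam n ((T', p'), \<tau>'') \<bullet> FA A (Arrow (T', p') h (U', q'))) \<bullet> FA A (Arrow (U', q') ?e' (U, q))"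
    using l hA F'(2) by simp
  also have "lam n ((T', p'), \<tau>'') \<bullet> FA A (Arrow (T', p') h (U', q')) = lam n (flank n \<upsilon>)"
    using lam_natural[of "(T', p')" \<tau>'' h "(U', q')" \<upsilon>'' n] h(1) by (simp add: fl')
  finally show ?thesis
    unfolding kap_def[of n "tgt g"] by (simp add: fl' g'(1) flip: \<upsilon>_def)
qed

lemma kap_ext:
  assumes "h \<in> hom V (L n) M" "h' \<in> hom V (L n) M"
    and "\<And>T \<tau>. T \<in> necklaces \<Longrightarrow> \<tau> \<in> flags n T \<Longrightarrow> h \<bullet> kap n T \<tau> = h' \<bullet> kap n T \<tau>"
  shows "h = h'"
proof (rule lam_ext[OF assms(1,2)])
  fix T \<tau> assume fl: "(T, \<tau>) \<in> flanked_flags n"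
  then have "T \<in> necklaces" "\<tau> \<in> flags n T" by (cases T; simp add: flanked_flags_iff)+
  from assms(3)[OF this] show "h \<bullet> lam n (T, \<tau>) = h' \<bullet> lam n (T, \<tau>)" by (simp add: kap_flanked[OF fl])
qed

text \<open>With \<open>kap_ext\<close> this is the universal property of \<open>L n\<close> among
  compatible families on all flags: a family restricts to flanked pairs, and compatibility with the
  counit forces its other values.\<close>

lemma kap_ex:
  assumes m: "compat n M m"
  obtains h where "h \<in> hom V (L n) M" "\<And>T \<tau>. T \<in> necklaces \<Longrightarrow> \<tau> \<in> flags n T \<Longrightarrow> h \<bullet> kap n T \<tau> = m T \<tau>"
proof -
  have m': "M \<in> Ob V" "\<And>T \<tau>. T \<in> necklaces \<Longrightarrow> \<tau> \<in> flags n T \<Longrightarrow> m T \<tau> \<in> hom V (FO A T) M"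
    "\<And>g \<tau>. g \<in> Arr nec \<Longrightarrow> \<tau> \<in> flags n (src g) \<Longrightarrow> m (src g) \<tau> \<bullet> FA A g = m (tgt g) (push n (amap g) \<tau>)"
    using m by (auto simp: compat_def)
  have fl: "T \<in> necklaces \<and> \<tau> \<in> flags n T" if "(T, \<tau>) \<in> flanked_flags n" for T \<tau>
    using that by (cases T) (simp add: flanked_flags_iff)
  have nat: "m T \<tau> \<bullet> FA A (Arrow T f U) = m U \<upsilon>" if "Arrow (T, \<tau>) f (U, \<upsilon>) \<in> Arr (nec_flanked n)" for T \<tau> f U \<upsilon>
  proof -
    have f: "(T, \<tau>) \<in> flanked_flags n" "(U, \<upsilon>) \<in> flanked_flags n" "Arrow T f U \<in> Arr nec" "\<forall>i\<le>n. f ` \<tau> i = \<upsilon> i"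
      using that by (auto simp: nec_flanked_Arr)
    have "\<upsilon> \<in> extensional {..n}" using f(2) by (cases U) (simp add: flanked_flags_iff flags_iff)
    then have "push n f \<tau> = \<upsilon>" using f(4) by (auto simp: push_def extensional_def fun_eq_iff)
    then show ?thesis using m'(3)[OF f(3), of \<tau>] fl[OF f(1)] by simp
  qed
  obtain h where h: "h \<in> hom V (L n) M" "\<And>T \<tau>. (T, \<tau>) \<in> flanked_flags n \<Longrightarrow> h \<bullet> lam n (T, \<tau>) = m T \<tau>"
    using lam_ex[OF m'(1), of n m] m'(2) fl nat by metis
  have "h \<bullet> kap n T \<tau> = m T \<tau>" if T: "T \<in> necklaces" and \<tau>: "\<tau> \<in> flags n T" for T \<tau>
  proof -
    obtain U p where T': "T = (U, p)" by (cases T)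
    obtain W \<omega> where w: "flank n \<tau> = (W, \<omega>)" by (cases "flank n \<tau>")
    note F = flank[OF T[unfolded T'] \<tau>[unfolded T'], unfolded w fst_conv snd_conv]
    have "h \<bullet> kap n T \<tau> = (h \<bullet> lam n (W, \<omega>)) \<bullet> FA A (Arrow W (enum (\<tau> n)) T)"
      using h(1) lam_hom[OF F(1)] F(2) by (simp add: kap_def w hom_def T')
    also have "\<dots> = m W \<omega> \<bullet> FA A (Arrow W (enum (\<tau> n)) T)" by (simp add: h(2)[OF F(1)])
    also have "\<dots> = m T \<tau>" using m'(3)[OF F(2), of \<omega>] fl[OF F(1)] F(3) by (simp add: T')
    finally show ?thesis .
  qed
  with h(1) show ?thesis by (rule that)
qed

end

context weighted
begin

subsection \<open>The simplicial structure on the level-wise colimits\<close>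

lemma push_pull:
  assumes "\<theta> \<in> Arr delta"
  shows "push (src \<theta>) g (pull \<theta> \<tau>) = pull \<theta> (push (tgt \<theta>) g \<tau>)"
proof -
  have "amap \<theta> i \<le> tgt \<theta>" if "i \<le> src \<theta>" for i
    using assms that by (cases \<theta>) (simp add: delta_Arr)
  then show ?thesis by (auto simp: push_def pull_def compose_def fun_eq_iff)
qed

lemma pull_Idn: "\<tau> \<in> flags n T \<Longrightarrow> pull (Idn delta n) \<tau> = \<tau>"
  by (cases T) (auto simp: pull_def compose_def flags_iff extensional_def fun_eq_iff)

lemma pull_Comp:
  assumes "\<theta> \<in> Arr delta" "\<eta> \<in> Arr delta" "src \<eta> = tgt \<theta>"
  shows "pull (\<eta> \<bullet>\<^bsub>delta\<^esub> \<theta>) \<tau> = pull \<theta> (pull \<eta> \<tau>)"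
proof -
  have "amap \<theta> i \<le> src \<eta>" if "i \<le> src \<theta>" for i
    using assms that by (cases \<theta>) (simp add: delta_Arr)
  then show ?thesis by (auto simp: pull_def compose_def fun_eq_iff)
qed

lemma push_Idn: "\<tau> \<in> flags n (T, p) \<Longrightarrow> push n (\<lambda>i\<in>{..p}. i) \<tau> = \<tau>"
proof
  fix i assume \<tau>: "\<tau> \<in> flags n (T, p)"
  show "push n (\<lambda>i\<in>{..p}. i) \<tau> i = \<tau> i"
  proof (cases "i \<le> n")
    case True
    then have "\<tau> i \<subseteq> {..p}" using \<tau> by (simp add: flags_iff)
    then have "(\<lambda>i\<in>{..p}. i) ` \<tau> i = \<tau> i" by force
    with True show ?thesis by (simp add: push_def)
  next
    case False
    with \<tau> show ?thesis by (simp add: push_def flags_iff extensional_def)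
  qed
qed

text \<open>Restricting flags along \<theta> commutes with pushing them forward, so the restricted
  family is compatible. Faces at the two ends change the bottom or the top, so flanked flags are not
  stable under \<open>pull\<close>; this is why the operators are defined through \<open>kap\<close>
  instead of \<open>lam\<close>.\<close>

lemma lmap_ex:
  assumes \<theta>: "\<theta> \<in> Arr delta"
  shows "\<exists>h. h \<in> hom V (L (tgt \<theta>)) (L (src \<theta>)) \<and> (\<forall>T\<in>necklaces. \<forall>\<tau>\<in>flags (tgt \<theta>) T.
    h \<bullet> kap (tgt \<theta>) T \<tau> = kap (src \<theta>) T (pull \<theta> \<tau>))"
proof -
  have "compat (tgt \<theta>) (L (src \<theta>)) (\<lambda>T \<tau>. kap (src \<theta>) T (pull \<theta> \<tau>))"
    unfolding compat_def
    using kap_hom pull_flags[OF \<theta>] kap_natural push_pull[OF \<theta>] by simp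
  from kap_ex[OF this] show ?thesis by metis
qed

definition lmap :: "mon_map \<Rightarrow> 'a" where
  "lmap \<theta> = (SOME h. h \<in> hom V (L (tgt \<theta>)) (L (src \<theta>)) \<and> (\<forall>T\<in>necklaces. \<forall>\<tau>\<in>flags (tgt \<theta>) T.
    h \<bullet> kap (tgt \<theta>) T \<tau> = kap (src \<theta>) T (pull \<theta> \<tau>)))"

lemma lmap:
  assumes "\<theta> \<in> Arr delta"
  shows "lmap \<theta> \<in> hom V (L (tgt \<theta>)) (L (src \<theta>))"
    "T \<in> necklaces \<Longrightarrow> \<tau> \<in> flags (tgt \<theta>) T \<Longrightarrow> lmap \<theta> \<bullet> kap (tgt \<theta>) T \<tau> = kap (src \<theta>) T (pull \<theta> \<tau>)"
  using someI_ex[OF lmap_ex[OF assms], folded lmap_def] by blast+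

definition Ls :: "('o, 'a) simp_obj" where
  "Ls = mk_functor (op_cat delta) L lmap"

lemma Ls_simps [simp]: "FO Ls n = L n" "\<theta> \<in> Arr delta \<Longrightarrow> FA Ls \<theta> = lmap \<theta>"
  by (simp_all add: Ls_def)

lemma Ls_Ob [simp]: "Ls \<in> Ob (simplicial V)"
  unfolding simplicial_Ob
proof
  interpret delta: category delta by (rule category_delta)
  show "FA Ls \<in> extensional (Arr delta)" by (simp add: Ls_def mk_functor_def)
  show "is_functor (op_cat delta) V Ls"
    unfolding is_functor_def
  proof (intro conjI ballI impI)
    fix n assume "n \<in> Ob (op_cat delta)"
    show "FO Ls n \<in> Ob V" by simp
    have I: "Idn delta n \<in> Arr delta" by (rule delta.Arr_Idn) simp
    have "lmap (Idn delta n) = Idn V (L n)"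
    proof (rule kap_ext)
      show "lmap (Idn delta n) \<in> hom V (L n) (L n)" using lmap(1)[OF I] by simp
      show "Idn V (L n) \<in> hom V (L n) (L n)" by (rule Idn_hom) simp
      fix T \<tau> assume T: "T \<in> necklaces" "\<tau> \<in> flags n T"
      show "lmap (Idn delta n) \<bullet> kap n T \<tau> = Idn V (L n) \<bullet> kap n T \<tau>"
        using lmap(2)[OF I, of T \<tau>] T pull_Idn[OF T(2)] Comp_Idn_left[OF kap_hom[OF T]] by simp
    qed
    then show "FA Ls (Idn (op_cat delta) n) = Idn V (FO Ls n)" using I by simp
  next
    fix \<theta> assume "\<theta> \<in> Arr (op_cat delta)"
    then show "FA Ls \<theta> \<in> hom V (FO Ls (Dom (op_cat delta) \<theta>)) (FO Ls (Cod (op_cat delta) \<theta>))"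
      using lmap(1)[of \<theta>] by simp
  next
    fix \<eta> \<theta> assume "\<eta> \<in> Arr (op_cat delta)" "\<theta> \<in> Arr (op_cat delta)"
      "Cod (op_cat delta) \<eta> = Dom (op_cat delta) \<theta>"
    then have t: "\<theta> \<in> Arr delta" "\<eta> \<in> Arr delta" "src \<eta> = tgt \<theta>" by simp_all
    have C: "\<eta> \<bullet>\<^bsub>delta\<^esub> \<theta> \<in> Arr delta" by (rule delta.Arr_Comp(1)) (use t in simp_all)
    have st: "src (\<eta> \<bullet>\<^bsub>delta\<^esub> \<theta>) = src \<theta>" "tgt (\<eta> \<bullet>\<^bsub>delta\<^esub> \<theta>) = tgt \<eta>" by simp_all
    have l: "lmap \<eta> \<in> hom V (L (tgt \<eta>)) (L (tgt \<theta>))" using lmap(1)[OF t(2)] t(3) by simp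
    have "lmap (\<eta> \<bullet>\<^bsub>delta\<^esub> \<theta>) = lmap \<theta> \<bullet> lmap \<eta>"
    proof (rule kap_ext)
      show "lmap (\<eta> \<bullet>\<^bsub>delta\<^esub> \<theta>) \<in> hom V (L (tgt \<eta>)) (L (src \<theta>))" using lmap(1)[OF C] unfolding st .
      show "lmap \<theta> \<bullet> lmap \<eta> \<in> hom V (L (tgt \<eta>)) (L (src \<theta>))" by (rule Comp_hom[OF l lmap(1)[OF t(1)]])
      fix T \<tau> assume T: "T \<in> necklaces" "\<tau> \<in> flags (tgt \<eta>) T"
      have "(lmap \<theta> \<bullet> lmap \<eta>) \<bullet> kap (tgt \<eta>) T \<tau> = lmap \<theta> \<bullet> (lmap \<eta> \<bullet> kap (tgt \<eta>) T \<tau>)"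
        by (rule Comp_assoc[OF kap_hom[OF T] l lmap(1)[OF t(1)]])
      also have "\<dots> = kap (src \<theta>) T (pull \<theta> (pull \<eta> \<tau>))"
        using lmap(2)[OF t(2) T] lmap(2)[OF t(1) T(1), of "pull \<eta> \<tau>"] pull_flags[OF t(2) T(2)] t(3) by simp
      also have "\<dots> = lmap (\<eta> \<bullet>\<^bsub>delta\<^esub> \<theta>) \<bullet> kap (tgt \<eta>) T \<tau>"
        using lmap(2)[OF C T(1), of \<tau>, unfolded st] T(2) pull_Comp[OF t, of \<tau>] by metis
      finally show "lmap (\<eta> \<bullet>\<^bsub>delta\<^esub> \<theta>) \<bullet> kap (tgt \<eta>) T \<tau> = (lmap \<theta> \<bullet> lmap \<eta>) \<bullet> kap (tgt \<eta>) T \<tau>" ..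
    qed
    then show "FA Ls (\<theta> \<bullet>\<^bsub>op_cat delta\<^esub> \<eta>) = FA Ls \<theta> \<bullet> FA Ls \<eta>" using C t by simp
  qed
qed

text \<open>The legs of the future cowedge at level n: by the copower property it is enough to
  prescribe them on the flags.\<close>

lemma w_ex:
  assumes T: "T \<in> necklaces"
  shows "\<exists>h. h \<in> hom V (FO A T \<otimes> FN T n) (L n) \<and> (\<forall>\<tau>\<in>flags n T. h \<bullet> tinj (FO A T) T n \<tau> = kap n T \<tau>)"
proof -
  have c: "is_coprod V (flags n T) (\<lambda>_. FO A T) (FO A T \<otimes> FN T n) (tinj (FO A T) T n)"
    by (rule tinj_coprod[OF A_Ob[OF T]])
  show ?thesis
    using coprod_ex[OF c L_Ob[of n], of "kap n T"] kap_hom[OF T, of _ n] by metis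
qed

definition w :: "necklace \<Rightarrow> nat \<Rightarrow> 'a" where
  "w T n = (SOME h. h \<in> hom V (FO A T \<otimes> FN T n) (L n) \<and> (\<forall>\<tau>\<in>flags n T. h \<bullet> tinj (FO A T) T n \<tau> = kap n T \<tau>))"

lemma w:
  assumes "T \<in> necklaces"
  shows "w T n \<in> hom V (FO A T \<otimes> FN T n) (L n)" "\<tau> \<in> flags n T \<Longrightarrow> w T n \<bullet> tinj (FO A T) T n \<tau> = kap n T \<tau>"
  using someI_ex[OF w_ex[OF assms], folded w_def] by blast+

subsection \<open>The integrand\<close>

text \<open>The object a is kept independent of T because the dinaturality condition involves the
  mixed values of the integrand, with A at the target and N(P) at the source of a necklace
  map.\<close>

definition gob :: "'o \<Rightarrow> necklace \<Rightarrow> ('o, 'a) simp_obj" where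
  "gob a T = simp_ten V a (comp_functor (op_cat delta) F (nerve (nec_poset T)))"

lemma gob_simps [simp]: "FO (gob a T) n = a \<otimes> FN T n"
  "\<theta> \<in> Arr delta \<Longrightarrow> FA (gob a T) \<theta> = Idn V a \<odot> FA F (smap T \<theta>)"
proof -
  show "FO (gob a T) n = a \<otimes> FN T n"
    by (simp add: gob_def simp_ten_def comp_functor_def nerve_def)
  show "\<theta> \<in> Arr delta \<Longrightarrow> FA (gob a T) \<theta> = Idn V a \<odot> FA F (smap T \<theta>)"
    by (cases \<theta>) (simp add: gob_def simp_ten_def comp_functor_def nerve_def smap_def pull_def)
qed

lemma gob_Ob [simp]:
  assumes a: "a \<in> Ob V"
  shows "gob a T \<in> Ob (simplicial V)"
  unfolding simplicial_Ob
proof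
  interpret delta: category delta by (rule category_delta)
  show "FA (gob a T) \<in> extensional (Arr delta)" by (simp add: gob_def simp_ten_def mk_functor_def)
  have h: "Idn V a \<odot> FA F (smap T \<theta>) \<in> hom V (a \<otimes> FN T (tgt \<theta>)) (a \<otimes> FN T (src \<theta>))"
    if "\<theta> \<in> Arr delta" for \<theta>
    using a that by (simp add: hom_def)
  show "is_functor (op_cat delta) V (gob a T)"
    unfolding is_functor_def
  proof (intro conjI ballI impI)
    fix n assume "n \<in> Ob (op_cat delta)"
    show "FO (gob a T) n \<in> Ob V" using a by simp
    have I: "Idn delta n \<in> Arr delta" by (rule delta.Arr_Idn) simp
    have "Idn V a \<odot> FA F (smap T (Idn delta n)) = Idn V (a \<otimes> FN T n)"
    proof (rule coprod_ext[OF tinj_coprod[OF a]])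
      show "Idn V a \<odot> FA F (smap T (Idn delta n)) \<in> hom V (a \<otimes> FN T n) (a \<otimes> FN T n)"
        using h[OF I] by simp
      show "Idn V (a \<otimes> FN T n) \<in> hom V (a \<otimes> FN T n) (a \<otimes> FN T n)" by (rule Idn_hom) (use a in simp)
      fix \<tau> assume \<tau>: "\<tau> \<in> flags n T"
      show "(Idn V a \<odot> FA F (smap T (Idn delta n))) \<bullet> tinj a T n \<tau> = Idn V (a \<otimes> FN T n) \<bullet> tinj a T n \<tau>"
        using tinj_smap[OF a I, of \<tau> T] \<tau> pull_Idn[OF \<tau>] a by simp
    qed
    then show "FA (gob a T) (Idn (op_cat delta) n) = Idn V (FO (gob a T) n)" using I by simp
  next
    fix \<theta> assume "\<theta> \<in> Arr (op_cat delta)"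
    then show "FA (gob a T) \<theta> \<in> hom V (FO (gob a T) (Dom (op_cat delta) \<theta>)) (FO (gob a T) (Cod (op_cat delta) \<theta>))"
      using h[of \<theta>] by simp
  next
    fix \<eta> \<theta> assume "\<eta> \<in> Arr (op_cat delta)" "\<theta> \<in> Arr (op_cat delta)"
      "Cod (op_cat delta) \<eta> = Dom (op_cat delta) \<theta>"
    then have t: "\<theta> \<in> Arr delta" "\<eta> \<in> Arr delta" "src \<eta> = tgt \<theta>" by simp_all
    have C: "\<eta> \<bullet>\<^bsub>delta\<^esub> \<theta> \<in> Arr delta" by (rule delta.Arr_Comp(1)) (use t in simp_all)
    have st: "src (\<eta> \<bullet>\<^bsub>delta\<^esub> \<theta>) = src \<theta>" "tgt (\<eta> \<bullet>\<^bsub>delta\<^esub> \<theta>) = tgt \<eta>" by simp_all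
    let ?g = "\<lambda>\<theta>. Idn V a \<odot> FA F (smap T \<theta>)"
    have l: "?g \<eta> \<in> hom V (a \<otimes> FN T (tgt \<eta>)) (a \<otimes> FN T (tgt \<theta>))" using h[OF t(2)] t(3) by simp
    have "?g (\<eta> \<bullet>\<^bsub>delta\<^esub> \<theta>) = ?g \<theta> \<bullet> ?g \<eta>"
    proof (rule coprod_ext[OF tinj_coprod[OF a]])
      show "?g (\<eta> \<bullet>\<^bsub>delta\<^esub> \<theta>) \<in> hom V (a \<otimes> FN T (tgt \<eta>)) (a \<otimes> FN T (src \<theta>))" using h[OF C] unfolding st .
      show "?g \<theta> \<bullet> ?g \<eta> \<in> hom V (a \<otimes> FN T (tgt \<eta>)) (a \<otimes> FN T (src \<theta>))" by (rule Comp_hom[OF l h[OF t(1)]])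
      fix \<tau> assume \<tau>: "\<tau> \<in> flags (tgt \<eta>) T"
      have "(?g \<theta> \<bullet> ?g \<eta>) \<bullet> tinj a T (tgt \<eta>) \<tau> = ?g \<theta> \<bullet> (?g \<eta> \<bullet> tinj a T (tgt \<eta>) \<tau>)"
        by (rule Comp_assoc[OF coprod_hom[OF tinj_coprod[OF a] \<tau>] l h[OF t(1)]])
      also have "\<dots> = tinj a T (src \<theta>) (pull \<theta> (pull \<eta> \<tau>))"
        unfolding tinj_smap[OF a t(2) \<tau>] unfolding t(3)
        by (rule tinj_smap[OF a t(1)]) (use pull_flags[OF t(2) \<tau>] t(3) in simp)
      also have "\<dots> = ?g (\<eta> \<bullet>\<^bsub>delta\<^esub> \<theta>) \<bullet> tinj a T (tgt \<eta>) \<tau>"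
        using tinj_smap[OF a C, unfolded st, OF \<tau>] pull_Comp[OF t, of \<tau>] by metis
      finally show "?g (\<eta> \<bullet>\<^bsub>delta\<^esub> \<theta>) \<bullet> tinj a T (tgt \<eta>) \<tau> = (?g \<theta> \<bullet> ?g \<eta>) \<bullet> tinj a T (tgt \<eta>) \<tau>" ..
    qed
    then show "FA (gob a T) (\<theta> \<bullet>\<^bsub>op_cat delta\<^esub> \<eta>) = FA (gob a T) \<theta> \<bullet> FA (gob a T) \<eta>" using C t by simp
  qed
qed

definition integrand ::
  "(necklace \<times> necklace, nec_map \<times> nec_map, ('o, 'a) simp_obj, ('o, 'a) simp_map) ftr" where
  "integrand = mk_functor (prod_cat (op_cat nec) nec)
     (\<lambda>(T, U). simp_ten V (FO A T) (FO (levelwise F) (FO nec_nerve U)))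
     (\<lambda>(f, g). simp_ten_arr V (FA A f) (FA (levelwise F) (FA nec_nerve g)))"

lemma integrand_FO [simp]:
  "T \<in> necklaces \<Longrightarrow> U \<in> necklaces \<Longrightarrow> FO integrand (T, U) = gob (FO A T) U"
  by (simp add: integrand_def prod_cat_def gob_def levelwise_def nec_nerve_def)

lemma integrand_FA:
  assumes "f \<in> Arr nec" "g \<in> Arr nec"
  shows "FA integrand (f, g) = Arrow (gob (FO A (tgt f)) (src g)) (\<lambda>n. FA A f \<odot> FA F (nmap g n)) (gob (FO A (src f)) (tgt g))"
  using assms by (simp add: integrand_def prod_cat_def gob_def levelwise_def nec_nerve_def
      simp_ten_arr_def nerve_map_def nmap_def push_def[abs_def])

lemma FA_F_nmap_Idn:
  assumes "T \<in> necklaces"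
  shows "FA F (nmap (Idn nec T) n) = Idn V (FN T n)"
proof -
  obtain U p where T: "T = (U, p)" by (cases T)
  have "nmap (Idn nec T) n = Idn (set_cat TYPE('u)) (flags n T)"
    using push_Idn by (auto simp: nmap_def T intro!: restrict_ext)
  moreover have "FA F (Idn (set_cat TYPE('u)) (flags n T)) = Idn V (FN T n)"
    using F unfolding is_functor_def by simp
  ultimately show ?thesis by simp
qed

lemma integrand_FA_Idn:
  assumes g: "g \<in> Arr nec"
  shows "FA integrand (g, Idn nec (src g)) =
      Arrow (gob (FO A (tgt g)) (src g)) (\<lambda>n. FA A g \<odot> Idn V (FN (src g) n)) (gob (FO A (src g)) (src g))"
    "FA integrand (Idn nec (tgt g), g) =
      Arrow (gob (FO A (tgt g)) (src g)) (\<lambda>n. Idn V (FO A (tgt g)) \<odot> FA F (nmap g n)) (gob (FO A (tgt g)) (tgt g))"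
proof -
  interpret nec: category nec by (rule category_nec)
  note T = nec_Arr_necklaces[OF g]
  have I: "Idn nec T \<in> Arr nec" "src (Idn nec T) = T" "tgt (Idn nec T) = T" if "T \<in> necklaces" for T
    using nec.Arr_Idn[of T] that by simp_all
  show "FA integrand (g, Idn nec (src g)) =
      Arrow (gob (FO A (tgt g)) (src g)) (\<lambda>n. FA A g \<odot> Idn V (FN (src g) n)) (gob (FO A (src g)) (src g))"
    by (simp add: integrand_FA[OF g I(1)[OF T(1)]] I[OF T(1)] FA_F_nmap_Idn[OF T(1)])
  show "FA integrand (Idn nec (tgt g), g) =
      Arrow (gob (FO A (tgt g)) (src g)) (\<lambda>n. Idn V (FO A (tgt g)) \<odot> FA F (nmap g n)) (gob (FO A (tgt g)) (tgt g))"
    by (simp add: integrand_FA[OF I(1)[OF T(2)] g] I[OF T(2)] A_Idn[OF T(2)])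
qed

text \<open>The last clause is the translation of cowedges into compatible families: both sides of
  the dinaturality square are evaluated on the coprojections, where \<open>tinj_left\<close> and
  \<open>tinj_nmap\<close> turn them into the action of A and the pushforward of flags.\<close>

lemma cowedgeD:
  assumes cw: "is_cowedge (simplicial V) nec integrand M \<kappa>"
  shows "M \<in> Ob (simplicial V)"
    and "T \<in> necklaces \<Longrightarrow> \<kappa> T = Arrow (gob (FO A T) T) (amap (\<kappa> T)) M"
    and "T \<in> necklaces \<Longrightarrow> amap (\<kappa> T) n \<in> hom V (FO A T \<otimes> FN T n) (FO M n)"
    and "T \<in> necklaces \<Longrightarrow> \<theta> \<in> Arr delta \<Longrightarrow>
      amap (\<kappa> T) (src \<theta>) \<bullet> (Idn V (FO A T) \<odot> FA F (smap T \<theta>)) = FA M \<theta> \<bullet> amap (\<kappa> T) (tgt \<theta>)"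
    and "compat n (FO M n) (\<lambda>T \<tau>. amap (\<kappa> T) n \<bullet> tinj (FO A T) T n \<tau>)"
proof -
  show M: "M \<in> Ob (simplicial V)" using cw by (simp add: is_cowedge_def)
  have \<kappa>: "\<kappa> T \<in> hom (simplicial V) (gob (FO A T) T) M" if "T \<in> necklaces" for T
    using cw that by (simp add: is_cowedge_def)
  have \<kappa>_Arrow: "\<kappa> T = Arrow (gob (FO A T) T) (amap (\<kappa> T)) M" if "T \<in> necklaces" for T
    using \<kappa>[OF that] by (auto simp: simplicial_hom)
  then show "T \<in> necklaces \<Longrightarrow> \<kappa> T = Arrow (gob (FO A T) T) (amap (\<kappa> T)) M" .
  have Arr: "Arrow (gob (FO A T) T) (amap (\<kappa> T)) M \<in> Arr (simplicial V)" if "T \<in> necklaces" for T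
    using \<kappa>[OF that] by (auto simp: simplicial_hom)
  have hom: "amap (\<kappa> T) n \<in> hom V (FO A T \<otimes> FN T n) (FO M n)" if "T \<in> necklaces" for T n
    using Arr[OF that] unfolding simplicial_Arr by simp
  then show "T \<in> necklaces \<Longrightarrow> amap (\<kappa> T) n \<in> hom V (FO A T \<otimes> FN T n) (FO M n)" .
  show "T \<in> necklaces \<Longrightarrow> \<theta> \<in> Arr delta \<Longrightarrow>
      amap (\<kappa> T) (src \<theta>) \<bullet> (Idn V (FO A T) \<odot> FA F (smap T \<theta>)) = FA M \<theta> \<bullet> amap (\<kappa> T) (tgt \<theta>)"
    using Arr[of T] unfolding simplicial_Arr by simp
  show "compat n (FO M n) (\<lambda>T \<tau>. amap (\<kappa> T) n \<bullet> tinj (FO A T) T n \<tau>)"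
    unfolding compat_def
  proof (intro conjI ballI)
    show "FO M n \<in> Ob V" by (rule simplicial_functor[OF M])
    show "amap (\<kappa> T) n \<bullet> tinj (FO A T) T n \<tau> \<in> hom V (FO A T) (FO M n)" if "T \<in> necklaces" "\<tau> \<in> flags n T" for T \<tau>
      by (rule Comp_hom[OF coprod_hom[OF tinj_coprod[OF A_Ob[OF that(1)]] that(2)] hom[OF that(1)]])
    fix g \<tau> assume g: "g \<in> Arr nec" and \<tau>: "\<tau> \<in> flags n (src g)"
    note T = nec_Arr_necklaces[OF g]
    have "\<kappa> (src g) \<bullet>\<^bsub>simplicial V\<^esub> FA integrand (g, Idn nec (src g)) =
        \<kappa> (tgt g) \<bullet>\<^bsub>simplicial V\<^esub> FA integrand (Idn nec (tgt g), g)"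
      using cw g unfolding is_cowedge_def by simp
    then have "(\<lambda>n. amap (\<kappa> (src g)) n \<bullet> (FA A g \<odot> Idn V (FN (src g) n))) =
        (\<lambda>n. amap (\<kappa> (tgt g)) n \<bullet> (Idn V (FO A (tgt g)) \<odot> FA F (nmap g n)))"
      unfolding integrand_FA_Idn[OF g] by simp
    note eq = fun_cong[OF this, of n]
    have k: "amap (\<kappa> (src g)) n \<in> Arr V" "Dom V (amap (\<kappa> (src g)) n) = FO A (src g) \<otimes> FN (src g) n"
      "amap (\<kappa> (tgt g)) n \<in> Arr V" "Dom V (amap (\<kappa> (tgt g)) n) = FO A (tgt g) \<otimes> FN (tgt g) n"
      using hom[OF T(1), of n] hom[OF T(2), of n] by (simp_all add: hom_def)
    have Ag: "FA A g \<in> hom V (FO A (tgt g)) (FO A (src g))" using g by (simp add: hom_def)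
    have "(amap (\<kappa> (src g)) n \<bullet> tinj (FO A (src g)) (src g) n \<tau>) \<bullet> FA A g =
        amap (\<kappa> (src g)) n \<bullet> (tinj (FO A (src g)) (src g) n \<tau> \<bullet> FA A g)"
      using k g \<tau> T by simp
    also have "\<dots> = (amap (\<kappa> (src g)) n \<bullet> (FA A g \<odot> Idn V (FN (src g) n))) \<bullet> tinj (FO A (tgt g)) (src g) n \<tau>"
      unfolding tinj_left[OF Ag \<tau>, symmetric] using k g \<tau> T by simp
    also have "\<dots> = amap (\<kappa> (tgt g)) n \<bullet> ((Idn V (FO A (tgt g)) \<odot> FA F (nmap g n)) \<bullet> tinj (FO A (tgt g)) (src g) n \<tau>)"
      unfolding eq using k g \<tau> T by simp
    also have "\<dots> = amap (\<kappa> (tgt g)) n \<bullet> tinj (FO A (tgt g)) (tgt g) n (push n (amap g) \<tau>)"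
      unfolding tinj_nmap[OF A_Ob[OF T(2)] g \<tau>] ..
    finally show "(amap (\<kappa> (src g)) n \<bullet> tinj (FO A (src g)) (src g) n \<tau>) \<bullet> FA A g =
        amap (\<kappa> (tgt g)) n \<bullet> tinj (FO A (tgt g)) (tgt g) n (push n (amap g) \<tau>)" .
  qed
qed

section \<open>The coend and the comparison isomorphism\<close>

abbreviation "ws \<equiv> \<lambda>T. Arrow (gob (FO A T) T) (w T) Ls"

text \<open>Tested on coprojections, compatibility of a leg with the simplicial operators is the
  defining equation of \<open>lmap\<close>, and dinaturality in the necklace is
  \<open>kap_natural\<close>.\<close>

lemma ws_cowedge: "is_cowedge (simplicial V) nec integrand Ls ws"
  unfolding is_cowedge_def
proof (intro conjI ballI)
  show "Ls \<in> Ob (simplicial V)" by simp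
  fix T assume "T \<in> Ob nec"
  then have T: "T \<in> necklaces" by simp
  have "w T (src \<theta>) \<bullet> (Idn V (FO A T) \<odot> FA F (smap T \<theta>)) = lmap \<theta> \<bullet> w T (tgt \<theta>)" if \<theta>: "\<theta> \<in> Arr delta" for \<theta>
  proof (rule coprod_ext[OF tinj_coprod[OF A_Ob[OF T]]])
    have h: "Idn V (FO A T) \<odot> FA F (smap T \<theta>) \<in> hom V (FO A T \<otimes> FN T (tgt \<theta>)) (FO A T \<otimes> FN T (src \<theta>))"
      using \<theta> T by (simp add: hom_def)
    show "w T (src \<theta>) \<bullet> (Idn V (FO A T) \<odot> FA F (smap T \<theta>)) \<in> hom V (FO A T \<otimes> FN T (tgt \<theta>)) (L (src \<theta>))"
      by (rule Comp_hom[OF h w(1)[OF T]])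
    show "lmap \<theta> \<bullet> w T (tgt \<theta>) \<in> hom V (FO A T \<otimes> FN T (tgt \<theta>)) (L (src \<theta>))"
      by (rule Comp_hom[OF w(1)[OF T] lmap(1)[OF \<theta>]])
    fix \<tau> assume \<tau>: "\<tau> \<in> flags (tgt \<theta>) T"
    note i = coprod_hom[OF tinj_coprod[OF A_Ob[OF T]] \<tau>]
    show "(w T (src \<theta>) \<bullet> (Idn V (FO A T) \<odot> FA F (smap T \<theta>))) \<bullet> tinj (FO A T) T (tgt \<theta>) \<tau> =
        (lmap \<theta> \<bullet> w T (tgt \<theta>)) \<bullet> tinj (FO A T) T (tgt \<theta>) \<tau>"
      unfolding Comp_assoc[OF i h w(1)[OF T]] Comp_assoc[OF i w(1)[OF T] lmap(1)[OF \<theta>]]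
        tinj_smap[OF A_Ob[OF T] \<theta> \<tau>] w(2)[OF T \<tau>] w(2)[OF T pull_flags[OF \<theta> \<tau>]] lmap(2)[OF \<theta> T \<tau>] ..
  qed
  then show "ws T \<in> hom (simplicial V) (FO integrand (T, T)) Ls"
    using T w(1)[OF T] by (simp add: simplicial_hom simplicial_Arr)
next
  fix g assume g: "g \<in> Arr nec"
  note T = nec_Arr_necklaces[OF g]
  have "w (src g) n \<bullet> (FA A g \<odot> Idn V (FN (src g) n)) = w (tgt g) n \<bullet> (Idn V (FO A (tgt g)) \<odot> FA F (nmap g n))" for n
  proof (rule coprod_ext[OF tinj_coprod[OF A_Ob[OF T(2)]]])
    have Ag: "FA A g \<in> hom V (FO A (tgt g)) (FO A (src g))" using g by (simp add: hom_def)
    have h: "FA A g \<odot> Idn V (FN (src g) n) \<in> hom V (FO A (tgt g) \<otimes> FN (src g) n) (FO A (src g) \<otimes> FN (src g) n)"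
      "Idn V (FO A (tgt g)) \<odot> FA F (nmap g n) \<in> hom V (FO A (tgt g) \<otimes> FN (src g) n) (FO A (tgt g) \<otimes> FN (tgt g) n)"
      using g T by (simp_all add: hom_def)
    show "w (src g) n \<bullet> (FA A g \<odot> Idn V (FN (src g) n)) \<in> hom V (FO A (tgt g) \<otimes> FN (src g) n) (L n)"
      "w (tgt g) n \<bullet> (Idn V (FO A (tgt g)) \<odot> FA F (nmap g n)) \<in> hom V (FO A (tgt g) \<otimes> FN (src g) n) (L n)"
      by (rule Comp_hom[OF h(1) w(1)[OF T(1)]], rule Comp_hom[OF h(2) w(1)[OF T(2)]])
    fix \<tau> assume \<tau>: "\<tau> \<in> flags n (src g)"
    note i = coprod_hom[OF tinj_coprod[OF A_Ob[OF T(2)]] \<tau>] and j = coprod_hom[OF tinj_coprod[OF A_Ob[OF T(1)]] \<tau>]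
    have "(w (src g) n \<bullet> (FA A g \<odot> Idn V (FN (src g) n))) \<bullet> tinj (FO A (tgt g)) (src g) n \<tau> =
        kap n (src g) \<tau> \<bullet> FA A g"
      unfolding Comp_assoc[OF i h(1) w(1)[OF T(1)]] tinj_left[OF Ag \<tau>] Comp_assoc[OF Ag j w(1)[OF T(1)], symmetric]
        w(2)[OF T(1) \<tau>] ..
    also have "\<dots> = kap n (tgt g) (push n (amap g) \<tau>)" by (rule kap_natural[OF g \<tau>])
    also have "\<dots> = (w (tgt g) n \<bullet> (Idn V (FO A (tgt g)) \<odot> FA F (nmap g n))) \<bullet> tinj (FO A (tgt g)) (src g) n \<tau>"
      unfolding Comp_assoc[OF i h(2) w(1)[OF T(2)]] tinj_nmap[OF A_Ob[OF T(2)] g \<tau>] w(2)[OF T(2) push_flags'[OF g \<tau>]] ..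
    finally show "(w (src g) n \<bullet> (FA A g \<odot> Idn V (FN (src g) n))) \<bullet> tinj (FO A (tgt g)) (src g) n \<tau> =
        (w (tgt g) n \<bullet> (Idn V (FO A (tgt g)) \<odot> FA F (nmap g n))) \<bullet> tinj (FO A (tgt g)) (src g) n \<tau>" .
  qed
  then show "ws (Dom nec g) \<bullet>\<^bsub>simplicial V\<^esub> FA integrand (g, Idn nec (Dom nec g)) =
      ws (Cod nec g) \<bullet>\<^bsub>simplicial V\<^esub> FA integrand (Idn nec (Cod nec g), g)"
    unfolding nec_simps(2,3) integrand_FA_Idn[OF g] by simp
qed

text \<open>The mediating map is built level by level from \<open>kap_ex\<close>. Its compatibility
  with the simplicial operators is then a consequence of uniqueness: both composites agree on all
  \<open>kap\<close>.\<close>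

lemma ws_coend: "is_coend (simplicial V) nec integrand Ls ws"
  unfolding is_coend_def
proof (intro conjI allI impI)
  show "is_cowedge (simplicial V) nec integrand Ls ws" by (rule ws_cowedge)
  fix M \<kappa> assume cw: "is_cowedge (simplicial V) nec integrand M \<kappa>"
  note K = cowedgeD[OF cw]
  let ?m = "\<lambda>n T \<tau>. amap (\<kappa> T) n \<bullet> tinj (FO A T) T n \<tau>"
  have "\<exists>h. h \<in> hom V (L n) (FO M n) \<and> (\<forall>T\<in>necklaces. \<forall>\<tau>\<in>flags n T. h \<bullet> kap n T \<tau> = ?m n T \<tau>)" for n
    using kap_ex[OF K(5)] by metis
  then obtain h where h: "\<And>n. h n \<in> hom V (L n) (FO M n)"
    "\<And>n T \<tau>. T \<in> necklaces \<Longrightarrow> \<tau> \<in> flags n T \<Longrightarrow> h n \<bullet> kap n T \<tau> = ?m n T \<tau>" by metis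
  have hw: "h n \<bullet> w T n = amap (\<kappa> T) n" if T: "T \<in> necklaces" for T n
  proof (rule coprod_ext[OF tinj_coprod[OF A_Ob[OF T]]])
    show "h n \<bullet> w T n \<in> hom V (FO A T \<otimes> FN T n) (FO M n)" by (rule Comp_hom[OF w(1)[OF T] h(1)])
    show "amap (\<kappa> T) n \<in> hom V (FO A T \<otimes> FN T n) (FO M n)" by (rule K(3)[OF T])
    fix \<tau> assume \<tau>: "\<tau> \<in> flags n T"
    show "(h n \<bullet> w T n) \<bullet> tinj (FO A T) T n \<tau> = amap (\<kappa> T) n \<bullet> tinj (FO A T) T n \<tau>"
      unfolding Comp_assoc[OF coprod_hom[OF tinj_coprod[OF A_Ob[OF T]] \<tau>] w(1)[OF T] h(1)] w(2)[OF T \<tau>] h(2)[OF T \<tau>] ..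
  qed
  have nat: "h (src \<theta>) \<bullet> lmap \<theta> = FA M \<theta> \<bullet> h (tgt \<theta>)" if \<theta>: "\<theta> \<in> Arr delta" for \<theta>
  proof (rule kap_ext)
    have M: "FA M \<theta> \<in> hom V (FO M (tgt \<theta>)) (FO M (src \<theta>))"
      using simplicial_functor[OF K(1)] \<theta> by (simp add: hom_def)
    show "h (src \<theta>) \<bullet> lmap \<theta> \<in> hom V (L (tgt \<theta>)) (FO M (src \<theta>))" by (rule Comp_hom[OF lmap(1)[OF \<theta>] h(1)])
    show "FA M \<theta> \<bullet> h (tgt \<theta>) \<in> hom V (L (tgt \<theta>)) (FO M (src \<theta>))" by (rule Comp_hom[OF h(1) M])
    fix T \<tau> assume T: "T \<in> necklaces" and \<tau>: "\<tau> \<in> flags (tgt \<theta>) T"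
    note i = coprod_hom[OF tinj_coprod[OF A_Ob[OF T]] \<tau>]
    have s: "Idn V (FO A T) \<odot> FA F (smap T \<theta>) \<in> hom V (FO A T \<otimes> FN T (tgt \<theta>)) (FO A T \<otimes> FN T (src \<theta>))"
      using \<theta> T by (simp add: hom_def)
    have "(h (src \<theta>) \<bullet> lmap \<theta>) \<bullet> kap (tgt \<theta>) T \<tau> = amap (\<kappa> T) (src \<theta>) \<bullet> tinj (FO A T) T (src \<theta>) (pull \<theta> \<tau>)"
      unfolding Comp_assoc[OF kap_hom[OF T \<tau>] lmap(1)[OF \<theta>] h(1)] lmap(2)[OF \<theta> T \<tau>] h(2)[OF T pull_flags[OF \<theta> \<tau>]] ..
    also have "\<dots> = (FA M \<theta> \<bullet> amap (\<kappa> T) (tgt \<theta>)) \<bullet> tinj (FO A T) T (tgt \<theta>) \<tau>"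
      unfolding tinj_smap[OF A_Ob[OF T] \<theta> \<tau>, symmetric] Comp_assoc[OF i s K(3)[OF T], symmetric] K(4)[OF T \<theta>] ..
    also have "\<dots> = (FA M \<theta> \<bullet> h (tgt \<theta>)) \<bullet> kap (tgt \<theta>) T \<tau>"
      unfolding Comp_assoc[OF i K(3)[OF T] M] Comp_assoc[OF kap_hom[OF T \<tau>] h(1) M] h(2)[OF T \<tau>] ..
    finally show "(h (src \<theta>) \<bullet> lmap \<theta>) \<bullet> kap (tgt \<theta>) T \<tau> = (FA M \<theta> \<bullet> h (tgt \<theta>)) \<bullet> kap (tgt \<theta>) T \<tau>" .
  qed
  show "\<exists>!k. k \<in> hom (simplicial V) Ls M \<and> (\<forall>T\<in>Ob nec. k \<bullet>\<^bsub>simplicial V\<^esub> ws T = \<kappa> T)"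
  proof (rule ex1I[of _ "Arrow Ls h M"], intro conjI ballI)
    show "Arrow Ls h M \<in> hom (simplicial V) Ls M"
      using K(1) h(1) nat by (simp add: simplicial_hom simplicial_Arr)
    show "Arrow Ls h M \<bullet>\<^bsub>simplicial V\<^esub> ws T = \<kappa> T" if "T \<in> Ob nec" for T
      using that hw[of T] K(2)[of T] by simp
  next
    fix k assume k: "k \<in> hom (simplicial V) Ls M \<and> (\<forall>T\<in>Ob nec. k \<bullet>\<^bsub>simplicial V\<^esub> ws T = \<kappa> T)"
    then obtain k' where k': "k = Arrow Ls k' M" "Arrow Ls k' M \<in> Arr (simplicial V)"
      by (auto simp: simplicial_hom)
    have k'_hom: "k' n \<in> hom V (L n) (FO M n)" for n using k'(2) by (simp add: simplicial_Arr)
    have k'w: "k' n \<bullet> w T n = amap (\<kappa> T) n" if "T \<in> necklaces" for T n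
    proof -
      have "amap (k \<bullet>\<^bsub>simplicial V\<^esub> ws T) n = amap (\<kappa> T) n" using k that by simp
      then show ?thesis by (simp add: k'(1))
    qed
    have "k' n = h n" for n
    proof (rule kap_ext[OF k'_hom h(1)])
      fix T \<tau> assume T: "T \<in> necklaces" and \<tau>: "\<tau> \<in> flags n T"
      note i = coprod_hom[OF tinj_coprod[OF A_Ob[OF T]] \<tau>]
      show "k' n \<bullet> kap n T \<tau> = h n \<bullet> kap n T \<tau>"
        unfolding w(2)[OF T \<tau>, symmetric] Comp_assoc[OF i w(1)[OF T] k'_hom, symmetric]
          Comp_assoc[OF i w(1)[OF T] h(1), symmetric] k'w[OF T] hw[OF T] ..
    qed
    then have "k' = h" by (rule ext)
    then show "k = Arrow Ls h M" by (simp add: k'(1))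
  qed
qed

text \<open>The chosen coend is isomorphic to \<open>Ls\<close> compatibly with the legs, and an
  isomorphism of simplicial objects is one at every level. Uniqueness of \<phi> comes from the
  colimit alone, since the coprojections \<open>lam\<close> determine it.\<close>

lemma level_iso:
  defines "E \<equiv> coend (simplicial V) nec integrand"
  shows "\<exists>!\<phi>. \<phi> \<in> hom V (L n) (FO (fst E) n) \<and> is_iso V \<phi> \<and>
    (\<forall>(T, \<tau>)\<in>flanked_flags n. \<phi> \<bullet> lam n (T, \<tau>) = amap (snd E T) n \<bullet> tinj (FO A T) T n \<tau>)"
proof -
  interpret S: category "simplicial V" by (rule category_simplicial)
  note coend = is_coend_coend[OF ws_coend, folded E_def]
  obtain \<Phi> where \<Phi>: "\<Phi> \<in> hom (simplicial V) Ls (fst E)" "is_iso (simplicial V) \<Phi>"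
    "\<And>T. T \<in> necklaces \<Longrightarrow> \<Phi> \<bullet>\<^bsub>simplicial V\<^esub> ws T = snd E T"
  proof (rule S.coend_unique[OF ws_coend coend])
    fix h assume h: "h \<in> hom (simplicial V) Ls (fst E)" "is_iso (simplicial V) h"
      and "\<And>T. T \<in> Ob nec \<Longrightarrow> h \<bullet>\<^bsub>simplicial V\<^esub> ws T = snd E T"
    then show thesis by (intro that[OF h]) simp
  qed
  let ?f = "amap \<Phi> n"
  have f: "?f \<in> hom V (L n) (FO (fst E) n)"
    using \<Phi>(1) by (auto simp: simplicial_hom simplicial_Arr)
  have eq: "?f \<bullet> lam n (T, \<tau>) = amap (snd E T) n \<bullet> tinj (FO A T) T n \<tau>" if fl: "(T, \<tau>) \<in> flanked_flags n" for T \<tau>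
  proof -
    have T: "T \<in> necklaces" "\<tau> \<in> flags n T" using fl by (cases T; simp add: flanked_flags_iff)+
    have "amap (snd E T) n = ?f \<bullet> w T n" unfolding \<Phi>(3)[OF T(1), symmetric] by simp
    then have "amap (snd E T) n \<bullet> tinj (FO A T) T n \<tau> = ?f \<bullet> (w T n \<bullet> tinj (FO A T) T n \<tau>)"
      using Comp_assoc[OF coprod_hom[OF tinj_coprod[OF A_Ob[OF T(1)]] T(2)] w(1)[OF T(1)] f] by simp
    then show ?thesis by (simp add: w(2)[OF T] kap_flanked[OF fl])
  qed
  show ?thesis
  proof (rule ex1I[of _ ?f])
    show "?f \<in> hom V (L n) (FO (fst E) n) \<and> is_iso V ?f \<and>
        (\<forall>(T, \<tau>)\<in>flanked_flags n. ?f \<bullet> lam n (T, \<tau>) = amap (snd E T) n \<bullet> tinj (FO A T) T n \<tau>)"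
      using f simplicial_iso_level[OF \<Phi>(2)] eq by auto
    fix \<phi> assume \<phi>: "\<phi> \<in> hom V (L n) (FO (fst E) n) \<and> is_iso V \<phi> \<and>
        (\<forall>(T, \<tau>)\<in>flanked_flags n. \<phi> \<bullet> lam n (T, \<tau>) = amap (snd E T) n \<bullet> tinj (FO A T) T n \<tau>)"
    show "\<phi> = ?f"
      by (rule lam_ext[OF _ f]) (use \<phi> eq in auto)
  qed
qed

end

section \<open>Specialisation to templicial objects\<close>

theorem proposition4p15:
  fixes V :: "('o, 'a) smoncat"
    and S :: "'u set"
    and X :: "('u, 'o, 'a) templicial"
    and F :: "(simplex set, set_map, 'o, 'a) ftr"
    and pt :: simplex
    and a b :: 'u
    and n :: nat
  assumes "infinite (UNIV :: 'u set)"
    and "closed_symmetric_monoidal_category V"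
    and "complete_cat TYPE('u) V"
    and "cocomplete_cat TYPE('u) V"
    and "is_functor (set_cat TYPE('u)) V F"
    and "preserves_colimits TYPE('u) (set_cat TYPE('u)) V F"
    and "FO F {pt} = Unit V"
    and "templicial_object V S X"
    and "a \<in> S" and "b \<in> S"
  shows "\<exists>!\<phi>. \<phi> \<in> hom V (fst (flanked_colimit V S X a b n))
                        (FO (categorification_hom V F S X a b) n) \<and>
              is_iso V \<phi> \<and>
              (\<forall>(T, \<tau>) \<in> Ob (nec_flanked n).
                 \<phi> \<bullet>\<^bsub>V\<^esub> snd (flanked_colimit V S X a b n) (T, \<tau>) =
                 flag_map V F pt S X a b n T \<tau>)"
proof -
  interpret quivers V S
    using assms(2,4) by (simp add: quivers_def quivers_axioms_def)
  interpret D: strongly_unital "quiv V S" X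
    using monoidal_category_quiv assms(8)
    by (simp add: strongly_unital_def strongly_unital_axioms_def templicial_object_def)
  let ?N = "nec_functor (quiv V S) X" and ?A = "nec_functor_at V S X a b"
  have N: "is_functor (op_cat nec) QV ?N" by (rule D.nec_functor)
  have NA: "FA ?N f \<in> Arr QV" "src (FA ?N f) = FO ?N (tgt f)" "tgt (FA ?N f) = FO ?N (src f)"
    if "f \<in> Arr nec" for f
    using N that by (simp_all add: is_functor_def hom_def)
  have N_Ob: "FO ?N T \<in> QOb" and N_Idn: "FA ?N (Idn nec T) = Idn QV (FO ?N T)" if "T \<in> necklaces" for T
    using N that by (simp_all add: is_functor_def)
  have N_Comp: "FA ?N (g \<bullet>\<^bsub>nec\<^esub> f) = FA ?N f \<bullet>\<^bsub>QV\<^esub> FA ?N g"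
    if "f \<in> Arr nec" "g \<in> Arr nec" "src g = tgt f" for f g
    using N that by (simp add: is_functor_def)
  interpret nec: category nec by (rule category_nec)
  \<comment> \<open>Evaluation at (a, b) is functorial on quivers, since their composites and
    identities are taken componentwise on S \<times> S.\<close>
  have A: "is_functor (op_cat nec) V ?A"
    unfolding is_functor_def
  proof (intro conjI ballI impI)
    fix T assume "T \<in> Ob (op_cat nec)"
    then have T: "T \<in> necklaces" by simp
    show "FO ?A T \<in> Ob V" using T N_Ob[OF T] assms(9,10) by (simp add: nec_functor_at_def)
    have "Idn nec T \<in> Arr nec" using nec.Arr_Idn(1)[of T] T by simp
    then show "FA ?A (Idn (op_cat nec) T) = Idn V (FO ?A T)"
      using T N_Idn[OF T] assms(9,10) by (simp add: nec_functor_at_def)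
  next
    fix f assume "f \<in> Arr (op_cat nec)"
    then have f: "f \<in> Arr nec" by simp
    have "src f \<in> necklaces" "tgt f \<in> necklaces" using f by (auto elim!: nec_ArrE)
    then show "FA ?A f \<in> hom V (FO ?A (Dom (op_cat nec) f)) (FO ?A (Cod (op_cat nec) f))"
      using f quiv_hom[OF NA(1)[OF f] assms(9,10)] NA(2,3)[OF f] by (simp add: nec_functor_at_def)
  next
    fix g f assume "g \<in> Arr (op_cat nec)" "f \<in> Arr (op_cat nec)" "Cod (op_cat nec) g = Dom (op_cat nec) f"
    then have fg: "f \<in> Arr nec" "g \<in> Arr nec" "src g = tgt f" by simp_all
    have "g \<bullet>\<^bsub>nec\<^esub> f \<in> Arr nec" using nec.Arr_Comp(1)[of f g] fg by simp
    then show "FA ?A (f \<bullet>\<^bsub>op_cat nec\<^esub> g) = FA ?A f \<bullet>\<^bsub>V\<^esub> FA ?A g"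
      using fg N_Comp[OF fg] assms(9,10) by (simp add: nec_functor_at_def)
  qed
  interpret W: weighted V S ?A F pt
    using quivers_axioms assms(1,5-7) A by (simp add: weighted_def weighted_axioms_def)
  \<comment> \<open>The integrand and the diagram of the statement coincide with those of the locale
    by definition, so the two choices of coend and of colimit are literally the same.\<close>
  have "categorification_coend V F S X a b = coend (simplicial V) nec W.integrand"
    by (simp add: categorification_coend_def cat_integrand_def W.integrand_def)
  moreover have "flanked_colimit V S X a b n = (W.L n, W.lam n)"
    by (simp add: flanked_colimit_def W.L_def W.lam_def flanked_diagram_def W.fdiag_def)
  ultimately show ?thesis
    using W.level_iso[of n] by (simp add: flag_map_def Let_def W.tinj_def pick_def)
qed

end
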